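(* Let $n\geq d\geq 4$ be integers and let $M$ be the boundary poset of the $d$-dimensional multiplex $M^{d,n}$ with $n+1$ vertices. Let $I$ be an (order) ideal in $M$ which contains all the elements of $M$ of rank at most $\lceil \frac{d}{2}\rceil+1$. Let $P$ be the Bier poset $P=\mathrm{Bier}(M,I)$. Then $P$ is a Gorenstein$^{*}$ meet semi-lattice and its toric $g$-vector $g(P)$ is nonnegative, i.e. all coefficients of the polynomial $g(P,x)$ are nonnegative.
   Context: All posets are finite. An ideal of a poset is a down-closed subset. Multiplex: for integers $n\ge d\ge 2$, the multiplex $M^{d,n}$ is a $d$-dimensional convex polytope with $n+1$ vertices $x_0,\dots,x_n$ whose facets are $F_i=\mathrm{conv}(x_{i-d+1},\dots,x_{i-1},x_{i+1},\dots,x_{i+d-1})$, $0\le i\le n$, with the convention $x_j=x_0$ for $j<0$ and $x_j=x_n$ for $j>n$ (such a polytope exists; this determines its combinatorial type). Its boundary poset $M$ is the set of all proper faces, including the empty face $\hat 0$, ordered by inclusion; the rank of a face $F$ is $r(F)=\dim F+1$ (so $r(\hat 0)=0$ and facets have rank $d$). For a poset $X$, $\hat X=X\cup\{\hat 1\}$ denotes $X$ with a new maximum $\hat 1$ added. Bier poset: for a poset $X$ with minimum $\hat 0$ and a proper ideal $I$ of $\hat X$, $\mathrm{Bier}(X,I)$ is the set of all intervals $[a,b]$ of $\hat X$ with $a\in I$, $b\in \hat X\setminus I$, $a\le b$, ordered by reverse inclusion; its minimum is $[\hat 0,\hat 1]$. Gorenstein$^*$: a poset $X$ with minimum $\hat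 0$ is Gorenstein$^*$ if the order complex of $X\setminus\{\hat 0\}$ is Gorenstein$^*$, equivalently $\hat X$ is both Eulerian and Cohen–Macaulay (over a fixed field). Toric $g$-polynomial: for a lower Eulerian poset $X$ (a graded poset with minimum $\hat 0$ all of whose intervals are Eulerian) of rank $r$ (the maximal rank of an element), define recursively $f(\emptyset,x)=g(\emptyset,x)=1$, $f(X,x)=\sum_{t\in X} g([\hat 0,t),x)(x-1)^{r-r(t)}$, where $[\hat 0,t)=\{z\in X: z<t\}$, and, writing $f(X,x)=h_0+h_1x+h_2x^2+\cdots$, $g(X,x)=h_0+\sum_{i=1}^{\lfloor r/2\rfloor}(h_i-h_{i-1})x^i$. The toric $g$-vector $g(X)$ is the coefficient sequence of $g(X,x)$. *)

theory Defs
  imports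
    "HOL-Analysis.Analysis"
    "HOL-Algebra.Lattice"
    "HOL-Computational_Algebra.Polynomial"
begin

section \<open>Finite posets\<close>

text \<open>
  Posets are HOL-Algebra structures of type \<^typ>\<open>'a gorder\<close> whose \<^const>\<open>eq\<close> is equality
  (this is part of \<^locale>\<open>partial_order\<close>).
\<close>

definition order_ideal :: "'a gorder \<Rightarrow> 'a set \<Rightarrow> bool" where
  "order_ideal X I \<longleftrightarrow>
     I \<subseteq> carrier X \<and> (\<forall>a\<in>I. \<forall>b\<in>carrier X. b \<sqsubseteq>\<^bsub>X\<^esub> a \<longrightarrow> b \<in> I)"

definition is_chain :: "'a gorder \<Rightarrow> 'a set \<Rightarrow> bool" where
  "is_chain X C \<longleftrightarrow>
     C \<subseteq> carrier X \<and> (\<forall>a\<in>C. \<forall>b\<in>C. a \<sqsubseteq>\<^bsub>X\<^esub> b \<or> b \<sqsubseteq>\<^bsub>X\<^esub> a)"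

definition subposet :: "'a gorder \<Rightarrow> 'a set \<Rightarrow> 'a gorder" where
  "subposet X A = X\<lparr>carrier := {z \<in> carrier X. z \<in> A}\<rparr>"

text \<open>The half-open interval from the minimum to \<open>t\<close>, as a set.\<close>

definition strict_below :: "'a gorder \<Rightarrow> 'a \<Rightarrow> 'a set" where
  "strict_below X t = {z \<in> carrier X. z \<sqsubseteq>\<^bsub>X\<^esub> t \<and> z \<noteq> t}"

definition open_interval :: "'a gorder \<Rightarrow> 'a \<Rightarrow> 'a \<Rightarrow> 'a gorder" where
  "open_interval X a b =
     subposet X {z. a \<sqsubseteq>\<^bsub>X\<^esub> z \<and> z \<noteq> a \<and> z \<sqsubseteq>\<^bsub>X\<^esub> b \<and> z \<noteq> b}"

definition covers :: "'a gorder \<Rightarrow> 'a \<Rightarrow> 'a \<Rightarrow> bool" where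
  "covers X b a \<longleftrightarrow>
     a \<in> carrier X \<and> b \<in> carrier X \<and> a \<sqsubseteq>\<^bsub>X\<^esub> b \<and> a \<noteq> b \<and>
     carrier (open_interval X a b) = {}"

text \<open>The rank of \<open>a\<close> is the length of a longest chain with top element \<open>a\<close>.\<close>

definition poset_rank :: "'a gorder \<Rightarrow> 'a \<Rightarrow> nat" where
  "poset_rank X a = Max (card ` {C. is_chain X C \<and> C \<subseteq> strict_below X a})"

definition total_rank :: "'a gorder \<Rightarrow> nat" where
  "total_rank X = Max (poset_rank X ` carrier X)"

definition has_minimum :: "'a gorder \<Rightarrow> bool" where
  "has_minimum X \<longleftrightarrow> (\<exists>z. least X z (carrier X))"

definition has_maximum :: "'a gorder \<Rightarrow> bool" where
  "has_maximum X \<longleftrightarrow> (\<exists>z. greatest X z (carrier X))"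

definition graded_bounded_poset :: "'a gorder \<Rightarrow> bool" where
  "graded_bounded_poset X \<longleftrightarrow>
     partial_order X \<and> finite (carrier X) \<and> has_minimum X \<and> has_maximum X \<and>
     (\<forall>a b. covers X b a \<longrightarrow> poset_rank X b = poset_rank X a + 1)"

text \<open>\<open>add_top X\<close> is the poset obtained from \<open>X\<close> by adding a new maximum \<^const>\<open>None\<close>.\<close>

definition add_top :: "'a gorder \<Rightarrow> 'a option gorder" where
  "add_top X =
     \<lparr>carrier = insert None (Some ` carrier X),
      eq = (=),
      le = (\<lambda>u v. v = None \<or> (\<exists>a b. u = Some a \<and> v = Some b \<and> a \<sqsubseteq>\<^bsub>X\<^esub> b))\<rparr>"


section \<open>Bier posets\<close>

text \<open>Here \<open>I\<close> is an ideal of \<^term>\<open>add_top X\<close>, and intervals are represented as sets.\<close>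

definition Bier :: "'a gorder \<Rightarrow> 'a option set \<Rightarrow> 'a option set gorder" where
  "Bier X I =
     \<lparr>carrier = {at_least_at_most (add_top X) a b | a b.
                   a \<in> I \<and> b \<in> carrier (add_top X) - I \<and> a \<sqsubseteq>\<^bsub>add_top X\<^esub> b},
      eq = (=),
      le = (\<supseteq>)\<rparr>"


section \<open>Simplicial homology of order complexes over a field\<close>

definition order_complex :: "'a gorder \<Rightarrow> 'a set set" where
  "order_complex X = {\<sigma>. finite \<sigma> \<and> is_chain X \<sigma>}"

text \<open>
  The augmented simplicial chain complex. The vertices of a simplex of the order complex are
  ordered by the poset order. This fixes all orientations, so \<open>i\<close>-chains are simply
  coefficient functions on the \<open>i\<close>-dimensional simplices. The empty simplex has dimension \<open>-1\<close>.
\<close>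

definition simplicial_chains :: "'a gorder \<Rightarrow> int \<Rightarrow> ('a set \<Rightarrow> 'k::field) set" where
  "simplicial_chains X i =
     {c. \<forall>\<sigma>. c \<sigma> \<noteq> 0 \<longrightarrow> \<sigma> \<in> order_complex X \<and> int (card \<sigma>) = i + 1}"

text \<open>
  The coefficient of \<open>\<tau>\<close> in the boundary of \<open>c\<close>: deleting the vertex at position \<open>j\<close>
  (counted from \<open>0\<close>) of a simplex carries the sign \<open>(-1) ^ j\<close>.
\<close>

definition simplicial_boundary ::
    "'a gorder \<Rightarrow> ('a set \<Rightarrow> 'k::field) \<Rightarrow> 'a set \<Rightarrow> 'k" where
  "simplicial_boundary X c \<tau> =
     (\<Sum>v \<in> {v \<in> carrier X - \<tau>. insert v \<tau> \<in> order_complex X}.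
        (-1) ^ card {u \<in> \<tau>. u \<sqsubseteq>\<^bsub>X\<^esub> v} * c (insert v \<tau>))"

definition reduced_homology_vanishes ::
    "'k::field itself \<Rightarrow> 'a gorder \<Rightarrow> int \<Rightarrow> bool" where
  "reduced_homology_vanishes K X i \<longleftrightarrow>
     {c \<in> simplicial_chains X i. \<forall>\<tau>. simplicial_boundary X c \<tau> = (0::'k)}
       = simplicial_boundary X ` simplicial_chains X (i + 1)"


section \<open>Eulerian, Cohen--Macaulay and Gorenstein* posets\<close>

definition Eulerian :: "'a gorder \<Rightarrow> bool" where
  "Eulerian X \<longleftrightarrow>
     graded_bounded_poset X \<and>
     (\<forall>a\<in>carrier X. \<forall>b\<in>carrier X. a \<sqsubseteq>\<^bsub>X\<^esub> b \<and> a \<noteq> b \<longrightarrow>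
        card {z \<in> at_least_at_most X a b. even (poset_rank X z)} =
        card {z \<in> at_least_at_most X a b. odd (poset_rank X z)})"

text \<open>
  The order complex of the open interval from \<open>a\<close> to \<open>b\<close> has dimension
  \<open>poset_rank X b - poset_rank X a - 2\<close>.
\<close>

definition Cohen_Macaulay :: "'k::field itself \<Rightarrow> 'a gorder \<Rightarrow> bool" where
  "Cohen_Macaulay K X \<longleftrightarrow>
     graded_bounded_poset X \<and>
     (\<forall>a\<in>carrier X. \<forall>b\<in>carrier X. a \<sqsubseteq>\<^bsub>X\<^esub> b \<and> a \<noteq> b \<longrightarrow>
        (\<forall>i. i < int (poset_rank X b) - int (poset_rank X a) - 2 \<longrightarrow>
           reduced_homology_vanishes K (open_interval X a b) i))"

definition Gorenstein_star :: "'k::field itself \<Rightarrow> 'a gorder \<Rightarrow> bool" where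
  "Gorenstein_star K X \<longleftrightarrow>
     partial_order X \<and> finite (carrier X) \<and> has_minimum X \<and>
     Eulerian (add_top X) \<and> Cohen_Macaulay K (add_top X)"


section \<open>The toric g-polynomial\<close>

text \<open>
  The notion is intended for lower Eulerian posets; the recursion makes sense for every finite
  poset. The value \<open>0\<close> for infinite carriers is only there to make the functions total.
\<close>

function (sequential) toric_f :: "'a gorder \<Rightarrow> int poly"
  and toric_g :: "'a gorder \<Rightarrow> int poly" where
  "toric_f X =
     (if carrier X = {} then 1
      else if infinite (carrier X) then 0
      else \<Sum>t\<in>carrier X. toric_g (subposet X (strict_below X t)) *
             [:-1, 1:] ^ (total_rank X - poset_rank X t))"
| "toric_g X =
     (if carrier X = {} then 1
      else (let h = coeff (toric_f X) in
        monom (h 0) 0 + (\<Sum>i=1..total_rank X div 2. monom (h i - h (i - 1)) i)))"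
  by pat_completeness auto
termination
proof (relation "Wellfounded.measure (\<lambda>v. case v of Inl X \<Rightarrow> 2 * card (carrier X)
                                      | Inr X \<Rightarrow> 2 * card (carrier X) + 1)")
  fix X :: "'a gorder" and t
  assume "\<not> infinite (carrier X)" and t: "t \<in> carrier X"
  then have "card (carrier (subposet X (strict_below X t))) < card (carrier X)"
    by (intro psubset_card_mono) (auto simp: subposet_def strict_below_def)
  then show "(Inr (subposet X (strict_below X t)), Inl X)
      \<in> Wellfounded.measure (\<lambda>v. case v of Inl X \<Rightarrow> 2 * card (carrier X)
                              | Inr X \<Rightarrow> 2 * card (carrier X) + 1)"
    by simp
qed auto

declare toric_f.simps [simp del] toric_g.simps [simp del]


section \<open>Multiplexes\<close>

text \<open>\<open>clamped n x j\<close> is \<open>x\<^sub>j\<close> with the convention \<open>x\<^sub>j = x\<^sub>0\<close> for \<open>j < 0\<close> and \<open>x\<^sub>j = x\<^sub>n\<close> for \<open>j > n\<close>.\<close>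

definition clamped :: "nat \<Rightarrow> (nat \<Rightarrow> 'a) \<Rightarrow> int \<Rightarrow> 'a" where
  "clamped n x j = (if j < 0 then x 0 else if j > int n then x n else x (nat j))"

text \<open>
  In the facets below the index \<open>i\<close> itself is left out, but the point \<open>x\<^sub>i\<close> can still occur
  by the convention above: for example, the facet with \<open>i = 0\<close> contains \<open>x\<^sub>0\<close>.
\<close>

definition is_multiplex ::
    "nat \<Rightarrow> nat \<Rightarrow> (nat \<Rightarrow> 'a::euclidean_space) \<Rightarrow> 'a set \<Rightarrow> bool" where
  "is_multiplex d n x S \<longleftrightarrow>
     2 \<le> d \<and> d \<le> n \<and> polytope S \<and> aff_dim S = int d \<and>
     inj_on x {0..n} \<and> {v. v extreme_point_of S} = x ` {0..n} \<and>
     {F. F facet_of S} =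
       (\<lambda>i. convex hull (clamped n x ` ({int i - int d + 1 .. int i + int d - 1} - {int i}))) ` {0..n}"

definition boundary_poset :: "'a::euclidean_space set \<Rightarrow> 'a set gorder" where
  "boundary_poset S = \<lparr>carrier = {F. F face_of S \<and> F \<noteq> S}, eq = (=), le = (\<subseteq>)\<rparr>"

end

theory Submission
  imports Defs
begin

text \<open>
  Identify the vertices of the multiplex with \<open>0, \<dots>, n\<close>. Its faces are the sets closed under the Galois
  connection of a symmetric relation: \<open>i\<close> lies on the facet \<open>F\<^sub>j\<close> iff \<open>\<bar>i - j\<bar> < d\<close> and \<open>i = j\<close> only if
  \<open>i = j \<in> {0, n}\<close>. Facets and vertex figures are again of this kind, so every interval of the face lattice
  has two elements or is the face lattice of a smaller multiplex. Adding the facets \<open>0, 1, \<dots>\<close> one by one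
  builds the boundary by removals of elements with nonevasive links, which bounds its homology.

  If the ideal grows by one element \<open>c\<close>, the two Bier posets differ from their intersection by sets of
  intervals which can be added one at a time with nonevasive links, together with the trivial interval
  \<open>[c, c]\<close>. So the vanishing of homology carries over from the ideal \<open>{0}\<close> to all ideals, and the
  intervals of a Bier poset are of the same type or products of intervals of the lattice.

  An interval \<open>[a, b]\<close> of rank \<open>r\<close> satisfies \<open>\<Sum>\<^sub>s x ^ (r(b) - r(s)) = (1 + x) ^ r + e(a, b) x (1 + x) ^ (r - 2)\<close>
  with \<open>e(a, b) \<ge> 0\<close>, whence \<open>\<gamma>(a, b) = 1 + e(a, b) x\<close> is its Kazhdan--Lusztig--Stanley polynomial.
  Multiplicativity on products yields
  \<open>(1 - x) f(P, x) = \<Sum>\<^sub>a \<gamma>(0, a) x ^ (d + 1 - r(a)) \<gamma>(a, 1)(1/x) - \<Sum>\<^sub>b \<gamma>(b, 1) x ^ r(b) \<gamma>(0, b)(1/x)\<close>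
  with both sums over the complement of the ideal. As \<open>r(b) \<ge> d div 2 + 2\<close> there, the second sum does not
  contribute to the coefficients up to \<open>d div 2\<close>, and the first one is nonnegative.
\<close>

section \<open>Nonevasive order complexes\<close>

text \<open>The hypotheses give only vertices and facets, so the face lattice is rebuilt from
  incidences: a proper nonempty face is the intersection of the facets containing it. As
  \<open>adj\<close> is symmetric, the lattice is self-dual, and a single induction on
  \<open>d\<close> covers facets and vertex figures. Two notions of connectivity occur.
  \<open>highly_connected\<close> is combinatorial and passes through isomorphisms, dualities, joins
  and products. Comparing two ideals, however, also means deleting elements, for which that
  inductive notion is not made; in homology, insertion and deletion along acyclic links are both
  harmless. An interval that is a multiplex of type \<open>(d, n)\<close> has
  \<open>e = n - d\<close>. The only type of dimension 1 is the segment, so \<open>e = 0\<close> up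
  to rank 2, and this puts \<open>1 + e x\<close> under the degree bound of the recursion. The
  factor \<open>1 - x\<close> turns the coefficients of \<open>f\<close> into successive
  differences, which are the \<open>g\<close>-coefficients up to the middle degree. The bound on the
  ranks in the ideal is what lifts the lowest possible term of the second sum, of degree
  \<open>r(b) - 1\<close>, above that middle degree.\<close>

text \<open>Order complexes are flag complexes, so deletions and links of vertices are again order
  complexes, and a complex can be represented by its vertex set alone.\<close>

definition link :: "('b \<Rightarrow> 'b \<Rightarrow> bool) \<Rightarrow> 'b set \<Rightarrow> 'b \<Rightarrow> 'b set" where
  "link R X x = {y \<in> X. y \<noteq> x \<and> (R x y \<or> R y x)}"

text \<open>Nonevasive complexes in the sense of Kahn, Saks and Sturtevant, with cones as base case.
  \<open>R\<close> enters only through comparability.\<close>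

inductive nonevasive :: "('b \<Rightarrow> 'b \<Rightarrow> bool) \<Rightarrow> 'b set \<Rightarrow> bool" for R where
  cone: "finite X \<Longrightarrow> x \<in> X \<Longrightarrow> (\<And>y. y \<in> X \<Longrightarrow> R x y \<or> R y x) \<Longrightarrow> nonevasive R X"
| step: "finite X \<Longrightarrow> x \<in> X \<Longrightarrow> nonevasive R (X - {x}) \<Longrightarrow> nonevasive R (link R X x) \<Longrightarrow> nonevasive R X"

text \<open>The index is one more than a dimension: homology will vanish below degree
  \<open>k - 1\<close>. The empty complex is the sphere of dimension \<open>-1\<close>. In the exact
  sequence of a vertex the link is shifted by one degree, hence its smaller index.\<close>

inductive highly_connected :: "('b \<Rightarrow> 'b \<Rightarrow> bool) \<Rightarrow> nat \<Rightarrow> 'b set \<Rightarrow> bool" for R where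
  empty: "highly_connected R 0 {}"
| nonevasive: "nonevasive R X \<Longrightarrow> highly_connected R k X"
| step: "finite X \<Longrightarrow> x \<in> X \<Longrightarrow> highly_connected R (Suc k) (X - {x}) \<Longrightarrow> highly_connected R k (link R X x) \<Longrightarrow>
    highly_connected R (Suc k) X"

lemma nonevasive_finite: "nonevasive R X \<Longrightarrow> finite X"
  by (induction rule: nonevasive.induct) auto

lemma highly_connected_finite: "highly_connected R k X \<Longrightarrow> finite X"
  by (induction rule: highly_connected.induct) (auto simp: nonevasive_finite)

lemma link_image:
  assumes "inj_on f X" "x \<in> X"
    and "\<And>x y. x \<in> X \<Longrightarrow> y \<in> X \<Longrightarrow> (R x y \<or> R y x) \<longleftrightarrow> (R' (f x) (f y) \<or> R' (f y) (f x))"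
  shows "link R' (f ` X) (f x) = f ` link R X x"
  using assms by (auto simp: link_def inj_on_eq_iff)

lemma nonevasive_image:
  assumes "nonevasive R X" "inj_on f X"
    and "\<And>x y. x \<in> X \<Longrightarrow> y \<in> X \<Longrightarrow> (R x y \<or> R y x) \<longleftrightarrow> (R' (f x) (f y) \<or> R' (f y) (f x))"
  shows "nonevasive R' (f ` X)"
  using assms
proof (induction rule: nonevasive.induct)
  case (cone X x)
  then show ?case by (intro nonevasive.cone[of _ "f x"]) auto
next
  case (step X x)
  have 1: "f ` X - {f x} = f ` (X - {x})"
    using step.prems(1) step.hyps(2) by (auto simp: inj_on_eq_iff)
  have 2: "link R' (f ` X) (f x) = f ` link R X x"
    by (rule link_image) (use step.prems step.hyps in auto)
  have s: "link R X x \<subseteq> X" by (auto simp: link_def)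
  have "nonevasive R' (f ` (X - {x}))"
    by (rule step.IH(1)) (use step.prems in \<open>auto intro: inj_on_subset\<close>)
  moreover have "nonevasive R' (f ` link R X x)"
    by (rule step.IH(2)[OF inj_on_subset[OF step.prems(1) s]]) (use step.prems(2) s in blast)
  ultimately show ?case
    using step.hyps(1,2) 1 2 by - (rule nonevasive.step[of _ "f x"], auto)
qed

lemma highly_connected_image:
  assumes "highly_connected R k X" "inj_on f X"
    and "\<And>x y. x \<in> X \<Longrightarrow> y \<in> X \<Longrightarrow> (R x y \<or> R y x) \<longleftrightarrow> (R' (f x) (f y) \<or> R' (f y) (f x))"
  shows "highly_connected R' k (f ` X)"
  using assms
proof (induction rule: highly_connected.induct)
  case empty
  then show ?case by (auto intro: highly_connected.empty)
next
  case (nonevasive X k)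
  then show ?case by (auto intro!: highly_connected.nonevasive nonevasive_image)
next
  case (step X x k)
  have 1: "f ` X - {f x} = f ` (X - {x})"
    using step.prems(1) step.hyps(2) by (auto simp: inj_on_eq_iff)
  have 2: "link R' (f ` X) (f x) = f ` link R X x"
    by (rule link_image) (use step.prems step.hyps in auto)
  have s: "link R X x \<subseteq> X" by (auto simp: link_def)
  have "highly_connected R' (Suc k) (f ` (X - {x}))"
    by (rule step.IH(1)) (use step.prems in \<open>auto intro: inj_on_subset\<close>)
  moreover have "highly_connected R' k (f ` link R X x)"
    by (rule step.IH(2)[OF inj_on_subset[OF step.prems(1) s]]) (use step.prems(2) s in blast)
  ultimately show ?case
    using step.hyps(1,2) 1 2 by - (rule highly_connected.step[of _ "f x"], auto)
qed

lemma link_Un: "(\<And>y. y \<in> Y \<Longrightarrow> y \<noteq> x \<and> (R x y \<or> R y x)) \<Longrightarrow> link R (X \<union> Y) x = link R X x \<union> Y"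
  by (auto simp: link_def)

text \<open>Deletion and link of a vertex of \<open>X\<close> in the join are the joins of
  \<open>Y\<close> with the deletion and the link in \<open>X\<close>, so a derivation for
  \<open>X\<close> carries over step by step. A cone point of \<open>X\<close> is a cone point of
  the join.\<close>

lemma nonevasive_join:
  assumes "nonevasive R X" "finite Y" "X \<inter> Y = {}"
    and "\<And>x y. x \<in> X \<Longrightarrow> y \<in> Y \<Longrightarrow> R x y \<or> R y x"
  shows "nonevasive R (X \<union> Y)"
  using assms
proof (induction rule: nonevasive.induct)
  case (cone X x)
  then show ?case by (intro nonevasive.cone[of _ x]) auto
next
  case (step X x)
  have s: "link R X x \<subseteq> X" by (auto simp: link_def)
  have x: "x \<notin> Y" using step.hyps step.prems by auto
  have 1: "nonevasive R (X - {x} \<union> Y)"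
    by (rule step.IH(1)) (use step.prems in auto)
  have 2: "nonevasive R (link R X x \<union> Y)"
    by (rule step.IH(2)) (use step.prems s in auto)
  have e1: "X \<union> Y - {x} = X - {x} \<union> Y" using x by auto
  have e2: "link R (X \<union> Y) x = link R X x \<union> Y"
    using step.prems step.hyps x by (intro link_Un) auto
  have f: "finite (X \<union> Y)" using step.hyps(1) step.prems(1) by simp
  show ?case
    by (rule nonevasive.step[OF f, of x]) (use step.hyps(2) 1 2 in \<open>simp_all only: e1 e2 UnI1\<close>)
qed

text \<open>The recursion of \<open>nonevasive_join\<close> again. It ends with \<open>Y\<close>
  alone, of index \<open>l\<close>, or with a nonevasive complex joined with
  \<open>Y\<close>.\<close>

lemma highly_connected_join:
  assumes "highly_connected R k X" "highly_connected R l Y" "X \<inter> Y = {}"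
    and "\<And>x y. x \<in> X \<Longrightarrow> y \<in> Y \<Longrightarrow> R x y \<or> R y x"
  shows "highly_connected R (k + l) (X \<union> Y)"
  using assms
proof (induction rule: highly_connected.induct)
  case empty
  then show ?case by simp
next
  case (nonevasive X k)
  then show ?case by (intro highly_connected.nonevasive nonevasive_join) (auto dest: highly_connected_finite)
next
  case (step X x k)
  have s: "link R X x \<subseteq> X" by (auto simp: link_def)
  have x: "x \<notin> Y" using step.hyps step.prems by auto
  have 1: "highly_connected R (Suc k + l) (X - {x} \<union> Y)"
    by (rule step.IH(1)) (use step.prems in auto)
  have 2: "highly_connected R (k + l) (link R X x \<union> Y)"
    by (rule step.IH(2)) (use step.prems s in auto)
  have e1: "X \<union> Y - {x} = X - {x} \<union> Y" using x by auto
  have e2: "link R (X \<union> Y) x = link R X x \<union> Y"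
    using step.prems step.hyps x by (intro link_Un) auto
  have f: "finite (X \<union> Y)" using step.hyps(1) highly_connected_finite[OF step.prems(1)] by simp
  have "highly_connected R (Suc (k + l)) (X \<union> Y)"
    by (rule highly_connected.step[OF f, of x]) (use step.hyps(2) 1 2 in \<open>simp_all only: e1 e2 add_Suc UnI1\<close>)
  then show ?case by (simp only: add_Suc)
qed

lemma nonevasive_converse: "nonevasive (\<lambda>x y. R y x) X \<longleftrightarrow> nonevasive R X"
proof
  assume a: "nonevasive (\<lambda>x y. R y x) X"
  have "nonevasive R (id ` X)" by (rule nonevasive_image[OF a]) auto
  then show "nonevasive R X" by simp
next
  assume a: "nonevasive R X"
  have "nonevasive (\<lambda>x y. R y x) (id ` X)" by (rule nonevasive_image[OF a]) auto
  then show "nonevasive (\<lambda>x y. R y x) X" by simp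
qed

definition porder :: "('b \<Rightarrow> 'b \<Rightarrow> bool) \<Rightarrow> bool" where
  "porder R \<longleftrightarrow> (\<forall>x. R x x) \<and> (\<forall>x y. R x y \<longrightarrow> R y x \<longrightarrow> x = y) \<and>
     (\<forall>x y z. R x y \<longrightarrow> R y z \<longrightarrow> R x z)"

lemma porder_refl: "porder R \<Longrightarrow> R x x"
  and porder_antisym: "porder R \<Longrightarrow> R x y \<Longrightarrow> R y x \<Longrightarrow> x = y"
  and porder_trans: "porder R \<Longrightarrow> R x y \<Longrightarrow> R y z \<Longrightarrow> R x z"
proof -
  assume p: "porder R"
  show "R x x" using p unfolding porder_def by simp
  show "R x y \<Longrightarrow> R y x \<Longrightarrow> x = y" using p unfolding porder_def by simp
  show "R x y \<Longrightarrow> R y z \<Longrightarrow> R x z" using p unfolding porder_def by meson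
qed

lemma porder_converse: "porder R \<Longrightarrow> porder (\<lambda>x y. R y x)"
  unfolding porder_def by meson

lemma porder_minimal:
  assumes "porder R" "finite N" "N \<noteq> {}"
  obtains z where "z \<in> N" "\<And>w. w \<in> N \<Longrightarrow> R w z \<Longrightarrow> w = z"
proof -
  have "\<exists>z\<in>N. \<forall>w\<in>N. R w z \<longrightarrow> w = z"
    using assms(2,3)
  proof (induction rule: finite_ne_induct)
    case (insert x F)
    then obtain z where z: "z \<in> F" "\<forall>w\<in>F. R w z \<longrightarrow> w = z" by auto
    show ?case
    proof (cases "R x z")
      case True
      have "w = x" if w: "w \<in> insert x F" "R w x" for w
      proof (rule ccontr)
        assume "w \<noteq> x"
        then have "w \<in> F" using w by simp
        moreover have "R w z" using w(2) True by (rule porder_trans[OF assms(1)])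
        ultimately have "w = z" using z by simp
        then show False using \<open>w \<noteq> x\<close> w(2) True porder_antisym[OF assms(1)] by simp
      qed
      then show ?thesis by blast
    next
      case False
      then show ?thesis using z by auto
    qed
  qed auto
  then show ?thesis using that by blast
qed

text \<open>Elements are added from the top downwards, so that only the elements of \<open>N\<close> above \<open>z\<close>
  are present when \<open>z\<close> is added.\<close>

lemma nonevasive_add_up:
  assumes "porder R" "finite N" "X \<inter> N = {}" "nonevasive R X"
    and "\<And>z. z \<in> N \<Longrightarrow> nonevasive R (link R (X \<union> {w \<in> N. R z w}) z)"
  shows "nonevasive R (X \<union> N)"
  using assms(2,3,5)
proof (induction "card N" arbitrary: N)
  case 0
  then show ?case using assms(4) by simp
next
  case (Suc m)
  then have "N \<noteq> {}" by auto
  from porder_minimal[OF assms(1) Suc.prems(1) this]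
  obtain z where z: "z \<in> N" "\<And>w. w \<in> N \<Longrightarrow> R w z \<Longrightarrow> w = z" by blast
  have zX: "z \<notin> X" using z Suc.prems(2) by auto
  have eq: "{w \<in> N - {z}. R u w} = {w \<in> N. R u w}" if "u \<in> N - {z}" for u
    using z that by auto
  have 1: "nonevasive R (X \<union> (N - {z}))"
  proof (rule Suc.hyps(1))
    fix u assume u: "u \<in> N - {z}"
    show "nonevasive R (link R (X \<union> {w \<in> N - {z}. R u w}) u)"
      unfolding eq[OF u] using Suc.prems(3)[of u] u by blast
  qed (use Suc.prems Suc.hyps(2) z in auto)
  have 2: "X \<union> N - {z} = X \<union> (N - {z})" using zX by auto
  have 3: "link R (X \<union> N) z = link R (X \<union> {w \<in> N. R z w}) z"
    using z by (auto simp: link_def)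
  have f: "finite (X \<union> N)" using Suc.prems(1) nonevasive_finite[OF assms(4)] by simp
  show ?case
  proof (rule nonevasive.step[OF f])
    show "z \<in> X \<union> N" using z(1) by simp
    show "nonevasive R (X \<union> N - {z})" using 1 by (simp only: 2)
    show "nonevasive R (link R (X \<union> N) z)" using Suc.prems(3)[OF z(1)] by (simp only: 3)
  qed
qed

text \<open>The preceding lemma for the converse relation: elements are now added from the bottom
  upwards.\<close>

lemma nonevasive_add_down:
  assumes "porder R" "finite N" "X \<inter> N = {}" "nonevasive R X"
    and "\<And>z. z \<in> N \<Longrightarrow> nonevasive R (link R (X \<union> {w \<in> N. R w z}) z)"
  shows "nonevasive R (X \<union> N)"
proof -
  have link: "link (\<lambda>x y. R y x) Y z = link R Y z" for Y z by (auto simp: link_def)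
  have "nonevasive (\<lambda>x y. R y x) (X \<union> N)"
  proof (rule nonevasive_add_up[OF porder_converse[OF assms(1)] assms(2,3)])
    show "nonevasive (\<lambda>x y. R y x) X" unfolding nonevasive_converse[of R] by (rule assms(4))
    show "nonevasive (\<lambda>x y. R y x) (link (\<lambda>x y. R y x) (X \<union> {w \<in> N. R w z}) z)" if "z \<in> N" for z
      unfolding nonevasive_converse[of R] link by (rule assms(5)[OF that])
  qed
  then show ?thesis unfolding nonevasive_converse[of R] .
qed

section \<open>Reduced homology of order complexes\<close>

definition poset_on :: "('b \<Rightarrow> 'b \<Rightarrow> bool) \<Rightarrow> 'b set \<Rightarrow> 'b gorder" where
  "poset_on R X = \<lparr>carrier = X, eq = (=), le = R\<rparr>"

lemma poset_on_simps [simp]: "carrier (poset_on R X) = X" "gorder.le (poset_on R X) = R" "eq (poset_on R X) = (=)"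
  by (auto simp: poset_on_def)

definition bd_sign :: "('b \<Rightarrow> 'b \<Rightarrow> bool) \<Rightarrow> 'b \<Rightarrow> 'b set \<Rightarrow> 'k::field" where
  "bd_sign R v \<tau> = (-1) ^ card {u \<in> \<tau>. R u v}"

text \<open>The sum runs over all vertices outside \<open>\<tau>\<close>, not only over those that
  complete it to a chain. On simplicial chains the additional terms vanish, and the index set no
  longer depends on the order.\<close>

definition bdry :: "('b \<Rightarrow> 'b \<Rightarrow> bool) \<Rightarrow> 'b set \<Rightarrow> ('b set \<Rightarrow> 'k::field) \<Rightarrow> 'b set \<Rightarrow> 'k" where
  "bdry R X c \<tau> = (\<Sum>v\<in>X - \<tau>. bd_sign R v \<tau> * c (insert v \<tau>))"

abbreviation poset_chains :: "('b \<Rightarrow> 'b \<Rightarrow> bool) \<Rightarrow> 'b set \<Rightarrow> int \<Rightarrow> ('b set \<Rightarrow> 'k::field) set" where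
  "poset_chains R X i \<equiv> simplicial_chains (poset_on R X) i"

lemma poset_chains_iff: "c \<in> poset_chains R X i \<longleftrightarrow> (\<forall>\<sigma>. c \<sigma> \<noteq> 0 \<longrightarrow> finite \<sigma> \<and> \<sigma> \<subseteq> X \<and>
    (\<forall>a\<in>\<sigma>. \<forall>b\<in>\<sigma>. R a b \<or> R b a) \<and> int (card \<sigma>) = i + 1)"
  by (auto simp: simplicial_chains_def order_complex_def is_chain_def)

lemma poset_chains_D:
  assumes "c \<in> poset_chains R X i" "c \<sigma> \<noteq> 0"
  shows "finite \<sigma>" "\<sigma> \<subseteq> X" "\<forall>a\<in>\<sigma>. \<forall>b\<in>\<sigma>. R a b \<or> R b a" "int (card \<sigma>) = i + 1"
  using assms(1)[unfolded poset_chains_iff, THEN spec, THEN mp, OF assms(2)] by simp_all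

lemma boundary_eq:
  assumes "finite X" "c \<in> poset_chains R X i"
  shows "simplicial_boundary (poset_on R X) c \<tau> = bdry R X c \<tau>"
  unfolding simplicial_boundary_def bdry_def bd_sign_def poset_on_simps
  using assms(1)
  by (intro sum.mono_neutral_left)
     (use assms(2) in \<open>auto simp: simplicial_chains_def\<close>)

lemma bdry_mono:
  assumes "finite X" "Y \<subseteq> X" "c \<in> poset_chains R Y i"
  shows "bdry R X c = bdry R Y c"
proof
  fix \<tau>
  show "bdry R X c \<tau> = bdry R Y c \<tau>"
    unfolding bdry_def using assms(1,2)
    by (intro sum.mono_neutral_right) (use assms(3) in \<open>auto simp: poset_chains_iff\<close>)
qed

lemma poset_chains_mono: "Y \<subseteq> X \<Longrightarrow> c \<in> poset_chains R Y i \<Longrightarrow> c \<in> poset_chains R X i"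
  by (force simp: poset_chains_iff)

lemma bdry_add: "bdry R X (\<lambda>\<sigma>. c \<sigma> + e \<sigma>) \<tau> = bdry R X c \<tau> + bdry R X e \<tau>"
  by (simp add: bdry_def sum.distrib algebra_simps)

lemma bdry_diff: "bdry R X (\<lambda>\<sigma>. c \<sigma> - e \<sigma>) \<tau> = bdry R X c \<tau> - bdry R X e \<tau>"
  by (simp add: bdry_def sum_subtractf algebra_simps)

lemma bdry_in_poset_chains:
  assumes "c \<in> poset_chains R X (i + 1)"
  shows "bdry R X c \<in> poset_chains R X i"
  unfolding poset_chains_iff
proof (intro allI impI)
  fix \<sigma> assume "bdry R X c \<sigma> \<noteq> 0"
  then obtain v where v: "v \<in> X - \<sigma>" "c (insert v \<sigma>) \<noteq> 0"
    unfolding bdry_def by (metis (no_types, lifting) mult_zero_right sum.neutral)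
  from poset_chains_D[OF assms v(2)] v(1) show "finite \<sigma> \<and> \<sigma> \<subseteq> X \<and> (\<forall>a\<in>\<sigma>. \<forall>b\<in>\<sigma>. R a b \<or> R b a) \<and> int (card \<sigma>) = i + 1"
    by auto
qed

lemma bd_sign_sq [simp]: "bd_sign R v \<tau> * bd_sign R v \<tau> = (1::'k::field)"
  by (simp add: bd_sign_def flip: power_add mult_2)

lemma bd_sign_sq' [simp]: "bd_sign R v \<tau> * (bd_sign R v \<tau> * a) = (a::'k::field)"
  by (simp flip: mult.assoc)

lemma bd_sign_insert:
  assumes "finite \<tau>" "v \<notin> \<tau>"
  shows "bd_sign R w (insert v \<tau>) = (if R v w then - bd_sign R w \<tau> else (bd_sign R w \<tau> :: 'k::field))"
proof -
  have "{u \<in> insert v \<tau>. R u w} = (if R v w then insert v {u \<in> \<tau>. R u w} else {u \<in> \<tau>. R u w})"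
    by auto
  then show ?thesis using assms by (simp add: bd_sign_def)
qed

text \<open>Removing \<open>v\<close> and then \<open>w\<close>, or \<open>w\<close> and then
  \<open>v\<close>, gives opposite signs: of two comparable vertices exactly one is counted in the
  sign of the other.\<close>

lemma bdry_bdry:
  assumes "porder R" "finite X" "c \<in> poset_chains R X i"
  shows "bdry R X (bdry R X c) \<tau> = (0::'k::field)"
proof (cases "finite \<tau>")
  \<comment> \<open>Chains are supported on finite simplices; the signs are meaningful for finite
    \<open>\<tau>\<close> only.\<close>
  case False
  then have "bdry R X c (insert v \<tau>) = 0" for v
    unfolding bdry_def using assms(3) by (intro sum.neutral) (auto simp: poset_chains_iff)
  then show ?thesis by (simp add: bdry_def)
next
  case fin: True
  define f where "f v w = (bd_sign R v \<tau> :: 'k) * bd_sign R w (insert v \<tau>) * c (insert w (insert v \<tau>))" for v w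
  let ?Y = "X - \<tau>"
  have fY: "finite ?Y" using assms by auto
  have R: "R v w \<or> R w v" if "c (insert w (insert v \<tau>)) \<noteq> 0" for v w
    using poset_chains_D(3)[OF assms(3) that] by simp
  have "bdry R X (bdry R X c) \<tau> = (\<Sum>v\<in>?Y. \<Sum>w\<in>?Y - {v}. f v w)"
    unfolding bdry_def f_def
    by (intro sum.cong refl) (auto simp: sum_distrib_left mult.assoc intro!: sum.cong)
  also have "\<dots> = (\<Sum>v\<in>?Y. \<Sum>w\<in>?Y. if v \<noteq> w then f v w else 0)"
    using fY by (intro sum.cong refl sum.mono_neutral_cong_left) auto
  \<comment> \<open>The ordered pairs are split by which of the two vertices is the lower one.
    Swapping the summation in one half matches it with the negative of the other.\<close>
  also have "\<dots> = (\<Sum>v\<in>?Y. \<Sum>w\<in>?Y. (if v \<noteq> w \<and> R v w then f v w else 0) +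
       (if v \<noteq> w \<and> R w v then f v w else 0))"
  proof (intro sum.cong refl)
    fix v w
    show "(if v \<noteq> w then f v w else 0) = (if v \<noteq> w \<and> R v w then f v w else 0) +
       (if v \<noteq> w \<and> R w v then f v w else 0)"
      using R[of w v] porder_antisym[OF assms(1), of v w] unfolding f_def
      by (cases "c (insert w (insert v \<tau>)) = 0"; cases "v = w"; cases "R v w"; cases "R w v") simp_all
  qed
  also have "\<dots> = (\<Sum>v\<in>?Y. \<Sum>w\<in>?Y. if v \<noteq> w \<and> R v w then f v w else 0) +
       (\<Sum>v\<in>?Y. \<Sum>w\<in>?Y. if v \<noteq> w \<and> R w v then f v w else 0)"
    by (simp add: sum.distrib)
  also have "(\<Sum>v\<in>?Y. \<Sum>w\<in>?Y. if v \<noteq> w \<and> R w v then f v w else 0) =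
      (\<Sum>w\<in>?Y. \<Sum>v\<in>?Y. if v \<noteq> w \<and> R w v then f v w else 0)"
    by (rule sum.swap)
  also have "\<dots> = (\<Sum>v\<in>?Y. \<Sum>w\<in>?Y. - (if v \<noteq> w \<and> R v w then f v w else 0))"
  proof (intro sum.cong refl)
    fix v w assume "v \<in> ?Y" "w \<in> ?Y"
    then show "(if w \<noteq> v \<and> R v w then f w v else 0) = - (if v \<noteq> w \<and> R v w then f v w else 0)"
      using fin porder_antisym[OF assms(1), of v w]
      by (auto simp: f_def bd_sign_insert insert_commute)
  qed
  finally show ?thesis by (simp add: sum_negf)
qed

section \<open>Homology under insertion and deletion of a vertex\<close>

definition homology_vanishes :: "'k::field itself \<Rightarrow> ('b \<Rightarrow> 'b \<Rightarrow> bool) \<Rightarrow> 'b set \<Rightarrow> int \<Rightarrow> bool" where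
  "homology_vanishes K R X i \<longleftrightarrow> (\<forall>c\<in>poset_chains R X i. (\<forall>\<tau>. bdry R X c \<tau> = (0::'k)) \<longrightarrow> (\<exists>w\<in>poset_chains R X (i + 1). c = bdry R X w))"

text \<open>Boundaries are cycles by \<open>bdry_bdry\<close>, so \<open>homology_vanishes\<close>
  keeps only the inclusion of cycles in boundaries.\<close>

lemma homology_vanishes_iff:
  assumes "porder R" "finite X"
  shows "reduced_homology_vanishes (K :: 'k::field itself) (poset_on R X) i \<longleftrightarrow> homology_vanishes K R X i"
proof -
  let ?Z = "{c \<in> poset_chains R X i. \<forall>\<tau>. bdry R X c \<tau> = (0::'k)}"
  let ?B = "bdry R X ` poset_chains R X (i + 1) :: ('a set \<Rightarrow> 'k) set"
  have Z: "{c \<in> poset_chains R X i. \<forall>\<tau>. simplicial_boundary (poset_on R X) c \<tau> = (0::'k)} = ?Z"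
    by (intro Collect_cong conj_cong refl) (simp add: boundary_eq[OF assms(2)])
  have "simplicial_boundary (poset_on R X) c = bdry R X c" if "c \<in> poset_chains R X (i + 1)" for c :: "'a set \<Rightarrow> 'k"
    using boundary_eq[OF assms(2) that] by auto
  then have B: "simplicial_boundary (poset_on R X) ` poset_chains R X (i + 1) = ?B" by auto
  have "?B \<subseteq> ?Z" using bdry_in_poset_chains bdry_bdry[OF assms] by blast
  then show ?thesis
    unfolding reduced_homology_vanishes_def Z B homology_vanishes_def by blast
qed

text \<open>The cone with apex \<open>x\<close> over the chain \<open>b\<close>. The sign is the one
  with which \<open>b\<close> reappears in the boundary of the cone.\<close>

definition cone_part :: "('b \<Rightarrow> 'b \<Rightarrow> bool) \<Rightarrow> 'b \<Rightarrow> ('b set \<Rightarrow> 'k::field) \<Rightarrow> 'b set \<Rightarrow> 'k" where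
  "cone_part R x b \<sigma> = (if x \<in> \<sigma> then bd_sign R x (\<sigma> - {x}) * b (\<sigma> - {x}) else 0)"

lemma cone_part_in_poset_chains:
  assumes "b \<in> poset_chains R (link R X x) i" "x \<in> X" "porder R"
  shows "cone_part R x b \<in> poset_chains R X (i + 1)"
  unfolding poset_chains_iff
proof (intro allI impI)
  fix \<sigma> assume "cone_part R x b \<sigma> \<noteq> 0"
  then have x: "x \<in> \<sigma>" and bx: "b (\<sigma> - {x}) \<noteq> 0" by (auto simp: cone_part_def split: if_splits)
  note * = poset_chains_D[OF assms(1) bx]
  have R: "R x a \<or> R a x" if "a \<in> \<sigma>" for a
    using *(2) that porder_refl[OF assms(3)] by (cases "a = x") (auto simp: link_def)
  from * have "finite \<sigma>" by auto
  moreover have "\<sigma> \<subseteq> X" using *(2) assms(2) by (auto simp: link_def)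
  moreover have "int (card \<sigma>) = i + 1 + 1"
    using * x \<open>finite \<sigma>\<close> by (metis card.remove of_nat_Suc add.commute)
  moreover have "\<forall>a\<in>\<sigma>. \<forall>b\<in>\<sigma>. R a b \<or> R b a"
    using *(3) R by (metis Diff_iff singletonD)
  ultimately show "finite \<sigma> \<and> \<sigma> \<subseteq> X \<and> (\<forall>a\<in>\<sigma>. \<forall>b\<in>\<sigma>. R a b \<or> R b a) \<and> int (card \<sigma>) = i + 1 + 1"
    by blast
qed

text \<open>The cone formula. On a simplex without \<open>x\<close> only the removal of the apex
  contributes; on a simplex with \<open>x\<close> every term is one of the boundary of
  \<open>b\<close> with reversed sign.\<close>

lemma bdry_cone_part:
  assumes "porder R" "finite X" "x \<in> X" "b \<in> poset_chains R (link R X x) i"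
  shows "bdry R X (cone_part R x b) \<tau> = b \<tau> - cone_part R x (bdry R X b) \<tau>"
proof (cases "x \<in> \<tau>")
  case False
  have "bdry R X (cone_part R x b) \<tau> = (\<Sum>v\<in>{x}. bd_sign R v \<tau> * cone_part R x b (insert v \<tau>))"
    unfolding bdry_def using assms(2,3) False
    by (intro sum.mono_neutral_right) (auto simp: cone_part_def)
  also have "\<dots> = b \<tau>" using False by (simp add: cone_part_def)
  finally show ?thesis using False by (simp add: cone_part_def)
next
  case True
  let ?t = "\<tau> - {x}"
  have b0: "b \<tau> = 0"
    using assms(4) True by (force simp: poset_chains_iff link_def)
  have b1: "b (insert x ?t) = 0" using b0 True by (simp add: insert_absorb)
  have t: "insert x ?t = \<tau>" using True by auto
  have "bdry R X (cone_part R x b) \<tau> = (\<Sum>v\<in>X - \<tau>. - (bd_sign R x ?t * (bd_sign R v ?t * b (insert v ?t))))"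
    unfolding bdry_def
  proof (intro sum.cong refl)
    fix v assume v: "v \<in> X - \<tau>"
    have e: "insert v \<tau> - {x} = insert v ?t" using v True by auto
    show "bd_sign R v \<tau> * cone_part R x b (insert v \<tau>) = - (bd_sign R x ?t * (bd_sign R v ?t * b (insert v ?t)))"
    proof (cases "b (insert v ?t) = 0")
      case True
      then show ?thesis by (simp add: cone_part_def e)
    next
      case False
      note * = poset_chains_D[OF assms(4) False]
      then have "R x v \<or> R v x" "x \<noteq> v" by (auto simp: link_def)
      \<comment> \<open>Exactly one of \<open>x\<close> and \<open>v\<close> is below the other, so
        exactly one of the two signs changes.\<close>
      then have "R x v \<longleftrightarrow> \<not> R v x" using porder_antisym[OF assms(1), of x v] by auto
      moreover have "bd_sign R v \<tau> = (if R x v then - bd_sign R v ?t else (bd_sign R v ?t :: 'b))"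
        using bd_sign_insert[of ?t x R v] * t by auto
      moreover have "bd_sign R x (insert v ?t) = (if R v x then - bd_sign R x ?t else (bd_sign R x ?t :: 'b))"
        using bd_sign_insert[of ?t v R x] * v by auto
      ultimately show ?thesis using True by (auto simp: cone_part_def e)
    qed
  qed
  also have "\<dots> = - (bd_sign R x ?t * (\<Sum>v\<in>X - \<tau>. bd_sign R v ?t * b (insert v ?t)))"
    by (simp add: sum_negf sum_distrib_left)
  also have "(\<Sum>v\<in>X - \<tau>. bd_sign R v ?t * b (insert v ?t)) = bdry R X b ?t"
    unfolding bdry_def using assms(2) True b1
    by (intro sum.mono_neutral_left) auto
  finally have 1: "bdry R X (cone_part R x b) \<tau> = - (bd_sign R x ?t * bdry R X b ?t)" .
  have "cone_part R x (bdry R X b) \<tau> = bd_sign R x ?t * bdry R X b ?t" using True by (simp add: cone_part_def)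
  then show ?thesis using 1 b0 by simp
qed

text \<open>A chain splits uniquely into the simplices avoiding \<open>x\<close> and a cone over a
  chain \<open>b\<close> in the link. The signs squared are 1, so \<open>b\<close> is read off by
  multiplying with the sign again.\<close>

lemma chain_split:
  assumes "porder R" "finite X" "x \<in> X" "z \<in> poset_chains R X i"
  obtains z0 b where "z0 \<in> poset_chains R (X - {x}) i" "b \<in> poset_chains R (link R X x) (i - 1)"
    "z = (\<lambda>\<sigma>. z0 \<sigma> + cone_part R x b \<sigma>)" "\<And>\<tau>. bdry R X z \<tau> = bdry R X z0 \<tau> + b \<tau> - cone_part R x (bdry R X b) \<tau>"
proof -
  define z0 where "z0 \<sigma> = (if x \<in> \<sigma> then 0 else z \<sigma>)" for \<sigma>
  define b where "b \<tau> = (if x \<in> \<tau> then 0 else bd_sign R x \<tau> * z (insert x \<tau>))" for \<tau>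
  have 1: "z0 \<in> poset_chains R (X - {x}) i"
    using assms(4) by (auto simp: poset_chains_iff z0_def split: if_splits)
  have 2: "b \<in> poset_chains R (link R X x) (i - 1)"
    unfolding poset_chains_iff
  proof (intro allI impI)
    fix \<sigma> assume "b \<sigma> \<noteq> 0"
    then have x: "x \<notin> \<sigma>" and z: "z (insert x \<sigma>) \<noteq> 0" by (auto simp: b_def split: if_splits)
    note * = poset_chains_D[OF assms(4) z]
    moreover have "\<sigma> \<subseteq> link R X x" using * x by (auto simp: link_def)
    ultimately show "finite \<sigma> \<and> \<sigma> \<subseteq> link R X x \<and> (\<forall>a\<in>\<sigma>. \<forall>b\<in>\<sigma>. R a b \<or> R b a) \<and> int (card \<sigma>) = i - 1 + 1"
      using x by auto
  qed
  have 3: "z = (\<lambda>\<sigma>. z0 \<sigma> + cone_part R x b \<sigma>)"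
    by (auto simp: z0_def cone_part_def b_def insert_absorb)
  have 4: "bdry R X z \<tau> = bdry R X z0 \<tau> + b \<tau> - cone_part R x (bdry R X b) \<tau>" for \<tau>
    using bdry_cone_part[OF assms(1-3) 2] by (simp add: 3 bdry_add)
  show ?thesis by (rule that[OF 1 2 3 4])
qed

lemma poset_chains_notin: "c \<in> poset_chains R X i \<Longrightarrow> x \<notin> X \<Longrightarrow> x \<in> \<tau> \<Longrightarrow> c \<tau> = 0"
  by (auto simp: poset_chains_iff)

lemma bdry_notin: "c \<in> poset_chains R Y i \<Longrightarrow> x \<notin> Y \<Longrightarrow> x \<in> \<tau> \<Longrightarrow> bdry R X c \<tau> = 0"
  unfolding bdry_def by (intro sum.neutral) (auto simp: poset_chains_iff)

text \<open>On simplices through \<open>x\<close> only the cone over the boundary of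
  \<open>b\<close> can be nonzero. If the total vanishes there, \<open>b\<close> is a cycle of the
  link.\<close>

lemma split_link_cycle:
  assumes R: "porder R" "finite X" "x \<in> X"
    and z0: "z0 \<in> poset_chains R (X - {x}) i" and b: "b \<in> poset_chains R (link R X x) j"
    and d: "\<And>\<tau>. x \<in> \<tau> \<Longrightarrow> bdry R X z0 \<tau> + b \<tau> - cone_part R x (bdry R X b) \<tau> = 0"
  shows "bdry R X b \<tau> = 0"
proof (cases "x \<in> \<tau>")
  case True
  then show ?thesis using bdry_notin[OF b, of x \<tau> X] by (auto simp: link_def)
next
  case False
  have "x \<notin> X - {x}" "x \<notin> link R X x" by (auto simp: link_def)
  then have "cone_part R x (bdry R X b) (insert x \<tau>) = 0"
    using d[of "insert x \<tau>"] bdry_notin[OF z0, of x "insert x \<tau>" X] poset_chains_notin[OF b, of x "insert x \<tau>"]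
    by simp
  then have "bd_sign R x \<tau> * bdry R X b \<tau> = 0" using False by (simp add: cone_part_def)
  then have "bd_sign R x \<tau> * (bd_sign R x \<tau> * bdry R X b \<tau>) = 0" by (simp only: mult_zero_right)
  then show ?thesis by (simp only: bd_sign_sq')
qed

text \<open>Mayer-Vietoris on the level of chains. If \<open>b\<close> bounds \<open>e\<close> in
  the link, then the cone over \<open>b\<close> equals \<open>e\<close> minus the boundary of the
  cone over \<open>e\<close>. Thus the cycle is homologous to \<open>z0 + e\<close>, which avoids
  \<open>x\<close>.\<close>

lemma homology_vanishes_add:
  assumes R: "porder R" "finite X" "x \<in> X"
    and 1: "homology_vanishes K R (X - {x}) i" and 2: "homology_vanishes K R (link R X x) (i - 1)"
  shows "homology_vanishes (K :: 'k::field itself) R X i"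
  unfolding homology_vanishes_def
proof (intro ballI impI)
  fix z :: "'a set \<Rightarrow> 'k" assume z: "z \<in> poset_chains R X i" and dz: "\<forall>\<tau>. bdry R X z \<tau> = 0"
  from chain_split[OF R z] obtain z0 b where z0: "z0 \<in> poset_chains R (X - {x}) i"
    and b: "b \<in> poset_chains R (link R X x) (i - 1)" and eq: "z = (\<lambda>\<sigma>. z0 \<sigma> + cone_part R x b \<sigma>)"
    and bdz: "\<And>\<tau>. bdry R X z \<tau> = bdry R X z0 \<tau> + b \<tau> - cone_part R x (bdry R X b) \<tau>" by blast
  have sub: "link R X x \<subseteq> X" "X - {x} \<subseteq> X" "link R X x \<subseteq> X - {x}" by (auto simp: link_def)
  have db: "bdry R X b \<tau> = 0" for \<tau>
    by (rule split_link_cycle[OF R z0 b]) (use bdz dz in auto)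
  with 2 b sub bdry_mono[OF R(2) sub(1) b] obtain e where e: "e \<in> poset_chains R (link R X x) i" "b = bdry R (link R X x) e"
    unfolding homology_vanishes_def by force
  have be: "b = bdry R X e" using e bdry_mono[OF R(2) sub(1) e(1)] by simp
  have xb: "cone_part R x b \<tau> = e \<tau> - bdry R X (cone_part R x e) \<tau>" for \<tau>
    using bdry_cone_part[OF R e(1)] be by simp
  define z1 where "z1 = (\<lambda>\<sigma>. z0 \<sigma> + e \<sigma>)"
  have eC: "e \<in> poset_chains R (X - {x}) i" by (rule poset_chains_mono[OF sub(3) e(1)])
  have z1: "z1 \<in> poset_chains R (X - {x}) i"
    using z0 eC unfolding z1_def poset_chains_iff by (metis add.right_neutral)
  have "bdry R X z1 \<tau> = 0" for \<tau>
  proof -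
    have "bdry R X z0 \<tau> + b \<tau> = 0" using bdz[of \<tau>] dz db by (simp add: cone_part_def)
    then show ?thesis by (simp add: z1_def bdry_add be)
  qed
  with z1 bdry_mono[OF R(2) sub(2) z1] 1 obtain w where w: "w \<in> poset_chains R (X - {x}) (i + 1)" "z1 = bdry R (X - {x}) w"
    unfolding homology_vanishes_def by force
  have w': "z1 = bdry R X w" using w bdry_mono[OF R(2) sub(2) w(1)] by simp
  have wC: "w \<in> poset_chains R X (i + 1)" by (rule poset_chains_mono[OF sub(2) w(1)])
  have xe: "cone_part R x e \<in> poset_chains R X (i + 1)" by (rule cone_part_in_poset_chains[OF e(1) R(3,1)])
  have "(\<lambda>\<sigma>. w \<sigma> - cone_part R x e \<sigma>) \<in> poset_chains R X (i + 1)"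
    using wC xe unfolding poset_chains_iff by (metis diff_zero)
  moreover have "z = bdry R X (\<lambda>\<sigma>. w \<sigma> - cone_part R x e \<sigma>)"
  proof
    fix \<tau>
    have "z \<tau> = z0 \<tau> + (e \<tau> - bdry R X (cone_part R x e) \<tau>)" using eq xb by simp
    also have "\<dots> = z1 \<tau> - bdry R X (cone_part R x e) \<tau>" by (simp add: z1_def)
    finally show "z \<tau> = bdry R X (\<lambda>\<sigma>. w \<sigma> - cone_part R x e \<sigma>) \<tau>" using w' by (simp add: bdry_diff)
  qed
  ultimately show "\<exists>w\<in>poset_chains R X (i + 1). z = bdry R X w" by blast
qed

text \<open>A cycle avoiding \<open>x\<close> bounds some \<open>w\<close> that may use
  \<open>x\<close>. The link part of \<open>w\<close> has the same degree as the cycle and bounds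
  \<open>e\<close> in the link; replacing the cone in \<open>w\<close> by \<open>e\<close> removes
  \<open>x\<close>. Hence degree \<open>i\<close> of the link is needed here, not
  \<open>i - 1\<close>.\<close>

lemma homology_vanishes_del:
  assumes R: "porder R" "finite X" "x \<in> X"
    and 1: "homology_vanishes K R X i" and 2: "homology_vanishes K R (link R X x) i"
  shows "homology_vanishes (K :: 'k::field itself) R (X - {x}) i"
  unfolding homology_vanishes_def
proof (intro ballI impI)
  fix z :: "'a set \<Rightarrow> 'k" assume z: "z \<in> poset_chains R (X - {x}) i" and dz: "\<forall>\<tau>. bdry R (X - {x}) z \<tau> = 0"
  have sub: "link R X x \<subseteq> X" "X - {x} \<subseteq> X" "link R X x \<subseteq> X - {x}" by (auto simp: link_def)
  have zX: "z \<in> poset_chains R X i" by (rule poset_chains_mono[OF sub(2) z])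
  from dz bdry_mono[OF R(2) sub(2) z] zX 1 obtain w where w: "w \<in> poset_chains R X (i + 1)" "z = bdry R X w"
    unfolding homology_vanishes_def by force
  from chain_split[OF R w(1)] obtain w0 b where w0: "w0 \<in> poset_chains R (X - {x}) (i + 1)"
    and b: "b \<in> poset_chains R (link R X x) (i + 1 - 1)" and eq: "w = (\<lambda>\<sigma>. w0 \<sigma> + cone_part R x b \<sigma>)"
    and bdw: "\<And>\<tau>. bdry R X w \<tau> = bdry R X w0 \<tau> + b \<tau> - cone_part R x (bdry R X b) \<tau>" by blast
  have db: "bdry R X b \<tau> = 0" for \<tau>
  proof (rule split_link_cycle[OF R w0 b])
    fix \<tau> assume "x \<in> \<tau>"
    then have "z \<tau> = 0" using poset_chains_notin[OF z] by auto
    then show "bdry R X w0 \<tau> + b \<tau> - cone_part R x (bdry R X b) \<tau> = 0" using w bdw by metis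
  qed
  with 2 b bdry_mono[OF R(2) sub(1) b] obtain e where e: "e \<in> poset_chains R (link R X x) (i + 1)" "b = bdry R (link R X x) e"
    unfolding homology_vanishes_def by force
  have be: "b = bdry R X e" using e bdry_mono[OF R(2) sub(1) e(1)] by simp
  have eC: "e \<in> poset_chains R (X - {x}) (i + 1)" by (rule poset_chains_mono[OF sub(3) e(1)])
  have we: "(\<lambda>\<sigma>. w0 \<sigma> + e \<sigma>) \<in> poset_chains R (X - {x}) (i + 1)"
    using w0 eC unfolding poset_chains_iff by (metis add.right_neutral)
  moreover have "z = bdry R X (\<lambda>\<sigma>. w0 \<sigma> + e \<sigma>)"
  proof
    fix \<tau>
    have "cone_part R x (bdry R X b) \<tau> = 0" using db by (simp add: cone_part_def)
    then show "z \<tau> = bdry R X (\<lambda>\<sigma>. w0 \<sigma> + e \<sigma>) \<tau>" using w(2) bdw[of \<tau>] be by (simp add: bdry_add)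
  qed
  ultimately show "\<exists>w\<in>poset_chains R (X - {x}) (i + 1). z = bdry R (X - {x}) w"
    using bdry_mono[OF R(2) sub(2) we] by auto
qed

text \<open>The link of the apex is the whole rest, and a cycle is the boundary of the cone over its
  part avoiding the apex.\<close>

lemma homology_vanishes_cone:
  assumes R: "porder R" "finite X" "x \<in> X" and c: "\<And>y. y \<in> X \<Longrightarrow> R x y \<or> R y x"
  shows "homology_vanishes (K :: 'k::field itself) R X i"
  unfolding homology_vanishes_def
proof (intro ballI impI)
  fix z :: "'a set \<Rightarrow> 'k" assume z: "z \<in> poset_chains R X i" and dz: "\<forall>\<tau>. bdry R X z \<tau> = 0"
  from chain_split[OF R z] obtain z0 b where z0: "z0 \<in> poset_chains R (X - {x}) i"
    and b: "b \<in> poset_chains R (link R X x) (i - 1)" and eq: "z = (\<lambda>\<sigma>. z0 \<sigma> + cone_part R x b \<sigma>)"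
    and bdz: "\<And>\<tau>. bdry R X z \<tau> = bdry R X z0 \<tau> + b \<tau> - cone_part R x (bdry R X b) \<tau>" by blast
  have link: "link R X x = X - {x}" using c by (auto simp: link_def)
  have db: "bdry R X b \<tau> = 0" for \<tau>
    by (rule split_link_cycle[OF R z0 b]) (use bdz dz in auto)
  have bz: "bdry R X z0 \<tau> = - b \<tau>" for \<tau>
    using bdz[of \<tau>] dz db by (simp add: cone_part_def eq_neg_iff_add_eq_0)
  have z0': "z0 \<in> poset_chains R (link R X x) i" using z0 link by simp
  have "z = bdry R X (cone_part R x z0)"
  proof
    fix \<tau> show "z \<tau> = bdry R X (cone_part R x z0) \<tau>"
      using bdry_cone_part[OF R z0', of \<tau>] bz eq by (simp add: cone_part_def)
  qed
  then show "\<exists>w\<in>poset_chains R X (i + 1). z = bdry R X w" using cone_part_in_poset_chains[OF z0' R(3,1)] by blast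
qed

lemma nonevasive_homology_vanishes:
  assumes "nonevasive R X" "porder R" shows "homology_vanishes (K :: 'k::field itself) R X i"
  using assms(1)
proof (induction arbitrary: i rule: nonevasive.induct)
  case (cone X x)
  then show ?case using homology_vanishes_cone[OF assms(2)] by blast
next
  case (step X x)
  then show ?case using homology_vanishes_add[OF assms(2)] by blast
qed

text \<open>The homological counterpart of \<open>highly_connected\<close> with the same index. It
  is invariant under inserting and deleting elements with nonevasive links, which is what the change
  of ideals requires.\<close>

definition vanishes_below :: "'k::field itself \<Rightarrow> ('b \<Rightarrow> 'b \<Rightarrow> bool) \<Rightarrow> nat \<Rightarrow> 'b set \<Rightarrow> bool" where
  "vanishes_below K R k X \<longleftrightarrow> (\<forall>i. i + 1 < int k \<longrightarrow> homology_vanishes K R X i)"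

lemma highly_connected_vanishes_below:
  assumes "highly_connected R k X" "porder R" shows "vanishes_below (K :: 'k::field itself) R k X"
  using assms(1)
proof (induction rule: highly_connected.induct)
  case empty
  have "\<exists>w\<in>poset_chains R {} (i + 1). c = bdry R {} w"
    if "i + 1 < 0" "c \<in> poset_chains R {} i" for i and c :: "'a set \<Rightarrow> 'k"
    using that by (intro bexI[of _ "\<lambda>_. 0"]) (auto simp: poset_chains_iff bdry_def fun_eq_iff)
  then show ?case by (auto simp: vanishes_below_def homology_vanishes_def)
next
  case (nonevasive X k)
  then show ?case using nonevasive_homology_vanishes[OF _ assms(2)] by (auto simp: vanishes_below_def)
next
  case (step X x k)
  then show ?case unfolding vanishes_below_def by (auto intro!: homology_vanishes_add[OF assms(2), of X x])
qed

lemma vanishes_below_remove_iff: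
  assumes "porder R" "finite X" "x \<in> X" "nonevasive R (link R X x)"
  shows "vanishes_below (K :: 'k::field itself) R k X \<longleftrightarrow> vanishes_below K R k (X - {x})"
proof
  assume "vanishes_below K R k X"
  then show "vanishes_below K R k (X - {x})"
    unfolding vanishes_below_def using homology_vanishes_del[OF assms(1-3) _ nonevasive_homology_vanishes[OF assms(4,1)]] by blast
next
  assume "vanishes_below K R k (X - {x})"
  then show "vanishes_below K R k X"
    unfolding vanishes_below_def using homology_vanishes_add[OF assms(1-3) _ nonevasive_homology_vanishes[OF assms(4,1)]] by blast
qed

text \<open>The hypothesis on all subsets \<open>Z\<close> allows the elements of \<open>N\<close>
  to be added in any order.\<close>

lemma vanishes_below_add_iff:
  assumes "porder R" "finite X" "finite N" "X \<inter> N = {}"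
    and "\<And>z Z. z \<in> N \<Longrightarrow> Z \<subseteq> N \<Longrightarrow> nonevasive R (link R (X \<union> Z) z)"
  shows "vanishes_below (K :: 'k::field itself) R k (X \<union> N) \<longleftrightarrow> vanishes_below K R k X"
  using assms(3-5)
proof (induction rule: finite_induct)
  case (insert x N)
  have "X \<union> insert x N - {x} = X \<union> N" using insert by auto
  then have "vanishes_below K R k (X \<union> insert x N) \<longleftrightarrow> vanishes_below K R k (X \<union> N)"
    using vanishes_below_remove_iff[OF assms(1), of "X \<union> insert x N" x K k]
      insert.prems(2)[of x "insert x N"] insert.hyps(1) assms(2) by simp
  moreover have "vanishes_below K R k (X \<union> N) \<longleftrightarrow> vanishes_below K R k X"
  proof (rule insert.IH)
    show "nonevasive R (link R (X \<union> Z) z)" if "z \<in> N" "Z \<subseteq> N" for z Z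
      by (rule insert.prems(2)) (use that in auto)
  qed (use insert.prems(1) in auto)
  ultimately show ?case by simp
next
  case empty
  show ?case by (simp only: Un_empty_right)
qed

text \<open>Here the bijection must preserve the order and not just comparability, since the order
  fixes the signs. Chains are transported by \<open>pull\<close> and \<open>push\<close>, which are
  extended by zero to sets that are not contained in the carriers.\<close>

lemma homology_vanishes_iso:
  assumes "bij_betw f (carrier Y) X" "porder R" "finite X"
    and R: "\<And>u v. u \<in> carrier Y \<Longrightarrow> v \<in> carrier Y \<Longrightarrow> u \<sqsubseteq>\<^bsub>Y\<^esub> v \<longleftrightarrow> R (f u) (f v)"
    and "homology_vanishes (K :: 'k::field itself) R X i"
  shows "reduced_homology_vanishes K Y i"
proof -
  define C where "C = carrier Y"
  have inj: "inj_on f C" using assms(1) unfolding C_def bij_betw_def by blast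
  have im: "f ` C = X" using assms(1) unfolding C_def bij_betw_def by blast
  have finC: "finite C" using bij_betw_finite[OF assms(1)] assms(3) by (simp add: C_def)
  have oc: "f ` \<sigma> \<in> order_complex (poset_on R X) \<longleftrightarrow> \<sigma> \<in> order_complex Y" if s: "\<sigma> \<subseteq> C" for \<sigma>
  proof -
    have "finite \<sigma>" using finC s finite_subset by blast
    moreover have "f ` \<sigma> \<subseteq> X" using s im by auto
    moreover have "(\<forall>a\<in>\<sigma>. \<forall>b\<in>\<sigma>. R (f a) (f b) \<or> R (f b) (f a)) \<longleftrightarrow>
        (\<forall>a\<in>\<sigma>. \<forall>b\<in>\<sigma>. a \<sqsubseteq>\<^bsub>Y\<^esub> b \<or> b \<sqsubseteq>\<^bsub>Y\<^esub> a)"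
      using s R by (metis C_def subsetD)
    ultimately show ?thesis using s by (auto simp: order_complex_def is_chain_def C_def)
  qed
  have ocC: "\<sigma> \<in> order_complex Y \<Longrightarrow> \<sigma> \<subseteq> C" for \<sigma>
    by (auto simp: order_complex_def is_chain_def C_def)
  have ocX: "\<sigma> \<in> order_complex (poset_on R X) \<Longrightarrow> \<sigma> \<subseteq> X" for \<sigma>
    by (auto simp: order_complex_def is_chain_def)
  have cd: "card (f ` \<sigma>) = card \<sigma>" if "\<sigma> \<subseteq> C" for \<sigma>
    using inj that by (metis card_image inj_on_subset)
  define pull :: "('b set \<Rightarrow> 'k) \<Rightarrow> 'a set \<Rightarrow> 'k" where
    "pull c \<sigma> = (if \<sigma> \<subseteq> C then c (f ` \<sigma>) else 0)" for c \<sigma>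
  define push :: "('a set \<Rightarrow> 'k) \<Rightarrow> 'b set \<Rightarrow> 'k" where
    "push c \<sigma> = (if \<sigma> \<subseteq> X then c {u \<in> C. f u \<in> \<sigma>} else 0)" for c \<sigma>
  have inv1: "{u \<in> C. f u \<in> f ` \<sigma>} = \<sigma>" if "\<sigma> \<subseteq> C" for \<sigma>
    using that inj by (auto simp: inj_on_eq_iff subset_iff)
  have inv2: "f ` {u \<in> C. f u \<in> \<sigma>} = \<sigma>" if "\<sigma> \<subseteq> X" for \<sigma> using that im by auto
  have pull_poset_chains: "pull c \<in> simplicial_chains Y j" if "c \<in> poset_chains R X j" for c j
    using that oc cd by (auto simp: simplicial_chains_def pull_def split: if_splits)
  have push_poset_chains: "push c \<in> poset_chains R X j" if c: "c \<in> simplicial_chains Y j" for c j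
    unfolding simplicial_chains_def mem_Collect_eq
  proof (intro allI impI)
    fix \<sigma> assume "push c \<sigma> \<noteq> 0"
    then have s: "\<sigma> \<subseteq> X" "c {u \<in> C. f u \<in> \<sigma>} \<noteq> 0" by (auto simp: push_def split: if_splits)
    let ?s = "{u \<in> C. f u \<in> \<sigma>}"
    have "?s \<in> order_complex Y" "int (card ?s) = j + 1"
      using s c by (auto simp: simplicial_chains_def)
    then show "\<sigma> \<in> order_complex (poset_on R X) \<and> int (card \<sigma>) = j + 1"
      using oc[of ?s] cd[of ?s] inv2[OF s(1)] by auto
  qed
  have bdry_pull: "simplicial_boundary Y (pull c) \<tau> = pull (simplicial_boundary (poset_on R X) c) \<tau>"
    if c: "c \<in> poset_chains R X j" for c \<tau> j
  proof (cases "\<tau> \<subseteq> C")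
    case False
    then have "{v \<in> carrier Y - \<tau>. insert v \<tau> \<in> order_complex Y} = {}"
      using ocC by blast
    then show ?thesis using False by (simp add: pull_def simplicial_boundary_def)
  next
    case True
    let ?A = "{v \<in> C - \<tau>. insert v \<tau> \<in> order_complex Y}"
    let ?B = "{v \<in> X - f ` \<tau>. insert v (f ` \<tau>) \<in> order_complex (poset_on R X)}"
    have AB: "?B = f ` ?A"
    proof (intro Set.set_eqI iffI)
      fix v assume v: "v \<in> ?B"
      then obtain u where u: "u \<in> C" "v = f u" using im by auto
      then have "u \<notin> \<tau>" "insert u \<tau> \<in> order_complex Y"
        using v True oc[of "insert u \<tau>"] by auto
      then show "v \<in> f ` ?A" using u by auto
    next
      fix v assume "v \<in> f ` ?A"
      then obtain u where u: "u \<in> C" "u \<notin> \<tau>" "insert u \<tau> \<in> order_complex Y" "v = f u" by auto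
      then show "v \<in> ?B"
        using True im inj oc[of "insert u \<tau>"] by (auto simp: inj_on_eq_iff subset_iff)
    qed
    have "simplicial_boundary (poset_on R X) c (f ` \<tau>) =
       (\<Sum>v\<in>?A. (-1) ^ card {u \<in> f ` \<tau>. R u (f v)} * c (insert (f v) (f ` \<tau>)))"
      unfolding simplicial_boundary_def poset_on_simps AB
      by (subst sum.reindex) (use inj in \<open>auto intro: inj_on_subset\<close>)
    also have "\<dots> = (\<Sum>v\<in>?A. (-1) ^ card {u \<in> \<tau>. u \<sqsubseteq>\<^bsub>Y\<^esub> v} * pull c (insert v \<tau>))"
    proof (intro sum.cong refl)
      fix v assume v: "v \<in> ?A"
      then have "{u \<in> f ` \<tau>. R u (f v)} = f ` {u \<in> \<tau>. u \<sqsubseteq>\<^bsub>Y\<^esub> v}"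
        using True R by (auto simp: C_def subset_iff)
      then have "card {u \<in> f ` \<tau>. R u (f v)} = card {u \<in> \<tau>. u \<sqsubseteq>\<^bsub>Y\<^esub> v}"
        using cd[of "{u \<in> \<tau>. u \<sqsubseteq>\<^bsub>Y\<^esub> v}"] True by auto
      then show "(-1) ^ card {u \<in> f ` \<tau>. R u (f v)} * c (insert (f v) (f ` \<tau>)) =
          (-1) ^ card {u \<in> \<tau>. u \<sqsubseteq>\<^bsub>Y\<^esub> v} * pull c (insert v \<tau>)"
        using v True by (simp add: pull_def)
    qed
    finally show ?thesis using True by (simp add: pull_def simplicial_boundary_def C_def)
  qed
  have pull_push: "pull (push c) = c" if "c \<in> simplicial_chains Y j" for c j
  proof
    fix \<sigma> show "pull (push c) \<sigma> = c \<sigma>"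
      using that inv1[of \<sigma>] ocC im by (auto simp: pull_def push_def simplicial_chains_def)
  qed
  have rh: "reduced_homology_vanishes K (poset_on R X) i" using assms homology_vanishes_iff by blast
  have rhD: "c \<in> simplicial_boundary (poset_on R X) ` poset_chains R X (i + 1) \<longleftrightarrow>
      c \<in> poset_chains R X i \<and> (\<forall>\<tau>. simplicial_boundary (poset_on R X) c \<tau> = 0)" for c :: "'b set \<Rightarrow> 'k"
    using rh unfolding reduced_homology_vanishes_def by blast
  show ?thesis unfolding reduced_homology_vanishes_def
  proof (intro Set.set_eqI iffI)
    fix c :: "'a set \<Rightarrow> 'k"
    assume "c \<in> {c \<in> simplicial_chains Y i. \<forall>\<tau>. simplicial_boundary Y c \<tau> = 0}"
    then have c: "c \<in> simplicial_chains Y i" "\<And>\<tau>. simplicial_boundary Y c \<tau> = 0" by auto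
    have p: "push c \<in> poset_chains R X i" by (rule push_poset_chains[OF c(1)])
    have "simplicial_boundary (poset_on R X) (push c) \<tau> = 0" for \<tau>
    proof (cases "\<tau> \<subseteq> X")
      case True
      have "pull (simplicial_boundary (poset_on R X) (push c)) {u \<in> C. f u \<in> \<tau>} = 0"
        using bdry_pull[OF p] pull_push[OF c(1)] c(2) by metis
      then show ?thesis using inv2[OF True] by (simp add: pull_def)
    next
      case False
      then have "{v \<in> carrier (poset_on R X) - \<tau>. insert v \<tau> \<in> order_complex (poset_on R X)} = {}"
        using ocX by blast
      then show ?thesis unfolding simplicial_boundary_def by (simp only: sum.empty)
    qed
    with p rhD obtain w where w: "w \<in> poset_chains R X (i + 1)" "push c = simplicial_boundary (poset_on R X) w"
      by blast
    have "c = simplicial_boundary Y (pull w)"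
      using pull_push[OF c(1)] w(2) bdry_pull[OF w(1)] by auto
    then show "c \<in> simplicial_boundary Y ` simplicial_chains Y (i + 1)"
      using pull_poset_chains[OF w(1)] by blast
  next
    fix c :: "'a set \<Rightarrow> 'k"
    assume "c \<in> simplicial_boundary Y ` simplicial_chains Y (i + 1)"
    then obtain w where w: "w \<in> simplicial_chains Y (i + 1)" "c = simplicial_boundary Y w" by blast
    have pw: "push w \<in> poset_chains R X (i + 1)" by (rule push_poset_chains[OF w(1)])
    let ?b = "simplicial_boundary (poset_on R X) (push w)"
    have b: "?b \<in> poset_chains R X i" "\<And>\<tau>. simplicial_boundary (poset_on R X) ?b \<tau> = 0" using rhD pw by blast+
    have c: "c = pull ?b" using w bdry_pull[OF pw] pull_push[OF w(1)] by auto
    have "simplicial_boundary Y c \<tau> = 0" for \<tau>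
      unfolding c bdry_pull[OF b(1)] using b(2) by (simp add: pull_def)
    then show "c \<in> {c \<in> simplicial_chains Y i. \<forall>\<tau>. simplicial_boundary Y c \<tau> = 0}"
      using pull_poset_chains[OF b(1)] c by auto
  qed
qed

section \<open>Products and ideals with one element more\<close>

text \<open>Reverse inclusion of intervals, that is, the product of the order with its dual.\<close>

definition interval_le :: "'b::order \<times> 'b \<Rightarrow> 'b \<times> 'b \<Rightarrow> bool" where
  "interval_le p q \<longleftrightarrow> fst p \<le> fst q \<and> snd q \<le> snd p"

lemma interval_le_Pair [simp]: "interval_le (a, b) (c, d) \<longleftrightarrow> a \<le> c \<and> d \<le> b"
  by (simp add: interval_le_def)

lemma porder_interval_le: "porder interval_le"
  unfolding porder_def interval_le_def by (intro conjI allI impI prod_eqI) auto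

lemma porder_order: "porder ((\<le>) :: 'b::order \<Rightarrow> _)"
  unfolding porder_def by (intro conjI allI impI) auto

text \<open>In the product order \<open>t\<close> is the greatest second coordinate. The slice
  \<open>E1 \<times> {t}\<close> is a cone with apex \<open>(a1, t)\<close>. The remaining pairs are
  added from below, and the link of \<open>(s, u)\<close> is a cone with apex \<open>(s, t)\<close>,
  its projection to the slice.\<close>

lemma nonevasive_prod:
  fixes E1 E2 :: "'b::order set"
  assumes E1: "finite E1" "a1 \<in> E1" "\<And>s. s \<in> E1 \<Longrightarrow> a1 \<le> s"
    and E2: "finite E2" "t \<in> E2" "\<And>u. u \<in> E2 \<Longrightarrow> t \<le> u" and ne: "t \<noteq> b1"
  shows "nonevasive interval_le (E1 \<times> E2 - {(a1, b1)})"
proof -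
  define X where "X = E1 \<times> {t}"
  define N where "N = E1 \<times> (E2 - {t}) - {(a1, b1)}"
  have fX: "finite X" and fN: "finite N" using E1 E2 by (auto simp: X_def N_def)
  have "nonevasive interval_le (X \<union> N)"
  proof (rule nonevasive_add_down[OF porder_interval_le fN])
    show "X \<inter> N = {}" by (auto simp: X_def N_def)
    show "nonevasive interval_le X" by (rule nonevasive.cone[of _ "(a1, t)"]) (use fX E1 in \<open>auto simp: X_def\<close>)
    fix z assume z: "z \<in> N"
    then obtain s u where su: "z = (s, u)" "s \<in> E1" "u \<in> E2" "u \<noteq> t" by (auto simp: N_def)
    have tu: "t \<le> u" "\<not> u \<le> t" using E2(3)[OF su(3)] su(4) by auto
    show "nonevasive interval_le (link interval_le (X \<union> {w \<in> N. interval_le w z}) z)"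
    proof (rule nonevasive.cone[of _ "(s, t)"])
      show "finite (link interval_le (X \<union> {w \<in> N. interval_le w z}) z)" using fX fN by (simp add: link_def)
      show "(s, t) \<in> link interval_le (X \<union> {w \<in> N. interval_le w z}) z"
        using su tu by (auto simp: link_def X_def)
      fix y assume y: "y \<in> link interval_le (X \<union> {w \<in> N. interval_le w z}) z"
      obtain p q where pq: "y = (p, q)" by fastforce
      show "interval_le (s, t) y \<or> interval_le y (s, t)"
        using y tu E2(3) by (auto simp: link_def X_def N_def su pq)
    qed
  qed
  moreover have "X \<union> N = E1 \<times> E2 - {(a1, b1)}" using ne E2(2) by (auto simp: X_def N_def)
  ultimately show ?thesis by simp
qed

text \<open>The proper part of a product is a suspension of the join of the proper parts. The corner
  \<open>(a2, b1)\<close> serves as a suspension point: its link is that join, and without it a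
  nonevasive complex remains.\<close>

lemma highly_connected_prod:
  fixes E1 E2 :: "'b::order set"
  assumes E1: "finite E1" "a1 \<in> E1" "a2 \<in> E1" "\<And>s. s \<in> E1 \<Longrightarrow> a1 \<le> s \<and> s \<le> a2" "a1 \<noteq> a2"
    and E2: "finite E2" "b1 \<in> E2" "b2 \<in> E2" "\<And>u. u \<in> E2 \<Longrightarrow> b2 \<le> u \<and> u \<le> b1" "b1 \<noteq> b2"
    and s1: "highly_connected (\<le>) k1 (E1 - {a1, a2})" and s2: "highly_connected (\<le>) k2 (E2 - {b1, b2})"
  shows "highly_connected interval_le (Suc (k1 + k2)) (E1 \<times> E2 - {(a1, b1), (a2, b2)})"
proof -
  \<comment> \<open>\<open>X\<close> lacks the slice over the greatest element \<open>a2\<close>;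
    \<open>N\<close> is this slice without its two ends. The end \<open>(a2, b2)\<close> is the
    maximum of the product and \<open>(a2, b1)\<close> is the corner.\<close>
  define X where "X = (E1 - {a2}) \<times> E2 - {(a1, b1)}"
  define N where "N = {a2} \<times> (E2 - {b1, b2})"
  have fN: "finite N" using E2(1) by (simp add: N_def)
  have ac: "nonevasive interval_le (X \<union> N)"
  proof (rule nonevasive_add_up[OF porder_interval_le fN])
    show "X \<inter> N = {}" by (auto simp: X_def N_def)
    show "nonevasive interval_le X" unfolding X_def
      by (rule nonevasive_prod[where t = b2]) (use E1 E2 in auto)
    fix z assume z: "z \<in> N"
    \<comment> \<open>Below \<open>(a2, t)\<close> lies the product \<open>?A\<close>, above it the
      part \<open>?B\<close> of the slice. Their join is nonevasive because \<open>?A\<close>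
      is.\<close>
    then obtain t where t: "z = (a2, t)" "t \<in> E2" "t \<noteq> b1" "t \<noteq> b2" by (auto simp: N_def)
    let ?A = "(E1 - {a2}) \<times> {u \<in> E2. t \<le> u} - {(a1, b1)}"
    let ?B = "{a2} \<times> {u \<in> E2 - {b1, b2}. u \<le> t \<and> u \<noteq> t}"
    have "link interval_le (X \<union> {w \<in> N. interval_le z w}) z = ?A \<union> ?B"
    proof (intro subset_antisym subsetI)
      fix y assume y: "y \<in> link interval_le (X \<union> {w \<in> N. interval_le z w}) z"
      obtain p q where pq: "y = (p, q)" by fastforce
      show "y \<in> ?A \<union> ?B"
        using y E1(4)[of p] by (auto simp: link_def X_def N_def t(1) pq)
    next
      fix y assume y: "y \<in> ?A \<union> ?B"
      obtain p q where pq: "y = (p, q)" by fastforce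
      show "y \<in> link interval_le (X \<union> {w \<in> N. interval_le z w}) z"
        using y E1(4)[of p] by (auto simp: link_def X_def N_def t(1) pq)
    qed
    moreover have "nonevasive interval_le ?A"
      by (rule nonevasive_prod[where t = t]) (use E1 E2 t in auto)
    moreover have "nonevasive interval_le (?A \<union> ?B)"
      by (rule nonevasive_join) (use \<open>nonevasive interval_le ?A\<close> E1(4) E2(1) in auto)
    ultimately show "nonevasive interval_le (link interval_le (X \<union> {w \<in> N. interval_le z w}) z)" by simp
  qed
  let ?Y = "E1 \<times> E2 - {(a1, b1), (a2, b2)}"
  have Y: "?Y - {(a2, b1)} = X \<union> N" using E1 E2 by (auto simp: X_def N_def)
  let ?A = "(\<lambda>s. (s, b1)) ` (E1 - {a1, a2})" and ?B = "(\<lambda>u. (a2, u)) ` (E2 - {b1, b2})"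
  have L: "link interval_le ?Y (a2, b1) = ?A \<union> ?B"
  proof (intro subset_antisym subsetI)
    fix y assume y: "y \<in> link interval_le ?Y (a2, b1)"
    obtain p q where pq: "y = (p, q)" by fastforce
    show "y \<in> ?A \<union> ?B"
      using y E1(4)[of p] E2(4)[of q] by (auto simp: link_def pq)
  next
    fix y assume "y \<in> ?A \<union> ?B"
    then show "y \<in> link interval_le ?Y (a2, b1)"
      using E1(2-5) E2(2-5) by (auto simp: link_def)
  qed
  have "highly_connected interval_le k1 ?A" by (rule highly_connected_image[OF s1]) (auto simp: inj_on_def)
  moreover have "highly_connected interval_le k2 ?B" by (rule highly_connected_image[OF s2]) (auto simp: inj_on_def)
  ultimately have "highly_connected interval_le (k1 + k2) (?A \<union> ?B)"
    by (rule highly_connected_join) (use E1 E2 in auto)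
  then have "highly_connected interval_le (k1 + k2) (link interval_le ?Y (a2, b1))" by (simp only: L)
  moreover have "highly_connected interval_le (Suc (k1 + k2)) (?Y - {(a2, b1)})"
    unfolding Y by (rule highly_connected.nonevasive[OF ac])
  moreover have "finite ?Y" "(a2, b1) \<in> ?Y" using E1 E2 by auto
  ultimately show ?thesis using highly_connected.step[of ?Y "(a2, b1)" interval_le "k1 + k2"] by blast
qed

text \<open>The Bier poset of the interval \<open>[a0, b0]\<close> with ideal \<open>I\<close>,
  without its minimum.\<close>

definition proper_pairs :: "'b::order set \<Rightarrow> 'b set \<Rightarrow> 'b \<Rightarrow> 'b \<Rightarrow> ('b \<times> 'b) set" where
  "proper_pairs E I a0 b0 = {(a, b). a \<in> I \<and> b \<in> E - I \<and> a \<le> b} - {(a0, b0)}"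

text \<open>Enlarging the ideal by \<open>c\<close> replaces the intervals ending at \<open>c\<close> by those starting at \<open>c\<close>.
  Both posets are obtained from their union with the trivial interval at \<open>c\<close> by deleting
  elements with contractible links.\<close>

lemma vanishes_below_proper_pairs_insert:
  fixes E :: "'b::order set"
  assumes E: "finite E" "a0 \<in> E" "b0 \<in> E" "\<And>z. z \<in> E \<Longrightarrow> a0 \<le> z \<and> z \<le> b0"
    and I: "I \<subseteq> E" "a0 \<in> I" "\<And>a b. a \<in> I \<Longrightarrow> b \<in> E \<Longrightarrow> b \<le> a \<Longrightarrow> b \<in> I"
    and c: "c \<in> E" "c \<notin> I" "c \<noteq> b0" "\<And>z. z \<in> E \<Longrightarrow> z \<notin> I \<Longrightarrow> z \<le> c \<Longrightarrow> z = c"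
  shows "vanishes_below (K :: 'k::field itself) interval_le k (proper_pairs E I a0 b0) \<longleftrightarrow> vanishes_below K interval_le k (proper_pairs E (insert c I) a0 b0)"
proof -
  have b0: "b0 \<notin> I" using I(3)[of b0 c] E(4)[of c] c by blast
  have ac: "a0 \<noteq> c" "b0 \<noteq> a0" using I(2) c(2) b0 by auto
  define Q where "Q = proper_pairs E I a0 b0"
  define Q' where "Q' = proper_pairs E (insert c I) a0 b0"
  define N1 where "N1 = {(c, b) | b. b \<in> E - insert c I \<and> c \<le> b}"
  define N2 where "N2 = {(a, c) | a. a \<in> I \<and> a \<le> c}"
  have EE: "finite (E \<times> E)" using E(1) by simp
  have fin: "finite Q" "finite Q'" "finite N1" "finite N2"
    using I(1) c(1) by (auto simp: Q_def Q'_def N1_def N2_def proper_pairs_def intro!: finite_subset[OF _ EE])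
  \<comment> \<open>\<open>Q\<close> already contains \<open>N2\<close> and \<open>Q'\<close>
    already contains \<open>N1\<close>, so both unions consist of the common intervals, the trivial
    one and the two families.\<close>
  have QQ: "Q \<union> {(c, c)} \<union> N1 = Q' \<union> {(c, c)} \<union> N2"
    using c ac I(2) by (auto simp: Q_def Q'_def N1_def N2_def proper_pairs_def)
  have s1: "vanishes_below K interval_le k (Q \<union> {(c, c)} \<union> N1) \<longleftrightarrow> vanishes_below K interval_le k (Q \<union> {(c, c)})"
  proof (rule vanishes_below_add_iff[OF porder_interval_le])
    fix z Z assume z: "z \<in> N1" and Z: "Z \<subseteq> N1"
    have fZ: "finite Z" using fin Z finite_subset by blast
    from z obtain b where b: "z = (c, b)" "b \<in> E" "b \<notin> I" "b \<noteq> c" "c \<le> b" by (auto simp: N1_def)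
    show "nonevasive interval_le (link interval_le (Q \<union> {(c, c)} \<union> Z) z)"
    proof (rule nonevasive.cone[of _ "(c, c)"])
      show "finite (link interval_le (Q \<union> {(c, c)} \<union> Z) z)" using fin fZ by (simp add: link_def)
      show "(c, c) \<in> link interval_le (Q \<union> {(c, c)} \<union> Z) z" using b by (auto simp: link_def)
      fix y assume y: "y \<in> link interval_le (Q \<union> {(c, c)} \<union> Z) z"
      obtain p q where pq: "y = (p, q)" by fastforce
      consider "(p, q) \<in> Q" | "p = c" "q = c" | "(p, q) \<in> N1" using y pq Z by (auto simp: link_def)
      then show "interval_le (c, c) y \<or> interval_le y (c, c)"
      proof cases
        case 1
        \<comment> \<open>Hence a neighbour of \<open>(c, b)\<close> in \<open>Q\<close> is below
          it, and therefore also below \<open>(c, c)\<close>.\<close>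
        have "\<not> c \<le> p" using I(3)[of p c] c 1 by (auto simp: Q_def proper_pairs_def)
        then show ?thesis using y b by (auto simp: link_def pq)
      qed (auto simp: N1_def pq)
    qed
  qed (use fin c in \<open>auto simp: Q_def N1_def proper_pairs_def\<close>)
  have s2: "vanishes_below K interval_le k (Q' \<union> {(c, c)} \<union> N2) \<longleftrightarrow> vanishes_below K interval_le k (Q' \<union> {(c, c)})"
  proof (rule vanishes_below_add_iff[OF porder_interval_le])
    fix z Z assume z: "z \<in> N2" and Z: "Z \<subseteq> N2"
    have fZ: "finite Z" using fin Z finite_subset by blast
    from z obtain a where a: "z = (a, c)" "a \<in> I" "a \<le> c" by (auto simp: N2_def)
    show "nonevasive interval_le (link interval_le (Q' \<union> {(c, c)} \<union> Z) z)"
    proof (rule nonevasive.cone[of _ "(c, c)"])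
      show "finite (link interval_le (Q' \<union> {(c, c)} \<union> Z) z)" using fin fZ by (simp add: link_def)
      show "(c, c) \<in> link interval_le (Q' \<union> {(c, c)} \<union> Z) z" using a c by (auto simp: link_def)
      fix y assume y: "y \<in> link interval_le (Q' \<union> {(c, c)} \<union> Z) z"
      obtain p q where pq: "y = (p, q)" by fastforce
      consider "(p, q) \<in> Q'" | "p = c" "q = c" | "(p, q) \<in> N2" using y pq Z by (auto simp: link_def)
      then show "interval_le (c, c) y \<or> interval_le y (c, c)"
      proof cases
        case 1
        have "\<not> q \<le> c" using c(4)[of q] 1 by (auto simp: Q'_def proper_pairs_def)
        then show ?thesis using y a by (auto simp: link_def pq)
      qed (auto simp: N2_def pq)
    qed
  qed (use fin c in \<open>auto simp: Q'_def N2_def proper_pairs_def\<close>)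
  have L1: "nonevasive interval_le (link interval_le (Q \<union> {(c, c)}) (c, c))"
  proof -
    \<comment> \<open>The link of \<open>(c, c)\<close> consists of the intervals containing
      \<open>c\<close>. Those ending at \<open>c\<close> form a cone with apex
      \<open>(a0, c)\<close>, and every other \<open>(a, b)\<close> is added along a cone with apex
      \<open>(a, c)\<close>.\<close>
    define N where "N = {(a, b). a \<in> I \<and> b \<in> E - I \<and> a \<le> c \<and> c \<le> b \<and> b \<noteq> c} - {(a0, b0)}"
    have fN: "finite N" using I(1) by (auto simp: N_def intro!: finite_subset[OF _ EE])
    have "link interval_le (Q \<union> {(c, c)}) (c, c) = N2 \<union> N"
    proof (intro subset_antisym subsetI)
      fix y assume y: "y \<in> link interval_le (Q \<union> {(c, c)}) (c, c)"
      obtain p q where pq: "y = (p, q)" by fastforce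
      have "\<not> c \<le> p" if "p \<in> I" using I(3)[of p c] c that by auto
      then show "y \<in> N2 \<union> N" using y by (auto simp: link_def Q_def proper_pairs_def N2_def N_def pq)
    next
      fix y assume y: "y \<in> N2 \<union> N"
      then show "y \<in> link interval_le (Q \<union> {(c, c)}) (c, c)"
        using c by (auto simp: link_def Q_def proper_pairs_def N2_def N_def intro: order_trans)
    qed
    moreover have "nonevasive interval_le (N2 \<union> N)"
    proof (rule nonevasive_add_down[OF porder_interval_le fN])
      show "N2 \<inter> N = {}" by (auto simp: N_def N2_def)
      show "nonevasive interval_le N2"
        by (rule nonevasive.cone[of _ "(a0, c)"]) (use fin I E(4) c(1) in \<open>auto simp: N2_def\<close>)
      fix z assume z: "z \<in> N"
      then obtain a b where ab: "z = (a, b)" "a \<in> I" "b \<in> E" "a \<le> c" "c \<le> b" "b \<noteq> c" by (auto simp: N_def)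
      show "nonevasive interval_le (link interval_le (N2 \<union> {w \<in> N. interval_le w z}) z)"
      proof (rule nonevasive.cone[of _ "(a, c)"])
        show "finite (link interval_le (N2 \<union> {w \<in> N. interval_le w z}) z)" using fin fN by (simp add: link_def)
        show "(a, c) \<in> link interval_le (N2 \<union> {w \<in> N. interval_le w z}) z" using ab by (auto simp: link_def N2_def)
        fix y assume y: "y \<in> link interval_le (N2 \<union> {w \<in> N. interval_le w z}) z"
        obtain p q where pq: "y = (p, q)" by fastforce
        show "interval_le (a, c) y \<or> interval_le y (a, c)"
          using y ab by (auto simp: link_def N_def N2_def pq)
      qed
    qed
    ultimately show ?thesis by simp
  qed
  have L2: "nonevasive interval_le (link interval_le (Q' \<union> {(c, c)}) (c, c))"
  proof -
    \<comment> \<open>The dual situation: the intervals starting at \<open>c\<close> have the apex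
      \<open>(c, b0)\<close>, and \<open>(a, b)\<close> is added along a cone with apex
      \<open>(c, b)\<close>.\<close>
    define N where "N = {(a, b). a \<in> I \<and> b \<in> E - insert c I \<and> a \<le> c \<and> c \<le> b} - {(a0, b0)}"
    have fN: "finite N" using I(1) by (auto simp: N_def intro!: finite_subset[OF _ EE])
    have "link interval_le (Q' \<union> {(c, c)}) (c, c) = N1 \<union> N"
    proof (intro subset_antisym subsetI)
      fix y assume y: "y \<in> link interval_le (Q' \<union> {(c, c)}) (c, c)"
      obtain p q where pq: "y = (p, q)" by fastforce
      have "\<not> q \<le> c" if "q \<in> E" "q \<notin> insert c I" using c(4)[of q] that by auto
      then show "y \<in> N1 \<union> N" using y by (auto simp: link_def Q'_def proper_pairs_def N1_def N_def pq)
    next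
      fix y assume y: "y \<in> N1 \<union> N"
      then show "y \<in> link interval_le (Q' \<union> {(c, c)}) (c, c)"
        using c ac by (auto simp: link_def Q'_def proper_pairs_def N1_def N_def intro: order_trans)
    qed
    moreover have "nonevasive interval_le (N1 \<union> N)"
    proof (rule nonevasive_add_down[OF porder_interval_le fN])
      show "N1 \<inter> N = {}" using c(2) by (auto simp: N_def N1_def)
      show "nonevasive interval_le N1"
        by (rule nonevasive.cone[of _ "(c, b0)"]) (use fin I b0 E(3,4) c(1,3) in \<open>auto simp: N1_def\<close>)
      fix z assume z: "z \<in> N"
      then obtain a b where ab: "z = (a, b)" "a \<in> I" "b \<in> E" "b \<notin> I" "a \<le> c" "c \<le> b" "b \<noteq> c"
        by (auto simp: N_def)
      have ca: "\<not> c \<le> a" using I(3)[OF ab(2) c(1)] c(2) by blast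
      show "nonevasive interval_le (link interval_le (N1 \<union> {w \<in> N. interval_le w z}) z)"
      proof (rule nonevasive.cone[of _ "(c, b)"])
        show "finite (link interval_le (N1 \<union> {w \<in> N. interval_le w z}) z)" using fin fN by (simp add: link_def)
        show "(c, b) \<in> link interval_le (N1 \<union> {w \<in> N. interval_le w z}) z" using ab c(1,2) by (auto simp: link_def N1_def)
        fix y assume y: "y \<in> link interval_le (N1 \<union> {w \<in> N. interval_le w z}) z"
        obtain p q where pq: "y = (p, q)" by fastforce
        show "interval_le (c, b) y \<or> interval_le y (c, b)"
          using y ab ca by (auto simp: link_def N_def N1_def pq)
      qed
    qed
    ultimately show ?thesis by simp
  qed
  have nQ: "(c, c) \<notin> Q" "(c, c) \<notin> Q'" using c by (auto simp: Q_def Q'_def proper_pairs_def)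
  have "vanishes_below K interval_le k (Q \<union> {(c, c)}) \<longleftrightarrow> vanishes_below K interval_le k (Q \<union> {(c, c)} - {(c, c)})"
    by (rule vanishes_below_remove_iff[OF porder_interval_le _ _ L1]) (use fin in auto)
  moreover have "vanishes_below K interval_le k (Q' \<union> {(c, c)}) \<longleftrightarrow> vanishes_below K interval_le k (Q' \<union> {(c, c)} - {(c, c)})"
    by (rule vanishes_below_remove_iff[OF porder_interval_le _ _ L2]) (use fin in auto)
  moreover have "Q \<union> {(c, c)} - {(c, c)} = Q" "Q' \<union> {(c, c)} - {(c, c)} = Q'" using nQ by auto
  ultimately show ?thesis using s1 s2 QQ unfolding Q_def Q'_def by simp
qed

text \<open>Induction on the number of elements outside the ideal, adding a minimal one each time.
  At the largest proper ideal all upper ends equal \<open>b0\<close>, and the pairs form a copy of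
  the open interval.\<close>

lemma vanishes_below_proper_pairs:
  fixes E :: "'b::order set"
  assumes E: "finite E" "a0 \<in> E" "b0 \<in> E" "\<And>z. z \<in> E \<Longrightarrow> a0 \<le> z \<and> z \<le> b0"
    and s: "highly_connected (\<le>) k (E - {a0, b0})"
    and I: "I \<subseteq> E" "a0 \<in> I" "b0 \<notin> I" "\<And>a b. a \<in> I \<Longrightarrow> b \<in> E \<Longrightarrow> b \<le> a \<Longrightarrow> b \<in> I"
  shows "vanishes_below (K :: 'k::field itself) interval_le k (proper_pairs E I a0 b0)"
  using I
proof (induction "card (E - I)" arbitrary: I rule: less_induct)
  case less
  let ?C = "E - I - {b0}"
  show ?case
  proof (cases "?C = {}")
    case True
    then have "I = E - {b0}" using less.prems by auto
    then have "proper_pairs E I a0 b0 = (\<lambda>a. (a, b0)) ` (E - {a0, b0})"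
      using E by (auto simp: proper_pairs_def)
    moreover have "highly_connected interval_le k ((\<lambda>a. (a, b0)) ` (E - {a0, b0}))"
      by (rule highly_connected_image[OF s]) (auto simp: inj_on_def)
    ultimately show ?thesis using highly_connected_vanishes_below[OF _ porder_interval_le] by simp
  next
    case False
    obtain c where c: "c \<in> ?C" "\<And>w. w \<in> ?C \<Longrightarrow> w \<le> c \<Longrightarrow> w = c"
      by (rule porder_minimal[OF porder_order _ False]) (use E(1) in auto)
    have cm: "z = c" if "z \<in> E" "z \<notin> I" "z \<le> c" for z
    proof (cases "z = b0")
      case True
      then show ?thesis using that(3) E(4)[of c] c(1) by auto
    next
      case False
      then show ?thesis using c(2) that by auto
    qed
    have "vanishes_below K interval_le k (proper_pairs E (insert c I) a0 b0)"
    proof (rule less.hyps)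
      show "card (E - insert c I) < card (E - I)"
        using E(1) c(1) by (intro psubset_card_mono) auto
      show "b \<in> insert c I" if "a \<in> insert c I" "b \<in> E" "b \<le> a" for a b
        using that cm[of b] less.prems(4)[of a b] by auto
    qed (use less.prems c(1) in auto)
    moreover have "vanishes_below K interval_le k (proper_pairs E I a0 b0) \<longleftrightarrow> vanishes_below K interval_le k (proper_pairs E (insert c I) a0 b0)"
    proof (rule vanishes_below_proper_pairs_insert)
      show "a0 \<le> z \<and> z \<le> b0" if "z \<in> E" for z by (rule E(4)[OF that])
      show "b \<in> I" if "a \<in> I" "b \<in> E" "b \<le> a" for a b by (rule less.prems(4)[OF that])
      show "z = c" if "z \<in> E" "z \<notin> I" "z \<le> c" for z by (rule cm[OF that])
    qed (use E(1-3) less.prems(1,2) c(1) in blast)+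
    ultimately show ?thesis by blast
  qed
qed

section \<open>The closed sets of the multiplex relation\<close>

text \<open>For \<open>d \<ge> 2\<close> the diagonal entries come from the clamping convention: the
  facet \<open>0\<close> contains the index \<open>-1\<close>, read as \<open>0\<close>, and the
  facet \<open>n\<close> contains \<open>n + 1\<close>, read as \<open>n\<close>. The additive
  bounds avoid truncated subtraction.\<close>

definition adj :: "nat \<Rightarrow> nat \<Rightarrow> nat \<Rightarrow> nat \<Rightarrow> bool" where
  "adj d n i j \<longleftrightarrow> i \<le> n \<and> j \<le> n \<and> i < j + d \<and> j < i + d \<and> (i = j \<longrightarrow> i = 0 \<or> i = n)"

definition facet_set :: "nat \<Rightarrow> nat \<Rightarrow> nat \<Rightarrow> nat set" where
  "facet_set d n j = {i. adj d n i j}"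

text \<open>The intersection of the facets with index in \<open>J\<close> and, by symmetry of
  \<open>adj\<close>, also the set of facets through all vertices in \<open>J\<close>. On
  \<open>closed_sets\<close> it is an involution reversing inclusion.\<close>

definition polar :: "nat \<Rightarrow> nat \<Rightarrow> nat set \<Rightarrow> nat set" where
  "polar d n J = {i. i \<le> n \<and> (\<forall>j\<in>J. adj d n i j)}"

definition closed_sets :: "nat \<Rightarrow> nat \<Rightarrow> nat set set" where
  "closed_sets d n = polar d n ` Pow {..n}"

definition multiplex_pair :: "nat \<Rightarrow> nat \<Rightarrow> bool" where
  "multiplex_pair d n \<longleftrightarrow> 1 \<le> d \<and> d \<le> n \<and> (d = 1 \<longrightarrow> n = 1)"

lemma adj_sym: "adj d n i j \<longleftrightarrow> adj d n j i"
  by (auto simp: adj_def)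

lemma polar_subset: "polar d n J \<subseteq> {..n}"
  by (auto simp: polar_def)

lemma polar_galois: "A \<subseteq> {..n} \<Longrightarrow> J \<subseteq> {..n} \<Longrightarrow> A \<subseteq> polar d n J \<longleftrightarrow> J \<subseteq> polar d n A"
  unfolding polar_def using adj_sym by blast

lemma polar_antimono: "A \<subseteq> B \<Longrightarrow> polar d n B \<subseteq> polar d n A"
  by (auto simp: polar_def)

lemma polar_polar_polar: "J \<subseteq> {..n} \<Longrightarrow> polar d n (polar d n (polar d n J)) = polar d n J"
proof
  assume J: "J \<subseteq> {..n}"
  have "J \<subseteq> polar d n (polar d n J)" using polar_galois[of "polar d n J" n J d] polar_subset J by simp
  then show "polar d n (polar d n (polar d n J)) \<subseteq> polar d n J" by (rule polar_antimono)
  show "polar d n J \<subseteq> polar d n (polar d n (polar d n J))"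
    using polar_galois[of "polar d n J" n "polar d n (polar d n J)" d] polar_subset by simp
qed

lemma closed_sets_iff: "A \<in> closed_sets d n \<longleftrightarrow> A \<subseteq> {..n} \<and> polar d n (polar d n A) = A"
proof
  assume "A \<in> closed_sets d n"
  then obtain J where "J \<subseteq> {..n}" "A = polar d n J" by (auto simp: closed_sets_def)
  then show "A \<subseteq> {..n} \<and> polar d n (polar d n A) = A" using polar_polar_polar[of J n d] polar_subset by simp
next
  assume A: "A \<subseteq> {..n} \<and> polar d n (polar d n A) = A"
  have "polar d n (polar d n A) \<in> closed_sets d n" unfolding closed_sets_def using polar_subset by blast
  then show "A \<in> closed_sets d n" using A by simp
qed

lemma closed_sets_subset: "A \<in> closed_sets d n \<Longrightarrow> A \<subseteq> {..n}" by (simp add: closed_sets_iff)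

lemma closed_sets_finite: "A \<in> closed_sets d n \<Longrightarrow> finite A" by (rule finite_subset[OF closed_sets_subset]) auto

lemma finite_closed_sets: "finite (closed_sets d n)" by (simp add: closed_sets_def)

lemma polar_closed_sets: "J \<subseteq> {..n} \<Longrightarrow> polar d n J \<in> closed_sets d n" by (auto simp: closed_sets_def)

lemma polar_polar: "A \<in> closed_sets d n \<Longrightarrow> polar d n (polar d n A) = A" by (simp add: closed_sets_iff)

lemma polar_le_iff: "A \<in> closed_sets d n \<Longrightarrow> B \<in> closed_sets d n \<Longrightarrow> polar d n A \<subseteq> polar d n B \<longleftrightarrow> B \<subseteq> A"
  using polar_antimono[of B A d n] polar_antimono[of "polar d n A" "polar d n B" d n] polar_polar[of A d n] polar_polar[of B d n]
  by auto

lemma full_closed_sets: "{..n} \<in> closed_sets d n"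
proof -
  have "polar d n {} = {..n}" by (auto simp: polar_def)
  then show ?thesis using polar_closed_sets[of "{}" n d] by simp
qed

lemma closed_sets_Int: "A \<in> closed_sets d n \<Longrightarrow> B \<in> closed_sets d n \<Longrightarrow> A \<inter> B \<in> closed_sets d n"
proof -
  assume "A \<in> closed_sets d n" "B \<in> closed_sets d n"
  then obtain J K where "J \<subseteq> {..n}" "K \<subseteq> {..n}" "A = polar d n J" "B = polar d n K"
    by (auto simp: closed_sets_def)
  moreover have "polar d n J \<inter> polar d n K = polar d n (J \<union> K)" by (auto simp: polar_def)
  ultimately show ?thesis using polar_closed_sets[of "J \<union> K" n d] by simp
qed

lemma facet_set_polar: "j \<le> n \<Longrightarrow> facet_set d n j = polar d n {j}"
  by (auto simp: facet_set_def polar_def adj_def)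

lemma facet_set_closed_sets: "j \<le> n \<Longrightarrow> facet_set d n j \<in> closed_sets d n"
  using polar_closed_sets[of "{j}" n d] by (simp add: facet_set_polar)

lemma closed_sets_sepD:
  assumes "A \<in> closed_sets d n" "i \<le> n" "i \<notin> A"
  obtains j where "j \<le> n" "A \<subseteq> facet_set d n j" "i \<notin> facet_set d n j"
proof -
  from assms(1) obtain J where J: "J \<subseteq> {..n}" "A = polar d n J" by (auto simp: closed_sets_def)
  then obtain j where "j \<in> J" "\<not> adj d n i j" using assms by (auto simp: polar_def)
  then show ?thesis using J by (intro that[of j]) (auto simp: facet_set_def polar_def)
qed

text \<open>The double polar of \<open>A\<close> lies in every closed set that contains
  \<open>A\<close>, so excluding each outside point by one of these forces \<open>A\<close> to be
  closed.\<close>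

lemma closed_sets_sepI:
  assumes "A \<subseteq> {..n}" "\<And>i. i \<le> n \<Longrightarrow> i \<notin> A \<Longrightarrow> \<exists>B\<in>closed_sets d n. A \<subseteq> B \<and> i \<notin> B"
  shows "A \<in> closed_sets d n"
proof -
  have "polar d n (polar d n A) \<subseteq> A"
  proof (rule ccontr)
    assume "\<not> ?thesis"
    then obtain i where i: "i \<in> polar d n (polar d n A)" "i \<notin> A" by blast
    then have "i \<le> n" using polar_subset by blast
    with assms(2) i obtain B where B: "B \<in> closed_sets d n" "A \<subseteq> B" "i \<notin> B" by blast
    then have "polar d n (polar d n A) \<subseteq> B" using polar_antimono[OF polar_antimono[OF B(2)], of d n d n] polar_polar[OF B(1)] by simp
    then show False using i B by blast
  qed
  moreover have "A \<subseteq> polar d n (polar d n A)" using polar_galois[of A n "polar d n A" d] assms(1) polar_subset by simp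
  ultimately show ?thesis using assms(1) by (simp add: closed_sets_iff subset_antisym)
qed

lemma facet_set_0: "multiplex_pair d n \<Longrightarrow> facet_set d n 0 = {..<d}"
  by (auto simp: facet_set_def adj_def multiplex_pair_def)

lemma facet_set_n: "multiplex_pair d n \<Longrightarrow> facet_set d n n = {n - d<..n}"
  by (auto simp: facet_set_def adj_def multiplex_pair_def)

lemma closed_sets_sepI':
  assumes "A \<subseteq> {..n}" "\<And>i. i \<le> n \<Longrightarrow> i \<notin> A \<Longrightarrow> \<exists>k\<le>n. (\<forall>x\<in>A. adj d n x k) \<and> \<not> adj d n i k"
  shows "A \<in> closed_sets d n"
proof (rule closed_sets_sepI[OF assms(1)])
  fix i assume "i \<le> n" "i \<notin> A"
  from assms(2)[OF this] obtain k where "k \<le> n" "\<forall>x\<in>A. adj d n x k" "\<not> adj d n i k" by blast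
  then have "facet_set d n k \<in> closed_sets d n" "A \<subseteq> facet_set d n k" "i \<notin> facet_set d n k"
    using facet_set_closed_sets[of k n d] by (auto simp: facet_set_def)
  then show "\<exists>B\<in>closed_sets d n. A \<subseteq> B \<and> i \<notin> B" by blast
qed

text \<open>The facet \<open>0\<close> is a simplex: each of its vertices is missed by another facet
  that contains all its other vertices.\<close>

lemma closed_sets_subset_facet_set_0:
  assumes m: "multiplex_pair d n" and B: "B \<subseteq> {..<d}"
  shows "B \<in> closed_sets d n"
proof (rule closed_sets_sepI')
  show "B \<subseteq> {..n}" using assms by (auto simp: multiplex_pair_def)
  fix i assume i: "i \<le> n" "i \<notin> B"
  \<comment> \<open>Points outside the facet \<open>0\<close> are excluded by this facet. An inner
    facet \<open>i\<close> misses only its own vertex among those below \<open>d\<close>. The vertex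
    \<open>0\<close> lies on its own facet, so the facet \<open>d\<close> is used, whose least
    vertex is \<open>1\<close>.\<close>
  define k where "k = (if i \<ge> d then 0 else if i = 0 then d else i)"
  have "adj d n x k" if "x \<in> B" for x
  proof -
    have "x < d" "x \<noteq> i" using that B i by auto
    then show ?thesis using m i by (auto simp: k_def adj_def multiplex_pair_def)
  qed
  moreover have "k \<le> n" "\<not> adj d n i k" using m i by (auto simp: k_def adj_def multiplex_pair_def)
  ultimately show "\<exists>k\<le>n. (\<forall>x\<in>B. adj d n x k) \<and> \<not> adj d n i k" by auto
qed

lemma closed_sets_subset_facet_set_n:
  assumes m: "multiplex_pair d n" and B: "B \<subseteq> {n - d<..n}"
  shows "B \<in> closed_sets d n"
proof (rule closed_sets_sepI')
  show "B \<subseteq> {..n}" using assms by auto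
  fix i assume i: "i \<le> n" "i \<notin> B"
  \<comment> \<open>The mirror image of the choice for the facet \<open>0\<close>, with
    \<open>n - i\<close> in place of \<open>i\<close>.\<close>
  define k where "k = (if i \<le> n - d then n else if i = n then n - d else i)"
  have "adj d n x k" if "x \<in> B" for x
  proof -
    have "n - d < x" "x \<noteq> i" "x \<le> n" using that B i by auto
    then show ?thesis using m i by (auto simp: k_def adj_def multiplex_pair_def)
  qed
  moreover have "k \<le> n" "\<not> adj d n i k" using m i by (auto simp: k_def adj_def multiplex_pair_def)
  ultimately show "\<exists>k\<le>n. (\<forall>x\<in>B. adj d n x k) \<and> \<not> adj d n i k" by auto
qed

lemma closed_sets_simplex:
  assumes m: "1 \<le> m" and B: "B \<subseteq> {..m}"
  shows "B \<in> closed_sets m m"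
proof (rule closed_sets_sepI')
  show "B \<subseteq> {..m}" using assms by auto
  fix i assume i: "i \<le> m" "i \<notin> B"
  define k where "k = (if i = m then 0 else if i = 0 then m else i)"
  have "adj m m x k" if "x \<in> B" for x
  proof -
    have "x \<noteq> i" "x \<le> m" using that B i by auto
    then show ?thesis using m i by (auto simp: k_def adj_def)
  qed
  moreover have "k \<le> m" "\<not> adj m m i k" using m i by (auto simp: k_def adj_def)
  ultimately show "\<exists>k\<le>m. (\<forall>x\<in>B. adj m m x k) \<and> \<not> adj m m i k" by auto
qed

lemma empty_closed_sets: "multiplex_pair d n \<Longrightarrow> {} \<in> closed_sets d n"
  by (rule closed_sets_subset_facet_set_0) auto

lemma polar_full: "multiplex_pair d n \<Longrightarrow> polar d n {..n} = {}"
proof -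
  assume "multiplex_pair d n"
  then have "polar d n (polar d n {}) = {}" by (simp add: empty_closed_sets polar_polar)
  moreover have "polar d n {} = {..n}" by (auto simp: polar_def)
  ultimately show ?thesis by simp
qed

lemma polar_empty: "polar d n {} = {..n}" by (auto simp: polar_def)

section \<open>Facets as multiplexes of one dimension less\<close>

text \<open>If \<open>j\<close> is close to \<open>i\<close> and inner, the vertex \<open>j\<close>
  lies on the facet \<open>i\<close> but not on its own facet. Otherwise an extreme vertex of the
  facet \<open>i\<close> is out of reach for the facet \<open>j\<close>.\<close>

lemma facet_set_incomparable:
  assumes m: "multiplex_pair d n" and ij: "i \<le> n" "j \<le> n" and sub: "facet_set d n i \<subseteq> facet_set d n j"
  shows "i = j"
proof (rule ccontr)
  assume ne: "i \<noteq> j"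
  have D: "adj d n w i \<Longrightarrow> adj d n w j" for w using sub by (auto simp: facet_set_def)
  consider "i < j" "j < i + d" "j < n" | "i < j" "j \<ge> i + d \<or> j = n"
    | "j < i" "i < j + d" "0 < j" | "j < i" "i \<ge> j + d \<or> j = 0" using ne ij by linarith
  then show False
  proof cases
    case 1
    then show False using D[of j] ij by (auto simp: adj_def)
  next
    case 2
    \<comment> \<open>The least vertex of the facet \<open>i\<close>.\<close>
    define w where "w = (if i = 0 then 0 else i + 1 - d)"
    have "adj d n w i" using ij m 2 by (cases "i = 0"; cases "d = 1") (auto simp: w_def adj_def multiplex_pair_def)
    moreover have "\<not> adj d n w j" using ij m 2 by (cases "i = 0"; cases "d = 1") (auto simp: w_def adj_def multiplex_pair_def)
    ultimately show False using D[of w] by simp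
  next
    case 3
    then show False using D[of j] ij by (auto simp: adj_def)
  next
    case 4
    \<comment> \<open>The greatest vertex of the facet \<open>i\<close>.\<close>
    define w where "w = (if i = n then n else min n (i + d - 1))"
    have "adj d n w i" using ij m 4 by (cases "i = n"; cases "d = 1") (auto simp: w_def adj_def multiplex_pair_def min_def)
    moreover have "\<not> adj d n w j" using ij m 4 by (cases "i = n"; cases "d = 1") (auto simp: w_def adj_def multiplex_pair_def min_def)
    ultimately show False using D[of w] by simp
  qed
qed

lemma facet_set_not_full: "multiplex_pair d n \<Longrightarrow> j \<le> n \<Longrightarrow> facet_set d n j \<noteq> {..n}"
proof
  assume m: "multiplex_pair d n" "j \<le> n" "facet_set d n j = {..n}"
  have "i \<le> n \<Longrightarrow> i = j" for i
    by (rule facet_set_incomparable[OF m(1) _ m(2)]) (auto simp: m(3), auto simp: facet_set_def adj_def)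
  from this[of 0] this[of 1] show False using m(1) by (auto simp: multiplex_pair_def)
qed

lemma facet_set_maximal:
  assumes "multiplex_pair d n" "j \<le> n" "A \<in> closed_sets d n" "facet_set d n j \<subseteq> A" "A \<noteq> {..n}"
  shows "A = facet_set d n j"
proof -
  obtain i where "i \<le> n" "i \<notin> A" using assms(3,5) closed_sets_subset by blast
  with closed_sets_sepD[OF assms(3)] obtain k where k: "k \<le> n" "A \<subseteq> facet_set d n k" by metis
  then have "j = k" using facet_set_incomparable[OF assms(1,2)] assms(4) by blast
  then show ?thesis using k assms(4) by blast
qed

text \<open>The vertices of the facet \<open>j\<close>, renumbered from \<open>0\<close>.\<close>

definition renumber :: "nat \<Rightarrow> nat \<Rightarrow> nat \<Rightarrow> nat \<Rightarrow> nat" where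
  "renumber d n j u = (if u < j \<or> j = 0 \<or> j = n then u - (j + 1 - d) else u - (j + 1 - d) - 1)"

text \<open>The last new number. An inner facet extends from \<open>j + 1 - d\<close>, cut off at
  \<open>0\<close>, to \<open>min n (j + d - 1)\<close>, and leaving out \<open>j\<close> costs one
  number. The two end facets have \<open>d\<close> vertices.\<close>

definition facet_max :: "nat \<Rightarrow> nat \<Rightarrow> nat \<Rightarrow> nat" where
  "facet_max d n j = (if j = 0 \<or> j = n then d - 1 else min n (j + d - 1) - (j + 1 - d) - 1)"

lemma multiplex_pair_facet_max: "multiplex_pair d n \<Longrightarrow> 2 \<le> d \<Longrightarrow> j \<le> n \<Longrightarrow> multiplex_pair (d - 1) (facet_max d n j)"
  unfolding multiplex_pair_def facet_max_def min_def by (cases "j = 0 \<or> j = n") (auto split: if_splits)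

lemma renumber_strict_mono: "multiplex_pair d n \<Longrightarrow> j \<le> n \<Longrightarrow> u \<in> facet_set d n j \<Longrightarrow> v \<in> facet_set d n j \<Longrightarrow> u < v \<Longrightarrow>
    renumber d n j u < renumber d n j v"
  unfolding multiplex_pair_def renumber_def facet_set_def adj_def by (auto split: if_splits)

lemma renumber_bij:
  assumes "multiplex_pair d n" "2 \<le> d" "j \<le> n"
  shows "bij_betw (renumber d n j) (facet_set d n j) {..facet_max d n j}"
proof -
  have "inj_on (renumber d n j) (facet_set d n j)"
    using renumber_strict_mono[OF assms(1,3)] by (intro inj_onI) (metis less_irrefl nat_neq_iff)
  moreover have "renumber d n j u \<le> facet_max d n j" if "u \<in> facet_set d n j" for u
    using that assms unfolding multiplex_pair_def renumber_def facet_set_def adj_def facet_max_def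
    by (cases "j = 0"; cases "j = n"; cases "u < j") (auto simp: min_def)
  moreover have "\<exists>u\<in>facet_set d n j. renumber d n j u = w" if w: "w \<le> facet_max d n j" for w
  proof -
    consider "j = 0 \<or> j = n" | "0 < j" "j < n" "w + (j + 1 - d) < j" | "0 < j" "j < n" "w + (j + 1 - d) \<ge> j"
      using assms(3) by linarith
    then show ?thesis
    proof cases
      case 1
      then show ?thesis using w assms
        by (intro bexI[of _ "w + (j + 1 - d)"])
           (auto simp: multiplex_pair_def renumber_def facet_set_def adj_def facet_max_def)
    next
      case 2
      then show ?thesis using w assms
        by (intro bexI[of _ "w + (j + 1 - d)"])
           (auto simp: multiplex_pair_def renumber_def facet_set_def adj_def facet_max_def min_def split: if_splits)
    next
      case 3
      then show ?thesis using w assms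
        by (intro bexI[of _ "w + (j + 1 - d) + 1"])
           (auto simp: multiplex_pair_def renumber_def facet_set_def adj_def facet_max_def min_def split: if_splits)
    qed
  qed
  ultimately have "renumber d n j ` facet_set d n j = {..facet_max d n j}" by blast
  with \<open>inj_on (renumber d n j) (facet_set d n j)\<close> show ?thesis unfolding bij_betw_def by blast
qed

text \<open>For \<open>u\<close> and \<open>k\<close> on opposite sides of \<open>j\<close>, closing
  the gap at \<open>j\<close> lowers their distance by one, just like the bound. On the same side
  the distance is below both bounds anyway. The strict bounds on \<open>k\<close> keep it away from
  vertices at distance \<open>d - 1\<close> from \<open>j\<close>: these may become the first or
  last vertex of the facet, and so acquire a diagonal entry, without being \<open>0\<close> or
  \<open>n\<close>.\<close>

lemma adj_renumber:
  assumes "multiplex_pair d n" "2 \<le> d" "0 < j" "j < n" "adj d n u j" "k \<le> n" "k \<noteq> j" "k + 1 < j + d" "j + 1 < k + d"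
  shows "adj (d - 1) (facet_max d n j) (renumber d n j u) (renumber d n j k) \<longleftrightarrow> adj d n u k"
proof -
  \<comment> \<open>With \<open>d = e + 2\<close> and additive equations for \<open>lo\<close>,
    \<open>hi\<close> and the new numbers, truncated subtraction disappears and each case is linear
    arithmetic.\<close>
  obtain e where e: "d = e + 2" using assms(2) by (metis add.commute le_Suc_ex)
  define lo where "lo = j + 1 - d"
  define hi where "hi = min n (j + d - 1)"
  have lo: "lo = 0 \<and> j < d \<or> lo + e + 1 = j \<and> d \<le> j + 1" by (auto simp: lo_def e)
  have hi: "hi = n \<and> n \<le> j + e + 1 \<or> hi = j + e + 1 \<and> j + e + 1 \<le> n" by (auto simp: hi_def e)
  have u: "u \<noteq> j" "u \<le> n" "u < j + e + 2" "j < u + e + 2" using assms(3-5) by (auto simp: adj_def e)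
  have k: "k \<noteq> j" "k \<le> n" "k < j + e + 1" "j < k + e + 1" using assms by (auto simp: e)
  obtain N where N: "facet_max d n j = N" "N + lo + 1 = hi"
    using assms(3,4) lo hi unfolding facet_max_def by (auto simp: lo_def hi_def e)
  have P: "renumber d n j v + lo + (if v < j then 0 else 1) = v" if "v \<noteq> j" "j < v + e + 2" for v
    using assms(3,4) that unfolding renumber_def by (auto simp: lo_def e)
  have pu: "renumber d n j u + lo + (if u < j then 0 else 1) = u" using P u by blast
  have pk: "renumber d n j k + lo + (if k < j then 0 else 1) = k" using P k by simp
  obtain p where p: "renumber d n j u = p" by simp
  obtain q where q: "renumber d n j k = q" by simp
  have j: "0 < j" "j < n" by fact+
  note * = lo hi u k N(2) pu[unfolded p] pk[unfolded q] j
  have d1: "d - 1 = e + 1" using e by simp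
  consider "u < j" "k < j" | "u > j" "k > j" | "u < j" "k > j" | "u > j" "k < j"
    using u k by linarith
  then show ?thesis unfolding N(1) p q adj_def d1
  proof cases
    case 1
    with * show "p \<le> N \<and> q \<le> N \<and> p < q + (e + 1) \<and> q < p + (e + 1) \<and> (p = q \<longrightarrow> p = 0 \<or> p = N) \<longleftrightarrow>
      u \<le> n \<and> k \<le> n \<and> u < k + d \<and> k < u + d \<and> (u = k \<longrightarrow> u = 0 \<or> u = n)"
      unfolding e by auto
  next
    case 2
    with * show "p \<le> N \<and> q \<le> N \<and> p < q + (e + 1) \<and> q < p + (e + 1) \<and> (p = q \<longrightarrow> p = 0 \<or> p = N) \<longleftrightarrow>
      u \<le> n \<and> k \<le> n \<and> u < k + d \<and> k < u + d \<and> (u = k \<longrightarrow> u = 0 \<or> u = n)"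
      unfolding e by auto
  next
    case 3
    with * show "p \<le> N \<and> q \<le> N \<and> p < q + (e + 1) \<and> q < p + (e + 1) \<and> (p = q \<longrightarrow> p = 0 \<or> p = N) \<longleftrightarrow>
      u \<le> n \<and> k \<le> n \<and> u < k + d \<and> k < u + d \<and> (u = k \<longrightarrow> u = 0 \<or> u = n)"
      unfolding e by auto
  next
    case 4
    with * show "p \<le> N \<and> q \<le> N \<and> p < q + (e + 1) \<and> q < p + (e + 1) \<and> (p = q \<longrightarrow> p = 0 \<or> p = N) \<longleftrightarrow>
      u \<le> n \<and> k \<le> n \<and> u < k + d \<and> k < u + d \<and> (u = k \<longrightarrow> u = 0 \<or> u = n)"
      unfolding e by auto
  qed
qed


lemma renumber_low: "0 < j \<Longrightarrow> j < n \<Longrightarrow> u < j \<Longrightarrow> renumber d n j u = u - (j + 1 - d)"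
  and renumber_high: "0 < j \<Longrightarrow> j < n \<Longrightarrow> j < u \<Longrightarrow> renumber d n j u = u - (j + 1 - d) - 1"
  by (auto simp: renumber_def)

lemma facet_max_inner: "0 < j \<Longrightarrow> j < n \<Longrightarrow> facet_max d n j = min n (j + d - 1) - (j + 1 - d) - 1"
  by (auto simp: facet_max_def)

text \<open>A separating facet \<open>k\<close> close to \<open>j\<close> is renumbered by
  \<open>adj_renumber\<close>. A distant one meets the facet \<open>j\<close> on one side of
  \<open>j\<close> only, hence inside an end facet of the smaller multiplex, where every subset is
  closed.\<close>

lemma facet_iso_inner1:
  assumes m: "multiplex_pair d n" "2 \<le> d" "0 < j" "j < n" and B: "B \<subseteq> facet_set d n j" "B \<in> closed_sets d n"
  shows "renumber d n j ` B \<in> closed_sets (d - 1) (facet_max d n j)"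
proof (rule closed_sets_sepI)
  have jn: "j \<le> n" using m by simp
  note m' = multiplex_pair_facet_max[OF m(1,2) jn]
  note bij = renumber_bij[OF m(1,2) jn]
  have inj: "inj_on (renumber d n j) (facet_set d n j)" and im: "renumber d n j ` facet_set d n j = {..facet_max d n j}"
    using bij by (auto simp: bij_betw_def)
  show "renumber d n j ` B \<subseteq> {..facet_max d n j}" using B(1) im by blast
  fix w assume w: "w \<le> facet_max d n j" "w \<notin> renumber d n j ` B"
  then obtain u where u: "u \<in> facet_set d n j" "w = renumber d n j u" using im by (metis atMost_iff imageE)
  have "u \<notin> B" "u \<le> n" using u w by (auto simp: facet_set_def adj_def)
  then obtain k where k: "k \<le> n" "B \<subseteq> facet_set d n k" "u \<notin> facet_set d n k" using closed_sets_sepD[OF B(2)] by metis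
  have kj: "k \<noteq> j" using u k by auto
  have side: "\<exists>C\<in>closed_sets (d - 1) (facet_max d n j). renumber d n j ` B \<subseteq> C \<and> w \<notin> C"
    if C: "renumber d n j ` (facet_set d n k \<inter> facet_set d n j) \<in> closed_sets (d - 1) (facet_max d n j)"
  proof (rule bexI[OF _ C], intro conjI)
    show "renumber d n j ` B \<subseteq> renumber d n j ` (facet_set d n k \<inter> facet_set d n j)" using k B by blast
    show "w \<notin> renumber d n j ` (facet_set d n k \<inter> facet_set d n j)"
    proof
      assume "w \<in> renumber d n j ` (facet_set d n k \<inter> facet_set d n j)"
      then obtain v where "v \<in> facet_set d n k" "v \<in> facet_set d n j" "renumber d n j v = renumber d n j u" using u by auto
      then have "v = u" using inj_onD[OF inj] u by blast
      then show False using \<open>v \<in> facet_set d n k\<close> k(3) by simp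
    qed
  qed
  consider "k + 1 < j + d" "j + 1 < k + d" | "k + 1 \<ge> j + d" | "j + 1 \<ge> k + d" by linarith
  then show "\<exists>C\<in>closed_sets (d - 1) (facet_max d n j). renumber d n j ` B \<subseteq> C \<and> w \<notin> C"
  proof cases
    case 1
    have iff: "adj (d - 1) (facet_max d n j) (renumber d n j v) (renumber d n j k) \<longleftrightarrow> adj d n v k" if "v \<in> facet_set d n j" for v
      by (rule adj_renumber[OF m _ k(1) kj 1]) (use that in \<open>simp add: facet_set_def\<close>)
    have "k \<in> facet_set d n j" using 1 k kj m by (auto simp: facet_set_def adj_def)
    then have "renumber d n j k \<le> facet_max d n j" using im by blast
    from facet_set_closed_sets[OF this] show ?thesis
    proof (rule bexI[rotated], intro conjI)
      show "renumber d n j ` B \<subseteq> facet_set (d - 1) (facet_max d n j) (renumber d n j k)"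
      proof
        fix y assume "y \<in> renumber d n j ` B"
        then obtain v where v: "v \<in> B" "y = renumber d n j v" by blast
        then have "v \<in> facet_set d n j" "adj d n v k" using B k by (auto simp: facet_set_def)
        then show "y \<in> facet_set (d - 1) (facet_max d n j) (renumber d n j k)" using iff v by (simp add: facet_set_def)
      qed
      show "w \<notin> facet_set (d - 1) (facet_max d n j) (renumber d n j k)" using iff[OF u(1)] u k by (simp add: facet_set_def)
    qed
  next
    case 2
    have "renumber d n j ` (facet_set d n k \<inter> facet_set d n j) \<subseteq> {facet_max d n j - (d - 1)<..facet_max d n j}"
    proof
      fix y assume "y \<in> renumber d n j ` (facet_set d n k \<inter> facet_set d n j)"
      then obtain v where v: "v \<in> facet_set d n k" "v \<in> facet_set d n j" "y = renumber d n j v" by blast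
      have "j < v" using v(1,2) 2 m by (auto simp: facet_set_def adj_def)
      moreover have "facet_max d n j = j + d - 1 - (j + 1 - d) - 1"
      proof -
        have "min n (j + d - 1) = j + d - 1" using 2 k(1) m(2) by linarith
        then show ?thesis by (simp only: facet_max_inner[OF m(3,4)])
      qed
      ultimately have "facet_max d n j - (d - 1) < y"
        using m by (cases "d \<le> j + 1") (auto simp: v(3) renumber_high)
      moreover have "y \<le> facet_max d n j" using im v by blast
      ultimately show "y \<in> {facet_max d n j - (d - 1)<..facet_max d n j}" by simp
    qed
    from side[OF closed_sets_subset_facet_set_n[OF m' this]] show ?thesis .
  next
    case 3
    have "renumber d n j ` (facet_set d n k \<inter> facet_set d n j) \<subseteq> {..<d - 1}"
    proof
      fix y assume "y \<in> renumber d n j ` (facet_set d n k \<inter> facet_set d n j)"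
      then obtain v where v: "v \<in> facet_set d n k" "v \<in> facet_set d n j" "y = renumber d n j v" by blast
      have "v < j" using v(1,2) 3 m by (auto simp: facet_set_def adj_def)
      then have "y < d - 1" using 3 k m by (simp add: v renumber_low)
      then show "y \<in> {..<d - 1}" by simp
    qed
    from side[OF closed_sets_subset_facet_set_0[OF m' this]] show ?thesis .
  qed
qed

text \<open>Separating facets are carried back. When \<open>k\<close> is at distance
  \<open>d - 1\<close> from \<open>j\<close>, its number is that of an end facet, which consists of
  the vertices on one side of \<open>j\<close>. The facet at distance \<open>d\<close> from
  \<open>j\<close> cuts out the same vertices.\<close>

lemma facet_iso_inner2:
  assumes m: "multiplex_pair d n" "2 \<le> d" "0 < j" "j < n" and B: "B \<subseteq> facet_set d n j"
    and cB: "renumber d n j ` B \<in> closed_sets (d - 1) (facet_max d n j)"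
  shows "B \<in> closed_sets d n"
proof (rule closed_sets_sepI')
  have jn: "j \<le> n" using m by simp
  note bij = renumber_bij[OF m(1,2) jn]
  have inj: "inj_on (renumber d n j) (facet_set d n j)" and im: "renumber d n j ` facet_set d n j = {..facet_max d n j}"
    using bij by (auto simp: bij_betw_def)
  show "B \<subseteq> {..n}" using B by (auto simp: facet_set_def adj_def)
  fix i assume i: "i \<le> n" "i \<notin> B"
  show "\<exists>k\<le>n. (\<forall>x\<in>B. adj d n x k) \<and> \<not> adj d n i k"
  proof (cases "i \<in> facet_set d n j")
    case False
    then show ?thesis using B jn by (intro exI[of _ j]) (auto simp: facet_set_def)
  next
    case ij: True
    have "renumber d n j i \<notin> renumber d n j ` B" using inj_onD[OF inj _ ij] B i by blast
    moreover have "renumber d n j i \<le> facet_max d n j" using im ij by blast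
    ultimately obtain k' where k': "k' \<le> facet_max d n j" "renumber d n j ` B \<subseteq> facet_set (d - 1) (facet_max d n j) k'"
      "renumber d n j i \<notin> facet_set (d - 1) (facet_max d n j) k'" using closed_sets_sepD[OF cB] by metis
    then obtain k where k: "k \<in> facet_set d n j" "k' = renumber d n j k" using im by (metis atMost_iff imageE)
    have kn: "k \<le> n" "k \<noteq> j" "k < j + d" "j < k + d" using k m by (auto simp: facet_set_def adj_def)
    have iR: "\<not> adj (d - 1) (facet_max d n j) (renumber d n j i) (renumber d n j k)" using k' k by (simp add: facet_set_def)
    have BR: "adj (d - 1) (facet_max d n j) (renumber d n j x) (renumber d n j k)" if "x \<in> B" for x
      using k' k that by (auto simp: facet_set_def)
    have ib: "i \<noteq> j" "i < j + d" "j < i + d" using ij m by (auto simp: facet_set_def adj_def)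
    have xb: "x \<noteq> j" "x < j + d" "j < x + d" "x \<le> n" if "x \<in> B" for x
      using that B m by (auto simp: facet_set_def adj_def)
    consider "k + 1 < j + d" "j + 1 < k + d" | "k + 1 = j + d" | "j + 1 = k + d" using kn by linarith
    then show ?thesis
    proof cases
      case 1
      have iff: "adj (d - 1) (facet_max d n j) (renumber d n j v) (renumber d n j k) \<longleftrightarrow> adj d n v k" if "v \<in> facet_set d n j" for v
        by (rule adj_renumber[OF m _ kn(1,2) 1]) (use that in \<open>simp add: facet_set_def\<close>)
      show ?thesis using iff[OF ij] iR iff BR B kn(1) by (intro exI[of _ k]) blast
    next
      case 2
      have N: "facet_max d n j = j + d - 1 - (j + 1 - d) - 1" "renumber d n j k = facet_max d n j"
        using 2 kn m by (auto simp: facet_max_inner renumber_high)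
      have "i < j"
      proof (rule ccontr)
        assume "\<not> i < j"
        then have "j < i" using ib by simp
        then have "adj (d - 1) (facet_max d n j) (renumber d n j i) (renumber d n j k)"
          using \<open>j < i\<close> N m ib by (cases "d \<le> j + 1") (auto simp: adj_def renumber_high)
        then show False using iR by simp
      qed
      have jx: "j < x" if x: "x \<in> B" for x
      proof (rule ccontr)
        assume "\<not> j < x"
        then have "x < j" using xb[OF x] by simp
        then show False using BR[OF x] N m xb[OF x] by (cases "d \<le> j + 1") (auto simp: adj_def renumber_low)
      qed
      \<comment> \<open>Among the vertices of the facet \<open>j\<close> this facet contains just
        those above \<open>j\<close>. If \<open>j + d\<close> exceeds \<open>n\<close>, then
        \<open>n = j + d - 1\<close>, and the diagonal entry at \<open>n\<close> supplies the last
        vertex.\<close>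
      have "adj d n x (min n (j + d))" if x: "x \<in> B" for x
        using xb[OF x] jx[OF x] m(2) by (auto simp: adj_def min_def)
      moreover have "\<not> adj d n i (min n (j + d))" using \<open>i < j\<close> 2 kn by (auto simp: adj_def min_def)
      ultimately show ?thesis by (intro exI[of _ "min n (j + d)"]) auto
    next
      case 3
      have N: "j + 1 - d = k" "renumber d n j k = 0"
        using 3 kn m by (auto simp: renumber_low)
      have "j < i"
      proof (rule ccontr)
        assume "\<not> j < i"
        then have "i < j" using ib by simp
        have "renumber d n j i \<le> facet_max d n j" using im ij by blast
        then have "adj (d - 1) (facet_max d n j) (renumber d n j i) (renumber d n j k)"
          using \<open>i < j\<close> N m ib 3 by (auto simp: adj_def renumber_low)
        then show False using iR by simp
      qed
      have xj: "x < j" if x: "x \<in> B" for x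
      proof (rule ccontr)
        assume "\<not> x < j"
        then have "j < x" using xb[OF x] by simp
        then show False using BR[OF x] N m xb[OF x] 3 by (cases "d \<le> j + 1") (auto simp: adj_def renumber_high)
      qed
      have "adj d n x (j - d)" if x: "x \<in> B" for x using xb[OF x] xj[OF x] m 3 by (auto simp: adj_def)
      moreover have "\<not> adj d n i (j - d)" using \<open>j < i\<close> 3 m by (auto simp: adj_def)
      moreover have "j - d \<le> n" using m by simp
      ultimately show ?thesis by blast
    qed
  qed
qed

lemma facet_iso:
  assumes m: "multiplex_pair d n" "2 \<le> d" and j: "j \<le> n" and B: "B \<subseteq> facet_set d n j"
  shows "B \<in> closed_sets d n \<longleftrightarrow> renumber d n j ` B \<in> closed_sets (d - 1) (facet_max d n j)"
proof (cases "j = 0 \<or> j = n")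
  case True
  have "B \<in> closed_sets d n"
    using B True facet_set_0[OF m(1)] facet_set_n[OF m(1)] closed_sets_subset_facet_set_0[OF m(1)] closed_sets_subset_facet_set_n[OF m(1)] by metis
  moreover have "renumber d n j ` B \<in> closed_sets (d - 1) (facet_max d n j)"
  proof -
    have facet_max: "facet_max d n j = d - 1" using True by (simp add: facet_max_def)
    have "renumber d n j ` B \<subseteq> {..d - 1}"
      using renumber_bij[OF m j] B unfolding facet_max bij_betw_def by blast
    then show ?thesis unfolding facet_max using m by (intro closed_sets_simplex) auto
  qed
  ultimately show ?thesis by simp
next
  case False
  then show ?thesis using facet_iso_inner1[OF m] facet_iso_inner2[OF m] B j by (metis le_neq_implies_less neq0_conv)
qed

definition closed_sets_iso :: "nat \<Rightarrow> nat \<Rightarrow> 'b::order set \<Rightarrow> ('b \<Rightarrow> nat set) \<Rightarrow> bool" where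
  "closed_sets_iso d n X f \<longleftrightarrow> bij_betw f X (closed_sets d n) \<and> (\<forall>x\<in>X. \<forall>y\<in>X. x \<le> y \<longleftrightarrow> f x \<subseteq> f y)"

lemma facet_image_bij:
  assumes m: "multiplex_pair d n" "2 \<le> d" and j: "j \<le> n"
  shows "bij_betw ((`) (renumber d n j)) {A \<in> closed_sets d n. A \<subseteq> facet_set d n j} (closed_sets (d - 1) (facet_max d n j))"
proof -
  have inj: "inj_on (renumber d n j) (facet_set d n j)" and im: "renumber d n j ` facet_set d n j = {..facet_max d n j}"
    using renumber_bij[OF m j] by (auto simp: bij_betw_def)
  show ?thesis unfolding bij_betw_def
  proof (intro conjI subset_antisym subsetI)
    show "inj_on ((`) (renumber d n j)) {A \<in> closed_sets d n. A \<subseteq> facet_set d n j}"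
      by (intro inj_onI) (use inj_on_image_eq_iff[OF inj] in auto)
    fix C assume C: "C \<in> closed_sets (d - 1) (facet_max d n j)"
    define B where "B = {u \<in> facet_set d n j. renumber d n j u \<in> C}"
    have "C \<subseteq> renumber d n j ` facet_set d n j" using closed_sets_subset[OF C] im by simp
    then have "renumber d n j ` B = C" by (auto simp: B_def)
    then show "C \<in> (`) (renumber d n j) ` {A \<in> closed_sets d n. A \<subseteq> facet_set d n j}"
      using facet_iso[OF m j, of B] C by (intro image_eqI[of _ _ B]) (auto simp: B_def)
  qed (use facet_iso[OF m j] in auto)
qed

lemma facet_image_le_iff:
  assumes m: "multiplex_pair d n" "2 \<le> d" and j: "j \<le> n" and "A \<subseteq> facet_set d n j" "B \<subseteq> facet_set d n j"
  shows "renumber d n j ` A \<subseteq> renumber d n j ` B \<longleftrightarrow> A \<subseteq> B"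
proof -
  have inj: "inj_on (renumber d n j) (facet_set d n j)"
    using renumber_bij[OF m j] by (auto simp: bij_betw_def)
  show ?thesis using inj_on_image_subset_iff[OF inj] assms by blast
qed

lemma bij_betw_Collect:
  assumes "bij_betw f X Y"
  shows "bij_betw f {x \<in> X. P (f x)} {y \<in> Y. P y}"
proof -
  have "Y = f ` X" "inj_on f X" using assms by (auto simp: bij_betw_def)
  then show ?thesis unfolding bij_betw_def by (auto intro: inj_on_subset)
qed

text \<open>By symmetry of \<open>adj\<close> the facets through the vertex \<open>i\<close> have
  the vertices of the facet \<open>i\<close> as indices, so the vertex figure at \<open>i\<close> is
  dual to this facet.\<close>

lemma polar_vertex_bij:
  assumes "i \<le> n"
  shows "bij_betw (polar d n) {A \<in> closed_sets d n. i \<in> A} {J \<in> closed_sets d n. J \<subseteq> facet_set d n i}"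
proof (rule bij_betw_byWitness[where f' = "polar d n"])
  have *: "i \<in> polar d n J \<longleftrightarrow> J \<subseteq> facet_set d n i" if "J \<subseteq> {..n}" for J
    using assms adj_sym by (auto simp: polar_def facet_set_def)
  show "polar d n ` {A \<in> closed_sets d n. i \<in> A} \<subseteq> {J \<in> closed_sets d n. J \<subseteq> facet_set d n i}"
  proof safe
    fix A x assume A: "A \<in> closed_sets d n" "i \<in> A"
    then show "polar d n A \<in> closed_sets d n" using polar_closed_sets[OF closed_sets_subset] by blast
    assume "x \<in> polar d n A"
    moreover have "polar d n A \<subseteq> facet_set d n i" using *[OF polar_subset, of d A] A polar_polar by auto
    ultimately show "x \<in> facet_set d n i" by blast
  qed
  show "polar d n ` {J \<in> closed_sets d n. J \<subseteq> facet_set d n i} \<subseteq> {A \<in> closed_sets d n. i \<in> A}"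
    using *[OF closed_sets_subset] polar_closed_sets[OF closed_sets_subset] by auto
qed (auto simp: polar_polar)

lemma closed_sets_iso_facet:
  assumes "closed_sets_iso d n X f" and m: "multiplex_pair d n" "2 \<le> d" and j: "j \<le> n"
  shows "closed_sets_iso (d - 1) (facet_max d n j) {x \<in> X. f x \<subseteq> facet_set d n j} (\<lambda>x. renumber d n j ` f x)"
  unfolding closed_sets_iso_def
proof (intro conjI ballI)
  have f: "bij_betw f X (closed_sets d n)" using assms by (simp add: closed_sets_iso_def)
  have "bij_betw f {x \<in> X. f x \<subseteq> facet_set d n j} {A \<in> closed_sets d n. A \<subseteq> facet_set d n j}"
    by (rule bij_betw_Collect[OF f])
  from bij_betw_trans[OF this facet_image_bij[OF m j]]
  show "bij_betw (\<lambda>x. renumber d n j ` f x) {x \<in> X. f x \<subseteq> facet_set d n j} (closed_sets (d - 1) (facet_max d n j))"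
    by (simp add: comp_def)
  fix x y assume "x \<in> {x \<in> X. f x \<subseteq> facet_set d n j}" "y \<in> {x \<in> X. f x \<subseteq> facet_set d n j}"
  then show "x \<le> y \<longleftrightarrow> renumber d n j ` f x \<subseteq> renumber d n j ` f y"
    using assms(1) facet_image_le_iff[OF m j] by (auto simp: closed_sets_iso_def)
qed

text \<open>The vertex figure becomes the facet \<open>i\<close> under \<open>polar\<close>, is
  renumbered, and is turned back by the polar of the smaller multiplex, which restores the direction
  of the order.\<close>

lemma closed_sets_iso_vertex:
  assumes "closed_sets_iso d n X f" and m: "multiplex_pair d n" "2 \<le> d" and i: "i \<le> n"
  shows "closed_sets_iso (d - 1) (facet_max d n i) {x \<in> X. i \<in> f x}
    (\<lambda>x. polar (d - 1) (facet_max d n i) (renumber d n i ` polar d n (f x)))"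
  unfolding closed_sets_iso_def
proof (intro conjI ballI)
  let ?N = "facet_max d n i"
  have f: "bij_betw f X (closed_sets d n)" using assms by (simp add: closed_sets_iso_def)
  have 1: "bij_betw f {x \<in> X. i \<in> f x} {A \<in> closed_sets d n. i \<in> A}"
    by (rule bij_betw_Collect[OF f])
  have 2: "bij_betw (polar (d - 1) ?N) (closed_sets (d - 1) ?N) (closed_sets (d - 1) ?N)"
    by (rule bij_betw_byWitness[where f' = "polar (d - 1) ?N"]) (auto simp: polar_polar polar_closed_sets closed_sets_subset)
  note 3 = bij_betw_trans[OF bij_betw_trans[OF 1 polar_vertex_bij[OF i]] facet_image_bij[OF m i]]
  from bij_betw_trans[OF 3 2]
  show "bij_betw (\<lambda>x. polar (d - 1) ?N (renumber d n i ` polar d n (f x))) {x \<in> X. i \<in> f x} (closed_sets (d - 1) ?N)"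
    by (simp add: comp_def)
  fix x y assume xy: "x \<in> {x \<in> X. i \<in> f x}" "y \<in> {x \<in> X. i \<in> f x}"
  have fc: "f x \<in> closed_sets d n" "f y \<in> closed_sets d n" using xy f by (auto simp: bij_betw_def)
  have p: "polar d n (f x) \<subseteq> facet_set d n i" "polar d n (f y) \<subseteq> facet_set d n i"
    using polar_vertex_bij[OF i, of d] xy fc unfolding bij_betw_def by blast+
  have pc: "renumber d n i ` polar d n (f x) \<in> closed_sets (d - 1) ?N" "renumber d n i ` polar d n (f y) \<in> closed_sets (d - 1) ?N"
    using facet_iso[OF m i] p polar_closed_sets[OF closed_sets_subset] fc by blast+
  show "x \<le> y \<longleftrightarrow> polar (d - 1) ?N (renumber d n i ` polar d n (f x)) \<subseteq> polar (d - 1) ?N (renumber d n i ` polar d n (f y))"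
    using assms(1) xy polar_le_iff[OF pc] facet_image_le_iff[OF m i p(2,1)] polar_le_iff[OF fc(2,1)]
      polar_le_iff[OF fc]
    by (auto simp: closed_sets_iso_def)
qed

lemma nonevasive_iso:
  assumes "bij_betw f X Y" "nonevasive R' Y"
    and c: "\<And>x y. x \<in> X \<Longrightarrow> y \<in> X \<Longrightarrow> (R x y \<or> R y x) \<longleftrightarrow> (R' (f x) (f y) \<or> R' (f y) (f x))"
  shows "nonevasive R X"
proof -
  have b: "bij_betw (inv_into X f) Y X" by (rule bij_betw_inv_into[OF assms(1)])
  have "nonevasive R (inv_into X f ` Y)"
  proof (rule nonevasive_image[OF assms(2)])
    show "inj_on (inv_into X f) Y" using b by (simp add: bij_betw_def)
    fix x y assume xy: "x \<in> Y" "y \<in> Y"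
    have "inv_into X f x \<in> X" "inv_into X f y \<in> X" using b xy by (auto simp: bij_betw_def)
    moreover have "f (inv_into X f x) = x" "f (inv_into X f y) = y"
      using assms(1) xy by (auto simp: bij_betw_inv_into_right)
    ultimately show "(R' x y \<or> R' y x) \<longleftrightarrow>
      (R (inv_into X f x) (inv_into X f y) \<or> R (inv_into X f y) (inv_into X f x))"
      using c[of "inv_into X f x" "inv_into X f y"] by simp
  qed
  then show ?thesis using b by (simp add: bij_betw_def)
qed

lemma highly_connected_iso:
  assumes "bij_betw f X Y" "highly_connected R' k Y"
    and c: "\<And>x y. x \<in> X \<Longrightarrow> y \<in> X \<Longrightarrow> (R x y \<or> R y x) \<longleftrightarrow> (R' (f x) (f y) \<or> R' (f y) (f x))"
  shows "highly_connected R k X"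
proof -
  have b: "bij_betw (inv_into X f) Y X" by (rule bij_betw_inv_into[OF assms(1)])
  have "highly_connected R k (inv_into X f ` Y)"
  proof (rule highly_connected_image[OF assms(2)])
    show "inj_on (inv_into X f) Y" using b by (simp add: bij_betw_def)
    fix x y assume xy: "x \<in> Y" "y \<in> Y"
    have "inv_into X f x \<in> X" "inv_into X f y \<in> X" using b xy by (auto simp: bij_betw_def)
    moreover have "f (inv_into X f x) = x" "f (inv_into X f y) = y"
      using assms(1) xy by (auto simp: bij_betw_inv_into_right)
    ultimately show "(R' x y \<or> R' y x) \<longleftrightarrow>
      (R (inv_into X f x) (inv_into X f y) \<or> R (inv_into X f y) (inv_into X f x))"
      using c[of "inv_into X f x" "inv_into X f y"] by simp
  qed
  then show ?thesis using b by (simp add: bij_betw_def)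
qed

lemma porder_subset: "porder ((\<subseteq>) :: 'b set \<Rightarrow> _)"
  unfolding porder_def by auto

section \<open>Shelling and connectivity of the boundary\<close>

lemma antistar_cover:
  assumes "A \<in> closed_sets d n" "n \<notin> A"
  obtains j where "j + d \<le> n" "A \<subseteq> facet_set d n j"
proof -
  obtain j where "j \<le> n" "A \<subseteq> facet_set d n j" "n \<notin> facet_set d n j" using closed_sets_sepD[OF assms(1) _ assms(2)] by blast
  moreover then have "j + d \<le> n" by (auto simp: facet_set_def adj_def)
  ultimately show ?thesis using that by blast
qed

text \<open>The facets \<open>0, 1, \<dots>\<close> form a shelling: a face of the facet \<open>k + 1\<close> is new
  precisely when it contains the largest vertex of that facet.\<close>

lemma shelling_step:
  assumes m: "multiplex_pair d n" and A: "A \<in> closed_sets d n" "A \<subseteq> facet_set d n (Suc k)" and k: "Suc k + d \<le> n"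
    and kA: "k + d \<notin> A"
  obtains j where "j \<le> k" "A \<subseteq> facet_set d n j"
proof -
  have d2: "2 \<le> d" using m k by (auto simp: multiplex_pair_def)
  have "k + d \<le> n" using k by simp
  then obtain l where l: "l \<le> n" "A \<subseteq> facet_set d n l" "k + d \<notin> facet_set d n l" using closed_sets_sepD[OF A(1) _ kA] by blast
  show ?thesis
  proof (cases "l \<le> k")
    case True
    then show ?thesis using that l by blast
  next
    case False
    have "l \<noteq> Suc k" using l(3) k d2 by (auto simp: facet_set_def adj_def)
    then have link: "l \<ge> k + d" using l False k d2 by (auto simp: facet_set_def adj_def)
    have "adj d n x k" if x: "x \<in> A" for x
    proof -
      have "x < Suc k + d" "x \<noteq> k + d" "l < x + d" "x \<le> n"
        using x A l(2) kA by (auto simp: facet_set_def adj_def)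
      then show ?thesis using link k by (auto simp: adj_def)
    qed
    then show ?thesis using that[of k] by (auto simp: facet_set_def)
  qed
qed

text \<open>The antistar of the largest vertex in the boundary complex of the face \<open>G\<close>,
  as a poset of nonempty faces.\<close>

definition antistar :: "nat \<Rightarrow> nat \<Rightarrow> nat set \<Rightarrow> nat set set" where
  "antistar d n G = {s \<in> closed_sets d n. s \<subseteq> G \<and> s \<noteq> {} \<and> Max G \<notin> s}"

text \<open>Renumbering is increasing, so it maps the largest vertex to the largest vertex.\<close>

lemma antistar_facet:
  assumes m: "multiplex_pair d n" "2 \<le> d" and j: "j \<le> n" and G: "G \<in> closed_sets d n" "G \<subseteq> facet_set d n j" "2 \<le> card G"
    and ac: "nonevasive (\<subseteq>) (antistar (d - 1) (facet_max d n j) (renumber d n j ` G))"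
  shows "nonevasive (\<subseteq>) (antistar d n G)"
proof -
  let ?f = "renumber d n j" and ?N = "facet_max d n j"
  have inj: "inj_on ?f (facet_set d n j)" using renumber_bij[OF m j] by (auto simp: bij_betw_def)
  have fG: "finite G" "G \<noteq> {}" using G(3) by (auto intro: card_ge_0_finite)
  have MG: "Max G \<in> G" using fG by simp
  have Max: "Max (?f ` G) = ?f (Max G)"
  proof (rule Max_eqI)
    fix y assume "y \<in> ?f ` G"
    then obtain x where x: "x \<in> G" "y = ?f x" by blast
    then have "x \<le> Max G" using fG by simp
    then show "y \<le> ?f (Max G)"
      using renumber_strict_mono[OF m(1) j, of x "Max G"] x G(2) MG by (cases "x = Max G") (auto intro: less_imp_le)
  qed (use fG MG in auto)
  define P where "P B \<longleftrightarrow> B \<subseteq> ?f ` G \<and> B \<noteq> {} \<and> Max (?f ` G) \<notin> B" for B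
  have "bij_betw ((`) ?f) {A \<in> {A \<in> closed_sets d n. A \<subseteq> facet_set d n j}. P (?f ` A)} {B \<in> closed_sets (d - 1) ?N. P B}"
    by (rule bij_betw_Collect[OF facet_image_bij[OF m j]])
  moreover have "{A \<in> {A \<in> closed_sets d n. A \<subseteq> facet_set d n j}. P (?f ` A)} = antistar d n G"
  proof -
    have PA: "P (?f ` A) \<longleftrightarrow> A \<subseteq> G \<and> A \<noteq> {} \<and> Max G \<notin> A" if A: "A \<subseteq> facet_set d n j" for A
    proof -
      have "?f (Max G) \<in> ?f ` A \<longleftrightarrow> Max G \<in> A"
        by (rule inj_on_image_mem_iff[OF inj _ A]) (use MG G(2) in blast)
      then show ?thesis
        unfolding P_def Max facet_image_le_iff[OF m j A G(2)] image_is_empty by simp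
    qed
    show ?thesis
    proof (rule Set.set_eqI)
      fix A
      show "A \<in> {A \<in> {A \<in> closed_sets d n. A \<subseteq> facet_set d n j}. P (?f ` A)} \<longleftrightarrow> A \<in> antistar d n G"
      proof (cases "A \<subseteq> facet_set d n j")
        case True
        then show ?thesis by (simp add: antistar_def PA[OF True])
      next
        case False
        then have "\<not> A \<subseteq> G" using G(2) by blast
        then show ?thesis using False by (simp add: antistar_def)
      qed
    qed
  qed
  moreover have "{B \<in> closed_sets (d - 1) ?N. P B} = antistar (d - 1) ?N (?f ` G)"
    unfolding antistar_def P_def by auto
  ultimately have b: "bij_betw ((`) ?f) (antistar d n G) (antistar (d - 1) ?N (?f ` G))" by simp
  show ?thesis
  proof (rule nonevasive_iso[OF b ac])
    fix x y assume "x \<in> antistar d n G" "y \<in> antistar d n G"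
    then have "x \<subseteq> facet_set d n j" "y \<subseteq> facet_set d n j" using G(2) by (auto simp: antistar_def)
    then show "(x \<subseteq> y \<or> y \<subseteq> x) \<longleftrightarrow> (?f ` x \<subseteq> ?f ` y \<or> ?f ` y \<subseteq> ?f ` x)"
      using facet_image_le_iff[OF m j] by blast
  qed
qed

text \<open>Proper faces lie in a facet and fall to the induction hypothesis. For the whole polytope
  the facets missing \<open>n\<close> are shelled. The new faces of a facet are those through its
  largest vertex; the facet itself comes first, along its own antistar, and is then the apex of the
  links of the smaller new faces.\<close>

lemma nonevasive_antistar:
  assumes "multiplex_pair d n" "G \<in> closed_sets d n" "2 \<le> card G"
  shows "nonevasive (\<subseteq>) (antistar d n G)"
  using assms
proof (induction d arbitrary: n G rule: less_induct)
  case (less d)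
  note m = less.prems(1)
  have proper: "nonevasive (\<subseteq>) (antistar d n G)" if G: "G \<in> closed_sets d n" "2 \<le> card G" "G \<noteq> {..n}" for G
  proof -
    have "\<exists>i\<le>n. i \<notin> G" using G closed_sets_subset[OF G(1)] by auto
    then obtain j where j: "j \<le> n" "G \<subseteq> facet_set d n j" using closed_sets_sepD[OF G(1)] by metis
    \<comment> \<open>In dimension 1 a facet has at most one vertex.\<close>
    have "d \<noteq> 1"
    proof
      assume d: "d = 1"
      then have "facet_set d n j \<subseteq> {j}" by (auto simp: facet_set_def adj_def)
      then have "card G \<le> card {j}" using j by (intro card_mono) auto
      then show False using G(2) by simp
    qed
    then have d2: "2 \<le> d" using m by (auto simp: multiplex_pair_def)
    have "inj_on (renumber d n j) G"
      using renumber_bij[OF m d2 j(1)] j(2) unfolding bij_betw_def by (metis inj_on_subset)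
    then have "2 \<le> card (renumber d n j ` G)" using G(2) by (simp add: card_image)
    moreover have "renumber d n j ` G \<in> closed_sets (d - 1) (facet_max d n j)" using facet_iso[OF m d2 j] G(1) by simp
    ultimately have "nonevasive (\<subseteq>) (antistar (d - 1) (facet_max d n j) (renumber d n j ` G))"
      using d2 by (intro less.IH multiplex_pair_facet_max[OF m d2 j(1)]) auto
    then show ?thesis by (rule antistar_facet[OF m d2 j(1) G(1) j(2) G(2)])
  qed
  define Y where "Y k = {s \<in> closed_sets d n. s \<noteq> {} \<and> (\<exists>j\<le>k. s \<subseteq> facet_set d n j)}" for k
  have finY: "finite (Y k)" for k
    by (rule finite_subset[OF _ finite_closed_sets[of d n]]) (auto simp: Y_def)
  have Y: "nonevasive (\<subseteq>) (Y k)" if "k + d \<le> n" for k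
    using that
  proof (induction k)
    case 0
    have "facet_set d n 0 \<noteq> {}" using m facet_set_0[OF m] by (auto simp: multiplex_pair_def lessThan_empty_iff)
    then have "facet_set d n 0 \<in> Y 0" using facet_set_closed_sets[of 0 n d] by (simp add: Y_def)
    then show ?case by (rule nonevasive.cone[OF finY]) (auto simp: Y_def)
  next
    case (Suc k)
    have d2: "2 \<le> d" using m Suc.prems by (auto simp: multiplex_pair_def)
    let ?F = "facet_set d n (Suc k)"
    have Fc: "?F \<in> closed_sets d n" using Suc.prems by (intro facet_set_closed_sets) simp
    have kF: "k + d \<in> ?F" "k \<in> ?F" using Suc.prems d2 by (auto simp: facet_set_def adj_def)
    have fF: "finite ?F" by (rule closed_sets_finite[OF Fc])
    have Max: "Max ?F = k + d"
      by (rule Max_eqI) (use kF fF in \<open>auto simp: facet_set_def adj_def\<close>)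
    have "card {k, k + d} \<le> card ?F" by (rule card_mono) (use kF fF in auto)
    then have cF: "2 \<le> card ?F" using d2 by simp
    define N where "N = {s \<in> closed_sets d n. s \<subseteq> ?F \<and> k + d \<in> s}"
    have fN: "finite N"
      by (rule finite_subset[OF _ finite_closed_sets[of d n]]) (auto simp: N_def)
    have low: "k + d \<notin> s" if sY: "s \<in> Y k" for s
    proof
      assume "k + d \<in> s"
      moreover obtain j where "j \<le> k" "s \<subseteq> facet_set d n j" using sY by (auto simp: Y_def)
      ultimately have "k + d \<in> facet_set d n j" "j \<le> k" by auto
      then show False by (auto simp: facet_set_def adj_def)
    qed
    have "Y (Suc k) = Y k \<union> N"
    proof (intro subset_antisym subsetI)
      fix s assume "s \<in> Y (Suc k)"
      then obtain j where j: "s \<in> closed_sets d n" "s \<noteq> {}" "j \<le> Suc k" "s \<subseteq> facet_set d n j" by (auto simp: Y_def)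
      show "s \<in> Y k \<union> N"
      proof (cases "j \<le> k")
        case True
        then show ?thesis using j by (auto simp: Y_def)
      next
        case False
        then have s: "s \<subseteq> ?F" using j by (simp add: le_Suc_eq)
        show ?thesis
        proof (cases "k + d \<in> s")
          case True
          then show ?thesis using j s by (simp add: N_def)
        next
          case False
          obtain i where "i \<le> k" "s \<subseteq> facet_set d n i" by (rule shelling_step[OF m j(1) s Suc.prems False])
          then show ?thesis using j by (auto simp: Y_def)
        qed
      qed
    next
      fix s assume "s \<in> Y k \<union> N"
      then show "s \<in> Y (Suc k)" by (auto simp: Y_def N_def intro: le_SucI)
    qed
    moreover have "nonevasive (\<subseteq>) (Y k \<union> N)"
    proof (rule nonevasive_add_up[OF porder_subset fN])
      show "Y k \<inter> N = {}" using low by (auto simp: N_def)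
      show "nonevasive (\<subseteq>) (Y k)" using Suc by simp
      fix z assume z: "z \<in> N"
      show "nonevasive (\<subseteq>) (link (\<subseteq>) (Y k \<union> {w \<in> N. z \<subseteq> w}) z)"
      proof (cases "z = ?F")
        case True
        have "link (\<subseteq>) (Y k \<union> {w \<in> N. z \<subseteq> w}) z = antistar d n ?F"
        proof (intro subset_antisym subsetI)
          fix y assume y: "y \<in> link (\<subseteq>) (Y k \<union> {w \<in> N. z \<subseteq> w}) z"
          then have "y \<in> Y k" using True by (auto simp: link_def N_def)
          moreover have "\<not> z \<subseteq> y" using low[OF \<open>y \<in> Y k\<close>] z by (auto simp: N_def)
          ultimately show "y \<in> antistar d n ?F" using y low True Max by (auto simp: link_def antistar_def Y_def)
        next
          fix y assume y: "y \<in> antistar d n ?F"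
          then have y': "y \<in> closed_sets d n" "y \<subseteq> ?F" "k + d \<notin> y" "y \<noteq> {}" by (auto simp: antistar_def Max)
          obtain i where "i \<le> k" "y \<subseteq> facet_set d n i" by (rule shelling_step[OF m y'(1,2) Suc.prems y'(3)])
          then show "y \<in> link (\<subseteq>) (Y k \<union> {w \<in> N. z \<subseteq> w}) z"
            using y' True kF by (auto simp: link_def Y_def)
        qed
        moreover have "?F \<noteq> {..n}" using facet_set_not_full[OF m] Suc.prems by simp
        ultimately show ?thesis using proper[OF Fc cF] by simp
      next
        case False
        show ?thesis
        proof (rule nonevasive.cone[of _ ?F])
          show "finite (link (\<subseteq>) (Y k \<union> {w \<in> N. z \<subseteq> w}) z)" using finY fN by (simp add: link_def)
          show "?F \<in> link (\<subseteq>) (Y k \<union> {w \<in> N. z \<subseteq> w}) z"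
            using z False Fc kF by (auto simp: link_def N_def)
          fix y assume y: "y \<in> link (\<subseteq>) (Y k \<union> {w \<in> N. z \<subseteq> w}) z"
          have "y \<subseteq> ?F"
          proof (cases "y \<in> N")
            case False
            then have "y \<in> Y k" using y by (auto simp: link_def)
            then have "\<not> z \<subseteq> y" using low[of y] z by (auto simp: N_def)
            then show ?thesis using y z by (auto simp: link_def N_def)
          qed (auto simp: N_def)
          then show "?F \<subseteq> y \<or> y \<subseteq> ?F" by simp
        qed
      qed
    qed
    ultimately show ?case by simp
  qed
  show ?case
  proof (cases "G = {..n}")
    case True
    have M: "Max {..n} = n" by (rule Max_eqI) auto
    have "antistar d n G = Y (n - d)"
    proof (intro subset_antisym subsetI)
      fix s assume s: "s \<in> antistar d n G"
      then have s': "s \<in> closed_sets d n" "n \<notin> s" "s \<noteq> {}" by (auto simp: antistar_def True M)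
      obtain j where "j + d \<le> n" "s \<subseteq> facet_set d n j" by (rule antistar_cover[OF s'(1,2)])
      then have "j \<le> n - d" "s \<subseteq> facet_set d n j" by auto
      then show "s \<in> Y (n - d)" using s' by (auto simp: Y_def)
    next
      fix s assume "s \<in> Y (n - d)"
      then obtain j where j: "s \<in> closed_sets d n" "s \<noteq> {}" "j \<le> n - d" "s \<subseteq> facet_set d n j" by (auto simp: Y_def)
      have "n \<notin> facet_set d n j" using j(3) m by (auto simp: facet_set_def adj_def multiplex_pair_def)
      then show "s \<in> antistar d n G" using j closed_sets_subset[OF j(1)] by (auto simp: antistar_def True M)
    qed
    moreover have "n - d + d \<le> n" using m by (simp add: multiplex_pair_def)
    ultimately show ?thesis using Y by simp
  next
    case False
    then show ?thesis using proper less.prems by blast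
  qed
qed

text \<open>The vertex \<open>{n}\<close> is removed. Its link is the proper part of the vertex
  figure, which is dual to a facet and covered by the induction hypothesis. The rest is nonevasive:
  to the antistar of \<open>n\<close> the larger faces through \<open>n\<close> are added from the
  top, each along the join of its own antistar with the faces above it.\<close>

lemma highly_connected_closed_sets:
  assumes "multiplex_pair d n"
  shows "highly_connected (\<subseteq>) d (closed_sets d n - {{}, {..n}})"
  using assms
proof (induction d arbitrary: n)
  case 0
  then show ?case by (simp add: multiplex_pair_def)
next
  case (Suc e)
  let ?d = "Suc e"
  let ?X = "closed_sets ?d n - {{}, {..n}}"
  note m = Suc.prems
  have n0: "n \<noteq> 0" using m by (simp add: multiplex_pair_def)
  have sn: "{n} \<in> closed_sets ?d n" by (rule closed_sets_subset_facet_set_n[OF m]) (use n0 in auto)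
  have snX: "{n} \<in> ?X" using sn n0 by (auto dest: eq_refl)
  define Y where "Y = {s \<in> closed_sets ?d n. s \<noteq> {} \<and> n \<notin> s}"
  define N where "N = {s \<in> closed_sets ?d n. n \<in> s \<and> s \<noteq> {n} \<and> s \<noteq> {..n}}"
  have fin: "finite Y" "finite N"
    by (rule finite_subset[OF _ finite_closed_sets[of ?d n]]; auto simp: Y_def N_def)+
  have M: "Max {..n} = n" by (rule Max_eqI) auto
  have "nonevasive (\<subseteq>) (antistar ?d n {..n})" by (rule nonevasive_antistar[OF m full_closed_sets]) (use n0 in simp)
  moreover have "antistar ?d n {..n} = Y" using closed_sets_subset by (auto simp: antistar_def M Y_def)
  ultimately have acY: "nonevasive (\<subseteq>) Y" by simp
  have ac: "nonevasive (\<subseteq>) (Y \<union> N)"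
  proof (rule nonevasive_add_up[OF porder_subset fin(2) _ acY])
    show "Y \<inter> N = {}" by (auto simp: Y_def N_def)
    fix z assume z: "z \<in> N"
    have zc: "z \<in> closed_sets ?d n" "n \<in> z" using z by (auto simp: N_def)
    have Mz: "Max z = n" by (rule Max_eqI) (use zc closed_sets_finite[OF zc(1)] closed_sets_subset[OF zc(1)] in auto)
    have "2 \<le> card z"
    proof -
      obtain y where "y \<in> z" "y \<noteq> n" using z zc by (auto simp: N_def)
      then have "card {y, n} \<le> card z" using zc closed_sets_finite[OF zc(1)] by (intro card_mono) auto
      then show ?thesis using \<open>y \<noteq> n\<close> by simp
    qed
    then have a: "nonevasive (\<subseteq>) (antistar ?d n z)" by (rule nonevasive_antistar[OF m zc(1)])
    have "link (\<subseteq>) (Y \<union> {w \<in> N. z \<subseteq> w}) z = antistar ?d n z \<union> {w \<in> N. z \<subset> w}"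
      using z zc by (auto simp: link_def Y_def antistar_def Mz N_def)
    moreover have "nonevasive (\<subseteq>) (antistar ?d n z \<union> {w \<in> N. z \<subset> w})"
    proof (rule nonevasive_join[OF a])
      show "finite {w \<in> N. z \<subset> w}" using fin(2) by simp
    qed (auto simp: antistar_def N_def Mz)
    ultimately show "nonevasive (\<subseteq>) (link (\<subseteq>) (Y \<union> {w \<in> N. z \<subseteq> w}) z)" by simp
  qed
  have X: "?X - {{n}} = Y \<union> N" by (auto simp: Y_def N_def)
  have L: "link (\<subseteq>) ?X {n} = N" by (auto simp: link_def N_def)
  have "highly_connected (\<subseteq>) e N"
  proof (cases "e = 0")
    \<comment> \<open>For the segment nothing lies strictly between \<open>{n}\<close> and the
      whole, and the empty complex has index \<open>0\<close>.\<close>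
    case True
    then have n1: "n = 1" using m by (simp add: multiplex_pair_def)
    have "s = {..n}" if "s \<in> closed_sets ?d n" "n \<in> s" "s \<noteq> {n}" for s
    proof -
      have "s \<subseteq> {0, 1}" using closed_sets_subset[OF that(1)] n1 by auto
      then show ?thesis using that n1 by (auto simp: atMost_Suc)
    qed
    then have "N = {}" by (auto simp: N_def)
    then show ?thesis using True by (simp add: highly_connected.empty)
  next
    case False
    then have d2: "2 \<le> ?d" by simp
    let ?N = "facet_max ?d n n"
    have m': "multiplex_pair e ?N" using multiplex_pair_facet_max[OF m d2 order_refl] by simp
    \<comment> \<open>This map reverses inclusion, which \<open>highly_connected_iso\<close>
      tolerates.\<close>
    let ?g = "\<lambda>A. renumber ?d n n ` polar ?d n A"
    have b: "bij_betw ?g {A \<in> closed_sets ?d n. n \<in> A} (closed_sets e ?N)"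
      using bij_betw_trans[OF polar_vertex_bij[OF order_refl] facet_image_bij[OF m d2 order_refl]]
      by (simp add: comp_def)
    have g1: "?g {..n} = {}" by (simp add: polar_full[OF m])
    have g2: "?g {n} = {..?N}"
      using renumber_bij[OF m d2 order_refl] facet_set_polar[of n n ?d] by (simp add: bij_betw_def)
    have "bij_betw ?g ({A \<in> closed_sets ?d n. n \<in> A} - {{n}, {..n}}) (closed_sets e ?N - {{}, {..?N}})"
    proof (rule bij_betw_subset[OF b])
      have "?g ` ({A \<in> closed_sets ?d n. n \<in> A} - {{n}, {..n}}) =
          ?g ` {A \<in> closed_sets ?d n. n \<in> A} - ?g ` {{n}, {..n}}"
        by (rule inj_on_image_set_diff[of _ "{A \<in> closed_sets ?d n. n \<in> A}"])
           (use b sn full_closed_sets[of n ?d] in \<open>auto simp: bij_betw_def\<close>)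
      also have "?g ` {A \<in> closed_sets ?d n. n \<in> A} = closed_sets e ?N" using b unfolding bij_betw_def by blast
      also have "?g ` {{n}, {..n}} = {{}, {..?N}}" unfolding image_insert g1 g2 by auto
      finally show "?g ` ({A \<in> closed_sets ?d n. n \<in> A} - {{n}, {..n}}) = closed_sets e ?N - {{}, {..?N}}" .
    qed auto
    moreover have "{A \<in> closed_sets ?d n. n \<in> A} - {{n}, {..n}} = N" by (auto simp: N_def)
    ultimately have b': "bij_betw ?g N (closed_sets e ?N - {{}, {..?N}})" by simp
    show ?thesis
    proof (rule highly_connected_iso[OF b' Suc.IH[OF m']])
      fix x y assume xy: "x \<in> N" "y \<in> N"
      have p: "polar ?d n x \<subseteq> facet_set ?d n n" "polar ?d n y \<subseteq> facet_set ?d n n"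
        using xy polar_vertex_bij[of n n ?d] unfolding bij_betw_def N_def by blast+
      have c: "x \<in> closed_sets ?d n" "y \<in> closed_sets ?d n" using xy by (auto simp: N_def)
      have "?g x \<subseteq> ?g y \<longleftrightarrow> y \<subseteq> x"
        using facet_image_le_iff[OF m d2 order_refl p] polar_le_iff[OF c] by simp
      moreover have "?g y \<subseteq> ?g x \<longleftrightarrow> x \<subseteq> y"
        using facet_image_le_iff[OF m d2 order_refl p(2,1)] polar_le_iff[OF c(2,1)] by simp
      ultimately show "(x \<subseteq> y \<or> y \<subseteq> x) \<longleftrightarrow> (?g x \<subseteq> ?g y \<or> ?g y \<subseteq> ?g x)" by argo
    qed
  qed
  then have "highly_connected (\<subseteq>) e (link (\<subseteq>) ?X {n})" by (simp only: L)
  moreover have "highly_connected (\<subseteq>) (Suc e) (?X - {{n}})" unfolding X by (rule highly_connected.nonevasive[OF ac])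
  moreover have "finite ?X" using finite_closed_sets by simp
  ultimately show ?case using highly_connected.step[OF _ snX] by blast
qed

section \<open>Rank functions and face polynomials of multiplexes\<close>

definition graded_on :: "'b::order set \<Rightarrow> ('b \<Rightarrow> nat) \<Rightarrow> bool" where
  "graded_on X \<rho> \<longleftrightarrow> finite X \<and> (\<forall>x\<in>X. \<forall>y\<in>X. x < y \<longrightarrow> \<rho> x < \<rho> y) \<and>
     (\<forall>x\<in>X. \<forall>y\<in>X. x < y \<longrightarrow> (\<forall>z\<in>X. \<not> (x < z \<and> z < y)) \<longrightarrow> \<rho> y = Suc (\<rho> x))"

lemma graded_onD:
  assumes "graded_on X \<rho>"
  shows "finite X" "\<And>x y. x \<in> X \<Longrightarrow> y \<in> X \<Longrightarrow> x < y \<Longrightarrow> \<rho> x < \<rho> y"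
    "\<And>x y. x \<in> X \<Longrightarrow> y \<in> X \<Longrightarrow> x < y \<Longrightarrow> (\<And>z. z \<in> X \<Longrightarrow> x < z \<Longrightarrow> z < y \<Longrightarrow> False) \<Longrightarrow>
      \<rho> y = Suc (\<rho> x)"
  using assms unfolding graded_on_def by blast+

lemma graded_on_convex:
  assumes "graded_on X \<rho>" "Y \<subseteq> X"
    and "\<And>x y z. x \<in> Y \<Longrightarrow> y \<in> Y \<Longrightarrow> z \<in> X \<Longrightarrow> x \<le> z \<Longrightarrow> z \<le> y \<Longrightarrow> z \<in> Y"
  shows "graded_on Y \<rho>"
  unfolding graded_on_def
proof (intro conjI ballI impI)
  show "finite Y" using graded_onD(1)[OF assms(1)] assms(2) finite_subset by metis
  fix x y assume xy: "x \<in> Y" "y \<in> Y" "x < y"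
  show "\<rho> x < \<rho> y" by (rule graded_onD(2)[OF assms(1)]) (use xy assms(2) in auto)
  assume c: "\<forall>z\<in>Y. \<not> (x < z \<and> z < y)"
  show "\<rho> y = Suc (\<rho> x)"
  proof (rule graded_onD(3)[OF assms(1)])
    fix z assume z: "z \<in> X" "x < z" "z < y"
    have "z \<in> Y" by (rule assms(3)[OF xy(1,2) z(1)]) (use z in auto)
    then show False using c z by simp
  qed (use xy assms(2) in auto)
qed

text \<open>Adding one element of \<open>S\<close> is a cover, so a grading of a Boolean lattice is
  the cardinality up to a constant.\<close>

lemma Boolean_rank:
  assumes gr: "graded_on Y \<rho>" and g: "bij_betw g Y (Pow S)" "finite S"
    and mono: "\<And>x y. x \<in> Y \<Longrightarrow> y \<in> Y \<Longrightarrow> x \<le> y \<longleftrightarrow> g x \<subseteq> g y"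
    and b: "b \<in> Y" "g b = S"
  shows "y \<in> Y \<Longrightarrow> \<rho> b = \<rho> y + card (S - g y)"
proof (induction "card (S - g y)" arbitrary: y)
  case 0
  have "g y \<subseteq> S" using g(1) 0(2) by (auto simp: bij_betw_def)
  then have "g y = g b" using 0(1) g(2) b by auto
  then have "y = b" using g(1) 0(2) b(1) by (auto simp: bij_betw_def inj_on_def)
  then show ?case using b by simp
next
  case (Suc m)
  have gy: "g y \<subseteq> S" using g(1) Suc.prems by (auto simp: bij_betw_def)
  obtain e where e: "e \<in> S" "e \<notin> g y" using Suc.hyps(2) by (metis Diff_iff card.empty equals0I nat.simps(3))
  have "insert e (g y) \<in> Pow S" using gy e by auto
  then obtain y' where y': "y' \<in> Y" "g y' = insert e (g y)" using g(1) by (metis bij_betw_def imageE)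
  have S: "S - g y = insert e (S - g y')" using e y' by auto
  have "card (S - g y) = Suc (card (S - g y'))"
    unfolding S by (rule card_insert_disjoint) (use y' g(2) in auto)
  then have "\<rho> b = \<rho> y' + m" using Suc.hyps(1)[of y'] Suc.hyps(2) y'(1) by simp
  moreover have "\<rho> y' = Suc (\<rho> y)"
  proof (rule graded_onD(3)[OF gr Suc.prems y'(1)])
    have "y \<le> y'" "\<not> y' \<le> y"
      unfolding mono[OF Suc.prems y'(1)] mono[OF y'(1) Suc.prems] using y'(2) e(2) by auto
    then show "y < y'" by (simp add: less_le_not_le)
    fix z assume z: "z \<in> Y" "y < z" "z < y'"
    have "y \<le> z" "\<not> z \<le> y" "z \<le> y'" "\<not> y' \<le> z" using z(2,3) by (simp_all add: less_le_not_le)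
    then have "g y \<subseteq> g z" "\<not> g z \<subseteq> g y" "g z \<subseteq> insert e (g y)" "\<not> insert e (g y) \<subseteq> g z"
      by (simp_all only: mono[OF Suc.prems z(1)] mono[OF z(1) Suc.prems] mono[OF z(1) y'(1)]
        mono[OF y'(1) z(1)] y'(2) simp_thms)
    then show False by blast
  qed
  ultimately show ?case using Suc.hyps(2) by simp
qed

lemma sum_Pow_power:
  fixes t :: "'c::comm_ring_1"
  assumes "finite S"
  shows "(\<Sum>A\<in>Pow S. t ^ card (S - A)) = (1 + t) ^ card S"
  using assms
proof (induction S rule: finite_induct)
  case (insert x S)
  have fP: "finite (Pow S)" using insert by simp
  have disj: "Pow S \<inter> insert x ` Pow S = {}" using insert by auto
  have inj: "inj_on (insert x) (Pow S)" using insert by (auto simp: inj_on_def)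
  have 1: "card (insert x S - A) = Suc (card (S - A))" if "A \<in> Pow S" for A
  proof -
    have "insert x S - A = insert x (S - A)" using that insert by auto
    then show ?thesis using insert by simp
  qed
  have 2: "S - insert x A = S - A" for A using insert by auto
  have "(\<Sum>A\<in>Pow (insert x S). t ^ card (insert x S - A)) =
      (\<Sum>A\<in>Pow S. t ^ card (insert x S - A)) + (\<Sum>A\<in>Pow S. t ^ card (insert x S - insert x A))"
    unfolding Pow_insert by (subst sum.union_disjoint) (use fP disj inj in \<open>auto simp: sum.reindex\<close>)
  also have "\<dots> = t * (\<Sum>A\<in>Pow S. t ^ card (S - A)) + (\<Sum>A\<in>Pow S. t ^ card (S - A))"
    by (simp add: 1 2 sum_distrib_left)
  finally show ?case using insert by (simp add: algebra_simps)
qed simp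

lemma Boolean_sum:
  fixes t :: "'c::comm_ring_1"
  assumes "graded_on Y \<rho>" and g: "bij_betw g Y (Pow S)" "finite S"
    and "\<And>x y. x \<in> Y \<Longrightarrow> y \<in> Y \<Longrightarrow> x \<le> y \<longleftrightarrow> g x \<subseteq> g y"
    and "b \<in> Y" "g b = S"
  shows "(\<Sum>y\<in>Y. t ^ (\<rho> b - \<rho> y)) = (1 + t) ^ card S"
proof -
  have "(\<Sum>y\<in>Y. t ^ (\<rho> b - \<rho> y)) = (\<Sum>y\<in>Y. t ^ card (S - g y))"
    using Boolean_rank[OF assms] by (intro sum.cong refl) simp
  also have "\<dots> = (\<Sum>A\<in>Pow S. t ^ card (S - A))"
    using sum.reindex_bij_betw[OF g(1)] .
  finally show ?thesis using sum_Pow_power[OF g(2)] by simp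
qed

lemma Boolean_sum_anti:
  fixes t :: "'c::comm_ring_1"
  assumes gr: "graded_on Y \<rho>" and g: "bij_betw g Y (Pow S)" "finite S"
    and anti: "\<And>x y. x \<in> Y \<Longrightarrow> y \<in> Y \<Longrightarrow> x \<le> y \<longleftrightarrow> g y \<subseteq> g x"
    and b: "b \<in> Y" "g b = {}"
  shows "(\<Sum>y\<in>Y. t ^ (\<rho> b - \<rho> y)) = (1 + t) ^ card S"
proof -
  have "bij_betw (\<lambda>A. S - A) (Pow S) (Pow S)"
    by (rule bij_betw_byWitness[where f' = "\<lambda>A. S - A"]) auto
  from bij_betw_trans[OF g(1) this] have g': "bij_betw (\<lambda>y. S - g y) Y (Pow S)" by (simp add: comp_def)
  have gS: "g y \<subseteq> S" if "y \<in> Y" for y using g(1) that by (auto simp: bij_betw_def)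
  show ?thesis
  proof (rule Boolean_sum[OF gr g' g(2)])
    fix x y assume xy: "x \<in> Y" "y \<in> Y"
    show "x \<le> y \<longleftrightarrow> S - g x \<subseteq> S - g y" using anti[OF xy] gS[OF xy(1)] gS[OF xy(2)] by auto
  qed (use b in auto)
qed

text \<open>The facet \<open>n\<close> is a simplex, so its dual, the vertex figure at
  \<open>n\<close>, is Boolean as well. This makes the count of the faces through \<open>n\<close>
  binomial.\<close>

lemma polar_top_Boolean:
  assumes "multiplex_pair d n"
  shows "bij_betw (polar d n) {A \<in> closed_sets d n. n \<in> A} (Pow {n - d<..n})"
proof -
  have "{J \<in> closed_sets d n. J \<subseteq> facet_set d n n} = Pow {n - d<..n}"
    using closed_sets_subset_facet_set_n[OF assms] facet_set_n[OF assms] by auto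
  then show ?thesis using polar_vertex_bij[of n n d] by simp
qed

lemma closed_sets_iso_top_sum:
  fixes t :: "'c::comm_ring_1"
  assumes m: "multiplex_pair d n" and iso: "closed_sets_iso d n X f" and gr: "graded_on X \<rho>" and b: "b \<in> X" "f b = {..n}"
  shows "(\<Sum>s\<in>{s \<in> X. n \<in> f s}. t ^ (\<rho> b - \<rho> s)) = (1 + t) ^ d"
proof -
  let ?Y = "{s \<in> X. n \<in> f s}"
  have f: "bij_betw f X (closed_sets d n)" and le: "\<And>x y. x \<in> X \<Longrightarrow> y \<in> X \<Longrightarrow> x \<le> y \<longleftrightarrow> f x \<subseteq> f y"
    using iso by (auto simp: closed_sets_iso_def)
  have g: "bij_betw (\<lambda>s. polar d n (f s)) ?Y (Pow {n - d<..n})"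
    using bij_betw_trans[OF bij_betw_Collect[OF f] polar_top_Boolean[OF m]] by (simp add: comp_def)
  have fc: "f s \<in> closed_sets d n" if "s \<in> X" for s using f that by (auto simp: bij_betw_def)
  have "(\<Sum>s\<in>?Y. t ^ (\<rho> b - \<rho> s)) = (1 + t) ^ card {n - d<..n}"
  proof (rule Boolean_sum_anti[OF _ g])
    show "graded_on ?Y \<rho>"
    proof (rule graded_on_convex[OF gr])
      fix x y z assume "x \<in> ?Y" "y \<in> ?Y" "z \<in> X" "x \<le> z" "z \<le> y"
      then show "z \<in> ?Y" using le[of x z] by auto
    qed auto
    fix x y assume "x \<in> ?Y" "y \<in> ?Y"
    then show "x \<le> y \<longleftrightarrow> polar d n (f y) \<subseteq> polar d n (f x)"
      using le polar_le_iff[OF fc fc] by simp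
  qed (use b polar_full[OF m] in auto)
  moreover have "card {n - d<..n} = d" using m by (simp add: multiplex_pair_def)
  ultimately show ?thesis by simp
qed

text \<open>The shelling partitions the faces into those through \<open>n\<close>, those of the
  facet \<open>0\<close>, and, for each \<open>k\<close> from \<open>1\<close> to
  \<open>n - d\<close>, those of the facet \<open>k\<close> through its largest vertex
  \<open>k + d - 1\<close>. Every block is Boolean and contributes \<open>(1 + t) ^ d\<close>,
  \<open>t * (1 + t) ^ d\<close> and \<open>t * (1 + t) ^ (d - 1)\<close>, respectively. The
  coefficient \<open>n - d\<close> thus counts the shelling steps after the first facet.\<close>

lemma closed_sets_iso_face_poly:
  fixes t :: "'c::comm_ring_1"
  assumes m: "multiplex_pair d n" and iso: "closed_sets_iso d n X f" and gr: "graded_on X \<rho>"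
    and b: "b \<in> X" "f b = {..n}" and a: "a \<in> X" "f a = {}"
  shows "\<rho> b = \<rho> a + d + 1"
    and "(\<Sum>s\<in>X. t ^ (\<rho> b - \<rho> s)) = (1 + t) ^ (d + 1) + of_nat (n - d) * t * (1 + t) ^ (d - 1)"
proof -
  have f: "bij_betw f X (closed_sets d n)" and le: "\<And>x y. x \<in> X \<Longrightarrow> y \<in> X \<Longrightarrow> x \<le> y \<longleftrightarrow> f x \<subseteq> f y"
    using iso by (auto simp: closed_sets_iso_def)
  have fX: "finite X" using graded_onD(1)[OF gr] .
  have fc: "f s \<in> closed_sets d n" if "s \<in> X" for s using f that by (auto simp: bij_betw_def)
  have ex: "\<exists>s\<in>X. f s = A" if "A \<in> closed_sets d n" for A
  proof -
    have "A \<in> f ` X" using f that by (simp add: bij_betw_def)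
    then show ?thesis by auto
  qed
  have coatom: "\<rho> b = Suc (\<rho> c)" if c: "c \<in> X" "f c = facet_set d n j" "j \<le> n" for c j
  proof (rule graded_onD(3)[OF gr c(1) b(1)])
    have "facet_set d n j \<subseteq> {..n}" using closed_sets_subset[OF fc[OF c(1)]] c(2) by simp
    then have "c \<le> b" "\<not> b \<le> c" using le[OF c(1) b(1)] le[OF b(1) c(1)] b c facet_set_not_full[OF m c(3)] by auto
    then show "c < b" by simp
    fix z assume z: "z \<in> X" "c < z" "z < b"
    have "facet_set d n j \<subseteq> f z" "f z \<noteq> {..n}" "\<not> f z \<subseteq> facet_set d n j"
      using le[OF c(1) z(1)] le[OF z(1) c(1)] le[OF b(1) z(1)] z c b by auto
    then show False using facet_set_maximal[OF m c(3) fc[OF z(1)]] by auto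
  qed
  have face: "\<exists>c. c \<in> X \<and> f c = facet_set d n j" if "j \<le> n" for j using ex[OF facet_set_closed_sets[OF that]] by auto
  let ?T = "{s \<in> X. n \<in> f s}" and ?B = "{s \<in> X. f s \<subseteq> facet_set d n 0}"
  define N where "N k = {s \<in> X. f s \<subseteq> facet_set d n k \<and> k + d - 1 \<in> f s}" for k
  obtain c0 where c0: "c0 \<in> X" "f c0 = facet_set d n 0" using face[of 0] by auto
  have fB: "bij_betw f ?B (Pow {..<d})"
  proof -
    have "{A \<in> closed_sets d n. A \<subseteq> facet_set d n 0} = Pow {..<d}"
      using closed_sets_subset_facet_set_0[OF m] facet_set_0[OF m] by auto
    then show ?thesis using bij_betw_Collect[OF f, of "\<lambda>A. A \<subseteq> facet_set d n 0"] by simp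
  qed
  have grB: "graded_on ?B \<rho>"
  proof (rule graded_on_convex[OF gr])
    fix x y z assume "x \<in> ?B" "y \<in> ?B" "z \<in> X" "x \<le> z" "z \<le> y"
    then show "z \<in> ?B" using le[of z y] by auto
  qed auto
  have leB: "x \<le> y \<longleftrightarrow> f x \<subseteq> f y" if "x \<in> ?B" "y \<in> ?B" for x y using le that by auto
  have c0B: "c0 \<in> ?B" "f c0 = {..<d}" using c0 facet_set_0[OF m] by auto
  have aB: "a \<in> ?B" using a by auto
  have "\<rho> c0 = \<rho> a + d"
    using Boolean_rank[OF grB fB _ leB c0B aB] a by simp
  then show rk: "\<rho> b = \<rho> a + d + 1" using coatom[OF c0] by simp
  \<comment> \<open>A facet is a coatom, so measuring from the top instead of from the facet costs
    one factor \<open>t\<close>.\<close>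
  have shift: "t ^ (\<rho> b - \<rho> s) = t * t ^ (\<rho> c - \<rho> s)"
    if "c \<in> X" "f c = facet_set d n j" "j \<le> n" "s \<in> X" "f s \<subseteq> facet_set d n j" for c s j
  proof -
    have "s \<le> c" using le[OF that(4,1)] that by simp
    then have "\<rho> s \<le> \<rho> c"
      using graded_onD(2)[OF gr that(4,1)] by (cases "s = c") (auto simp: order.strict_iff_order)
    then show ?thesis using coatom[OF that(1-3)] by (simp add: Suc_diff_le)
  qed
  have sT: "(\<Sum>s\<in>?T. t ^ (\<rho> b - \<rho> s)) = (1 + t) ^ d"
    by (rule closed_sets_iso_top_sum[OF m iso gr b])
  have "(\<Sum>s\<in>?B. t ^ (\<rho> b - \<rho> s)) = (\<Sum>s\<in>?B. t * t ^ (\<rho> c0 - \<rho> s))"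
    using shift[OF c0] by (intro sum.cong refl) auto
  also have "\<dots> = t * (1 + t) ^ d"
    using Boolean_sum[OF grB fB _ leB c0B, of t] by (simp add: sum_distrib_left[symmetric])
  finally have sB: "(\<Sum>s\<in>?B. t ^ (\<rho> b - \<rho> s)) = t * (1 + t) ^ d" .
  have sN: "(\<Sum>s\<in>N k. t ^ (\<rho> b - \<rho> s)) = t * (1 + t) ^ (d - 1)" if k: "k \<in> {1..n - d}" for k
  proof -
    have d2: "2 \<le> d" using k m by (auto simp: multiplex_pair_def)
    have kn: "k \<le> n" using k by auto
    obtain c where c: "c \<in> X" "f c = facet_set d n k" using face[OF kn] by auto
    let ?X = "{x \<in> X. f x \<subseteq> facet_set d n k}" and ?N = "facet_max d n k"
    have kd: "k + d \<le> n" using k m by (auto simp: multiplex_pair_def)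
    \<comment> \<open>The largest vertex of the facet \<open>k\<close> receives the last number, so
      \<open>N k\<close> consists of the faces through the last vertex of a smaller
      multiplex.\<close>
    have renumber: "renumber d n k (k + d - 1) = ?N"
    proof -
      have "min n (k + d - 1) = k + d - 1" using kd by simp
      then show ?thesis using k kd d2 by (simp add: renumber_high facet_max_inner)
    qed
    have face_opt: "k + d - 1 \<in> facet_set d n k" using k kd d2 by (auto simp: facet_set_def adj_def)
    have inj: "inj_on (renumber d n k) (facet_set d n k)" and im: "renumber d n k ` facet_set d n k = {..?N}"
      using renumber_bij[OF m d2 kn] by (auto simp: bij_betw_def)
    have Nk: "N k = {s \<in> ?X. ?N \<in> renumber d n k ` f s}"
    proof -
      have "?N \<in> renumber d n k ` f s \<longleftrightarrow> k + d - 1 \<in> f s" if "f s \<subseteq> facet_set d n k" for s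
        unfolding renumber[symmetric] by (rule inj_on_image_mem_iff[OF inj face_opt that])
      then show ?thesis by (auto simp: N_def)
    qed
    have grX: "graded_on ?X \<rho>"
    proof (rule graded_on_convex[OF gr])
      fix x y z assume "x \<in> ?X" "y \<in> ?X" "z \<in> X" "x \<le> z" "z \<le> y"
      then show "z \<in> ?X" using le[of z y] by auto
    qed auto
    have "(\<Sum>s\<in>N k. t ^ (\<rho> b - \<rho> s)) = (\<Sum>s\<in>N k. t * t ^ (\<rho> c - \<rho> s))"
      using shift[OF c kn] by (intro sum.cong refl) (auto simp: N_def)
    also have "\<dots> = t * (\<Sum>s\<in>N k. t ^ (\<rho> c - \<rho> s))" by (simp add: sum_distrib_left)
    also have "(\<Sum>s\<in>N k. t ^ (\<rho> c - \<rho> s)) = (1 + t) ^ (d - 1)"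
      unfolding Nk
      by (rule closed_sets_iso_top_sum[OF multiplex_pair_facet_max[OF m d2 kn] closed_sets_iso_facet[OF iso m d2 kn] grX])
         (use c im in auto)
    finally show ?thesis .
  qed
  have low: "x < j + d" if "x \<in> f s" "f s \<subseteq> facet_set d n j" for x s j
    using that by (auto simp: facet_set_def adj_def)
  have dn: "d \<le> n" "1 \<le> d" using m by (auto simp: multiplex_pair_def)
  have X: "X = ?T \<union> (?B \<union> (\<Union>k\<in>{1..n - d}. N k))"
  proof (intro subset_antisym subsetI)
    fix s assume s: "s \<in> X"
    show "s \<in> ?T \<union> (?B \<union> (\<Union>k\<in>{1..n - d}. N k))"
    proof (cases "n \<in> f s")
      case False
      obtain j where j: "j + d \<le> n" "f s \<subseteq> facet_set d n j" by (rule antistar_cover[OF fc[OF s] False])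
      \<comment> \<open>The first facet of the shelling that contains the face.\<close>
      define k where "k = (LEAST k. f s \<subseteq> facet_set d n k)"
      have k: "f s \<subseteq> facet_set d n k" unfolding k_def by (rule LeastI[of _ j]) (rule j)
      have kj: "k \<le> j" unfolding k_def by (rule Least_le) (rule j)
      show ?thesis
      proof (cases k)
        case 0
        then show ?thesis using s k by simp
      next
        case (Suc l)
        have "l + d \<in> f s"
        proof (rule ccontr)
          assume l: "l + d \<notin> f s"
          have sl: "f s \<subseteq> facet_set d n (Suc l)" "Suc l + d \<le> n" using k kj j Suc by auto
          obtain i where i: "i \<le> l" "f s \<subseteq> facet_set d n i" by (rule shelling_step[OF m fc[OF s] sl l])
          have "k \<le> i" unfolding k_def by (rule Least_le) (rule i)
          then show False using i Suc by simp
        qed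
        then have "s \<in> N k" using s k Suc by (simp add: N_def)
        moreover have "k \<in> {1..n - d}" using Suc kj j by auto
        ultimately show ?thesis by blast
      qed
    qed (use s in auto)
  qed (auto simp: N_def)
  have fin: "finite ?T" "finite ?B" "finite (N k)" for k using fX by (auto simp: N_def)
  have d1: "?T \<inter> (?B \<union> (\<Union>k\<in>{1..n - d}. N k)) = {}"
  proof -
    have "n \<notin> f s" if "s \<in> ?B \<union> (\<Union>k\<in>{1..n - d}. N k)" for s
    proof
      assume n: "n \<in> f s"
      from that obtain k where "k \<le> n - d" "f s \<subseteq> facet_set d n k" by (auto simp: N_def)
      then show False using low[OF n] dn by fastforce
    qed
    then show ?thesis by blast
  qed
  have d2: "?B \<inter> (\<Union>k\<in>{1..n - d}. N k) = {}"
  proof -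
    have "s \<notin> N k" if "k \<in> {1..n - d}" "s \<in> ?B" for s k
      using low[of "k + d - 1" s 0] that dn by (auto simp: N_def)
    then show ?thesis by blast
  qed
  have d3: "N k \<inter> N l = {}" if "k < l" for k l
  proof -
    have "s \<notin> N k" if "s \<in> N l" for s
      using low[of "l + d - 1" s k] that \<open>k < l\<close> dn by (auto simp: N_def)
    then show ?thesis by blast
  qed
  have d3': "\<forall>k\<in>{1..n - d}. \<forall>l\<in>{1..n - d}. k \<noteq> l \<longrightarrow> N k \<inter> N l = {}"
    using d3 by (metis Int_commute nat_neq_iff)
  let ?s = "\<lambda>s. t ^ (\<rho> b - \<rho> s)"
  have "sum ?s X = sum ?s (?T \<union> (?B \<union> (\<Union>k\<in>{1..n - d}. N k)))" using X by simp
  also have "\<dots> = sum ?s ?T + sum ?s (?B \<union> (\<Union>k\<in>{1..n - d}. N k))"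
    by (rule sum.union_disjoint) (use fin d1 in auto)
  also have "sum ?s (?B \<union> (\<Union>k\<in>{1..n - d}. N k)) = sum ?s ?B + sum ?s (\<Union>k\<in>{1..n - d}. N k)"
    by (rule sum.union_disjoint) (use fin d2 in auto)
  also have "sum ?s (\<Union>k\<in>{1..n - d}. N k) = (\<Sum>k\<in>{1..n - d}. sum ?s (N k))"
    by (rule sum.UNION_disjoint) (use fin d3' in auto)
  also have "\<dots> = of_nat (n - d) * (t * (1 + t) ^ (d - 1))"
    using sN by simp
  finally show "(\<Sum>s\<in>X. t ^ (\<rho> b - \<rho> s)) = (1 + t) ^ (d + 1) + of_nat (n - d) * t * (1 + t) ^ (d - 1)"
    unfolding sT sB by (simp add: algebra_simps)
qed

text \<open>If \<open>a\<close> is nonempty or \<open>b\<close> is not full, the interval lies in a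
  vertex figure or in a facet, that is, in a multiplex of one dimension less. The descent stops at a
  full lattice or, in dimension 1, possibly at a cover.\<close>

lemma closed_sets_iso_interval:
  assumes "multiplex_pair d n" "closed_sets_iso d n X f" "a \<in> X" "b \<in> X" "a < b"
  shows "{s \<in> X. a \<le> s \<and> s \<le> b} = {a, b} \<or>
    (\<exists>d' n' g. multiplex_pair d' n' \<and> closed_sets_iso d' n' {s \<in> X. a \<le> s \<and> s \<le> b} g)"
  using assms
proof (induction d arbitrary: n X f)
  case 0
  then show ?case by (simp add: multiplex_pair_def)
next
  case (Suc e)
  let ?d = "Suc e"
  let ?I = "{s \<in> X. a \<le> s \<and> s \<le> b}"
  note m = Suc.prems(1) and iso = Suc.prems(2) and ab = Suc.prems(3-5)
  have f: "bij_betw f X (closed_sets ?d n)" and le: "\<And>x y. x \<in> X \<Longrightarrow> y \<in> X \<Longrightarrow> x \<le> y \<longleftrightarrow> f x \<subseteq> f y"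
    using iso by (auto simp: closed_sets_iso_def)
  have fc: "f s \<in> closed_sets ?d n" if "s \<in> X" for s using f that by (auto simp: bij_betw_def)
  have inj: "x = y" if "x \<in> X" "y \<in> X" "f x = f y" for x y
    using f that by (auto simp: bij_betw_def inj_on_def)
  have fab: "f a \<subset> f b" using le[OF ab(1,2)] le[OF ab(2,1)] ab(3) by auto
  have sub: "{s \<in> Y. a \<le> s \<and> s \<le> b} = ?I" if "?I \<subseteq> Y" "Y \<subseteq> X" for Y using that by auto
  show ?case
  proof (cases "e = 0")
    case True
    then have n: "n = 1" using m by (simp add: multiplex_pair_def)
    consider "f a = {} \<and> f b = {..n}" | "\<exists>i. f b = insert i (f a)"
    proof -
      have "f b \<subseteq> {0, 1}" using closed_sets_subset[OF fc[OF ab(2)]] n by auto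
      then have "f b \<in> {{}, {0}, {1}, {0, 1}}" by blast
      moreover have "f a \<in> {{}, {0}, {1}, {0, 1}}" using \<open>f b \<subseteq> {0, 1}\<close> fab by blast
      ultimately show ?thesis using fab that n by (auto simp: atMost_Suc)
    qed
    then show ?thesis
    proof cases
      case 1
      then have "?I = X" using le ab closed_sets_subset[OF fc] by auto
      then show ?thesis using m iso by auto
    next
      case 2
      then obtain i where i: "f b = insert i (f a)" by blast
      have "?I = {a, b}"
      proof (intro subset_antisym subsetI)
        fix s assume s: "s \<in> ?I"
        then have "f a \<subseteq> f s" "f s \<subseteq> insert i (f a)" using le[of a s] le[of s b] ab i by auto
        then have "f s = f a \<or> f s = f b" using i by auto
        then show "s \<in> {a, b}" using inj s ab by auto
      qed (use ab in auto)
      then show ?thesis by simp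
    qed
  next
    case False
    then have d2: "2 \<le> ?d" by simp
    show ?thesis
    proof (cases "f b = {..n}")
      case fb: True
      show ?thesis
      proof (cases "f a = {}")
        case True
        then have "?I = X" using le ab fb closed_sets_subset[OF fc] by auto
        then show ?thesis using m iso by auto
      next
        case False
        then obtain i where i: "i \<in> f a" by auto
        then have "i \<le> n" using closed_sets_subset[OF fc[OF ab(1)]] by auto
        let ?Y = "{x \<in> X. i \<in> f x}"
        have Y: "closed_sets_iso e (facet_max ?d n i) ?Y (\<lambda>x. polar e (facet_max ?d n i) (renumber ?d n i ` polar ?d n (f x)))"
          using closed_sets_iso_vertex[OF iso m d2 \<open>i \<le> n\<close>] by simp
        have IY: "?I \<subseteq> ?Y" using le[OF ab(1)] i by auto
        have m': "multiplex_pair e (facet_max ?d n i)" using multiplex_pair_facet_max[OF m d2 \<open>i \<le> n\<close>] by simp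
        have "a \<in> ?Y" "b \<in> ?Y" using IY ab by auto
        from Suc.IH[OF m' Y this ab(3)] show ?thesis using sub[OF IY] by simp
      qed
    next
      case False
      then obtain i where "i \<le> n" "i \<notin> f b" using closed_sets_subset[OF fc[OF ab(2)]] by auto
      then obtain j where j: "j \<le> n" "f b \<subseteq> facet_set ?d n j" using closed_sets_sepD[OF fc[OF ab(2)]] by metis
      let ?Y = "{x \<in> X. f x \<subseteq> facet_set ?d n j}"
      have Y: "closed_sets_iso e (facet_max ?d n j) ?Y (\<lambda>x. renumber ?d n j ` f x)"
        using closed_sets_iso_facet[OF iso m d2 j(1)] by simp
      have IY: "?I \<subseteq> ?Y" using le[OF _ ab(2)] j by auto
      have m': "multiplex_pair e (facet_max ?d n j)" using multiplex_pair_facet_max[OF m d2 j(1)] by simp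
      have "a \<in> ?Y" "b \<in> ?Y" using IY ab by auto
      from Suc.IH[OF m' Y this ab(3)] show ?thesis using sub[OF IY] by simp
    qed
  qed
qed

section \<open>Ranks and toric polynomials\<close>

text \<open>Strict monotonicity bounds the length of chains, and predecessors of rank one less build
  a chain that attains the bound. So \<open>\<rho>\<close> is the rank by longest chains.\<close>

definition ranked :: "'a gorder \<Rightarrow> ('a \<Rightarrow> nat) \<Rightarrow> bool" where
  "ranked X \<rho> \<longleftrightarrow> finite (carrier X) \<and>
     (\<forall>x\<in>carrier X. x \<sqsubseteq>\<^bsub>X\<^esub> x) \<and>
     (\<forall>x\<in>carrier X. \<forall>y\<in>carrier X. \<forall>z\<in>carrier X. x \<sqsubseteq>\<^bsub>X\<^esub> y \<longrightarrow> y \<sqsubseteq>\<^bsub>X\<^esub> z \<longrightarrow> x \<sqsubseteq>\<^bsub>X\<^esub> z) \<and>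
     (\<forall>x\<in>carrier X. \<forall>y\<in>carrier X. x \<sqsubseteq>\<^bsub>X\<^esub> y \<longrightarrow> x \<noteq> y \<longrightarrow> \<rho> x < \<rho> y) \<and>
     (\<forall>y\<in>carrier X. 0 < \<rho> y \<longrightarrow> (\<exists>x\<in>carrier X. x \<sqsubseteq>\<^bsub>X\<^esub> y \<and> x \<noteq> y \<and> Suc (\<rho> x) = \<rho> y))"

lemma rankedD:
  assumes "ranked X \<rho>"
  shows "finite (carrier X)"
    "\<And>x. x \<in> carrier X \<Longrightarrow> x \<sqsubseteq>\<^bsub>X\<^esub> x"
    "\<And>x y z. x \<in> carrier X \<Longrightarrow> y \<in> carrier X \<Longrightarrow> z \<in> carrier X \<Longrightarrow> x \<sqsubseteq>\<^bsub>X\<^esub> y \<Longrightarrow> y \<sqsubseteq>\<^bsub>X\<^esub> z \<Longrightarrow> x \<sqsubseteq>\<^bsub>X\<^esub> z"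
    "\<And>x y. x \<in> carrier X \<Longrightarrow> y \<in> carrier X \<Longrightarrow> x \<sqsubseteq>\<^bsub>X\<^esub> y \<Longrightarrow> x \<noteq> y \<Longrightarrow> \<rho> x < \<rho> y"
    "\<And>y. y \<in> carrier X \<Longrightarrow> 0 < \<rho> y \<Longrightarrow> \<exists>x\<in>carrier X. x \<sqsubseteq>\<^bsub>X\<^esub> y \<and> x \<noteq> y \<and> Suc (\<rho> x) = \<rho> y"
proof -
  note a = assms[unfolded ranked_def]
  note a1 = a[THEN conjunct1] and b1 = a[THEN conjunct2]
  note a2 = b1[THEN conjunct1] and b2 = b1[THEN conjunct2]
  note a3 = b2[THEN conjunct1] and b3 = b2[THEN conjunct2]
  note a4 = b3[THEN conjunct1] and a5 = b3[THEN conjunct2]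
  show "finite (carrier X)" by (rule a1)
  show "\<And>x. x \<in> carrier X \<Longrightarrow> x \<sqsubseteq>\<^bsub>X\<^esub> x" using a2 by blast
  show "\<And>x y z. x \<in> carrier X \<Longrightarrow> y \<in> carrier X \<Longrightarrow> z \<in> carrier X \<Longrightarrow> x \<sqsubseteq>\<^bsub>X\<^esub> y \<Longrightarrow> y \<sqsubseteq>\<^bsub>X\<^esub> z \<Longrightarrow> x \<sqsubseteq>\<^bsub>X\<^esub> z"
    using a3[THEN bspec, THEN bspec, THEN bspec, THEN mp, THEN mp] .
  show "\<And>x y. x \<in> carrier X \<Longrightarrow> y \<in> carrier X \<Longrightarrow> x \<sqsubseteq>\<^bsub>X\<^esub> y \<Longrightarrow> x \<noteq> y \<Longrightarrow> \<rho> x < \<rho> y"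
    using a4[THEN bspec, THEN bspec, THEN mp, THEN mp] .
  show "\<And>y. y \<in> carrier X \<Longrightarrow> 0 < \<rho> y \<Longrightarrow> \<exists>x\<in>carrier X. x \<sqsubseteq>\<^bsub>X\<^esub> y \<and> x \<noteq> y \<and> Suc (\<rho> x) = \<rho> y"
    using a5[THEN bspec, THEN mp] .
qed

lemma ranked_chain:
  assumes "ranked X \<rho>"
  shows "a \<in> carrier X \<Longrightarrow> \<exists>C. is_chain X C \<and> C \<subseteq> strict_below X a \<and> card C = \<rho> a"
proof (induction "\<rho> a" arbitrary: a)
  case 0
  then show ?case by (intro exI[of _ "{}"]) (auto simp: is_chain_def)
next
  case (Suc m)
  note D = rankedD[OF assms]
  obtain x where x: "x \<in> carrier X" "x \<sqsubseteq>\<^bsub>X\<^esub> a" "x \<noteq> a" "Suc (\<rho> x) = \<rho> a"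
    using D(5)[of a] Suc by auto
  then obtain C where C: "is_chain X C" "C \<subseteq> strict_below X x" "card C = \<rho> x"
    using Suc.hyps(1)[of x] Suc.hyps(2) by auto
  have fC: "finite C" using C(1) D(1) finite_subset unfolding is_chain_def by blast
  have below: "z \<in> carrier X \<and> z \<sqsubseteq>\<^bsub>X\<^esub> x \<and> z \<noteq> x" if "z \<in> C" for z
    using C(2) that by (auto simp: strict_below_def)
  have "is_chain X (insert x C)"
    using C(1) below D(2)[OF x(1)] x(1) unfolding is_chain_def by auto
  moreover have "insert x C \<subseteq> strict_below X a"
  proof
    fix z assume z: "z \<in> insert x C"
    show "z \<in> strict_below X a"
    proof (cases "z = x")
      case True
      then show ?thesis using x by (simp add: strict_below_def)
    next
      case False
      then have zb: "z \<in> carrier X" "z \<sqsubseteq>\<^bsub>X\<^esub> x" "z \<noteq> x" using below z by auto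
      then have "\<rho> z < \<rho> x" using D(4) x(1) by blast
      then have "z \<noteq> a" using x(4) by auto
      moreover have "z \<sqsubseteq>\<^bsub>X\<^esub> a" using D(3)[OF zb(1) x(1) Suc.prems zb(2) x(2)] .
      ultimately show ?thesis using zb by (simp add: strict_below_def)
    qed
  qed
  moreover have "card (insert x C) = \<rho> a" using fC below C(3) x(4) by (subst card_insert_disjoint) auto
  ultimately show ?case by blast
qed

lemma poset_rank_eq:
  assumes "ranked X \<rho>" "a \<in> carrier X"
  shows "poset_rank X a = \<rho> a"
  unfolding poset_rank_def
proof (rule Max_eqI)
  note D = rankedD[OF assms(1)]
  have "{C. is_chain X C \<and> C \<subseteq> strict_below X a} \<subseteq> Pow (carrier X)" by (auto simp: is_chain_def)
  then show "finite (card ` {C. is_chain X C \<and> C \<subseteq> strict_below X a})"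
    using D(1) finite_subset by (intro finite_imageI) blast
  fix k assume "k \<in> card ` {C. is_chain X C \<and> C \<subseteq> strict_below X a}"
  then obtain C where C: "is_chain X C" "C \<subseteq> strict_below X a" "k = card C" by auto
  have cC: "c \<in> carrier X" "\<rho> c < \<rho> a" if "c \<in> C" for c
    using C(2) that D(4)[OF _ assms(2)] by (auto simp: strict_below_def)
  have "inj_on \<rho> C"
  proof (rule inj_onI, rule ccontr)
    fix x y assume xy: "x \<in> C" "y \<in> C" "\<rho> x = \<rho> y" "x \<noteq> y"
    then have "x \<sqsubseteq>\<^bsub>X\<^esub> y \<or> y \<sqsubseteq>\<^bsub>X\<^esub> x" using C(1) by (auto simp: is_chain_def)
    then show False using D(4)[of x y] D(4)[of y x] cC xy by auto
  qed
  then have "card C \<le> card {..<\<rho> a}" by (rule card_inj_on_le) (use cC in auto)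
  then show "k \<le> \<rho> a" using C by simp
next
  show "\<rho> a \<in> card ` {C. is_chain X C \<and> C \<subseteq> strict_below X a}"
    using ranked_chain[OF assms] by (auto simp: image_iff)
qed

lemma subposet_simps [simp]: "carrier (subposet X A) = {z \<in> carrier X. z \<in> A}"
  "gorder.le (subposet X A) = gorder.le X"
  by (auto simp: subposet_def)

lemma ranked_below:
  assumes "ranked X \<rho>" "t \<in> carrier X"
  shows "ranked (subposet X (strict_below X t)) \<rho>"
proof -
  note D = rankedD[OF assms(1)]
  have pred: "\<exists>x\<in>carrier X. x \<in> strict_below X t \<and> x \<sqsubseteq>\<^bsub>X\<^esub> y \<and> x \<noteq> y \<and> Suc (\<rho> x) = \<rho> y"
    if y: "y \<in> carrier X" "y \<in> strict_below X t" "0 < \<rho> y" for y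
  proof -
    obtain x where x: "x \<in> carrier X" "x \<sqsubseteq>\<^bsub>X\<^esub> y" "x \<noteq> y" "Suc (\<rho> x) = \<rho> y" using D(5) y by blast
    have "y \<sqsubseteq>\<^bsub>X\<^esub> t" "y \<noteq> t" using y by (auto simp: strict_below_def)
    then have "x \<sqsubseteq>\<^bsub>X\<^esub> t" "\<rho> y < \<rho> t" using D(3)[OF x(1) y(1) assms(2) x(2)] D(4)[OF y(1) assms(2)] by auto
    then show ?thesis using x by (intro bexI[of _ x]) (auto simp: strict_below_def)
  qed
  show ?thesis unfolding ranked_def subposet_simps
  proof (intro conjI ballI impI)
    show "finite {z \<in> carrier X. z \<in> strict_below X t}" using D(1) by simp
  next
    fix x y z
    assume "x \<in> {z \<in> carrier X. z \<in> strict_below X t}" "y \<in> {z \<in> carrier X. z \<in> strict_below X t}"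
      "z \<in> {z \<in> carrier X. z \<in> strict_below X t}" "x \<sqsubseteq>\<^bsub>X\<^esub> y" "y \<sqsubseteq>\<^bsub>X\<^esub> z"
    then show "x \<sqsubseteq>\<^bsub>X\<^esub> z" using D(3)[of x y z] by simp
  next
    fix y assume "y \<in> {z \<in> carrier X. z \<in> strict_below X t}" "0 < \<rho> y"
    then show "\<exists>x\<in>{z \<in> carrier X. z \<in> strict_below X t}. x \<sqsubseteq>\<^bsub>X\<^esub> y \<and> x \<noteq> y \<and> Suc (\<rho> x) = \<rho> y"
      using pred[of y] by auto
  qed (use D(2,4) in auto)
qed

lemma subposet_below_below:
  assumes "ranked X \<rho>" "t \<in> carrier X" "s \<in> carrier X" "s \<in> strict_below X t"
  shows "subposet (subposet X (strict_below X t)) (strict_below (subposet X (strict_below X t)) s) =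
    subposet X (strict_below X s)"
proof -
  note D = rankedD[OF assms(1)]
  have st: "s \<sqsubseteq>\<^bsub>X\<^esub> t" "s \<noteq> t" using assms(4) by (auto simp: strict_below_def)
  have "{z \<in> carrier (subposet X (strict_below X t)). z \<in> strict_below (subposet X (strict_below X t)) s} =
      {z \<in> carrier X. z \<in> strict_below X s}"
  proof -
    have "z \<in> strict_below X t" if "z \<in> carrier X" "z \<sqsubseteq>\<^bsub>X\<^esub> s" "z \<noteq> s" for z
    proof -
      have "z \<sqsubseteq>\<^bsub>X\<^esub> t" using D(3)[OF that(1) assms(3,2) that(2) st(1)] .
      moreover have "\<rho> z < \<rho> s" "\<rho> s < \<rho> t" using D(4) that assms st by auto
      ultimately show ?thesis using that by (auto simp: strict_below_def)
    qed
    then show ?thesis by (auto simp: strict_below_def)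
  qed
  then show ?thesis by (simp add: subposet_def)
qed

lemma total_rank_below:
  assumes "ranked X \<rho>" "t \<in> carrier X" "0 < \<rho> t"
  shows "total_rank (subposet X (strict_below X t)) = \<rho> t - 1"
proof -
  note D = rankedD[OF assms(1)]
  let ?Y = "subposet X (strict_below X t)"
  have "poset_rank ?Y ` carrier ?Y = \<rho> ` carrier ?Y"
    using poset_rank_eq[OF ranked_below[OF assms(1,2)]] by auto
  moreover have "Max (\<rho> ` carrier ?Y) = \<rho> t - 1"
  proof (rule Max_eqI)
    show "finite (\<rho> ` carrier ?Y)" using D(1) by simp
    fix k assume "k \<in> \<rho> ` carrier ?Y"
    then show "k \<le> \<rho> t - 1" using D(4)[OF _ assms(2)] by (fastforce simp: strict_below_def)
  next
    obtain x where "x \<in> carrier X" "x \<sqsubseteq>\<^bsub>X\<^esub> t" "x \<noteq> t" "Suc (\<rho> x) = \<rho> t" using D(5) assms by blast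
    then show "\<rho> t - 1 \<in> \<rho> ` carrier ?Y" by (intro image_eqI[of _ _ x]) (auto simp: strict_below_def)
  qed
  ultimately show ?thesis by (simp add: total_rank_def)
qed

text \<open>A form of the definition in which the toric \<open>g\<close>-polynomial is
  \<open>(1 - x) f\<close> cut off after the middle degree. The constant term needs no
  exception.\<close>

lemma coeff_toric_g:
  assumes "carrier Y \<noteq> {}"
  shows "coeff (toric_g Y) i = (if i \<le> total_rank Y div 2 then - coeff ([:-1, 1:] * toric_f Y) i else 0)"
proof -
  let ?h = "coeff (toric_f Y)" and ?m = "total_rank Y div 2"
  have "coeff (toric_g Y) i = coeff (monom (?h 0) 0) i + (\<Sum>j=1..?m. if j = i then ?h j - ?h (j - 1) else 0)"
    using assms by (subst toric_g.simps) (simp add: Let_def coeff_sum)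
  also have "(\<Sum>j=1..?m. if j = i then ?h j - ?h (j - 1) else 0) =
      (if i \<in> {1..?m} then ?h i - ?h (i - 1) else 0)"
    by (rule sum.delta) simp
  finally have g: "coeff (toric_g Y) i =
      (if i = 0 then ?h 0 else 0) + (if i \<in> {1..?m} then ?h i - ?h (i - 1) else 0)" by simp
  have "coeff ([:-1, 1:] * toric_f Y) i = (if i = 0 then 0 else ?h (i - 1)) - ?h i"
    by (cases i) (simp_all add: coeff_pCons)
  then show ?thesis using g by auto
qed

lemma toric_f_eq:
  assumes "ranked X \<rho>" "carrier X \<noteq> {}"
  shows "toric_f X = (\<Sum>t\<in>carrier X. toric_g (subposet X (strict_below X t)) *
             [:-1, 1:] ^ (total_rank X - \<rho> t))"
  using assms rankedD(1)[OF assms(1)] poset_rank_eq[OF assms(1)]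
  by (subst toric_f.simps) simp

text \<open>The toric \<open>g\<close>-polynomials of the lower intervals are characterised by the
  Kazhdan--Lusztig--Stanley recursion together with the degree bound.\<close>

lemma toric_g_unique:
  fixes \<gamma> \<delta> :: "'a \<Rightarrow> int poly"
  assumes rk: "ranked X \<rho>"
    and \<gamma>0: "\<And>t. t \<in> carrier X \<Longrightarrow> \<rho> t = 0 \<Longrightarrow> \<gamma> t = 1"
    and sum: "\<And>t. t \<in> carrier X \<Longrightarrow>
      (\<Sum>s\<in>{s \<in> carrier X. s \<sqsubseteq>\<^bsub>X\<^esub> t}. \<gamma> s * [:-1, 1:] ^ (\<rho> t - \<rho> s)) = \<delta> t"
    and \<delta>: "\<And>t i. t \<in> carrier X \<Longrightarrow> 0 < \<rho> t \<Longrightarrow> i \<le> (\<rho> t - 1) div 2 \<Longrightarrow> coeff (\<delta> t) i = 0"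
    and \<gamma>: "\<And>t i. t \<in> carrier X \<Longrightarrow> 0 < \<rho> t \<Longrightarrow> i > (\<rho> t - 1) div 2 \<Longrightarrow> coeff (\<gamma> t) i = 0"
  shows "t \<in> carrier X \<Longrightarrow> toric_g (subposet X (strict_below X t)) = \<gamma> t"
proof (induction "\<rho> t" arbitrary: t rule: less_induct)
  case less
  note D = rankedD[OF rk]
  let ?Y = "subposet X (strict_below X t)"
  show ?case
  proof (cases "\<rho> t = 0")
    case True
    have "strict_below X t = {}" using D(4)[OF _ less.prems] True by (fastforce simp: strict_below_def)
    then show ?thesis using \<gamma>0[OF less.prems True] by (subst toric_g.simps) simp
  next
    case False
    have rkY: "ranked ?Y \<rho>" by (rule ranked_below[OF rk less.prems])
    have tr: "total_rank ?Y = \<rho> t - 1" using total_rank_below[OF rk less.prems] False by simp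
    have neY: "carrier ?Y \<noteq> {}"
    proof -
      obtain x where "x \<in> carrier X" "x \<sqsubseteq>\<^bsub>X\<^esub> t" "x \<noteq> t" using D(5)[OF less.prems] False by auto
      then show ?thesis by (auto simp: strict_below_def)
    qed
    have cY: "carrier ?Y = {s \<in> carrier X. s \<sqsubseteq>\<^bsub>X\<^esub> t} - {t}" by (auto simp: strict_below_def)
    have "toric_f ?Y = (\<Sum>s\<in>carrier ?Y. \<gamma> s * [:-1, 1:] ^ (\<rho> t - 1 - \<rho> s))"
      unfolding toric_f_eq[OF rkY neY] tr
    proof (intro sum.cong refl)
      fix s assume "s \<in> carrier ?Y"
      then have s: "s \<in> carrier X" "s \<in> strict_below X t" by auto
      then have "\<rho> s < \<rho> t" using D(4)[OF s(1) less.prems] by (auto simp: strict_below_def)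
      then show "toric_g (subposet ?Y (strict_below ?Y s)) * [:-1, 1:] ^ (\<rho> t - 1 - \<rho> s) =
          \<gamma> s * [:-1, 1:] ^ (\<rho> t - 1 - \<rho> s)"
        using subposet_below_below[OF rk less.prems s] less.hyps s by simp
    qed
    \<comment> \<open>The half-open interval has rank \<open>\<rho> t - 1\<close>. The factor
      \<open>x - 1\<close> raises all exponents to those of the recursion at \<open>t\<close>, whose
      only missing term is \<open>\<gamma> t\<close>. Up to the middle degree
      \<open>\<delta> t\<close> vanishes, and \<open>\<gamma> t\<close> is left.\<close>
    then have "[:-1, 1:] * toric_f ?Y = (\<Sum>s\<in>carrier ?Y. [:-1, 1:] * (\<gamma> s * [:-1, 1:] ^ (\<rho> t - 1 - \<rho> s)))"
      by (simp only: sum_distrib_left)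
    also have "\<dots> = (\<Sum>s\<in>carrier ?Y. \<gamma> s * [:-1, 1:] ^ (\<rho> t - \<rho> s))"
    proof (intro sum.cong refl)
      fix s assume "s \<in> carrier ?Y"
      then have "\<rho> s < \<rho> t" using D(4)[OF _ less.prems] by (auto simp: strict_below_def)
      then have e: "\<rho> t - \<rho> s = Suc (\<rho> t - 1 - \<rho> s)" by simp
      show "[:-1, 1:] * (\<gamma> s * [:-1, 1:] ^ (\<rho> t - 1 - \<rho> s)) = \<gamma> s * [:-1, 1:] ^ (\<rho> t - \<rho> s)"
        unfolding e power_Suc by (simp only: mult.left_commute)
    qed
    also have "\<dots> = \<delta> t - \<gamma> t"
      using sum[OF less.prems] D(1) D(2)[OF less.prems] less.prems unfolding cY
      by (subst sum_diff1) auto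
    finally have f: "[:-1, 1:] * toric_f ?Y = \<delta> t - \<gamma> t" .
    show ?thesis
    proof (rule poly_eqI)
      fix i
      show "coeff (toric_g ?Y) i = coeff (\<gamma> t) i"
        unfolding coeff_toric_g[OF neY] f tr
        using \<delta>[OF less.prems, of i] \<gamma>[OF less.prems, of i] False by auto
    qed
  qed
qed

lemma pderiv_power_monic:
  fixes p :: "int poly"
  assumes "pderiv p = 1"
  shows "pderiv (p ^ n) = of_nat n * p ^ (n - 1)"
proof (induction n)
  case (Suc n)
  have "pderiv (p ^ Suc n) = p * (of_nat n * p ^ (n - 1)) + p ^ n"
    using Suc by (simp add: pderiv_mult assms)
  also have "p * (of_nat n * p ^ (n - 1)) = of_nat n * p ^ n"
    by (cases n) (simp_all add: algebra_simps)
  finally show ?case by (simp add: algebra_simps)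
qed simp

lemma pderiv_sum: "pderiv (sum f A) = (\<Sum>x\<in>A. pderiv (f x :: int poly))"
  by (induction A rule: infinite_finite_induct) (simp_all add: pderiv_add)

text \<open>The computation that ends \<open>kls_Z\<close>, with \<open>r = p + 3\<close>. The
  bracket multiplied by \<open>u\<close> is the weighted sum of the numbers \<open>e a s\<close>: an
  atom count minus a rank count, the latter expressed by \<open>z\<close> times the derivative of
  the face polynomial.\<close>

lemma kls_identity:
  fixes u z E P :: "'c::comm_ring_1"
  assumes "u = 1 + z"
  shows "(u ^ (p + 3) + E * z * u ^ (p + 1)) +
    u * (((P + 3 + E) * u ^ (p + 2) + P * E * z * u ^ p) -
      ((P + 3) * (u ^ (p + 3) + E * z * u ^ (p + 1)) -
        z * ((P + 3) * u ^ (p + 2) + E * u ^ (p + 1) + E * z * (P + 1) * u ^ p)))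
    = u ^ (p + 3) + E * u ^ (p + 2)"
proof -
  have z: "z = u - 1" using assms by simp
  show ?thesis unfolding z by (simp add: power_add algebra_simps power2_eq_square power3_eq_cube)
qed

lemma coeff_U: "coeff ([:1, 1:] ^ n :: int poly) k = int (n choose k)"
proof (cases "k \<le> n")
  case True
  show ?thesis using coeff_linear_poly_power[of k n 1 1] True by simp
next
  case False
  have "degree ([:1, 1:] ^ n :: int poly) \<le> n" by (rule order.trans[OF degree_power_le]) simp
  then show ?thesis using False by (simp add: coeff_eq_0 binomial_eq_0)
qed

lemma Z_mult: "[:0, 1:] * p = pCons 0 (p :: int poly)" by simp

lemma coeff_Z_power: "coeff ([:0, 1:] ^ n :: int poly) k = (if n = k then 1 else 0)"
  using monom_altdef[of "1::int" n] by (metis coeff_monom smult_1_left)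

section \<open>Face counts of intervals\<close>

text \<open>For \<open>e = 0\<close> the rank polynomial of the Boolean lattice of rank
  \<open>r\<close>; a multiplex of type \<open>(d, n)\<close> has \<open>r = d + 1\<close> and
  \<open>e = n - d\<close>. It is applied with \<open>e = 0\<close> for \<open>r \<le> 2\<close>, so
  the truncation of \<open>r - 2\<close> is harmless.\<close>

definition face_poly :: "nat \<Rightarrow> nat \<Rightarrow> int poly" where
  "face_poly r e = [:1, 1:] ^ r + of_nat e * [:0, 1:] * [:1, 1:] ^ (r - 2)"

lemma coeff_face_poly: "coeff (face_poly r e) k =
    int (r choose k) + int e * (if k = 0 then 0 else int ((r - 2) choose (k - 1)))"
proof -
  have "coeff (of_nat e * [:0, 1:] * [:1, 1:] ^ (r - 2) :: int poly) k =
      int e * coeff (pCons 0 ([:1, 1:] ^ (r - 2))) k"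
    unfolding mult.assoc Z_mult of_nat_poly by (cases k) simp_all
  then show ?thesis unfolding face_poly_def coeff_add coeff_U
    by (cases k) (simp_all add: coeff_U)
qed

text \<open>Both summands are palindromic of degree \<open>r\<close>, so counting by rank and by
  corank gives the same polynomial.\<close>

lemma coeff_face_poly_sym:
  assumes "k \<le> r" "r \<le> 2 \<longrightarrow> e = 0"
  shows "coeff (face_poly r e) (r - k) = coeff (face_poly r e) k"
proof (cases "e = 0")
  case True
  then show ?thesis using binomial_symmetric[OF assms(1)] by (simp add: coeff_face_poly)
next
  case False
  then have r: "3 \<le> r" using assms by auto
  have "k = 0 \<or> k = r \<or> (0 < k \<and> k < r)" using assms(1) by auto
  then show ?thesis
  proof (elim disjE)
    assume "0 < k \<and> k < r"
    then have "(r - 2) choose (k - 1) = (r - 2) choose (r - k - 1)"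
    proof -
      have "k - 1 \<le> r - 2" "r - 2 - (k - 1) = r - k - 1" using \<open>0 < k \<and> k < r\<close> by linarith+
      then show ?thesis using binomial_symmetric[of "k - 1" "r - 2"] by simp
    qed
    then show ?thesis using binomial_symmetric[OF assms(1)] \<open>0 < k \<and> k < r\<close>
      by (simp add: coeff_face_poly)
  qed (use r in \<open>simp_all add: coeff_face_poly binomial_eq_0\<close>)
qed

lemma face_poly_unique:
  assumes "finite I" "(\<Sum>s\<in>I. [:0, 1:] ^ f s) = (p :: int poly)"
  shows "int (card {s \<in> I. f s = k}) = coeff p k"
proof -
  have "coeff p k = (\<Sum>s\<in>I. if f s = k then 1 else 0)"
    unfolding assms(2)[symmetric] coeff_sum coeff_Z_power by simp
  also have "\<dots> = int (card {s \<in> I. f s = k})" using assms(1) by (simp add: sum.If_cases Int_def)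
  finally show ?thesis by simp
qed

text \<open>The order is an arbitrary relation, so that all results are also available for the
  reversed order through \<open>dual\<close>.\<close>

locale face_counts =
  fixes L :: "'b set" and R :: "'b \<Rightarrow> 'b \<Rightarrow> bool" and \<rho> :: "'b \<Rightarrow> nat" and e :: "'b \<Rightarrow> 'b \<Rightarrow> nat"
  assumes fin: "finite L"
    and R_refl: "x \<in> L \<Longrightarrow> R x x"
    and R_trans: "x \<in> L \<Longrightarrow> y \<in> L \<Longrightarrow> z \<in> L \<Longrightarrow> R x y \<Longrightarrow> R y z \<Longrightarrow> R x z"
    and mono: "x \<in> L \<Longrightarrow> y \<in> L \<Longrightarrow> R x y \<Longrightarrow> x \<noteq> y \<Longrightarrow> \<rho> x < \<rho> y"
    and e0: "a \<in> L \<Longrightarrow> b \<in> L \<Longrightarrow> R a b \<Longrightarrow> \<rho> b - \<rho> a \<le> 2 \<Longrightarrow> e a b = 0"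
    and fp: "a \<in> L \<Longrightarrow> b \<in> L \<Longrightarrow> R a b \<Longrightarrow>
      (\<Sum>s\<in>{s \<in> L. R a s \<and> R s b}. [:0, 1:] ^ (\<rho> b - \<rho> s)) = face_poly (\<rho> b - \<rho> a) (e a b)"
begin

definition Interval :: "'b \<Rightarrow> 'b \<Rightarrow> 'b set" where "Interval a b = {s \<in> L. R a s \<and> R s b}"

lemma Interval_finite: "finite (Interval a b)" using fin by (simp add: Interval_def)

lemma mono_le: "x \<in> L \<Longrightarrow> y \<in> L \<Longrightarrow> R x y \<Longrightarrow> \<rho> x \<le> \<rho> y"
  using mono[of x y] by (cases "x = y") auto

lemma Interval_rank: "a \<in> L \<Longrightarrow> b \<in> L \<Longrightarrow> s \<in> Interval a b \<Longrightarrow> \<rho> a \<le> \<rho> s \<and> \<rho> s \<le> \<rho> b"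
  using mono_le by (auto simp: Interval_def)

definition level :: "'b \<Rightarrow> 'b \<Rightarrow> nat \<Rightarrow> 'b set" where
  "level a b k = {s \<in> Interval a b. \<rho> s = \<rho> a + k}"

lemma card_level:
  assumes "a \<in> L" "b \<in> L" "R a b" "k \<le> \<rho> b - \<rho> a"
  shows "int (card (level a b k)) = coeff (face_poly (\<rho> b - \<rho> a) (e a b)) k"
proof -
  have ab: "\<rho> a \<le> \<rho> b" using mono_le assms by blast
  have "level a b k = {s \<in> Interval a b. \<rho> b - \<rho> s = \<rho> b - \<rho> a - k}"
    using Interval_rank[OF assms(1,2)] assms(4) ab by (fastforce simp: level_def)
  then have "int (card (level a b k)) = coeff (face_poly (\<rho> b - \<rho> a) (e a b)) (\<rho> b - \<rho> a - k)"
    using face_poly_unique[OF Interval_finite fp[OF assms(1-3), folded Interval_def]] by simp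
  then show ?thesis
    using coeff_face_poly_sym[OF assms(4), of "e a b"] e0[OF assms(1-3)] by simp
qed

lemma card_atoms:
  assumes "a \<in> L" "b \<in> L" "R a b"
  shows "card (level a b 1) = \<rho> b - \<rho> a + e a b"
proof (cases "\<rho> b - \<rho> a = 0")
  case True
  then have "level a b 1 = {}" using Interval_rank[OF assms(1,2)] by (fastforce simp: level_def)
  then show ?thesis using True e0[OF assms] by simp
next
  case False
  then have "int (card (level a b 1)) = coeff (face_poly (\<rho> b - \<rho> a) (e a b)) 1"
    by (intro card_level[OF assms]) simp
  also have "\<dots> = int (\<rho> b - \<rho> a + e a b)" by (simp add: coeff_face_poly)
  finally show ?thesis by linarith
qed

text \<open>Double counting of the pairs of an atom and an element of \<open>S\<close> above
  it.\<close>

lemma sum_atoms: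
  assumes ab: "a \<in> L" "b \<in> L" "R a b" and A: "S \<subseteq> Interval a b"
  shows "(\<Sum>s\<in>S. of_nat (card (level a s 1)) * w s) = (\<Sum>i\<in>level a b 1. \<Sum>s\<in>{s \<in> S. R i s}. w s :: 'c::comm_ring_1)"
proof -
  have fS: "finite S" using A Interval_finite finite_subset by blast
  have fl: "finite (level a b 1)" using Interval_finite by (simp add: level_def)
  have l: "level a s 1 = {i \<in> level a b 1. R i s}" if "s \<in> S" for s
  proof -
    have s: "s \<in> L" "R a s" "R s b" using A that by (auto simp: Interval_def)
    then show ?thesis using R_trans[OF _ s(1) ab(2) _ s(3)] by (auto simp: level_def Interval_def)
  qed
  have "(\<Sum>s\<in>S. of_nat (card (level a s 1)) * w s) = (\<Sum>s\<in>S. \<Sum>i\<in>level a b 1. if R i s then w s else 0)"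
  proof (intro sum.cong refl)
    fix s assume s: "s \<in> S"
    show "of_nat (card (level a s 1)) * w s = (\<Sum>i\<in>level a b 1. if R i s then w s else 0)"
      unfolding l[OF s] sum.inter_filter[OF fl, symmetric] by simp
  qed
  also have "\<dots> = (\<Sum>i\<in>level a b 1. \<Sum>s\<in>S. if R i s then w s else 0)" by (rule sum.swap)
  also have "\<dots> = (\<Sum>i\<in>level a b 1. \<Sum>s\<in>{s \<in> S. R i s}. w s)"
    by (simp only: sum.inter_filter[OF fS])
  finally show ?thesis .
qed

lemma level_L: "i \<in> level a b k \<Longrightarrow> i \<in> L \<and> R a i \<and> R i b \<and> \<rho> i = \<rho> a + k"
  by (simp add: level_def Interval_def)

text \<open>Counts the flags consisting of an atom and an element of relative rank two.\<close>

lemma sum_e_atoms: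
  assumes ab: "a \<in> L" "b \<in> L" "R a b" and r: "\<rho> b - \<rho> a = p + 3"
  shows "(\<Sum>i\<in>level a b 1. e i b) = p * e a b"
proof -
  have lev: "{s \<in> level a b 2. R i s} = level i b 1" if i: "i \<in> level a b 1" for i
  proof -
    have i': "i \<in> L" "R a i" "R i b" "\<rho> i = \<rho> a + 1" using level_L[OF i] by auto
    then show ?thesis using R_trans[OF ab(1) i'(1) _ i'(2)] by (auto simp: level_def Interval_def)
  qed
  have "(\<Sum>s\<in>level a b 2. of_nat (card (level a s 1)) * (1::int)) =
      (\<Sum>i\<in>level a b 1. \<Sum>s\<in>{s \<in> level a b 2. R i s}. 1)"
    by (rule sum_atoms[OF ab]) (auto simp: level_def)
  also have "\<dots> = (\<Sum>i\<in>level a b 1. int (card (level i b 1)))"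
  proof (intro sum.cong refl)
    fix i assume i: "i \<in> level a b 1"
    show "(\<Sum>s\<in>{s \<in> level a b 2. R i s}. 1) = int (card (level i b 1))" unfolding lev[OF i] by simp
  qed
  also have "\<dots> = (\<Sum>i\<in>level a b 1. int (p + 2) + int (e i b))"
  proof (intro sum.cong refl)
    fix i assume i: "i \<in> level a b 1"
    have i': "i \<in> L" "R i b" "\<rho> i = \<rho> a + 1" using level_L[OF i] by auto
    show "int (card (level i b 1)) = int (p + 2) + int (e i b)"
      using card_atoms[OF i'(1) ab(2) i'(2)] i'(3) r by simp
  qed
  also have "\<dots> = int (card (level a b 1)) * int (p + 2) + (\<Sum>i\<in>level a b 1. int (e i b))"
    by (simp add: sum.distrib)
  also have "int (card (level a b 1)) = int (p + 3) + int (e a b)" using card_atoms[OF ab] r by simp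
  finally have 1: "(\<Sum>s\<in>level a b 2. int (card (level a s 1))) =
      (int (p + 3) + int (e a b)) * int (p + 2) + (\<Sum>i\<in>level a b 1. int (e i b))" by simp
  \<comment> \<open>The second count of the flags: an interval of rank two has exactly two atoms, as
    \<open>e\<close> vanishes there.\<close>
  have "(\<Sum>s\<in>level a b 2. int (card (level a s 1))) = (\<Sum>s\<in>level a b 2. 2)"
  proof (intro sum.cong refl)
    fix s assume s: "s \<in> level a b 2"
    have s': "s \<in> L" "R a s" "\<rho> s = \<rho> a + 2" using level_L[OF s] by auto
    show "int (card (level a s 1)) = 2" using card_atoms[OF ab(1) s'(1,2)] e0[OF ab(1) s'(1,2)] s'(3) by simp
  qed
  also have "\<dots> = 2 * int (card (level a b 2))" by simp
  also have "int (card (level a b 2)) = coeff (face_poly (p + 3) (e a b)) 2"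
    using card_level[OF ab, of 2] r by simp
  also have "2 * coeff (face_poly (p + 3) (e a b)) 2 = int (p + 3) * int (p + 2) + 2 * int (e a b) * int (p + 1)"
  proof -
    have "2 * ((p + 3) choose 2) = (p + 3) * (p + 2)"
    proof -
      have "p + 3 - 1 = p + 2" by simp
      then have "(p + 3) choose 2 = (p + 3) * (p + 2) div 2" by (simp only: choose_two)
      moreover have "even ((p + 3) * (p + 2))" by simp
      ultimately show ?thesis by (simp only: dvd_mult_div_cancel)
    qed
    then have "2 * int ((p + 3) choose 2) = int (p + 3) * int (p + 2)" by (metis of_nat_mult of_nat_numeral)
    then show ?thesis by (simp add: coeff_face_poly algebra_simps)
  qed
  finally have "(\<Sum>i\<in>level a b 1. int (e i b)) = int p * int (e a b)"
    using 1 by (simp add: algebra_simps)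
  then show ?thesis by (metis of_nat_eq_iff of_nat_mult of_nat_sum)
qed

text \<open>The recursion in the variables \<open>z = x - 1\<close> and \<open>u = x\<close>, in
  which sums over intervals are face polynomials. Each \<open>e a s\<close> is the number of atoms
  below \<open>s\<close> minus the relative rank of \<open>s\<close>. The atom count is exchanged
  for the face polynomials of the intervals from an atom \<open>i\<close> to \<open>b\<close>; they
  involve the numbers \<open>e i b\<close> only through their sum, which \<open>sum_e_atoms\<close>
  provides. The rank count is a derivative.\<close>

lemma kls_Z:
  assumes ab: "a \<in> L" "b \<in> L" "R a b"
  shows "(\<Sum>s\<in>Interval a b. (1 + of_nat (e a s) * [:1, 1:]) * [:0, 1:] ^ (\<rho> b - \<rho> s)) =
    ([:1, 1:] ^ (\<rho> b - \<rho> a) + of_nat (e a b) * [:1, 1:] ^ (\<rho> b - \<rho> a - 1) :: int poly)"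
proof -
  define Z where "Z = ([:0, 1:] :: int poly)"
  define U where "U = ([:1, 1:] :: int poly)"
  define r where "r = \<rho> b - \<rho> a"
  define G where "G = (\<Sum>s\<in>Interval a b. Z ^ (\<rho> b - \<rho> s))"
  have U: "U = 1 + Z" by (simp add: U_def Z_def one_pCons)
  have dZ: "pderiv Z = 1" by (simp add: Z_def pderiv_pCons one_pCons)
  have dU: "pderiv U = 1" by (simp add: U_def pderiv_pCons one_pCons)
  have G: "G = U ^ r + of_nat (e a b) * Z * U ^ (r - 2)"
    using fp[OF ab] unfolding G_def Z_def U_def r_def Interval_def face_poly_def by simp
  have split: "(\<Sum>s\<in>Interval a b. (1 + of_nat (e a s) * U) * Z ^ (\<rho> b - \<rho> s)) =
      G + U * (\<Sum>s\<in>Interval a b. of_nat (e a s) * Z ^ (\<rho> b - \<rho> s))"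
  proof -
    have "(1 + c * U) * z = z + U * (c * z)" for c z by (simp add: algebra_simps)
    then show ?thesis unfolding G_def sum_distrib_left sum.distrib[symmetric] by (intro sum.cong refl) simp
  qed
  have "(\<Sum>s\<in>Interval a b. (1 + of_nat (e a s) * U) * Z ^ (\<rho> b - \<rho> s)) = U ^ r + of_nat (e a b) * U ^ (r - 1)"
  proof (cases "r \<le> 2")
    case True
    have "e a s = 0" if s: "s \<in> Interval a b" for s
    proof -
      have "s \<in> L" "R a s" using s by (auto simp: Interval_def)
      moreover have "\<rho> s - \<rho> a \<le> 2" using Interval_rank[OF ab(1,2) s] True unfolding r_def by linarith
      ultimately show ?thesis using e0[OF ab(1)] by blast
    qed
    moreover have "e a b = 0" using e0[OF ab] True by (simp add: r_def)
    ultimately show ?thesis unfolding split G by simp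
  next
    case False
    then obtain p where p: "r = p + 3" by (metis add.commute le_Suc_ex not_less_eq_eq numeral_2_eq_2 numeral_3_eq_3)
    define E where "E = (of_nat (e a b) :: int poly)"
    define P where "P = (of_nat p :: int poly)"
    have G3: "G = U ^ (p + 3) + E * Z * U ^ (p + 1)" unfolding G p E_def by simp
    have dG: "pderiv G = (P + 3) * U ^ (p + 2) + E * U ^ (p + 1) + E * Z * (P + 1) * U ^ p"
    proof -
      have dE: "pderiv E = 0" unfolding E_def by (simp add: of_nat_poly pderiv_pCons)
      show ?thesis unfolding G3 pderiv_add pderiv_mult pderiv_power_monic[OF dU] dE dZ
        by (simp add: P_def algebra_simps)
    qed
    have ZdG: "Z * pderiv G = (\<Sum>s\<in>Interval a b. of_nat (\<rho> b - \<rho> s) * Z ^ (\<rho> b - \<rho> s))"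
      unfolding G_def pderiv_sum sum_distrib_left pderiv_power_monic[OF dZ]
    proof (intro sum.cong refl)
      fix s
      show "Z * (of_nat (\<rho> b - \<rho> s) * Z ^ (\<rho> b - \<rho> s - 1)) = of_nat (\<rho> b - \<rho> s) * Z ^ (\<rho> b - \<rho> s)"
        by (cases "\<rho> b - \<rho> s") (simp_all add: algebra_simps)
    qed
    have "(\<Sum>s\<in>Interval a b. of_nat (e a s) * Z ^ (\<rho> b - \<rho> s)) =
        (\<Sum>s\<in>Interval a b. of_nat (card (level a s 1)) * Z ^ (\<rho> b - \<rho> s) -
          (of_nat r * Z ^ (\<rho> b - \<rho> s) - of_nat (\<rho> b - \<rho> s) * Z ^ (\<rho> b - \<rho> s)))"
    proof (intro sum.cong refl)
      fix s assume s: "s \<in> Interval a b"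
      then have s': "s \<in> L" "R a s" by (auto simp: Interval_def)
      have rk: "\<rho> a \<le> \<rho> s" "\<rho> s \<le> \<rho> b" using Interval_rank[OF ab(1,2) s] by auto
      have "card (level a s 1) = \<rho> s - \<rho> a + e a s" by (rule card_atoms[OF ab(1) s'])
      moreover have "r = (\<rho> s - \<rho> a) + (\<rho> b - \<rho> s)" using rk by (simp add: r_def)
      ultimately show "of_nat (e a s) * Z ^ (\<rho> b - \<rho> s) = of_nat (card (level a s 1)) * Z ^ (\<rho> b - \<rho> s) -
          (of_nat r * Z ^ (\<rho> b - \<rho> s) - of_nat (\<rho> b - \<rho> s) * Z ^ (\<rho> b - \<rho> s))"
        by (simp add: algebra_simps)
    qed
    also have "\<dots> = (\<Sum>s\<in>Interval a b. of_nat (card (level a s 1)) * Z ^ (\<rho> b - \<rho> s)) - (of_nat r * G - Z * pderiv G)"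
      unfolding ZdG unfolding G_def by (simp add: sum_subtractf sum_distrib_left)
    also have "(\<Sum>s\<in>Interval a b. of_nat (card (level a s 1)) * Z ^ (\<rho> b - \<rho> s)) =
        (\<Sum>i\<in>level a b 1. \<Sum>s\<in>{s \<in> Interval a b. R i s}. Z ^ (\<rho> b - \<rho> s))"
      by (rule sum_atoms[OF ab order_refl])
    also have "\<dots> = (\<Sum>i\<in>level a b 1. U ^ (p + 2) + of_nat (e i b) * (Z * U ^ p))"
    proof (intro sum.cong refl)
      fix i assume i: "i \<in> level a b 1"
      have i': "i \<in> L" "R a i" "R i b" "\<rho> i = \<rho> a + 1" using level_L[OF i] by auto
      have "{s \<in> Interval a b. R i s} = {s \<in> L. R i s \<and> R s b}"
        using R_trans[OF ab(1) i'(1) _ i'(2)] by (auto simp: Interval_def)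
      moreover have "\<rho> b - \<rho> i = p + 2" using i'(4) p by (simp add: r_def)
      ultimately show "(\<Sum>s\<in>{s \<in> Interval a b. R i s}. Z ^ (\<rho> b - \<rho> s)) = U ^ (p + 2) + of_nat (e i b) * (Z * U ^ p)"
        using fp[OF i'(1) ab(2) i'(3)] unfolding Z_def U_def face_poly_def by (simp only: mult.assoc) simp
    qed
    also have "\<dots> = of_nat (card (level a b 1)) * U ^ (p + 2) + of_nat (\<Sum>i\<in>level a b 1. e i b) * (Z * U ^ p)"
      by (simp add: sum.distrib sum_distrib_right)
    also have "\<dots> = (P + 3 + E) * U ^ (p + 2) + P * E * Z * U ^ p"
      unfolding sum_e_atoms[OF ab p[unfolded r_def]] card_atoms[OF ab] p[unfolded r_def]
      by (simp add: P_def E_def algebra_simps)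
    finally have S: "(\<Sum>s\<in>Interval a b. of_nat (e a s) * Z ^ (\<rho> b - \<rho> s)) =
      ((P + 3 + E) * U ^ (p + 2) + P * E * Z * U ^ p) - ((P + 3) * G - Z * pderiv G)"
      by (simp add: p P_def)
    have "r - 1 = p + 2" using p by simp
    then show ?thesis unfolding split S dG unfolding G3 p E_def[symmetric]
      using kls_identity[OF U, of p E P] by simp
  qed
  then show ?thesis unfolding Z_def U_def r_def .
qed

definition gamma :: "'b \<Rightarrow> 'b \<Rightarrow> int poly" where "gamma a b = [:1, int (e a b):]"

text \<open>The reversal of \<open>gamma a b\<close> with respect to the rank \<open>r\<close> of
  the interval, \<open>x ^ r\<close> times \<open>gamma\<close> at \<open>1 / x\<close>.\<close>

definition del :: "'b \<Rightarrow> 'b \<Rightarrow> int poly" where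
  "del a b = monom 1 (\<rho> b - \<rho> a) + monom (int (e a b)) (\<rho> b - \<rho> a - 1)"

text \<open>Composition with \<open>x - 1\<close> turns \<open>kls_Z\<close> into the recursion, as
  \<open>1 + z\<close> becomes \<open>x\<close>.\<close>

theorem kls:
  assumes ab: "a \<in> L" "b \<in> L" "R a b"
  shows "(\<Sum>s\<in>{s \<in> L. R a s \<and> R s b}. gamma a s * [:-1, 1:] ^ (\<rho> b - \<rho> s)) = del a b"
proof -
  have pw: "pcompose (q ^ n) w = pcompose q w ^ n" for q w :: "int poly" and n
    by (induction n) (simp_all add: pcompose_mult pcompose_1)
  have z: "pcompose [:0, 1:] [:-1, 1:] = ([:-1, 1:] :: int poly)" by (simp add: pcompose_pCons)
  have u: "pcompose [:1, 1:] [:-1, 1:] = ([:0, 1:] :: int poly)" by (simp add: pcompose_pCons)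
  have n: "pcompose (of_nat k) w = of_nat k" for k and w :: "int poly" by (simp add: of_nat_poly)
  have "pcompose (\<Sum>s\<in>Interval a b. (1 + of_nat (e a s) * [:1, 1:]) * [:0, 1:] ^ (\<rho> b - \<rho> s)) [:-1, 1:] =
    pcompose ([:1, 1:] ^ (\<rho> b - \<rho> a) + of_nat (e a b) * [:1, 1:] ^ (\<rho> b - \<rho> a - 1)) ([:-1, 1:] :: int poly)"
    unfolding kls_Z[OF ab] ..
  then have *: "(\<Sum>s\<in>Interval a b. (1 + of_nat (e a s) * [:0, 1:]) * [:-1, 1:] ^ (\<rho> b - \<rho> s)) =
    ([:0, 1:] ^ (\<rho> b - \<rho> a) + of_nat (e a b) * [:0, 1:] ^ (\<rho> b - \<rho> a - 1) :: int poly)"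
    unfolding pcompose_sum pcompose_mult pcompose_add pw z u n pcompose_1 .
  have g: "1 + of_nat (e a s) * [:0, 1:] = gamma a s" for s by (simp add: gamma_def of_nat_poly one_pCons)
  have d: "[:0, 1:] ^ (\<rho> b - \<rho> a) + of_nat (e a b) * [:0, 1:] ^ (\<rho> b - \<rho> a - 1) = del a b"
    by (simp add: del_def monom_altdef of_nat_poly)
  show ?thesis using * unfolding g d Interval_def .
qed

text \<open>Face polynomials are palindromic, so the reversed order satisfies the same counts with
  the arguments of \<open>e\<close> exchanged.\<close>

lemma dual:
  assumes D: "\<And>x. x \<in> L \<Longrightarrow> \<rho> x \<le> D"
  shows "face_counts L (\<lambda>x y. R y x) (\<lambda>x. D - \<rho> x) (\<lambda>a b. e b a)"
proof -
  have d1: "D - \<rho> x < D - \<rho> y" if "x \<in> L" "y \<in> L" "R y x" "x \<noteq> y" for x y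
    using mono[of y x] D[of x] that by simp
  have d2: "e b a = 0" if ab: "a \<in> L" "b \<in> L" "R b a" "D - \<rho> b - (D - \<rho> a) \<le> 2" for a b
  proof -
  have "D - \<rho> b - (D - \<rho> a) = \<rho> a - \<rho> b"
    using D[OF ab(1)] D[OF ab(2)] mono_le[OF ab(2,1,3)] by linarith
  then show "e b a = 0" using e0[of b a] ab by simp
  qed
  have d3: "(\<Sum>s\<in>{s \<in> L. R s a \<and> R b s}. [:0, 1:] ^ (D - \<rho> b - (D - \<rho> s))) =
      face_poly (D - \<rho> b - (D - \<rho> a)) (e b a)" if ab: "a \<in> L" "b \<in> L" "R b a" for a b
  proof -
    have r: "D - \<rho> b - (D - \<rho> a) = \<rho> a - \<rho> b"
      using D[OF ab(1)] D[OF ab(2)] mono_le[OF ab(2,1,3)] by linarith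
    have I: "{s \<in> L. R s a \<and> R b s} = Interval b a" by (auto simp: Interval_def)
    have "(\<Sum>s\<in>Interval b a. [:0, 1:] ^ (D - \<rho> b - (D - \<rho> s))) = (\<Sum>s\<in>Interval b a. [:0, 1:] ^ (\<rho> s - \<rho> b) :: int poly)"
    proof (intro sum.cong refl)
      fix s assume s: "s \<in> Interval b a"
      then have "D - \<rho> b - (D - \<rho> s) = \<rho> s - \<rho> b" using D[of s] Interval_rank[OF ab(2,1) s] by (auto simp: Interval_def)
      then show "[:0, 1:] ^ (D - \<rho> b - (D - \<rho> s)) = ([:0, 1:] ^ (\<rho> s - \<rho> b) :: int poly)" by simp
    qed
    also have "\<dots> = face_poly (\<rho> a - \<rho> b) (e b a)"
    proof (rule poly_eqI)
      fix k
      have "coeff (\<Sum>s\<in>Interval b a. [:0, 1:] ^ (\<rho> s - \<rho> b) :: int poly) k = int (card {s \<in> Interval b a. \<rho> s - \<rho> b = k})"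
        using face_poly_unique[OF Interval_finite refl] by simp
      also have "{s \<in> Interval b a. \<rho> s - \<rho> b = k} = level b a k"
        using Interval_rank[OF ab(2,1)] by (fastforce simp: level_def)
      also have "int (card (level b a k)) = coeff (face_poly (\<rho> a - \<rho> b) (e b a)) k"
      proof (cases "k \<le> \<rho> a - \<rho> b")
        case True
        then show ?thesis by (rule card_level[OF ab(2,1,3)])
      next
        case False
        then have "level b a k = {}" using Interval_rank[OF ab(2,1)] by (fastforce simp: level_def)
        moreover have "coeff (face_poly (\<rho> a - \<rho> b) (e b a)) k = 0"
        proof (cases "e b a = 0")
          case True
          then show ?thesis using False by (simp add: coeff_face_poly binomial_eq_0)
        next
          case e: False
          then have "\<not> \<rho> a - \<rho> b \<le> 2" using e0[OF ab(2,1,3)] by auto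
          then show ?thesis using False by (simp add: coeff_face_poly binomial_eq_0)
        qed
        ultimately show ?thesis by simp
      qed
      finally show "coeff (\<Sum>s\<in>Interval b a. [:0, 1:] ^ (\<rho> s - \<rho> b) :: int poly) k = coeff (face_poly (\<rho> a - \<rho> b) (e b a)) k" .
    qed
    finally show "(\<Sum>s\<in>{s \<in> L. R s a \<and> R b s}. [:0, 1:] ^ (D - \<rho> b - (D - \<rho> s))) =
        face_poly (D - \<rho> b - (D - \<rho> a)) (e b a)" unfolding I r .
  qed
  show ?thesis
  proof (rule face_counts.intro)
    show "finite L" by (rule fin)
    show "R x x" if "x \<in> L" for x by (rule R_refl[OF that])
    show "R z x" if "x \<in> L" "y \<in> L" "z \<in> L" "R y x" "R z y" for x y z
      by (rule R_trans[OF that(3,2,1,5,4)])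
  qed (fact d1 d2 d3)+
qed

end

section \<open>Faces of the multiplex\<close>

locale multiplex_polytope =
  fixes d n :: nat and x :: "nat \<Rightarrow> 'a::euclidean_space" and S :: "'a set"
  assumes mp: "is_multiplex d n x S"
begin

lemma multiplex_pair: "multiplex_pair d n" and d2: "2 \<le> d" using mp by (auto simp: is_multiplex_def multiplex_pair_def)

lemma poly: "polytope S" using mp by (simp add: is_multiplex_def)

lemma dim: "aff_dim S = int d" using mp by (simp add: is_multiplex_def)

lemma inj: "inj_on x {0..n}" using mp by (simp add: is_multiplex_def)

lemma extreme: "v extreme_point_of S \<longleftrightarrow> v \<in> x ` {0..n}" using mp unfolding is_multiplex_def by blast

lemma clamped_image:
  assumes "i \<le> n"
  shows "clamped n x ` ({int i - int d + 1 .. int i + int d - 1} - {int i}) = x ` facet_set d n i"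
proof (intro subset_antisym subsetI)
  fix v assume "v \<in> clamped n x ` ({int i - int d + 1 .. int i + int d - 1} - {int i})"
  then obtain j where jv: "v = clamped n x j" "j \<in> {int i - int d + 1 .. int i + int d - 1} - {int i}"
    by (rule imageE)
  then have j: "int i - int d + 1 \<le> j" "j \<le> int i + int d - 1" "j \<noteq> int i" "v = clamped n x j"
    by auto
  define k where "k = (if j < 0 then 0 else if j > int n then n else nat j)"
  have "v = x k" using j by (simp add: k_def clamped_def)
  moreover have "k \<in> facet_set d n i" using j(1-3) assms d2 by (auto simp: k_def facet_set_def adj_def)
  ultimately show "v \<in> x ` facet_set d n i" by simp
next
  fix v assume "v \<in> x ` facet_set d n i"
  then obtain k where k: "v = x k" "adj d n k i" by (auto simp: facet_set_def)
  \<comment> \<open>The index \<open>i\<close> itself is left out, so a vertex on its own facet is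
    reached through a clamped index beyond the end; it is within range because
    \<open>d \<ge> 2\<close>.\<close>
  define j where "j = (if k \<noteq> i then int k else if k = 0 then -1 else int n + 1)"
  have "v = clamped n x j" using k by (auto simp: j_def clamped_def adj_def)
  moreover have "j \<in> {int i - int d + 1 .. int i + int d - 1} - {int i}"
    using k(2) d2 by (auto simp: j_def adj_def)
  ultimately show "v \<in> clamped n x ` ({int i - int d + 1 .. int i + int d - 1} - {int i})" by blast
qed

definition facet :: "nat \<Rightarrow> 'a set" where "facet i = convex hull (x ` facet_set d n i)"

lemma facets: "F facet_of S \<longleftrightarrow> (\<exists>i\<le>n. F = facet i)"
proof -
  have "{F. F facet_of S} = (\<lambda>i. convex hull (clamped n x ` ({int i - int d + 1 .. int i + int d - 1} - {int i}))) ` {0..n}"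
    using mp by (simp add: is_multiplex_def)
  also have "\<dots> = facet ` {0..n}"
    by (intro image_cong refl) (simp add: facet_def clamped_image)
  finally have "F \<in> {F. F facet_of S} \<longleftrightarrow> F \<in> facet ` {0..n}" by simp
  then show ?thesis by auto
qed

definition vs :: "'a set \<Rightarrow> nat set" where "vs F = {i. i \<le> n \<and> x i \<in> F}"

lemma face_hull:
  assumes "F face_of S"
  shows "F = convex hull (x ` vs F)"
proof -
  have "polytope F" by (rule face_of_polytope_polytope[OF poly assms])
  then have "F = convex hull {v. v extreme_point_of F}"
    by (intro Krein_Milman_Minkowski polytope_imp_compact polytope_imp_convex)
  also have "{v. v extreme_point_of F} = x ` vs F"
    using extreme_point_of_face[OF assms] extreme by (auto simp: vs_def)
  finally show ?thesis .
qed

lemma vs_le_iff: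
  assumes "F face_of S" "G face_of S"
  shows "vs F \<subseteq> vs G \<longleftrightarrow> F \<subseteq> G"
proof
  assume "vs F \<subseteq> vs G"
  then have "convex hull (x ` vs F) \<subseteq> convex hull (x ` vs G)" by (intro hull_mono image_mono)
  then show "F \<subseteq> G" using face_hull assms by simp
qed (auto simp: vs_def)

lemma vs_S: "vs S = {..n}"
proof -
  have "x i \<in> S" if "i \<le> n" for i
  proof -
    have "x i extreme_point_of S" unfolding extreme using that by simp
    then show ?thesis by (simp add: extreme_point_of_def)
  qed
  then show ?thesis by (auto simp: vs_def)
qed

lemma vs_facet:
  assumes "i \<le> n" shows "vs (facet i) = facet_set d n i"
proof (intro subset_antisym subsetI)
  have f: "facet i face_of S" using facets assms facet_of_imp_face_of by blast
  fix k assume k: "k \<in> vs (facet i)"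
  then have kn: "k \<le> n" "x k \<in> facet i" by (auto simp: vs_def)
  then have "x k extreme_point_of facet i" using extreme_point_of_face[OF f] extreme by auto
  then have "x k \<in> x ` facet_set d n i" unfolding facet_def by (rule extreme_point_of_convex_hull)
  then obtain l where l: "l \<in> facet_set d n i" "x k = x l" by auto
  then have "l \<le> n" by (auto simp: facet_set_def adj_def)
  then have "k = l" using inj_onD[OF inj l(2)] kn by auto
  then show "k \<in> facet_set d n i" using l by simp
next
  fix k assume "k \<in> facet_set d n i"
  moreover then have "k \<le> n" by (auto simp: facet_set_def adj_def)
  ultimately show "k \<in> vs (facet i)" unfolding vs_def facet_def by (auto intro: hull_inc)
qed

text \<open>A proper nonempty face is the intersection of the facets containing it, so one of these
  facets excludes any given vertex outside the face.\<close>

lemma vs_closed_sets: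
  assumes "F face_of S" shows "vs F \<in> closed_sets d n"
proof -
  consider "F = {}" | "F = S" | "F \<noteq> {}" "F \<noteq> S" by blast
  then show ?thesis
  proof cases
    case 1
    then show ?thesis using empty_closed_sets[OF multiplex_pair] by (simp add: vs_def)
  next
    case 2
    then show ?thesis using full_closed_sets vs_S by simp
  next
    case 3
    have F: "F = \<Inter>{G. G facet_of S \<and> F \<subseteq> G}"
      by (rule face_of_polyhedron[OF polytope_imp_polyhedron[OF poly] assms 3])
    show ?thesis
    proof (rule closed_sets_sepI)
      show "vs F \<subseteq> {..n}" by (auto simp: vs_def)
      fix i assume i: "i \<le> n" "i \<notin> vs F"
      then have "x i \<notin> F" by (simp add: vs_def)
      then obtain G where G: "G facet_of S" "F \<subseteq> G" "x i \<notin> G" using F by blast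
      obtain j where j: "j \<le> n" "G = facet j" using facets G(1) by blast
      have "vs F \<subseteq> facet_set d n j" using G(2) j vs_facet[OF j(1)] by (auto simp: vs_def)
      moreover have "i \<notin> facet_set d n j" using G(3) j vs_facet[OF j(1)] by (auto simp: vs_def)
      ultimately show "\<exists>B\<in>closed_sets d n. vs F \<subseteq> B \<and> i \<notin> B" using facet_set_closed_sets[OF j(1)] by blast
    qed
  qed
qed

text \<open>Intersections of faces are faces, and the facets with index in \<open>J\<close>
  intersect in a face with vertex set \<open>polar d n J\<close>.\<close>

lemma vs_surj:
  assumes "A \<in> closed_sets d n" shows "\<exists>F. F face_of S \<and> vs F = A"
proof -
  obtain J where J: "J \<subseteq> {..n}" "A = polar d n J" using assms by (auto simp: closed_sets_def)
  have "finite J" using J(1) finite_subset by blast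
  then have "J \<subseteq> {..n} \<Longrightarrow> \<exists>F. F face_of S \<and> vs F = polar d n J"
  proof (induction J rule: finite_induct)
    case empty
    then show ?case
      using face_of_refl[OF polytope_imp_convex[OF poly]] vs_S polar_empty by (intro exI[of _ S]) auto
  next
    case (insert j J)
    then obtain F where F: "F face_of S" "vs F = polar d n J" by auto
    have jn: "j \<le> n" using insert by simp
    then have "facet j face_of S" using facets facet_of_imp_face_of by blast
    then have "F \<inter> facet j face_of S" using F(1) by (rule face_of_Int[rotated])
    moreover have "vs (F \<inter> facet j) = vs F \<inter> vs (facet j)" by (auto simp: vs_def)
    moreover have "\<dots> = polar d n (insert j J)"
      unfolding F(2) vs_facet[OF jn] by (auto simp: polar_def facet_set_def adj_def)
    ultimately show ?case by (intro exI[of _ "F \<inter> facet j"]) simp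
  qed
  then show ?thesis using J by simp
qed

lemma vs_bij: "bij_betw vs {F. F face_of S} (closed_sets d n)"
  unfolding bij_betw_def
proof (intro conjI subset_antisym subsetI)
  show "inj_on vs {F. F face_of S}" using vs_le_iff by (intro inj_onI) (metis mem_Collect_eq order_refl subset_antisym)
  show "A \<in> vs ` {F. F face_of S}" if "A \<in> closed_sets d n" for A using vs_surj[OF that] by auto
qed (use vs_closed_sets in auto)

definition fc :: "nat set \<Rightarrow> 'a set" where "fc = inv_into {F. F face_of S} vs"

lemma fc: "A \<in> closed_sets d n \<Longrightarrow> fc A face_of S" and vs_fc: "A \<in> closed_sets d n \<Longrightarrow> vs (fc A) = A"
  and fc_vs: "F face_of S \<Longrightarrow> fc (vs F) = F"
proof -
  show "fc A face_of S" if "A \<in> closed_sets d n"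
    using that vs_bij inv_into_into[of A vs "{F. F face_of S}"] unfolding fc_def bij_betw_def by auto
  show "vs (fc A) = A" if "A \<in> closed_sets d n"
    using that vs_bij unfolding fc_def by (simp add: bij_betw_inv_into_right)
  show "fc (vs F) = F" if "F face_of S"
    using that vs_bij unfolding fc_def by (simp add: bij_betw_inv_into_left)
qed

lemma fc_le_iff: "A \<in> closed_sets d n \<Longrightarrow> B \<in> closed_sets d n \<Longrightarrow> fc A \<subseteq> fc B \<longleftrightarrow> A \<subseteq> B"
  using vs_le_iff[OF fc fc] vs_fc by simp

definition rk :: "nat set \<Rightarrow> nat" where "rk A = nat (aff_dim (fc A) + 1)"

lemma rk: "int (rk A) = aff_dim (fc A) + 1"
  using aff_dim_geq[of "fc A"] by (simp add: rk_def)

text \<open>A facet of \<open>G\<close> containing \<open>F\<close> must equal \<open>F\<close>. For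
  empty \<open>F\<close> an extreme point of \<open>G\<close> takes this role, and its dimension
  \<open>0\<close> follows \<open>-1\<close>, the dimension of the empty face.\<close>

lemma face_cover:
  assumes "F face_of S" "G face_of S" "F \<subset> G"
    and no: "\<And>H. H face_of S \<Longrightarrow> F \<subset> H \<Longrightarrow> H \<subset> G \<Longrightarrow> False"
  shows "aff_dim G = aff_dim F + 1"
proof -
  have pG: "polytope G" by (rule face_of_polytope_polytope[OF poly assms(2)])
  show ?thesis
  proof (cases "F = {}")
    case True
    have "G \<noteq> {}" using assms(3) by auto
    moreover have "G = convex hull {v. v extreme_point_of G}"
      by (intro Krein_Milman_Minkowski polytope_imp_compact polytope_imp_convex pG)
    ultimately obtain v where v: "v extreme_point_of G" by (metis convex_hull_empty empty_Collect_eq)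
    then have vS: "{v} face_of S" "{v} \<subseteq> G" using face_of_singleton face_of_face[OF assms(2)] by blast+
    have "{v} = G" using no[OF vS(1)] vS(2) True by blast
    then show ?thesis using True by (metis aff_dim_empty aff_dim_sing add.commute add.right_inverse)
  next
    case False
    have "F face_of G" using face_of_face[OF assms(2)] assms(1,3) by blast
    then obtain H where H: "H facet_of G" "F \<subseteq> H"
      using face_of_polyhedron_subset_facet[OF polytope_imp_polyhedron[OF pG], of F] False assms(3) by blast
    have "H face_of G" by (rule facet_of_imp_face_of[OF H(1)])
    then have HS: "H face_of S" "H \<subseteq> G" using face_of_face[OF assms(2)] by blast+
    have "H \<noteq> G" using H(1) by auto
    then have "H = F" using no[OF HS(1)] H(2) HS(2) by blast
    then show ?thesis using H(1) by (simp add: facet_of_def)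
  qed
qed

lemma graded_closed_sets: "graded_on (closed_sets d n) rk"
  unfolding graded_on_def
proof (intro conjI ballI impI)
  show "finite (closed_sets d n)" by (rule finite_closed_sets)
  fix A B assume A: "A \<in> closed_sets d n" and B: "B \<in> closed_sets d n" and AB: "A \<subset> B"
  have fAB: "fc A \<subset> fc B" using fc_le_iff[OF A B] fc_le_iff[OF B A] AB by auto
  have "fc A face_of fc B" using face_of_face[OF fc[OF B]] fc[OF A] fAB by blast
  moreover have "convex (fc B)"
    by (rule polytope_imp_convex[OF face_of_polytope_polytope[OF poly fc[OF B]]])
  ultimately have "aff_dim (fc A) < aff_dim (fc B)" using face_of_aff_dim_lt fAB by blast
  then show "rk A < rk B" using rk[of A] rk[of B] by linarith
  assume no: "\<forall>C\<in>closed_sets d n. \<not> (A \<subset> C \<and> C \<subset> B)"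
  have "aff_dim (fc B) = aff_dim (fc A) + 1"
  proof (rule face_cover[OF fc[OF A] fc[OF B] fAB])
    fix H assume H: "H face_of S" "fc A \<subset> H" "H \<subset> fc B"
    have "A \<subset> vs H" "vs H \<subset> B"
      using vs_le_iff[OF fc[OF A] H(1)] vs_le_iff[OF H(1) fc[OF A]] vs_le_iff[OF H(1) fc[OF B]]
        vs_le_iff[OF fc[OF B] H(1)] H(2,3) vs_fc[OF A] vs_fc[OF B] by auto
    then show False using no vs_closed_sets[OF H(1)] by blast
  qed
  then show "rk B = Suc (rk A)" using rk[of A] rk[of B] by linarith
qed

lemma fc_empty: "fc {} = {}"
  using fc_vs[of "{}"] by (simp add: vs_def)

lemma fc_full: "fc {..n} = S"
  using fc_vs[OF face_of_refl[OF polytope_imp_convex[OF poly]]] vs_S by simp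

lemma rk_empty: "rk {} = 0" using rk[of "{}"] by (simp add: fc_empty)

lemma rk_full: "rk {..n} = d + 1" using rk[of "{..n}"] by (simp add: fc_full dim)

end

section \<open>Covers, ranks and alternating sums in graded posets\<close>

lemma graded_on_pred:
  assumes "graded_on L \<rho>" "x \<in> L" "y \<in> L" "x < y"
  obtains z where "z \<in> L" "x \<le> z" "z < y" "\<rho> y = Suc (\<rho> z)"
proof -
  let ?A = "{z \<in> L. x \<le> z \<and> z < y}"
  have "finite ?A" "?A \<noteq> {}" using graded_onD(1)[OF assms(1)] assms(2,4) by auto
  then obtain z where z: "z \<in> ?A" "\<And>w. w \<in> ?A \<Longrightarrow> z \<le> w \<Longrightarrow> w = z"
    by (metis (no_types, lifting) finite_has_maximal)
  have "\<rho> y = Suc (\<rho> z)"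
  proof (rule graded_onD(3)[OF assms(1)])
    fix w assume w: "w \<in> L" "z < w" "w < y"
    have "x \<le> z" using z(1) by simp
    then have "x \<le> w" using less_imp_le[OF w(2)] by (rule order.trans)
    then have "w = z" using z(2)[of w] w less_imp_le[OF w(2)] by simp
    then show False using w(2) by simp
  qed (use z assms in auto)
  then show ?thesis using that z by blast
qed

lemma graded_on_succ:
  assumes "graded_on L \<rho>" "x \<in> L" "y \<in> L" "x < y"
  obtains z where "z \<in> L" "x < z" "z \<le> y" "\<rho> z = Suc (\<rho> x)"
proof -
  let ?A = "{z \<in> L. x < z \<and> z \<le> y}"
  have "finite ?A" "?A \<noteq> {}" using graded_onD(1)[OF assms(1)] assms(3,4) by auto
  then obtain z where z: "z \<in> ?A" "\<And>w. w \<in> ?A \<Longrightarrow> w \<le> z \<Longrightarrow> w = z"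
    by (metis (no_types, lifting) finite_has_minimal)
  have "\<rho> z = Suc (\<rho> x)"
  proof (rule graded_onD(3)[OF assms(1)])
    fix w assume w: "w \<in> L" "x < w" "w < z"
    have "z \<le> y" using z(1) by simp
    then have "w \<le> y" by (rule order.trans[OF less_imp_le[OF w(3)]])
    then have "w = z" using z(2)[of w] w less_imp_le[OF w(3)] by simp
    then show False using w(3) by simp
  qed (use z assms in auto)
  then show ?thesis using that z by blast
qed

lemma partial_orderI:
  assumes "eq X = (=)" "\<And>x. x \<in> carrier X \<Longrightarrow> x \<sqsubseteq>\<^bsub>X\<^esub> x"
    and "\<And>x y. x \<in> carrier X \<Longrightarrow> y \<in> carrier X \<Longrightarrow> x \<sqsubseteq>\<^bsub>X\<^esub> y \<Longrightarrow> y \<sqsubseteq>\<^bsub>X\<^esub> x \<Longrightarrow> x = y"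
    and "\<And>x y z. x \<in> carrier X \<Longrightarrow> y \<in> carrier X \<Longrightarrow> z \<in> carrier X \<Longrightarrow> x \<sqsubseteq>\<^bsub>X\<^esub> y \<Longrightarrow> y \<sqsubseteq>\<^bsub>X\<^esub> z \<Longrightarrow>
      x \<sqsubseteq>\<^bsub>X\<^esub> z"
  shows "partial_order X"
proof
  show "x \<sqsubseteq>\<^bsub>X\<^esub> z" if "x \<sqsubseteq>\<^bsub>X\<^esub> y" "y \<sqsubseteq>\<^bsub>X\<^esub> z" "x \<in> carrier X" "y \<in> carrier X" "z \<in> carrier X" for x y z
    by (rule assms(4)[OF that(3-5,1,2)])
  show "x .=\<^bsub>X\<^esub> y" if "x \<sqsubseteq>\<^bsub>X\<^esub> y" "y \<sqsubseteq>\<^bsub>X\<^esub> x" "x \<in> carrier X" "y \<in> carrier X" for x y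
    using assms(3)[OF that(3,4,1,2)] by (simp add: assms(1))
qed (use assms(1,2) in auto)

lemma ranked_cover:
  assumes "ranked X \<rho>" "covers X b a"
    and "\<And>x y. x \<in> carrier X \<Longrightarrow> y \<in> carrier X \<Longrightarrow> x \<sqsubseteq>\<^bsub>X\<^esub> y \<Longrightarrow> x \<noteq> y \<Longrightarrow> Suc (\<rho> x) < \<rho> y \<Longrightarrow>
      \<exists>z\<in>carrier X. x \<sqsubseteq>\<^bsub>X\<^esub> z \<and> z \<sqsubseteq>\<^bsub>X\<^esub> y \<and> z \<noteq> x \<and> z \<noteq> y"
  shows "poset_rank X b = poset_rank X a + 1"
proof -
  have ab: "a \<in> carrier X" "b \<in> carrier X" "a \<sqsubseteq>\<^bsub>X\<^esub> b" "a \<noteq> b" and no: "carrier (open_interval X a b) = {}"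
    using assms(2) by (auto simp: covers_def)
  have lt: "\<rho> a < \<rho> b" by (rule rankedD(4)[OF assms(1) ab])
  have "\<not> Suc (\<rho> a) < \<rho> b"
  proof
    assume "Suc (\<rho> a) < \<rho> b"
    from assms(3)[OF ab this] show False using no by (auto simp: open_interval_def)
  qed
  then show ?thesis using lt poset_rank_eq[OF assms(1)] ab by simp
qed

lemma card_even_odd:
  assumes "finite A" "(\<Sum>z\<in>A. (-1::int) ^ r z) = 0"
  shows "card {z \<in> A. even (r z)} = card {z \<in> A. odd (r z)}"
proof -
  have "(\<Sum>z\<in>A. (-1::int) ^ r z) = (\<Sum>z\<in>A. if even (r z) then 1 else -1)"
    by (intro sum.cong refl) auto
  also have "\<dots> = int (card {z \<in> A. even (r z)}) - int (card {z \<in> A. odd (r z)})"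
    using assms(1) by (simp add: sum.If_cases Int_def Collect_neg_eq[symmetric] conj_commute)
  finally show ?thesis using assms(2) by simp
qed

text \<open>The face polynomial at \<open>-1\<close>. Both of its terms contain a factor
  \<open>1 + t\<close>, the second one because \<open>e\<close> vanishes up to rank 2.\<close>

lemma (in face_counts) alternating_sum:
  assumes "a \<in> L" "b \<in> L" "R a b" "a \<noteq> b"
  shows "(\<Sum>s\<in>{s \<in> L. R a s \<and> R s b}. (-1::int) ^ \<rho> s) = 0"
proof -
  let ?I = "{s \<in> L. R a s \<and> R s b}"
  have lt: "\<rho> a < \<rho> b" by (rule mono[OF assms])
  have "poly (\<Sum>s\<in>?I. [:0, 1:] ^ (\<rho> b - \<rho> s)) (-1) = poly (face_poly (\<rho> b - \<rho> a) (e a b)) (-1::int)"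
    using fp[OF assms(1-3)] by simp
  then have "(\<Sum>s\<in>?I. (-1::int) ^ (\<rho> b - \<rho> s)) = 0 ^ (\<rho> b - \<rho> a) - int (e a b) * 0 ^ (\<rho> b - \<rho> a - 2)"
    by (simp add: face_poly_def poly_sum)
  also have "\<dots> = 0" using lt e0[OF assms(1-3)] by (cases "\<rho> b - \<rho> a \<le> 2") (auto simp: power_0_left)
  finally have 0: "(\<Sum>s\<in>?I. (-1::int) ^ (\<rho> b - \<rho> s)) = 0" .
  have "(\<Sum>s\<in>?I. (-1::int) ^ \<rho> s) = (\<Sum>s\<in>?I. (-1) ^ \<rho> b * (-1) ^ (\<rho> b - \<rho> s))"
  proof (intro sum.cong HOL.refl)
    fix s assume "s \<in> ?I"
    then have "\<rho> s \<le> \<rho> b" using mono_le assms(2) by blast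
    then have "\<rho> b + (\<rho> b - \<rho> s) = \<rho> s + 2 * (\<rho> b - \<rho> s)" by simp
    then show "(-1::int) ^ \<rho> s = (-1) ^ \<rho> b * (-1) ^ (\<rho> b - \<rho> s)"
      by (simp only: power_add[symmetric]) (simp add: power_add power_mult)
  qed
  also have "\<dots> = 0" using 0 by (simp add: sum_distrib_left[symmetric])
  finally show ?thesis .
qed

lemma add_top_simps [simp]: "carrier (add_top X) = insert None (Some ` carrier X)"
  "eq (add_top X) = (=)" "u \<sqsubseteq>\<^bsub>add_top X\<^esub> None" "Some a \<sqsubseteq>\<^bsub>add_top X\<^esub> Some b \<longleftrightarrow> a \<sqsubseteq>\<^bsub>X\<^esub> b"
  "None \<sqsubseteq>\<^bsub>add_top X\<^esub> v \<longleftrightarrow> v = None"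
  by (auto simp: add_top_def)

section \<open>Bier posets of lattices\<close>

text \<open>Elements of the Bier poset are handled as pairs of end points through
  \<open>\<phi>\<close>, on which reverse inclusion is \<open>interval_le\<close>. \<open>L\<close>
  includes the adjoined top \<open>tp\<close>, and \<open>J\<close> is a proper ideal. The bounds
  \<open>infL\<close> and \<open>supL\<close> yield the meets in \<open>P\<close>.\<close>

locale bier =
  fixes L :: "'b::order set" and \<rho> :: "'b \<Rightarrow> nat" and e :: "'b \<Rightarrow> 'b \<Rightarrow> nat" and D :: nat
    and bt tp :: 'b and J :: "'b set" and P :: "'c gorder" and \<phi> :: "'b \<times> 'b \<Rightarrow> 'c"
  assumes gr: "graded_on L \<rho>"
    and bt: "bt \<in> L" "\<And>x. x \<in> L \<Longrightarrow> bt \<le> x" "\<rho> bt = 0"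
    and tp: "tp \<in> L" "\<And>x. x \<in> L \<Longrightarrow> x \<le> tp" "\<rho> tp = D"
    and infL: "\<And>a b. a \<in> L \<Longrightarrow> b \<in> L \<Longrightarrow> \<exists>c\<in>L. c \<le> a \<and> c \<le> b \<and> (\<forall>z\<in>L. z \<le> a \<longrightarrow> z \<le> b \<longrightarrow> z \<le> c)"
    and supL: "\<And>a b. a \<in> L \<Longrightarrow> b \<in> L \<Longrightarrow> \<exists>c\<in>L. a \<le> c \<and> b \<le> c \<and> (\<forall>z\<in>L. a \<le> z \<longrightarrow> b \<le> z \<longrightarrow> c \<le> z)"
    and sphL: "\<And>a b. a \<in> L \<Longrightarrow> b \<in> L \<Longrightarrow> a < b \<Longrightarrow> highly_connected (\<le>) (\<rho> b - \<rho> a - 1) {s \<in> L. a < s \<and> s < b}"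
    and counts: "face_counts L (\<le>) \<rho> e"
    and J: "J \<subseteq> L" "bt \<in> J" "tp \<notin> J" "\<And>a b. a \<in> J \<Longrightarrow> b \<in> L \<Longrightarrow> b \<le> a \<Longrightarrow> b \<in> J"
    and eqP: "eq P = (=)"
    and bij: "bij_betw \<phi> {(a, b). a \<in> J \<and> b \<in> L - J \<and> a \<le> b} (carrier P)"
    and leP: "\<And>p q. p \<in> {(a, b). a \<in> J \<and> b \<in> L - J \<and> a \<le> b} \<Longrightarrow>
      q \<in> {(a, b). a \<in> J \<and> b \<in> L - J \<and> a \<le> b} \<Longrightarrow> \<phi> p \<sqsubseteq>\<^bsub>P\<^esub> \<phi> q \<longleftrightarrow> interval_le p q"
begin

definition PR :: "('b \<times> 'b) set" where "PR = {(a, b). a \<in> J \<and> b \<in> L - J \<and> a \<le> b}"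

definition pr :: "'c \<Rightarrow> 'b \<times> 'b" where "pr = inv_into PR \<phi>"

definition rP :: "'c \<Rightarrow> nat" where "rP v = \<rho> (fst (pr v)) + (D - \<rho> (snd (pr v)))"

lemma bij': "bij_betw \<phi> PR (carrier P)" using bij by (simp add: PR_def)

lemma pr_phi [simp]: "p \<in> PR \<Longrightarrow> pr (\<phi> p) = p"
  using bij' unfolding pr_def by (simp add: bij_betw_inv_into_left)

lemma phi_pr [simp]: "v \<in> carrier P \<Longrightarrow> \<phi> (pr v) = v"
  using bij' unfolding pr_def by (simp add: bij_betw_inv_into_right)

lemma phi_in [simp]: "p \<in> PR \<Longrightarrow> \<phi> p \<in> carrier P"
  using bij' by (auto simp: bij_betw_def)

lemma pr_in: "v \<in> carrier P \<Longrightarrow> pr v \<in> PR"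
  using bij' unfolding pr_def bij_betw_def by (metis inv_into_into)

lemma le_iff: "v \<in> carrier P \<Longrightarrow> w \<in> carrier P \<Longrightarrow> v \<sqsubseteq>\<^bsub>P\<^esub> w \<longleftrightarrow> interval_le (pr v) (pr w)"
  using leP[folded PR_def, OF pr_in pr_in] by simp

lemma PR_D: "(a, b) \<in> PR \<Longrightarrow> a \<in> J \<and> a \<in> L \<and> b \<in> L \<and> b \<notin> J \<and> a < b"
  using J(1) by (auto simp: PR_def order.strict_iff_order)

lemma PR_I: "a \<in> J \<Longrightarrow> b \<in> L \<Longrightarrow> b \<notin> J \<Longrightarrow> a \<le> b \<Longrightarrow> (a, b) \<in> PR"
  by (simp add: PR_def)

lemma phi_cases:
  assumes "v \<in> carrier P"
  obtains a b where "(a, b) \<in> PR" "v = \<phi> (a, b)" "pr v = (a, b)"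
  using pr_in[OF assms] phi_pr[OF assms] that by (metis surj_pair)

lemma rP_phi: "(a, b) \<in> PR \<Longrightarrow> rP (\<phi> (a, b)) = \<rho> a + (D - \<rho> b)"
  by (simp add: rP_def)

lemma finL: "finite L" using graded_onD(1)[OF gr] .

lemma finPR: "finite PR"
  by (rule finite_subset[of _ "L \<times> L"]) (use J(1) finL in \<open>auto simp: PR_def\<close>)

lemma finP: "finite (carrier P)" using bij_betw_finite[OF bij'] finPR by simp

lemma rho_less: "a \<in> L \<Longrightarrow> b \<in> L \<Longrightarrow> a < b \<Longrightarrow> \<rho> a < \<rho> b" by (rule graded_onD(2)[OF gr])

lemma rho_le: "a \<in> L \<Longrightarrow> b \<in> L \<Longrightarrow> a \<le> b \<Longrightarrow> \<rho> a \<le> \<rho> b"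
  using rho_less[of a b] by (cases "a = b") (auto simp: order.strict_iff_order)

lemma rho_D: "a \<in> L \<Longrightarrow> \<rho> a \<le> D" using rho_le[OF _ tp(1) tp(2)] tp(3) by simp

lemma upJ: "a \<in> L \<Longrightarrow> a \<notin> J \<Longrightarrow> b \<in> L \<Longrightarrow> a \<le> b \<Longrightarrow> b \<notin> J" using J(4) by blast

lemma rP_strict:
  assumes "p \<in> PR" "q \<in> PR" "interval_le p q" "p \<noteq> q"
  shows "rP (\<phi> p) < rP (\<phi> q)"
proof -
  obtain a b a' b' where pq: "p = (a, b)" "q = (a', b')" by fastforce
  have ab: "a \<in> L" "b \<in> L" "a' \<in> L" "b' \<in> L" using assms(1,2) PR_D unfolding pq by blast+
  have le: "a \<le> a'" "b' \<le> b" using assms(3) by (auto simp: pq)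
  have 1: "\<rho> a \<le> \<rho> a'" "\<rho> b' \<le> \<rho> b" "\<rho> b \<le> D" using rho_le rho_D ab le by auto
  have "a < a' \<or> b' < b" using assms(4) le by (auto simp: pq order.strict_iff_order)
  then have "\<rho> a < \<rho> a' \<or> \<rho> b' < \<rho> b" using rho_less ab by blast
  then show ?thesis using 1 rP_phi assms(1,2) unfolding pq by auto
qed

lemma partial_order_P: "partial_order P"
proof (rule partial_orderI[OF eqP])
  show "v \<sqsubseteq>\<^bsub>P\<^esub> v" if "v \<in> carrier P" for v using le_iff that by (simp add: interval_le_def)
  show "v = w" if "v \<in> carrier P" "w \<in> carrier P" "v \<sqsubseteq>\<^bsub>P\<^esub> w" "w \<sqsubseteq>\<^bsub>P\<^esub> v" for v w
  proof -
    have "pr v = pr w" using le_iff that porder_antisym[OF porder_interval_le] by blast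
    then show ?thesis using phi_pr that by metis
  qed
  show "u \<sqsubseteq>\<^bsub>P\<^esub> w" if "u \<in> carrier P" "v \<in> carrier P" "w \<in> carrier P" "u \<sqsubseteq>\<^bsub>P\<^esub> v" "v \<sqsubseteq>\<^bsub>P\<^esub> w" for u v w
    using porder_trans[OF porder_interval_le, of "pr u" "pr v" "pr w"] le_iff that by simp
qed

text \<open>The meet of two intervals runs from the infimum of the lower ends to the supremum of the
  upper ends. It is admissible since \<open>J\<close> is closed downwards and its complement
  upwards.\<close>

lemma lower_semilattice_P: "lower_semilattice P"
proof -
  interpret partial_order P by (rule partial_order_P)
  show ?thesis
  proof
    fix v w assume v: "v \<in> carrier P" and w: "w \<in> carrier P"
    obtain a b where ab: "(a, b) \<in> PR" "v = \<phi> (a, b)" "pr v = (a, b)" by (rule phi_cases[OF v])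
    obtain a' b' where ab': "(a', b') \<in> PR" "w = \<phi> (a', b')" "pr w = (a', b')" by (rule phi_cases[OF w])
    note D = PR_D[OF ab(1)] PR_D[OF ab'(1)]
    obtain c where c: "c \<in> L" "c \<le> a" "c \<le> a'" "\<And>z. z \<in> L \<Longrightarrow> z \<le> a \<Longrightarrow> z \<le> a' \<Longrightarrow> z \<le> c"
      using infL[of a a'] D by blast
    obtain s where s: "s \<in> L" "b \<le> s" "b' \<le> s" "\<And>z. z \<in> L \<Longrightarrow> b \<le> z \<Longrightarrow> b' \<le> z \<Longrightarrow> s \<le> z"
      using supL[of b b'] D by blast
    have "c \<in> J" using J(4)[of a c] D c by blast
    moreover have "s \<notin> J" using upJ[of b s] D s by blast
    moreover have "c \<le> s" using c(2) s(2) D by (meson order.trans less_imp_le)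
    ultimately have cs: "(c, s) \<in> PR" using s(1) by (intro PR_I)
    have csv: "\<phi> (c, s) \<sqsubseteq>\<^bsub>P\<^esub> v" "\<phi> (c, s) \<sqsubseteq>\<^bsub>P\<^esub> w"
      using le_iff[OF phi_in[OF cs]] v w cs ab ab' c s by auto
    have gl: "u \<sqsubseteq>\<^bsub>P\<^esub> \<phi> (c, s)" if u: "u \<in> carrier P" "u \<sqsubseteq>\<^bsub>P\<^esub> v" "u \<sqsubseteq>\<^bsub>P\<^esub> w" for u
    proof -
      obtain x y where xy: "(x, y) \<in> PR" "u = \<phi> (x, y)" "pr u = (x, y)" by (rule phi_cases[OF u(1)])
      have "x \<le> a" "b \<le> y" "x \<le> a'" "b' \<le> y"
        using le_iff[OF u(1) v] le_iff[OF u(1) w] u ab ab' xy by auto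
      then have "x \<le> c" "s \<le> y" using c(4) s(4) PR_D[OF xy(1)] by auto
      then show ?thesis using le_iff[OF u(1) phi_in[OF cs]] xy cs by simp
    qed
    have "greatest P (\<phi> (c, s)) (Lower P {v, w})"
      unfolding greatest_def Lower_def using csv gl phi_in[OF cs] v w by auto
    then show "\<exists>s. greatest P s (Lower P {v, w})" by blast
  qed
qed

lemma rP_less_D: "v \<in> carrier P \<Longrightarrow> rP v < D"
proof -
  assume v: "v \<in> carrier P"
  obtain a b where ab: "(a, b) \<in> PR" "v = \<phi> (a, b)" by (rule phi_cases[OF v])
  have "\<rho> a < \<rho> b" "\<rho> b \<le> D" using PR_D[OF ab(1)] rho_less rho_D by auto
  then show ?thesis using rP_phi[OF ab(1)] ab(2) by simp
qed

lemma ranked_P: "ranked P rP"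
  unfolding ranked_def
proof (intro conjI ballI impI)
  show "finite (carrier P)" by (rule finP)
  show "v \<sqsubseteq>\<^bsub>P\<^esub> v" if "v \<in> carrier P" for v using le_iff that by (simp add: interval_le_def)
  show "u \<sqsubseteq>\<^bsub>P\<^esub> w" if "u \<in> carrier P" "v \<in> carrier P" "w \<in> carrier P" "u \<sqsubseteq>\<^bsub>P\<^esub> v" "v \<sqsubseteq>\<^bsub>P\<^esub> w" for u v w
    using porder_trans[OF porder_interval_le, of "pr u" "pr v" "pr w"] le_iff that by simp
  show "rP v < rP w" if "v \<in> carrier P" "w \<in> carrier P" "v \<sqsubseteq>\<^bsub>P\<^esub> w" "v \<noteq> w" for v w
  proof -
    have "pr v \<noteq> pr w" using that phi_pr by metis
    then show ?thesis using rP_strict[OF pr_in pr_in] that le_iff by simp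
  qed
  fix w assume w: "w \<in> carrier P" "0 < rP w"
  obtain a b where ab: "(a, b) \<in> PR" "w = \<phi> (a, b)" "pr w = (a, b)" by (rule phi_cases[OF w(1)])
  note Dab = PR_D[OF ab(1)]
  show "\<exists>x\<in>carrier P. x \<sqsubseteq>\<^bsub>P\<^esub> w \<and> x \<noteq> w \<and> Suc (rP x) = rP w"
  proof (cases "a = bt")
    case False
    then have "bt < a" using bt(2) Dab by (simp add: order.strict_iff_order)
    then obtain z where z: "z \<in> L" "bt \<le> z" "z < a" "\<rho> a = Suc (\<rho> z)"
      using graded_on_pred[OF gr bt(1)] Dab by metis
    have "z \<in> J" using J(4)[of a z] Dab z by auto
    then have zb: "(z, b) \<in> PR" using Dab z by (intro PR_I) auto
    have "pr (\<phi> (z, b)) \<noteq> pr w" using zb z(3) ab by auto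
    then have "\<phi> (z, b) \<noteq> w" by auto
    moreover have "\<phi> (z, b) \<sqsubseteq>\<^bsub>P\<^esub> w" using le_iff[OF phi_in[OF zb] w(1)] zb ab z by auto
    ultimately show ?thesis using zb rP_phi[OF zb] rP_phi[OF ab(1)] ab(2) z(4)
      by (intro bexI[of _ "\<phi> (z, b)"]) auto
  next
    case True
    have "b \<noteq> tp" using True w(2) rP_phi[OF ab(1)] ab(2) bt(3) tp(3) by auto
    then have "b < tp" using tp(2) Dab by (simp add: order.strict_iff_order)
    then obtain z where z: "z \<in> L" "b < z" "z \<le> tp" "\<rho> z = Suc (\<rho> b)"
      using graded_on_succ[OF gr _ tp(1)] Dab by metis
    have "z \<notin> J" using upJ[of b z] Dab z by auto
    then have az: "(a, z) \<in> PR" using Dab z by (intro PR_I) auto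
    have "pr (\<phi> (a, z)) \<noteq> pr w" using az z(2) ab by auto
    then have "\<phi> (a, z) \<noteq> w" by auto
    moreover have "\<phi> (a, z) \<sqsubseteq>\<^bsub>P\<^esub> w" using le_iff[OF phi_in[OF az] w(1)] az ab z by auto
    moreover have "\<rho> z \<le> D" by (rule rho_D[OF z(1)])
    ultimately show ?thesis using az rP_phi[OF az] rP_phi[OF ab(1)] ab(2) z(4)
      by (intro bexI[of _ "\<phi> (a, z)"]) auto
  qed
qed

text \<open>A minimal element outside \<open>J\<close> covers an element of \<open>J\<close>, and
  this cover has rank \<open>D - 1\<close>.\<close>

lemma max_rank: "\<exists>v\<in>carrier P. Suc (rP v) = D"
proof -
  have "L - J \<noteq> {}" using tp(1) J(3) by blast
  moreover have "finite (L - J)" using finL by simp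
  ultimately obtain b where b: "b \<in> L - J" "\<And>w. w \<in> L - J \<Longrightarrow> w \<le> b \<Longrightarrow> w = b"
    using finite_has_minimal by metis
  have "bt < b" using bt J b by (auto simp: order.strict_iff_order)
  then obtain a where a: "a \<in> L" "a < b" "\<rho> b = Suc (\<rho> a)"
    using graded_on_pred[OF gr bt(1)] b(1) by blast
  have "a \<in> J" using b(2)[of a] a less_imp_le[OF a(2)] by auto
  then have ab: "(a, b) \<in> PR" using a b(1) by (intro PR_I) auto
  have "Suc (rP (\<phi> (a, b))) = D" using rP_phi[OF ab] a(3) rho_D[of b] b(1) by simp
  then show ?thesis using ab by (intro bexI[of _ "\<phi> (a, b)"]) auto
qed

definition rT :: "'c option \<Rightarrow> nat" where "rT u = (case u of None \<Rightarrow> D | Some v \<Rightarrow> rP v)"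

lemma rT_simps [simp]: "rT None = D" "rT (Some v) = rP v" by (simp_all add: rT_def)

lemma ranked_T: "ranked (add_top P) rT"
  unfolding ranked_def
proof (intro conjI ballI impI)
  note R = rankedD[OF ranked_P]
  show "finite (carrier (add_top P))" using finP by simp
  show "u \<sqsubseteq>\<^bsub>add_top P\<^esub> u" if "u \<in> carrier (add_top P)" for u using that R(2) by (cases u) auto
  show "u \<sqsubseteq>\<^bsub>add_top P\<^esub> w" if "u \<in> carrier (add_top P)" "v \<in> carrier (add_top P)" "w \<in> carrier (add_top P)"
    "u \<sqsubseteq>\<^bsub>add_top P\<^esub> v" "v \<sqsubseteq>\<^bsub>add_top P\<^esub> w" for u v w
  proof (cases w)
    case None
    then show ?thesis by simp
  next
    case (Some w')
    then obtain v' where v': "v = Some v'" using \<open>v \<sqsubseteq>\<^bsub>add_top P\<^esub> w\<close> by (cases v) auto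
    then obtain u' where u': "u = Some u'" using \<open>u \<sqsubseteq>\<^bsub>add_top P\<^esub> v\<close> by (cases u) auto
    have c: "u' \<in> carrier P" "v' \<in> carrier P" "w' \<in> carrier P" "u' \<sqsubseteq>\<^bsub>P\<^esub> v'" "v' \<sqsubseteq>\<^bsub>P\<^esub> w'"
      using that u' v' Some by auto
    show ?thesis using R(3)[OF c] u' Some by simp
  qed
  show "rT u < rT w" if uw: "u \<in> carrier (add_top P)" "w \<in> carrier (add_top P)"
    "u \<sqsubseteq>\<^bsub>add_top P\<^esub> w" "u \<noteq> w" for u w
  proof (cases w)
    case None
    then obtain u' where "u = Some u'" "u' \<in> carrier P" using uw by (cases u) auto
    then show ?thesis using None rP_less_D by simp
  next
    case (Some w')
    then obtain u' where u': "u = Some u'" using \<open>u \<sqsubseteq>\<^bsub>add_top P\<^esub> w\<close> by (cases u) auto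
    have c: "u' \<in> carrier P" "w' \<in> carrier P" "u' \<sqsubseteq>\<^bsub>P\<^esub> w'" "u' \<noteq> w'" using that u' Some by auto
    show ?thesis using R(4)[OF c] u' Some by simp
  qed
  show "\<exists>x\<in>carrier (add_top P). x \<sqsubseteq>\<^bsub>add_top P\<^esub> w \<and> x \<noteq> w \<and> Suc (rT x) = rT w"
    if "w \<in> carrier (add_top P)" "0 < rT w" for w
  proof (cases w)
    case None
    obtain v where "v \<in> carrier P" "Suc (rP v) = D" using max_rank by blast
    then show ?thesis using None by (intro bexI[of _ "Some v"]) auto
  next
    case (Some v)
    then have "v \<in> carrier P" "0 < rP v" using that by auto
    then obtain x where "x \<in> carrier P" "x \<sqsubseteq>\<^bsub>P\<^esub> v" "x \<noteq> v" "Suc (rP x) = rP v" using R(5) by blast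
    then show ?thesis using Some by (intro bexI[of _ "Some x"]) auto
  qed
qed

lemma between: "a \<in> L \<Longrightarrow> b \<in> L \<Longrightarrow> a < b \<Longrightarrow> Suc (\<rho> a) < \<rho> b \<Longrightarrow> \<exists>z\<in>L. a < z \<and> z < b"
  using graded_onD(3)[OF gr, of a b] by fastforce

text \<open>If both ends differ, moving the lower end alone gives an interval in between. If one end
  is fixed, or if \<open>y\<close> is the new top, an element strictly between in \<open>L\<close>
  becomes a new lower or upper end, according to whether it lies in \<open>J\<close>.\<close>

lemma gap_T:
  assumes "x \<in> carrier (add_top P)" "y \<in> carrier (add_top P)" "x \<sqsubseteq>\<^bsub>add_top P\<^esub> y" "x \<noteq> y" "Suc (rT x) < rT y"
  shows "\<exists>z\<in>carrier (add_top P). x \<sqsubseteq>\<^bsub>add_top P\<^esub> z \<and> z \<sqsubseteq>\<^bsub>add_top P\<^esub> y \<and> z \<noteq> x \<and> z \<noteq> y"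
proof -
  obtain v where v: "x = Some v" "v \<in> carrier P" using assms by (cases x) auto
  obtain a b where ab: "(a, b) \<in> PR" "v = \<phi> (a, b)" "pr v = (a, b)" by (rule phi_cases[OF v(2)])
  note Dab = PR_D[OF ab(1)]
  have key: "\<exists>z\<in>carrier (add_top P). x \<sqsubseteq>\<^bsub>add_top P\<^esub> z \<and> z \<sqsubseteq>\<^bsub>add_top P\<^esub> y \<and> z \<noteq> x \<and> z \<noteq> y"
    if q: "q \<in> PR" "interval_le (a, b) q" "q \<noteq> (a, b)" and y: "y = None \<or> (\<exists>q'\<in>PR. y = Some (\<phi> q') \<and> interval_le q q' \<and> q \<noteq> q')" for q
  proof (rule bexI[of _ "Some (\<phi> q)"], intro conjI)
    show "Some (\<phi> q) \<in> carrier (add_top P)" using q by simp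
    show "x \<sqsubseteq>\<^bsub>add_top P\<^esub> Some (\<phi> q)" using v le_iff[OF v(2) phi_in[OF q(1)]] ab q by simp
    have "pr (\<phi> q) \<noteq> pr v" using q ab by simp
    then show "Some (\<phi> q) \<noteq> x" using v by auto
    show "Some (\<phi> q) \<sqsubseteq>\<^bsub>add_top P\<^esub> y" using y le_iff[OF phi_in[OF q(1)] phi_in] q(1) by auto
    show "Some (\<phi> q) \<noteq> y" using y q(1) pr_phi by (metis option.distinct(1) option.inject)
  qed
  show ?thesis
  proof (cases y)
    case None
    have "Suc (\<rho> a) < \<rho> b" using assms(5) v ab(2) rP_phi[OF ab(1)] None rho_D[of b] Dab by auto
    then obtain z where z: "z \<in> L" "a < z" "z < b" using between Dab by blast
    show ?thesis
    proof (cases "z \<in> J")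
      case True
      then show ?thesis using key[of "(z, b)"] PR_I[of z b] z Dab None by auto
    next
      case False
      then show ?thesis using key[of "(a, z)"] PR_I[of a z] z Dab None by auto
    qed
  next
    case (Some w)
    then have w: "w \<in> carrier P" using assms(2) by auto
    obtain a' b' where ab': "(a', b') \<in> PR" "w = \<phi> (a', b')" "pr w = (a', b')" by (rule phi_cases[OF w])
    note Dab' = PR_D[OF ab'(1)]
    have le: "a \<le> a'" "b' \<le> b" using assms(3) v Some le_iff[OF v(2) w] ab ab' by auto
    have rr: "Suc (\<rho> a + (D - \<rho> b)) < \<rho> a' + (D - \<rho> b')"
      using assms(5) v Some ab(2) ab'(2) rP_phi[OF ab(1)] rP_phi[OF ab'(1)] by auto
    have rD: "\<rho> b \<le> D" "\<rho> b' \<le> \<rho> b" using rho_D rho_le Dab Dab' le by auto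
    consider "a < a'" "b' < b" | "a = a'" | "b = b'" using le by (auto simp: order.strict_iff_order)
    then show ?thesis
    proof cases
      case 1
      have "a' \<le> b" using 1(2) Dab' by (meson less_imp_le order.strict_trans)
      then have q: "(a', b) \<in> PR" using Dab Dab' by (intro PR_I) auto
      show ?thesis
      proof (rule key[OF q])
        show "y = None \<or> (\<exists>q'\<in>PR. y = Some (\<phi> q') \<and> interval_le (a', b) q' \<and> (a', b) \<noteq> q')"
          using ab' Some 1 by (intro disjI2 bexI[of _ "(a', b')"]) auto
      qed (use 1 le in auto)
    next
      case 2
      have bb: "b' < b" using le(2) assms(4) v Some ab ab' 2 by (auto simp: order.strict_iff_order)
      have "Suc (\<rho> b') < \<rho> b" using rr rD 2 by simp
      then obtain z where z: "z \<in> L" "b' < z" "z < b" using between[OF _ _ bb] Dab Dab' by blast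
      have "z \<notin> J" using upJ[of b' z] z Dab' by auto
      have "a \<le> z" using z(2) Dab' 2 by (meson less_imp_le order.strict_trans)
      then have q: "(a, z) \<in> PR" using Dab z \<open>z \<notin> J\<close> by (intro PR_I) auto
      show ?thesis
      proof (rule key[OF q])
        show "y = None \<or> (\<exists>q'\<in>PR. y = Some (\<phi> q') \<and> interval_le (a, z) q' \<and> (a, z) \<noteq> q')"
          using ab' Some 2 z by (intro disjI2 bexI[of _ "(a', b')"]) auto
      qed (use z in auto)
    next
      case 3
      have aa: "a < a'" using le(1) assms(4) v Some ab ab' 3 by (auto simp: order.strict_iff_order)
      have "Suc (\<rho> a) < \<rho> a'" using rr 3 by simp
      then obtain z where z: "z \<in> L" "a < z" "z < a'" using between[OF _ _ aa] Dab Dab' by blast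
      have "z \<in> J" using J(4)[of a' z] z Dab' by auto
      have "z \<le> b" using z(3) Dab' 3 by (meson less_imp_le order.strict_trans)
      then have q: "(z, b) \<in> PR" using Dab z \<open>z \<in> J\<close> by (intro PR_I) auto
      show ?thesis
      proof (rule key[OF q])
        show "y = None \<or> (\<exists>q'\<in>PR. y = Some (\<phi> q') \<and> interval_le (z, b) q' \<and> (z, b) \<noteq> q')"
          using ab' Some 3 z by (intro disjI2 bexI[of _ "(a', b')"]) auto
      qed (use z in auto)
    qed
  qed
qed

lemma graded_bounded_T: "graded_bounded_poset (add_top P)"
  unfolding graded_bounded_poset_def
proof (intro conjI allI impI)
  interpret partial_order P by (rule partial_order_P)
  show "partial_order (add_top P)"
  proof (rule partial_orderI)
    note R = rankedD[OF ranked_T]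
    show "u \<sqsubseteq>\<^bsub>add_top P\<^esub> u" if "u \<in> carrier (add_top P)" for u by (rule R(2)[OF that])
    show "u = v" if "u \<in> carrier (add_top P)" "v \<in> carrier (add_top P)" "u \<sqsubseteq>\<^bsub>add_top P\<^esub> v" "v \<sqsubseteq>\<^bsub>add_top P\<^esub> u" for u v
      using R(4)[of u v] R(4)[of v u] that by fastforce
    show "u \<sqsubseteq>\<^bsub>add_top P\<^esub> w" if "u \<in> carrier (add_top P)" "v \<in> carrier (add_top P)" "w \<in> carrier (add_top P)"
      "u \<sqsubseteq>\<^bsub>add_top P\<^esub> v" "v \<sqsubseteq>\<^bsub>add_top P\<^esub> w" for u v w by (rule R(3)[OF that])
  qed simp
  show "finite (carrier (add_top P))" using finP by simp
  have "greatest (add_top P) None (carrier (add_top P))" by (simp add: greatest_def)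
  then show "has_maximum (add_top P)" unfolding has_maximum_def by blast
  have m: "(bt, tp) \<in> PR" using J bt tp by (intro PR_I) auto
  have "\<phi> (bt, tp) \<sqsubseteq>\<^bsub>P\<^esub> v" if v: "v \<in> carrier P" for v
  proof -
    obtain a b where ab: "(a, b) \<in> PR" "v = \<phi> (a, b)" "pr v = (a, b)" by (rule phi_cases[OF v])
    show ?thesis using le_iff[OF phi_in[OF m] v] m ab bt(2) tp(2) PR_D[OF ab(1)] by simp
  qed
  then have "least (add_top P) (Some (\<phi> (bt, tp))) (carrier (add_top P))"
    using m by (auto simp: least_def)
  then show "has_minimum (add_top P)" unfolding has_minimum_def by blast
  show "poset_rank (add_top P) b = poset_rank (add_top P) a + 1" if "covers (add_top P) b a" for a b
    by (rule ranked_cover[OF ranked_T that gap_T])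
qed

lemma has_minimum_P: "has_minimum P"
proof -
  have m: "(bt, tp) \<in> PR" using J bt tp by (intro PR_I) auto
  have "\<phi> (bt, tp) \<sqsubseteq>\<^bsub>P\<^esub> v" if v: "v \<in> carrier P" for v
  proof -
    obtain a b where ab: "(a, b) \<in> PR" "v = \<phi> (a, b)" "pr v = (a, b)" by (rule phi_cases[OF v])
    show ?thesis using le_iff[OF phi_in[OF m] v] m ab bt(2) tp(2) PR_D[OF ab(1)] by simp
  qed
  then have "least P (\<phi> (bt, tp)) (carrier P)" using m by (auto simp: least_def)
  then show ?thesis unfolding has_minimum_def by blast
qed

end

section \<open>Eulerian and Cohen-Macaulay conditions for Bier posets\<close>

lemma sign_diff: "n \<le> m \<Longrightarrow> (-1::int) ^ (m - n) = (-1) ^ m * (-1) ^ n"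
  by (auto simp: minus_one_power_iff)

context bier begin

lemma alternating_L: "a \<in> L \<Longrightarrow> b \<in> L \<Longrightarrow> a < b \<Longrightarrow> (\<Sum>s\<in>{s \<in> L. a \<le> s \<and> s \<le> b}. (-1::int) ^ \<rho> s) = 0"
  by (rule face_counts.alternating_sum[OF counts]) auto

lemma box_PR:
  assumes "(a1, b1) \<in> PR" "(a2, b2) \<in> PR"
  shows "{a \<in> L. a1 \<le> a \<and> a \<le> a2} \<times> {b \<in> L. b2 \<le> b \<and> b \<le> b1} \<subseteq> PR"
proof safe
  fix a b assume a: "a \<in> L" "a1 \<le> a" "a \<le> a2" and b: "b \<in> L" "b2 \<le> b" "b \<le> b1"
  note D = PR_D[OF assms(1)] PR_D[OF assms(2)]
  have "a \<in> J" using J(4)[of a2 a] D a by blast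
  moreover have "b \<notin> J" using upJ[of b2 b] D b by blast
  moreover have "a \<le> b"
  proof -
    have "a2 \<le> b2" using D by (simp add: less_imp_le)
    then show ?thesis using a(3) b(2) by (meson order.trans)
  qed
  ultimately show "(a, b) \<in> PR" using b(1) by (intro PR_I)
qed

text \<open>Between two admissible pairs the conditions on \<open>J\<close> hold automatically, so
  an interval below the new top is a product of an interval of \<open>L\<close> with a dual
  one.\<close>

lemma interval_SS:
  assumes p: "p = (a1, b1)" "p \<in> PR" and q: "q = (a2, b2)" "q \<in> PR"
  shows "{z \<in> carrier (add_top P). Some (\<phi> p) \<sqsubseteq>\<^bsub>add_top P\<^esub> z \<and> z \<sqsubseteq>\<^bsub>add_top P\<^esub> Some (\<phi> q)} =
    Some ` \<phi> ` ({a \<in> L. a1 \<le> a \<and> a \<le> a2} \<times> {b \<in> L. b2 \<le> b \<and> b \<le> b1})"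
proof (intro subset_antisym subsetI)
  fix z assume z: "z \<in> {z \<in> carrier (add_top P). Some (\<phi> p) \<sqsubseteq>\<^bsub>add_top P\<^esub> z \<and> z \<sqsubseteq>\<^bsub>add_top P\<^esub> Some (\<phi> q)}"
  then obtain v where v: "z = Some v" by (cases z) auto
  then have vP: "v \<in> carrier P" "\<phi> p \<sqsubseteq>\<^bsub>P\<^esub> v" "v \<sqsubseteq>\<^bsub>P\<^esub> \<phi> q" using z by auto
  obtain a b where ab: "(a, b) \<in> PR" "v = \<phi> (a, b)" "pr v = (a, b)" by (rule phi_cases[OF vP(1)])
  have "interval_le (a1, b1) (a, b)" "interval_le (a, b) (a2, b2)"
    using le_iff[OF phi_in[OF p(2)] vP(1)] le_iff[OF vP(1) phi_in[OF q(2)]] vP ab p q by auto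
  then have "(a, b) \<in> {a \<in> L. a1 \<le> a \<and> a \<le> a2} \<times> {b \<in> L. b2 \<le> b \<and> b \<le> b1}" using PR_D[OF ab(1)] by auto
  then show "z \<in> Some ` \<phi> ` ({a \<in> L. a1 \<le> a \<and> a \<le> a2} \<times> {b \<in> L. b2 \<le> b \<and> b \<le> b1})"
    using v ab(2) by blast
next
  fix z assume "z \<in> Some ` \<phi> ` ({a \<in> L. a1 \<le> a \<and> a \<le> a2} \<times> {b \<in> L. b2 \<le> b \<and> b \<le> b1})"
  then obtain a b where ab: "z = Some (\<phi> (a, b))" "(a, b) \<in> {a \<in> L. a1 \<le> a \<and> a \<le> a2} \<times> {b \<in> L. b2 \<le> b \<and> b \<le> b1}"
    by auto
  then have abP: "(a, b) \<in> PR" using box_PR[OF p(2)[unfolded p(1)] q(2)[unfolded q(1)]] by blast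
  show "z \<in> {z \<in> carrier (add_top P). Some (\<phi> p) \<sqsubseteq>\<^bsub>add_top P\<^esub> z \<and> z \<sqsubseteq>\<^bsub>add_top P\<^esub> Some (\<phi> q)}"
    using ab abP le_iff[OF phi_in[OF p(2)] phi_in[OF abP]] le_iff[OF phi_in[OF abP] phi_in[OF q(2)]] p q
    by auto
qed

lemma interval_ST:
  assumes p: "p = (a1, b1)" "p \<in> PR"
  shows "{z \<in> carrier (add_top P). Some (\<phi> p) \<sqsubseteq>\<^bsub>add_top P\<^esub> z \<and> z \<sqsubseteq>\<^bsub>add_top P\<^esub> None} =
    insert None (Some ` \<phi> ` {q \<in> PR. interval_le p q})"
proof (intro subset_antisym subsetI)
  fix z assume z: "z \<in> {z \<in> carrier (add_top P). Some (\<phi> p) \<sqsubseteq>\<^bsub>add_top P\<^esub> z \<and> z \<sqsubseteq>\<^bsub>add_top P\<^esub> None}"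
  show "z \<in> insert None (Some ` \<phi> ` {q \<in> PR. interval_le p q})"
  proof (cases z)
    case (Some v)
    then have vP: "v \<in> carrier P" "\<phi> p \<sqsubseteq>\<^bsub>P\<^esub> v" using z by auto
    then have "pr v \<in> {q \<in> PR. interval_le p q}" using le_iff[OF phi_in[OF p(2)] vP(1)] pr_in p(2) by simp
    then show ?thesis using Some phi_pr[OF vP(1)] by (intro insertI2) (metis imageI)
  qed simp
next
  fix z assume "z \<in> insert None (Some ` \<phi> ` {q \<in> PR. interval_le p q})"
  then consider "z = None" | q where "z = Some (\<phi> q)" "q \<in> PR" "interval_le p q" by auto
  then show "z \<in> {z \<in> carrier (add_top P). Some (\<phi> p) \<sqsubseteq>\<^bsub>add_top P\<^esub> z \<and> z \<sqsubseteq>\<^bsub>add_top P\<^esub> None}"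
  proof cases
    case 2
    then show ?thesis using le_iff[OF phi_in[OF p(2)] phi_in[OF 2(2)]] p(2) by simp
  qed simp
qed

lemma sum_box:
  "(\<Sum>p\<in>{a \<in> L. a1 \<le> a \<and> a \<le> a2} \<times> {b \<in> L. b2 \<le> b \<and> b \<le> b1}. (-1::int) ^ (\<rho> (fst p) + (D - \<rho> (snd p)))) =
    (\<Sum>a\<in>{a \<in> L. a1 \<le> a \<and> a \<le> a2}. (-1) ^ \<rho> a) * ((-1) ^ D * (\<Sum>b\<in>{b \<in> L. b2 \<le> b \<and> b \<le> b1}. (-1) ^ \<rho> b))"
proof -
  have "(\<Sum>p\<in>{a \<in> L. a1 \<le> a \<and> a \<le> a2} \<times> {b \<in> L. b2 \<le> b \<and> b \<le> b1}. (-1::int) ^ (\<rho> (fst p) + (D - \<rho> (snd p)))) =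
    (\<Sum>a\<in>{a \<in> L. a1 \<le> a \<and> a \<le> a2}. \<Sum>b\<in>{b \<in> L. b2 \<le> b \<and> b \<le> b1}. (-1) ^ \<rho> a * (-1) ^ (D - \<rho> b))"
    by (simp add: sum.cartesian_product case_prod_unfold power_add)
  also have "\<dots> = (\<Sum>a\<in>{a \<in> L. a1 \<le> a \<and> a \<le> a2}. (-1) ^ \<rho> a) * (\<Sum>b\<in>{b \<in> L. b2 \<le> b \<and> b \<le> b1}. (-1) ^ (D - \<rho> b))"
    by (simp add: sum_product)
  also have "(\<Sum>b\<in>{b \<in> L. b2 \<le> b \<and> b \<le> b1}. (-1::int) ^ (D - \<rho> b)) =
      (-1) ^ D * (\<Sum>b\<in>{b \<in> L. b2 \<le> b \<and> b \<le> b1}. (-1) ^ \<rho> b)"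
    unfolding sum_distrib_left by (intro sum.cong refl) (auto simp: sign_diff rho_D)
  finally show ?thesis .
qed

lemma sum_image_phi:
  assumes "Q \<subseteq> PR"
  shows "(\<Sum>z\<in>Some ` \<phi> ` Q. (-1::int) ^ rT z) = (\<Sum>p\<in>Q. (-1) ^ (\<rho> (fst p) + (D - \<rho> (snd p))))"
proof -
  have "inj_on \<phi> Q" using bij' assms unfolding bij_betw_def by (metis inj_on_subset)
  then have "(\<Sum>z\<in>Some ` \<phi> ` Q. (-1::int) ^ rT z) = (\<Sum>p\<in>Q. (-1) ^ rP (\<phi> p))"
    by (simp add: sum.reindex)
  also have "\<dots> = (\<Sum>p\<in>Q. (-1) ^ (\<rho> (fst p) + (D - \<rho> (snd p))))"
    using assms by (intro sum.cong refl) (auto simp: rP_def)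
  finally show ?thesis .
qed

text \<open>For fixed \<open>a\<close>, the alternating sum over \<open>[a, b1]\<close> vanishes, so
  the sum over upper ends outside \<open>J\<close> is minus the sum over elements \<open>b\<close>
  of \<open>J\<close> above \<open>a\<close>. After exchanging the summations, the sum over
  \<open>a\<close> in \<open>[a1, b]\<close> vanishes unless \<open>b = a1\<close>, and one term
  remains.\<close>

lemma sum_ideal_part:
  assumes "a1 \<in> J" "b1 \<in> L" "b1 \<notin> J" "a1 \<le> b1"
  shows "(\<Sum>p\<in>{q \<in> PR. interval_le (a1, b1) q}. (-1::int) ^ (\<rho> (fst p) + (D - \<rho> (snd p)))) = - ((-1) ^ D)"
proof -
  define A where "A = {a \<in> J. a1 \<le> a \<and> a \<le> b1}"
  define B where "B = {b \<in> L - J. a1 \<le> b \<and> b \<le> b1}"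
  have fJ: "finite J" using finL J(1) finite_subset by metis
  have fin: "finite A" "finite B" using fJ finL by (auto simp: A_def B_def)
  have aL: "a1 \<in> L" using assms(1) J(1) by blast
  have AL: "a \<in> L" if "a \<in> A" for a using that J(1) by (auto simp: A_def)
  let ?s = "\<lambda>x. (-1::int) ^ \<rho> x"
  have eq: "{q \<in> PR. interval_le (a1, b1) q} = (SIGMA a:A. {b \<in> B. a \<le> b})"
  proof (intro subset_antisym subsetI)
    fix p assume p: "p \<in> {q \<in> PR. interval_le (a1, b1) q}"
    obtain a b where pab: "p = (a, b)" by fastforce
    have ab: "(a, b) \<in> PR" "a1 \<le> a" "b \<le> b1" using p pab by auto
    note Dab = PR_D[OF ab(1)]
    have lt: "a \<le> b" using Dab by (simp add: less_imp_le)
    have "a \<le> b1" "a1 \<le> b" using order.trans[OF lt ab(3)] order.trans[OF ab(2) lt] by auto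
    then show "p \<in> (SIGMA a:A. {b \<in> B. a \<le> b})" using Dab lt ab pab by (simp add: A_def B_def)
  next
    fix p assume "p \<in> (SIGMA a:A. {b \<in> B. a \<le> b})"
    then obtain a b where ab: "p = (a, b)" "a \<in> A" "b \<in> B" "a \<le> b" by auto
    then have "(a, b) \<in> PR" by (intro PR_I) (auto simp: A_def B_def)
    then show "p \<in> {q \<in> PR. interval_le (a1, b1) q}" using ab by (auto simp: A_def B_def)
  qed
  have "(\<Sum>p\<in>{q \<in> PR. interval_le (a1, b1) q}. (-1::int) ^ (\<rho> (fst p) + (D - \<rho> (snd p)))) =
      (\<Sum>a\<in>A. \<Sum>b\<in>{b \<in> B. a \<le> b}. ?s a * (-1) ^ (D - \<rho> b))"
    unfolding eq using fin by (subst sum.Sigma) (auto simp: case_prod_unfold power_add)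
  also have "\<dots> = (\<Sum>a\<in>A. \<Sum>b\<in>{b \<in> B. a \<le> b}. (-1) ^ D * (?s a * ?s b))"
    by (intro sum.cong refl) (auto simp: sign_diff rho_D B_def)
  also have "\<dots> = (-1) ^ D * (\<Sum>a\<in>A. ?s a * (\<Sum>b\<in>{b \<in> B. a \<le> b}. ?s b))"
    by (simp add: sum_distrib_left)
  also have "(\<Sum>a\<in>A. ?s a * (\<Sum>b\<in>{b \<in> B. a \<le> b}. ?s b)) = (\<Sum>a\<in>A. ?s a * - (\<Sum>b\<in>{b \<in> A. a \<le> b}. ?s b))"
  proof (intro sum.cong refl)
    fix a assume a: "a \<in> A"
    have aL': "a \<in> L" by (rule AL[OF a])
    have ab1: "a1 \<le> a" "a \<le> b1" "a \<in> J" using a by (auto simp: A_def)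
    have "{s \<in> L. a \<le> s \<and> s \<le> b1} = {b \<in> A. a \<le> b} \<union> {b \<in> B. a \<le> b}"
    proof (intro subset_antisym subsetI)
      fix s assume s: "s \<in> {s \<in> L. a \<le> s \<and> s \<le> b1}"
      then have "a1 \<le> s" using order.trans[OF ab1(1)] by simp
      then show "s \<in> {b \<in> A. a \<le> b} \<union> {b \<in> B. a \<le> b}" using s by (auto simp: A_def B_def)
    qed (use AL in \<open>auto simp: A_def B_def\<close>)
    moreover have "{b \<in> A. a \<le> b} \<inter> {b \<in> B. a \<le> b} = {}" by (auto simp: A_def B_def)
    moreover have "a < b1" using ab1 assms(3) by (auto simp: order.strict_iff_order)
    ultimately have "(\<Sum>b\<in>{b \<in> A. a \<le> b}. ?s b) + (\<Sum>b\<in>{b \<in> B. a \<le> b}. ?s b) = 0"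
      using alternating_L[OF aL' assms(2)] fin by (simp add: sum.union_disjoint)
    then have "(\<Sum>b\<in>{b \<in> B. a \<le> b}. ?s b) = - (\<Sum>b\<in>{b \<in> A. a \<le> b}. ?s b)" by linarith
    then show "?s a * (\<Sum>b\<in>{b \<in> B. a \<le> b}. ?s b) = ?s a * - (\<Sum>b\<in>{b \<in> A. a \<le> b}. ?s b)"
      by (simp only:)
  qed
  also have "\<dots> = - (\<Sum>a\<in>A. \<Sum>b\<in>A. if a \<le> b then ?s a * ?s b else 0)"
    using fin by (simp add: sum_negf sum_distrib_left sum.inter_filter if_distrib cong: if_cong)
  also have "(\<Sum>a\<in>A. \<Sum>b\<in>A. if a \<le> b then ?s a * ?s b else 0) = (\<Sum>b\<in>A. \<Sum>a\<in>A. if a \<le> b then ?s a * ?s b else 0)"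
    by (rule sum.swap)
  also have "\<dots> = (\<Sum>b\<in>A. if b = a1 then 1 else 0)"
  proof (intro sum.cong refl)
    fix b assume b: "b \<in> A"
    have b': "b \<in> L" "a1 \<le> b" "b \<in> J" "b \<le> b1" using b AL by (auto simp: A_def)
    have "{a \<in> A. a \<le> b} = {s \<in> L. a1 \<le> s \<and> s \<le> b}"
    proof (intro subset_antisym subsetI)
      fix s assume s: "s \<in> {s \<in> L. a1 \<le> s \<and> s \<le> b}"
      then have "s \<in> J" using J(4)[OF b'(3)] by blast
      moreover have "s \<le> b1" using s order.trans[OF _ b'(4)] by blast
      ultimately show "s \<in> {a \<in> A. a \<le> b}" using s by (simp add: A_def)
    qed (use AL in \<open>auto simp: A_def\<close>)
    then have *: "(\<Sum>a\<in>A. if a \<le> b then ?s a * ?s b else 0) = (\<Sum>a\<in>{s \<in> L. a1 \<le> s \<and> s \<le> b}. ?s a) * ?s b"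
      using fin by (simp add: sum.inter_filter[symmetric] sum_distrib_right)
    show "(\<Sum>a\<in>A. if a \<le> b then ?s a * ?s b else 0) = (if b = a1 then 1 else 0)"
    proof (cases "b = a1")
      case True
      then have "{s \<in> L. a1 \<le> s \<and> s \<le> b} = {a1}" using aL by auto
      then show ?thesis unfolding * using True by (simp flip: power_add mult_2)
    next
      case False
      then have "a1 < b" using b'(2) by (auto simp: order.strict_iff_order)
      then show ?thesis unfolding * using alternating_L[OF aL b'(1)] False by simp
    qed
  qed
  also have "\<dots> = 1"
  proof -
    have "a1 \<in> A" using assms by (simp add: A_def)
    then show ?thesis using fin by simp
  qed
  finally show ?thesis by simp
qed

lemma Eulerian_T: "Eulerian (add_top P)"
  unfolding Eulerian_def
proof (intro conjI ballI impI)
  show "graded_bounded_poset (add_top P)" by (rule graded_bounded_T)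
  fix x y assume xy: "x \<in> carrier (add_top P)" "y \<in> carrier (add_top P)" "x \<sqsubseteq>\<^bsub>add_top P\<^esub> y \<and> x \<noteq> y"
  let ?I = "at_least_at_most (add_top P) x y"
  have fin: "finite ?I" using finP by (simp add: at_least_at_most_def)
  obtain v where v: "x = Some v" "v \<in> carrier P" using xy by (cases x) auto
  obtain a1 b1 where p: "(a1, b1) \<in> PR" "v = \<phi> (a1, b1)" "pr v = (a1, b1)" by (rule phi_cases[OF v(2)])
  note Dp = PR_D[OF p(1)]
  have "(\<Sum>z\<in>?I. (-1::int) ^ rT z) = 0"
  proof (cases y)
    case None
    have I: "?I = insert None (Some ` \<phi> ` {q \<in> PR. interval_le (a1, b1) q})"
      using interval_ST[OF HOL.refl p(1)] v(1) p(2) None by (simp add: at_least_at_most_def)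
    have "finite (Some ` \<phi> ` {q \<in> PR. interval_le (a1, b1) q})" using finPR by simp
    then have "(\<Sum>z\<in>?I. (-1::int) ^ rT z) = (-1) ^ D + (\<Sum>z\<in>Some ` \<phi> ` {q \<in> PR. interval_le (a1, b1) q}. (-1::int) ^ rT z)"
      unfolding I by (subst sum.insert) auto
    also have "(\<Sum>z\<in>Some ` \<phi> ` {q \<in> PR. interval_le (a1, b1) q}. (-1::int) ^ rT z) = - ((-1) ^ D)"
      by (subst sum_image_phi) (use sum_ideal_part[of a1 b1] Dp in auto)
    finally show ?thesis by simp
  next
    case (Some w)
    then have w: "w \<in> carrier P" using xy by auto
    obtain a2 b2 where q: "(a2, b2) \<in> PR" "w = \<phi> (a2, b2)" "pr w = (a2, b2)" by (rule phi_cases[OF w])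
    note Dq = PR_D[OF q(1)]
    have le: "a1 \<le> a2" "b2 \<le> b1" using xy v Some le_iff[OF v(2) w] p q by auto
    have ne: "a1 < a2 \<or> b2 < b1" using xy v Some p q le by (auto simp: order.strict_iff_order)
    have I: "?I = Some ` \<phi> ` ({a \<in> L. a1 \<le> a \<and> a \<le> a2} \<times> {b \<in> L. b2 \<le> b \<and> b \<le> b1})"
      using interval_SS[OF HOL.refl p(1) HOL.refl q(1)] v(1) p(2) q(2) Some by (simp add: at_least_at_most_def)
    show ?thesis unfolding I sum_image_phi[OF box_PR[OF p(1) q(1)]] sum_box
      using ne alternating_L[of a1 a2] alternating_L[of b2 b1] Dp Dq by auto
  qed
  from card_even_odd[OF fin this]
  have "card {z \<in> ?I. even (rT z)} = card {z \<in> ?I. odd (rT z)}" .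
  moreover have "poset_rank (add_top P) z = rT z" if "z \<in> ?I" for z
    by (rule poset_rank_eq[OF ranked_T]) (use that in \<open>simp add: at_least_at_most_def\<close>)
  then have "{z \<in> ?I. even (poset_rank (add_top P) z)} = {z \<in> ?I. even (rT z)}"
    "{z \<in> ?I. odd (poset_rank (add_top P) z)} = {z \<in> ?I. odd (rT z)}" by auto
  ultimately show "card {z \<in> ?I. even (poset_rank (add_top P) z)} = card {z \<in> ?I. odd (poset_rank (add_top P) z)}"
    by simp
qed

text \<open>If one factor is a point, the box is an open interval of \<open>L\<close> or its dual.
  Otherwise the indices of the two open intervals add up, plus one for the product.\<close>

lemma highly_connected_box:
  assumes p: "(a1, b1) \<in> PR" and q: "(a2, b2) \<in> PR" and le: "a1 \<le> a2" "b2 \<le> b1" and ne: "(a1, b1) \<noteq> (a2, b2)"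
  shows "highly_connected interval_le (\<rho> a2 - \<rho> a1 + (\<rho> b1 - \<rho> b2) - 1)
    ({a \<in> L. a1 \<le> a \<and> a \<le> a2} \<times> {b \<in> L. b2 \<le> b \<and> b \<le> b1} - {(a1, b1), (a2, b2)})"
proof -
  note D = PR_D[OF p] PR_D[OF q]
  let ?A = "{a \<in> L. a1 \<le> a \<and> a \<le> a2}" and ?B = "{b \<in> L. b2 \<le> b \<and> b \<le> b1}"
  have oi: "{s \<in> L. x < s \<and> s < y} = {s \<in> L. x \<le> s \<and> s \<le> y} - {x, y}" for x y
    by (auto simp: order.strict_iff_order)
  show ?thesis
  proof (cases "a1 = a2")
    case True
    then have bb: "b2 < b1" using le ne by (auto simp: order.strict_iff_order)
    have "highly_connected interval_le (\<rho> b1 - \<rho> b2 - 1) ((\<lambda>b. (a1, b)) ` {s \<in> L. b2 < s \<and> s < b1})"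
      by (rule highly_connected_image[OF sphL]) (use bb D in \<open>auto simp: inj_on_def\<close>)
    moreover have "?A \<times> ?B - {(a1, b1), (a2, b2)} = (\<lambda>b. (a1, b)) ` {s \<in> L. b2 < s \<and> s < b1}"
      using D unfolding oi True by auto
    ultimately show ?thesis using True by simp
  next
    case aF: False
    then have aa: "a1 < a2" using le by (auto simp: order.strict_iff_order)
    show ?thesis
    proof (cases "b1 = b2")
      case True
      have "highly_connected interval_le (\<rho> a2 - \<rho> a1 - 1) ((\<lambda>a. (a, b1)) ` {s \<in> L. a1 < s \<and> s < a2})"
        by (rule highly_connected_image[OF sphL]) (use aa D in \<open>auto simp: inj_on_def\<close>)
      moreover have "?A \<times> ?B - {(a1, b1), (a2, b2)} = (\<lambda>a. (a, b1)) ` {s \<in> L. a1 < s \<and> s < a2}"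
        using D unfolding oi True by auto
      ultimately show ?thesis using True by simp
    next
      case False
      then have bb: "b2 < b1" using le by (auto simp: order.strict_iff_order)
      have "highly_connected (\<le>) (\<rho> a2 - \<rho> a1 - 1) {s \<in> L. a1 < s \<and> s < a2}" by (rule sphL) (use aa D in auto)
      then have s1: "highly_connected (\<le>) (\<rho> a2 - \<rho> a1 - 1) (?A - {a1, a2})" by (simp only: oi)
      have s2: "highly_connected (\<le>) (\<rho> b1 - \<rho> b2 - 1) (?B - {b1, b2})"
      proof -
        have e: "?B - {b1, b2} = ?B - {b2, b1}" by auto
        have "highly_connected (\<le>) (\<rho> b1 - \<rho> b2 - 1) {s \<in> L. b2 < s \<and> s < b1}" by (rule sphL) (use bb D in auto)
        then show ?thesis unfolding e by (simp only: oi)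
      qed
      have "highly_connected interval_le (Suc ((\<rho> a2 - \<rho> a1 - 1) + (\<rho> b1 - \<rho> b2 - 1))) (?A \<times> ?B - {(a1, b1), (a2, b2)})"
        by (rule highly_connected_prod[OF _ _ _ _ aF _ _ _ _ False s1 s2]) (use finL D le in auto)
      moreover have "Suc ((\<rho> a2 - \<rho> a1 - 1) + (\<rho> b1 - \<rho> b2 - 1)) = \<rho> a2 - \<rho> a1 + (\<rho> b1 - \<rho> b2) - 1"
        using rho_less[OF _ _ aa] rho_less[OF _ _ bb] D by simp
      ultimately show ?thesis by (simp only:)
    qed
  qed
qed

lemma homology_image:
  assumes Q: "Q \<subseteq> PR" and Y: "carrier Y = Some ` \<phi> ` Q" and leY: "gorder.le Y = gorder.le (add_top P)"
    and vanishes_below: "vanishes_below (K :: 'k::field itself) interval_le k Q" and i: "i + 1 < int k"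
  shows "reduced_homology_vanishes K Y i"
proof (rule homology_vanishes_iso)
  let ?f = "\<lambda>u. pr (the u)"
  have "inj_on \<phi> Q" using bij' Q unfolding bij_betw_def by (metis inj_on_subset)
  show "bij_betw ?f (carrier Y) Q"
  proof (rule bij_betw_byWitness[where f' = "\<lambda>q. Some (\<phi> q)"])
    show "\<forall>a\<in>carrier Y. Some (\<phi> (?f a)) = a" using Q Y by auto
    show "\<forall>q\<in>Q. ?f (Some (\<phi> q)) = q" using Q by auto
    show "?f ` carrier Y \<subseteq> Q" using Q Y by auto
    show "(\<lambda>q. Some (\<phi> q)) ` Q \<subseteq> carrier Y" using Y by auto
  qed
  show "porder interval_le" by (rule porder_interval_le)
  show "finite Q" using Q finPR finite_subset by metis
  show "u \<sqsubseteq>\<^bsub>Y\<^esub> v \<longleftrightarrow> interval_le (?f u) (?f v)" if uv: "u \<in> carrier Y" "v \<in> carrier Y" for u v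
  proof -
    obtain p where "p \<in> Q" "u = Some (\<phi> p)" using uv(1) Y by auto
    moreover obtain q where "q \<in> Q" "v = Some (\<phi> q)" using uv(2) Y by auto
    ultimately have pq: "p \<in> PR" "u = Some (\<phi> p)" "q \<in> PR" "v = Some (\<phi> q)" using Q by auto
    then show ?thesis using le_iff[OF phi_in[OF pq(1)] phi_in[OF pq(3)]] by (simp add: leY)
  qed
  show "homology_vanishes K interval_le Q i" using vanishes_below i by (simp add: vanishes_below_def)
qed

text \<open>Below the new top open intervals are boxes without two corners. An open interval up to
  the new top is the proper part of the Bier poset of \<open>[a1, b1]\<close> with the induced
  ideal, and here the homological statement takes over.\<close>

lemma Cohen_Macaulay_T: "Cohen_Macaulay (K :: 'k::field itself) (add_top P)"
  unfolding Cohen_Macaulay_def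
proof (intro conjI ballI impI allI)
  show "graded_bounded_poset (add_top P)" by (rule graded_bounded_T)
  fix x y i assume xy: "x \<in> carrier (add_top P)" "y \<in> carrier (add_top P)" "x \<sqsubseteq>\<^bsub>add_top P\<^esub> y \<and> x \<noteq> y"
    and i: "i < int (poset_rank (add_top P) y) - int (poset_rank (add_top P) x) - 2"
  let ?Y = "open_interval (add_top P) x y"
  have leY: "gorder.le ?Y = gorder.le (add_top P)" by (simp add: open_interval_def)
  have cY: "carrier ?Y = {z \<in> carrier (add_top P). x \<sqsubseteq>\<^bsub>add_top P\<^esub> z \<and> z \<sqsubseteq>\<^bsub>add_top P\<^esub> y} - {x, y}"
    by (auto simp: open_interval_def)
  have i': "i < int (rT y) - int (rT x) - 2" using i poset_rank_eq[OF ranked_T] xy by simp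
  obtain v where v: "x = Some v" "v \<in> carrier P" using xy by (cases x) auto
  obtain a1 b1 where p: "(a1, b1) \<in> PR" "v = \<phi> (a1, b1)" "pr v = (a1, b1)" by (rule phi_cases[OF v(2)])
  note Dp = PR_D[OF p(1)]
  have rx: "rT x = \<rho> a1 + (D - \<rho> b1)" using rP_phi[OF p(1)] v p by simp
  have inj: "Some (\<phi> q) = Some (\<phi> q') \<longleftrightarrow> q = q'" if "q \<in> PR" "q' \<in> PR" for q q'
    using that pr_phi by (metis option.inject)
  show "reduced_homology_vanishes K ?Y i"
  proof (cases y)
    case None
    let ?E = "{s \<in> L. a1 \<le> s \<and> s \<le> b1}"
    let ?Q = "proper_pairs ?E (J \<inter> ?E) a1 b1"
    have Q: "?Q = {q \<in> PR. interval_le (a1, b1) q} - {(a1, b1)}"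
    proof (intro subset_antisym subsetI)
      fix q assume q: "q \<in> ?Q"
      then show "q \<in> {q \<in> PR. interval_le (a1, b1) q} - {(a1, b1)}" by (auto simp: proper_pairs_def PR_def)
    next
      fix q assume q: "q \<in> {q \<in> PR. interval_le (a1, b1) q} - {(a1, b1)}"
      obtain a b where qab: "q = (a, b)" by fastforce
      have ab: "(a, b) \<in> PR" "a1 \<le> a" "b \<le> b1" using q qab by auto
      note Dab = PR_D[OF ab(1)]
      have lt: "a \<le> b" using Dab by (simp add: less_imp_le)
      have "a \<le> b1" "a1 \<le> b" using order.trans[OF lt ab(3)] order.trans[OF ab(2) lt] by auto
      then show "q \<in> ?Q" using Dab lt ab q qab by (simp add: proper_pairs_def)
    qed
    have E: "finite ?E" "a1 \<in> ?E" "b1 \<in> ?E" using finL Dp by (auto simp: less_imp_le)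
    have "highly_connected (\<le>) (\<rho> b1 - \<rho> a1 - 1) {s \<in> L. a1 < s \<and> s < b1}" by (rule sphL) (use Dp in auto)
    moreover have "{s \<in> L. a1 < s \<and> s < b1} = ?E - {a1, b1}" by (auto simp: order.strict_iff_order)
    ultimately have s: "highly_connected (\<le>) (\<rho> b1 - \<rho> a1 - 1) (?E - {a1, b1})" by simp
    have VQ: "vanishes_below K interval_le (\<rho> b1 - \<rho> a1 - 1) ?Q"
    proof (rule vanishes_below_proper_pairs[OF E _ s])
      show "b \<in> J \<inter> ?E" if "a \<in> J \<inter> ?E" "b \<in> ?E" "b \<le> a" for a b using J(4)[of a b] that by blast
    qed (use Dp E in auto)
    have c1: "carrier ?Y = Some ` \<phi> ` ?Q"
    proof -
      have "carrier ?Y = insert None (Some ` \<phi> ` {q \<in> PR. interval_le (a1, b1) q}) - {Some (\<phi> (a1, b1)), None}"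
        unfolding cY using interval_ST[OF HOL.refl p(1)] v(1) p(2) None by simp
      also have "\<dots> = Some ` \<phi> ` ({q \<in> PR. interval_le (a1, b1) q} - {(a1, b1)})" using inj p(1) by auto
      finally show ?thesis unfolding Q .
    qed
    have c2: "?Q \<subseteq> PR" unfolding Q by blast
    \<comment> \<open>The new top has rank \<open>D\<close>, so its distance from \<open>x\<close>
      is \<open>\<rho> b1 - \<rho> a1\<close>.\<close>
    have c3: "i + 1 < int (\<rho> b1 - \<rho> a1 - 1)"
      using i' None rx rho_D[of b1] rho_less[of a1 b1] Dp by auto
    show ?thesis by (rule homology_image[OF c2 c1 leY VQ c3])
  next
    case (Some w)
    then have w: "w \<in> carrier P" using xy by auto
    obtain a2 b2 where q: "(a2, b2) \<in> PR" "w = \<phi> (a2, b2)" "pr w = (a2, b2)" by (rule phi_cases[OF w])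
    note Dq = PR_D[OF q(1)]
    have le: "a1 \<le> a2" "b2 \<le> b1" using xy v Some le_iff[OF v(2) w] p q by auto
    have ne: "(a1, b1) \<noteq> (a2, b2)" using xy v Some p q by auto
    let ?X = "{a \<in> L. a1 \<le> a \<and> a \<le> a2} \<times> {b \<in> L. b2 \<le> b \<and> b \<le> b1}"
    let ?Q = "?X - {(a1, b1), (a2, b2)}"
    have XP: "?X \<subseteq> PR" by (rule box_PR[OF p(1) q(1)])
    have VQ: "vanishes_below K interval_le (\<rho> a2 - \<rho> a1 + (\<rho> b1 - \<rho> b2) - 1) ?Q"
      by (rule highly_connected_vanishes_below[OF highly_connected_box[OF p(1) q(1) le ne] porder_interval_le])
    have c1: "carrier ?Y = Some ` \<phi> ` ?Q"
    proof -
      have "carrier ?Y = Some ` \<phi> ` ?X - {Some (\<phi> (a1, b1)), Some (\<phi> (a2, b2))}"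
        unfolding cY using interval_SS[OF HOL.refl p(1) HOL.refl q(1)] v(1) p(2) q(2) Some by simp
      also have "\<dots> = Some ` \<phi> ` ?X - Some ` \<phi> ` {(a1, b1), (a2, b2)}" by auto
      also have "\<dots> = Some ` \<phi> ` ?Q"
      proof -
        have i: "inj_on (\<lambda>q. Some (\<phi> q)) PR" using inj by (intro inj_onI) blast
        have "(\<lambda>q. Some (\<phi> q)) ` (?X - {(a1, b1), (a2, b2)}) =
            (\<lambda>q. Some (\<phi> q)) ` ?X - (\<lambda>q. Some (\<phi> q)) ` {(a1, b1), (a2, b2)}"
          by (rule inj_on_image_set_diff[OF i]) (use XP p(1) q(1) in auto)
        then show ?thesis by (simp only: image_image)
      qed
      finally show ?thesis .
    qed
    have c2: "?Q \<subseteq> PR" using XP by blast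
    have c3: "i + 1 < int (\<rho> a2 - \<rho> a1 + (\<rho> b1 - \<rho> b2) - 1)"
      using i' Some rx rP_phi[OF q(1)] q(2) rho_D[of b1] rho_le[OF _ _ le(1)] rho_le[OF _ _ le(2)] Dp Dq by auto
    show ?thesis by (rule homology_image[OF c2 c1 leY VQ c3])
  qed
qed

lemma Gorenstein_star_P: "Gorenstein_star (K :: 'k::field itself) P"
  unfolding Gorenstein_star_def
  by (intro conjI partial_order_P finP has_minimum_P Eulerian_T Cohen_Macaulay_T)

end

section \<open>The toric polynomials of a Bier poset\<close>

text \<open>A factor has degree at most 1, and 0 unless its rank is at least 3. So each degree is
  below half the rank, and this persists for the product.\<close>

lemma coeff_gamma_product:
  assumes "r1 \<le> 2 \<Longrightarrow> e1 = 0" "r2 \<le> 2 \<Longrightarrow> e2 = 0" "0 < r1 + r2" "(r1 + r2 - 1) div 2 < i"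
  shows "coeff ([:1, e1:] * [:1, e2 :: int:]) i = 0"
proof -
  have p: "[:1, e1:] * [:1, e2:] = [:1, e1 + e2, e1 * e2:]" by simp
  consider "i = 1" | "i = 2" | "3 \<le> i" using assms(4) by linarith
  then show ?thesis
  proof cases
    case 1
    then have "r1 \<le> 2" "r2 \<le> 2" using assms(4) by auto
    then show ?thesis using assms(1,2) 1 unfolding p by simp
  next
    case 2
    then have "r1 \<le> 2 \<or> r2 \<le> 2" using assms(4) by auto
    then show ?thesis using assms(1,2) 2 unfolding p by (auto simp: numeral_2_eq_2)
  next
    case 3
    then have "i = Suc (Suc (Suc (i - 3)))" by simp
    then obtain j where "i = Suc (Suc (Suc j))" ..
    then show ?thesis unfolding p by simp
  qed
qed

lemma coeff_monom_zero: "c = 0 \<or> k \<noteq> i \<Longrightarrow> coeff (monom c k) i = 0"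
  by auto

text \<open>The dual estimate: reversal puts the lowest term of a factor above half its rank or at
  rank 0.\<close>

lemma coeff_delta_product:
  assumes "r1 \<le> 2 \<Longrightarrow> e1 = 0" "r2 \<le> 2 \<Longrightarrow> e2 = 0" "0 < r1 + r2" "i \<le> (r1 + r2 - 1) div 2"
  shows "coeff ((monom 1 r1 + monom e1 (r1 - 1)) * (monom 1 r2 + monom (e2 :: int) (r2 - 1))) i = 0"
proof -
  have p: "(monom 1 r1 + monom e1 (r1 - 1)) * (monom 1 r2 + monom e2 (r2 - 1)) =
     monom 1 (r1 + r2) + monom e2 (r1 + (r2 - 1)) + (monom e1 (r1 - 1 + r2) + monom (e1 * e2) (r1 - 1 + (r2 - 1)))"
    by (simp add: mult_monom distrib_left distrib_right)
  have e: "e1 = 0 \<or> 3 \<le> r1" "e2 = 0 \<or> 3 \<le> r2" using assms(1,2) by linarith+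
  have n1: "1 = (0::int) \<or> r1 + r2 \<noteq> i" using assms(3,4) by linarith
  have n2: "e2 = 0 \<or> r1 + (r2 - 1) \<noteq> i" using e(2) assms(4) by linarith
  have n3: "e1 = 0 \<or> r1 - 1 + r2 \<noteq> i" using e(1) assms(4) by linarith
  have n4: "e1 * e2 = 0 \<or> r1 - 1 + (r2 - 1) \<noteq> i"
  proof (cases "e1 = 0 \<or> e2 = 0")
    case False
    then have "3 \<le> r1" "3 \<le> r2" using e by auto
    then show ?thesis using assms(4) by linarith
  qed auto
  show ?thesis
    by (simp only: p coeff_add coeff_monom_zero[OF n1] coeff_monom_zero[OF n2] coeff_monom_zero[OF n3]
      coeff_monom_zero[OF n4] add_0)
qed

context bier begin

text \<open>\<open>g1\<close> and \<open>g2\<close> are the polynomials of the two factors of a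
  lower interval of \<open>P\<close>; the second factor is \<open>[b, tp]\<close> upside down.
  \<open>d1\<close> and \<open>d2\<close> are their reversals.\<close>

definition g1 :: "'b \<Rightarrow> int poly" where "g1 a = [:1, int (e bt a):]"
definition g2 :: "'b \<Rightarrow> int poly" where "g2 b = [:1, int (e b tp):]"
definition d1 :: "'b \<Rightarrow> int poly" where "d1 a = monom 1 (\<rho> a) + monom (int (e bt a)) (\<rho> a - 1)"
definition d2 :: "'b \<Rightarrow> int poly" where "d2 b = monom 1 (D - \<rho> b) + monom (int (e b tp)) (D - \<rho> b - 1)"

lemma e1_zero: "a \<in> L \<Longrightarrow> \<rho> a \<le> 2 \<Longrightarrow> e bt a = 0"
  using face_counts.e0[OF counts bt(1) _ bt(2)] bt(3) by simp

lemma e2_zero: "b \<in> L \<Longrightarrow> D - \<rho> b \<le> 2 \<Longrightarrow> e b tp = 0"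
  using face_counts.e0[OF counts _ tp(1) tp(2)] tp(3) by simp

lemma kls1:
  assumes "a \<in> L"
  shows "(\<Sum>s\<in>{s \<in> L. s \<le> a}. g1 s * [:-1, 1:] ^ (\<rho> a - \<rho> s)) = d1 a"
proof -
  have "{s \<in> L. bt \<le> s \<and> s \<le> a} = {s \<in> L. s \<le> a}" using bt(2) by auto
  then show ?thesis
    using face_counts.kls[OF counts bt(1) assms bt(2)[OF assms]]
    by (simp add: face_counts.gamma_def[OF counts] face_counts.del_def[OF counts] g1_def d1_def bt(3))
qed

text \<open>The recursion \<open>kls\<close> for the reversed order, in which \<open>tp\<close> is
  the bottom; this is why the summation is over the elements above \<open>b\<close>.\<close>

lemma kls2:
  assumes "b \<in> L"
  shows "(\<Sum>s\<in>{s \<in> L. b \<le> s}. g2 s * [:-1, 1:] ^ (\<rho> s - \<rho> b)) = d2 b"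
proof -
  have dual: "face_counts L (\<lambda>x y. y \<le> x) (\<lambda>x. D - \<rho> x) (\<lambda>a b. e b a)"
    by (rule face_counts.dual[OF counts rho_D])
  have S: "{s \<in> L. s \<le> tp \<and> b \<le> s} = {s \<in> L. b \<le> s}" using tp(2) by auto
  have "(\<Sum>s\<in>{s \<in> L. s \<le> tp \<and> b \<le> s}. [:1, int (e s tp):] * [:-1, 1:] ^ (D - \<rho> b - (D - \<rho> s))) =
      monom 1 (D - \<rho> b) + monom (int (e b tp)) (D - \<rho> b - 1)"
    using face_counts.kls[OF dual tp(1) assms tp(2)[OF assms]]
    by (simp add: face_counts.gamma_def[OF dual] face_counts.del_def[OF dual] tp(3))
  then have 1: "(\<Sum>s\<in>{s \<in> L. b \<le> s}. g2 s * [:-1, 1:] ^ (D - \<rho> b - (D - \<rho> s))) = d2 b"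
    unfolding S g2_def d2_def .
  have 2: "D - \<rho> b - (D - \<rho> s) = \<rho> s - \<rho> b" if "s \<in> {s \<in> L. b \<le> s}" for s
    using that rho_D[of s] rho_D[OF assms] rho_le[OF assms, of s] by auto
  have "(\<Sum>s\<in>{s \<in> L. b \<le> s}. g2 s * [:-1, 1:] ^ (\<rho> s - \<rho> b)) =
      (\<Sum>s\<in>{s \<in> L. b \<le> s}. g2 s * [:-1, 1:] ^ (D - \<rho> b - (D - \<rho> s)))"
    by (intro sum.cong refl) (simp only: 2)
  then show ?thesis unfolding 1 .
qed

definition gP :: "'c \<Rightarrow> int poly" where "gP v = g1 (fst (pr v)) * g2 (snd (pr v))"
definition dP :: "'c \<Rightarrow> int poly" where "dP v = d1 (fst (pr v)) * d2 (snd (pr v))"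

lemma below_P:
  assumes "(a, b) \<in> PR"
  shows "{s \<in> carrier P. s \<sqsubseteq>\<^bsub>P\<^esub> \<phi> (a, b)} = \<phi> ` ({x \<in> L. x \<le> a} \<times> {y \<in> L. b \<le> y})"
    and "{x \<in> L. x \<le> a} \<times> {y \<in> L. b \<le> y} \<subseteq> PR"
proof -
  note D = PR_D[OF assms]
  show sub: "{x \<in> L. x \<le> a} \<times> {y \<in> L. b \<le> y} \<subseteq> PR"
  proof safe
    fix x y assume xy: "x \<in> L" "x \<le> a" "y \<in> L" "b \<le> y"
    have "x \<in> J" using J(4)[of a x] D xy by blast
    moreover have "y \<notin> J" using upJ[of b y] D xy by blast
    moreover have "x \<le> y" using order.trans[OF xy(2) order.trans[OF less_imp_le xy(4)]] D by blast
    ultimately show "(x, y) \<in> PR" using xy by (intro PR_I)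
  qed
  show "{s \<in> carrier P. s \<sqsubseteq>\<^bsub>P\<^esub> \<phi> (a, b)} = \<phi> ` ({x \<in> L. x \<le> a} \<times> {y \<in> L. b \<le> y})"
  proof (intro subset_antisym subsetI)
    fix s assume s: "s \<in> {s \<in> carrier P. s \<sqsubseteq>\<^bsub>P\<^esub> \<phi> (a, b)}"
    then have sP: "s \<in> carrier P" by simp
    obtain x y where xy: "(x, y) \<in> PR" "s = \<phi> (x, y)" "pr s = (x, y)" by (rule phi_cases[OF sP])
    have "x \<le> a" "b \<le> y" using s le_iff[OF sP phi_in[OF assms]] xy assms by auto
    then show "s \<in> \<phi> ` ({x \<in> L. x \<le> a} \<times> {y \<in> L. b \<le> y})" using xy(2) PR_D[OF xy(1)] by blast
  next
    fix s assume "s \<in> \<phi> ` ({x \<in> L. x \<le> a} \<times> {y \<in> L. b \<le> y})"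
    then obtain q where q: "s = \<phi> q" "q \<in> {x \<in> L. x \<le> a} \<times> {y \<in> L. b \<le> y}" by blast
    then have "q \<in> PR" using sub by blast
    then show "s \<in> {s \<in> carrier P. s \<sqsubseteq>\<^bsub>P\<^esub> \<phi> (a, b)}"
      using q le_iff[OF phi_in[OF \<open>q \<in> PR\<close>] phi_in[OF assms]] assms by (auto simp: interval_le_def)
  qed
qed

text \<open>The lower interval of \<open>(a, b)\<close> is the product of \<open>[bt, a]\<close>
  with the dual of \<open>[b, tp]\<close>. The recursions of the factors multiply, and the product
  obeys the degree bounds, so \<open>toric_g_unique\<close> applies.\<close>

lemma toric_g_below:
  assumes t: "t \<in> carrier P"
  shows "toric_g (subposet P (strict_below P t)) = gP t"
proof (rule toric_g_unique[OF ranked_P, where \<delta> = dP])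
  show "t \<in> carrier P" by (rule t)
next
  fix t assume t: "t \<in> carrier P" "rP t = 0"
  obtain a b where ab: "(a, b) \<in> PR" "t = \<phi> (a, b)" "pr t = (a, b)" by (rule phi_cases[OF t(1)])
  have "\<rho> a = 0" "D - \<rho> b = 0" using t(2) rP_phi[OF ab(1)] ab(2) by auto
  then have "e bt a = 0" "e b tp = 0" using e1_zero[of a] e2_zero[of b] PR_D[OF ab(1)] by auto
  then show "gP t = 1" by (simp add: gP_def ab(3) g1_def g2_def one_pCons)
next
  fix t assume t: "t \<in> carrier P"
  obtain a b where ab: "(a, b) \<in> PR" "t = \<phi> (a, b)" "pr t = (a, b)" by (rule phi_cases[OF t])
  note D = PR_D[OF ab(1)]
  let ?A = "{x \<in> L. x \<le> a}" and ?B = "{y \<in> L. b \<le> y}"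
  note B = below_P[OF ab(1)]
  have inj: "inj_on \<phi> (?A \<times> ?B)" using bij' B(2) unfolding bij_betw_def by (metis inj_on_subset)
  have "(\<Sum>s\<in>{s \<in> carrier P. s \<sqsubseteq>\<^bsub>P\<^esub> t}. gP s * [:-1, 1:] ^ (rP t - rP s)) =
      (\<Sum>q\<in>?A \<times> ?B. gP (\<phi> q) * [:-1, 1:] ^ (rP t - rP (\<phi> q)))"
    unfolding ab(2) B(1) by (subst sum.reindex[OF inj]) simp
  also have "\<dots> = (\<Sum>q\<in>?A \<times> ?B. (g1 (fst q) * [:-1, 1:] ^ (\<rho> a - \<rho> (fst q))) * (g2 (snd q) * [:-1, 1:] ^ (\<rho> (snd q) - \<rho> b)))"
  proof (intro sum.cong refl)
    fix q assume q: "q \<in> ?A \<times> ?B"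
    obtain x y where xy: "q = (x, y)" by fastforce
    have qP: "(x, y) \<in> PR" using q B(2) xy by blast
    have "\<rho> x \<le> \<rho> a" "\<rho> b \<le> \<rho> y" "\<rho> y \<le> D" using rho_le[of x a] rho_le[of b y] rho_D[of y] q xy D by auto
    then have "rP t - rP (\<phi> q) = (\<rho> a - \<rho> x) + (\<rho> y - \<rho> b)"
      using rP_phi[OF qP] rP_phi[OF ab(1)] ab(2) xy by simp
    then show "gP (\<phi> q) * [:-1, 1:] ^ (rP t - rP (\<phi> q)) =
      (g1 (fst q) * [:-1, 1:] ^ (\<rho> a - \<rho> (fst q))) * (g2 (snd q) * [:-1, 1:] ^ (\<rho> (snd q) - \<rho> b))"
      using qP unfolding xy gP_def pr_phi[OF qP] by (simp only: power_add fst_conv snd_conv mult_ac)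
  qed
  also have "\<dots> = (\<Sum>x\<in>?A. \<Sum>y\<in>?B. (g1 x * [:-1, 1:] ^ (\<rho> a - \<rho> x)) * (g2 y * [:-1, 1:] ^ (\<rho> y - \<rho> b)))"
    unfolding sum.cartesian_product by (simp only: case_prod_unfold)
  also have "\<dots> = d1 a * d2 b"
    unfolding sum_product[symmetric] using kls1[of a] kls2[of b] D by (simp only:)
  finally show "(\<Sum>s\<in>{s \<in> carrier P. s \<sqsubseteq>\<^bsub>P\<^esub> t}. gP s * [:-1, 1:] ^ (rP t - rP s)) = dP t"
    by (simp only: dP_def ab(3) fst_conv snd_conv)
next
  fix t i assume t: "t \<in> carrier P" "0 < rP t" "i \<le> (rP t - 1) div 2"
  obtain a b where ab: "(a, b) \<in> PR" "t = \<phi> (a, b)" "pr t = (a, b)" by (rule phi_cases[OF t(1)])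
  have r: "rP t = \<rho> a + (D - \<rho> b)" using rP_phi[OF ab(1)] ab(2) by simp
  show "coeff (dP t) i = 0"
    unfolding dP_def ab(3) fst_conv snd_conv d1_def d2_def
    by (rule coeff_delta_product) (use e1_zero e2_zero PR_D[OF ab(1)] t r in auto)
next
  fix t i assume t: "t \<in> carrier P" "0 < rP t" "(rP t - 1) div 2 < i"
  obtain a b where ab: "(a, b) \<in> PR" "t = \<phi> (a, b)" "pr t = (a, b)" by (rule phi_cases[OF t(1)])
  have r: "rP t = \<rho> a + (D - \<rho> b)" using rP_phi[OF ab(1)] ab(2) by simp
  show "coeff (gP t) i = 0"
    unfolding gP_def ab(3) fst_conv snd_conv g1_def g2_def
    by (rule coeff_gamma_product[of "\<rho> a" _ "D - \<rho> b"]) (use e1_zero e2_zero PR_D[OF ab(1)] t r in auto)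
qed

lemma total_rank_P: "total_rank P = D - 1"
  unfolding total_rank_def
proof (rule Max_eqI)
  show "finite (poset_rank P ` carrier P)" using finP by simp
  fix k assume "k \<in> poset_rank P ` carrier P"
  then show "k \<le> D - 1" using poset_rank_eq[OF ranked_P] rP_less_D by fastforce
next
  obtain v where "v \<in> carrier P" "Suc (rP v) = D" using max_rank by blast
  then show "D - 1 \<in> poset_rank P ` carrier P"
    using poset_rank_eq[OF ranked_P, of v] by (intro image_eqI[of _ _ v]) auto
qed

text \<open>For fixed \<open>b\<close>, the sum over \<open>a\<close> in \<open>J\<close> is the
  full recursion \<open>kls1\<close> minus its part outside \<open>J\<close>. In that part every
  upper end above \<open>a\<close> is outside \<open>J\<close> as well, so summing over
  \<open>b\<close> first gives the full recursion \<open>kls2\<close>.\<close>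

lemma toric_f_P:
  "[:-1, 1:] * toric_f P = (\<Sum>b\<in>L - J. g2 b * d1 b) - (\<Sum>a\<in>L - J. g1 a * d2 a)"
proof -
  let ?y = "[:-1, 1:] :: int poly"
  have ne: "carrier P \<noteq> {}" using max_rank by blast
  have "toric_f P = (\<Sum>v\<in>carrier P. gP v * ?y ^ (D - 1 - rP v))"
    unfolding toric_f_eq[OF ranked_P ne] total_rank_P by (intro sum.cong refl) (simp only: toric_g_below)
  then have "?y * toric_f P = (\<Sum>v\<in>carrier P. ?y * (gP v * ?y ^ (D - 1 - rP v)))"
    by (simp only: sum_distrib_left)
  also have "\<dots> = (\<Sum>v\<in>carrier P. gP v * ?y ^ (D - rP v))"
  proof (intro sum.cong refl)
    fix v assume "v \<in> carrier P"
    then have e: "D - rP v = Suc (D - 1 - rP v)" using rP_less_D[of v] by simp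
    show "?y * (gP v * ?y ^ (D - 1 - rP v)) = gP v * ?y ^ (D - rP v)"
      unfolding e power_Suc by (simp only: mult.left_commute)
  qed
  also have "\<dots> = (\<Sum>p\<in>PR. gP (\<phi> p) * ?y ^ (D - rP (\<phi> p)))"
    by (rule sum.reindex_bij_betw[OF bij', symmetric])
  also have "\<dots> = (\<Sum>p\<in>PR. g1 (fst p) * g2 (snd p) * ?y ^ (\<rho> (snd p) - \<rho> (fst p)))"
  proof (intro sum.cong refl)
    fix p assume p: "p \<in> PR"
    obtain a b where ab: "p = (a, b)" by fastforce
    have "\<rho> a \<le> \<rho> b" "\<rho> b \<le> D" using PR_D[of a b] p ab rho_less[of a b] rho_D[of b] by auto
    then have "D - rP (\<phi> p) = \<rho> b - \<rho> a" using rP_phi[of a b] p ab by simp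
    then show "gP (\<phi> p) * ?y ^ (D - rP (\<phi> p)) = g1 (fst p) * g2 (snd p) * ?y ^ (\<rho> (snd p) - \<rho> (fst p))"
      using p by (simp only: gP_def pr_phi ab fst_conv snd_conv)
  qed
  also have "PR = prod.swap ` (SIGMA b:L - J. {a \<in> J. a \<le> b})" by (auto simp: PR_def image_iff)
  also have "(\<Sum>p\<in>prod.swap ` (SIGMA b:L - J. {a \<in> J. a \<le> b}). g1 (fst p) * g2 (snd p) * ?y ^ (\<rho> (snd p) - \<rho> (fst p))) =
     (\<Sum>q\<in>(SIGMA b:L - J. {a \<in> J. a \<le> b}). g1 (snd q) * g2 (fst q) * ?y ^ (\<rho> (fst q) - \<rho> (snd q)))"
    by (subst sum.reindex) (auto simp: inj_on_def)
  also have "\<dots> = (\<Sum>b\<in>L - J. \<Sum>a\<in>{a \<in> J. a \<le> b}. g1 a * g2 b * ?y ^ (\<rho> b - \<rho> a))"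
    using finL finite_subset[OF J(1) finL] by (subst sum.Sigma) (auto simp: case_prod_unfold)
  also have "\<dots> = (\<Sum>b\<in>L - J. g2 b * d1 b - (\<Sum>a\<in>{a \<in> L - J. a \<le> b}. g1 a * (g2 b * ?y ^ (\<rho> b - \<rho> a))))"
  proof (intro sum.cong refl)
    fix b assume b: "b \<in> L - J"
    let ?t = "\<lambda>a. g1 a * ?y ^ (\<rho> b - \<rho> a)"
    have "{s \<in> L. s \<le> b} = {a \<in> J. a \<le> b} \<union> {a \<in> L - J. a \<le> b}" using J(1) by auto
    moreover have "{a \<in> J. a \<le> b} \<inter> {a \<in> L - J. a \<le> b} = {}" by auto
    ultimately have "d1 b = sum ?t {a \<in> J. a \<le> b} + sum ?t {a \<in> L - J. a \<le> b}"
      using kls1[of b] b finL finite_subset[OF J(1) finL] by (simp add: sum.union_disjoint)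
    then have "g2 b * d1 b = g2 b * sum ?t {a \<in> J. a \<le> b} + g2 b * sum ?t {a \<in> L - J. a \<le> b}"
      by (simp only: distrib_left)
    moreover have "g2 b * sum ?t {a \<in> J. a \<le> b} = (\<Sum>a\<in>{a \<in> J. a \<le> b}. g1 a * g2 b * ?y ^ (\<rho> b - \<rho> a))"
      unfolding sum_distrib_left by (intro sum.cong refl) (simp only: mult_ac)
    moreover have "g2 b * sum ?t {a \<in> L - J. a \<le> b} = (\<Sum>a\<in>{a \<in> L - J. a \<le> b}. g1 a * (g2 b * ?y ^ (\<rho> b - \<rho> a)))"
      unfolding sum_distrib_left by (intro sum.cong refl) (simp only: mult_ac)
    ultimately show "(\<Sum>a\<in>{a \<in> J. a \<le> b}. g1 a * g2 b * ?y ^ (\<rho> b - \<rho> a)) =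
        g2 b * d1 b - (\<Sum>a\<in>{a \<in> L - J. a \<le> b}. g1 a * (g2 b * ?y ^ (\<rho> b - \<rho> a)))" by (simp only: add_diff_cancel_right')
  qed
  also have "\<dots> = (\<Sum>b\<in>L - J. g2 b * d1 b) - (\<Sum>b\<in>L - J. \<Sum>a\<in>{a \<in> L - J. a \<le> b}. g1 a * (g2 b * ?y ^ (\<rho> b - \<rho> a)))"
    by (simp only: sum_subtractf)
  also have "(\<Sum>b\<in>L - J. \<Sum>a\<in>{a \<in> L - J. a \<le> b}. g1 a * (g2 b * ?y ^ (\<rho> b - \<rho> a))) =
     (\<Sum>b\<in>L - J. \<Sum>a\<in>L - J. if a \<le> b then g1 a * (g2 b * ?y ^ (\<rho> b - \<rho> a)) else 0)"
    using finL by (intro sum.cong refl sum.inter_filter) auto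
  also have "\<dots> = (\<Sum>a\<in>L - J. \<Sum>b\<in>L - J. if a \<le> b then g1 a * (g2 b * ?y ^ (\<rho> b - \<rho> a)) else 0)"
    by (rule sum.swap)
  also have "\<dots> = (\<Sum>a\<in>L - J. g1 a * d2 a)"
  proof (intro sum.cong refl)
    fix a assume a: "a \<in> L - J"
    have S: "{b \<in> L - J. a \<le> b} = {b \<in> L. a \<le> b}" using a upJ by auto
    have "(\<Sum>b\<in>L - J. if a \<le> b then g1 a * (g2 b * ?y ^ (\<rho> b - \<rho> a)) else 0) =
        (\<Sum>b\<in>{b \<in> L - J. a \<le> b}. g1 a * (g2 b * ?y ^ (\<rho> b - \<rho> a)))"
      using finL by (intro sum.inter_filter[symmetric]) auto
    also have "\<dots> = g1 a * d2 a"
      unfolding S sum_distrib_left[symmetric] using kls2[of a] a by (simp only: DiffD1)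
    finally show "(\<Sum>b\<in>L - J. if a \<le> b then g1 a * (g2 b * ?y ^ (\<rho> b - \<rho> a)) else 0) = g1 a * d2 a" .
  qed
  finally show ?thesis .
qed

lemma toric_g_nonneg:
  assumes high: "\<And>b. b \<in> L \<Longrightarrow> b \<notin> J \<Longrightarrow> (D - 1) div 2 + 2 \<le> \<rho> b"
  shows "0 \<le> coeff (toric_g P) i"
proof -
  have ne: "carrier P \<noteq> {}" using max_rank by blast
  show ?thesis
  proof (cases "i \<le> (D - 1) div 2")
    case False
    then show ?thesis unfolding coeff_toric_g[OF ne] total_rank_P by simp
  next
    case True
    have low: "coeff (g2 b * d1 b) i = 0" if b: "b \<in> L - J" for b
    proof -
      \<comment> \<open>\<open>d1 b\<close> is divisible by \<open>x ^ (\<rho> b - 1)\<close>, and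
        this exponent exceeds \<open>i\<close>.\<close>
      have "i + 1 < \<rho> b" using high[of b] b True by auto
      then have "i + 2 \<le> \<rho> b" by simp
      from le_Suc_ex[OF this] obtain k where k: "\<rho> b = i + 2 + k" ..
      have "d1 b = monom 1 (i + 1) * (monom 1 (k + 1) + monom (int (e bt b)) k)"
        unfolding d1_def k distrib_left mult_monom by simp
      then have "g2 b * d1 b = monom 1 (i + 1) * (g2 b * (monom 1 (k + 1) + monom (int (e bt b)) k))"
        by (simp only: mult.left_commute)
      then show ?thesis by (simp only: coeff_monom_mult) simp
    qed
    have pos: "0 \<le> coeff (g1 a * d2 a) i" for a
    proof -
      have "0 \<le> coeff ([:1, int m:] * (monom 1 r + monom (int m') r')) i" for m m' r r'
        by (cases i) (auto simp: coeff_pCons distrib_left)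
      then show ?thesis unfolding g1_def d2_def .
    qed
    have "coeff ([:-1, 1:] * toric_f P) i = - (\<Sum>a\<in>L - J. coeff (g1 a * d2 a) i)"
      unfolding toric_f_P coeff_diff coeff_sum using low by simp
    then show ?thesis unfolding coeff_toric_g[OF ne] total_rank_P
      using pos True by (simp add: sum_nonneg)
  qed
qed

end

section \<open>Intervals of the face lattice\<close>

text \<open>A two-element interval has index \<open>0\<close> and \<open>e = 0\<close>. Any other
  one is a multiplex of some type \<open>(d', n')\<close>, with \<open>e = n' - d'\<close>.\<close>

lemma closed_sets_interval:
  assumes m: "multiplex_pair d n" and gr: "graded_on (closed_sets d n) \<rho>"
    and ab: "a \<in> closed_sets d n" "b \<in> closed_sets d n" "a \<subset> b"
  shows "highly_connected (\<subseteq>) (\<rho> b - \<rho> a - 1) {s \<in> closed_sets d n. a \<subset> s \<and> s \<subset> b}"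
    and "\<exists>e. (\<rho> b - \<rho> a \<le> 2 \<longrightarrow> e = 0) \<and>
      (\<Sum>s\<in>{s \<in> closed_sets d n. a \<subseteq> s \<and> s \<subseteq> b}. [:0, 1:] ^ (\<rho> b - \<rho> s)) = face_poly (\<rho> b - \<rho> a) e"
proof -
  let ?I = "{s \<in> closed_sets d n. a \<subseteq> s \<and> s \<subseteq> b}" and ?O = "{s \<in> closed_sets d n. a \<subset> s \<and> s \<subset> b}"
  have OI: "?O = ?I - {a, b}" by auto
  have abI: "a \<in> ?I" "b \<in> ?I" using ab by auto
  have iso0: "closed_sets_iso d n (closed_sets d n) (\<lambda>x. x)" by (simp add: closed_sets_iso_def bij_betw_def)
  have "highly_connected (\<subseteq>) (\<rho> b - \<rho> a - 1) ?O \<and> (\<exists>e. (\<rho> b - \<rho> a \<le> 2 \<longrightarrow> e = 0) \<and>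
      (\<Sum>s\<in>?I. [:0, 1:] ^ (\<rho> b - \<rho> s)) = face_poly (\<rho> b - \<rho> a) e)"
    using closed_sets_iso_interval[OF m iso0 ab]
  proof
    assume I: "?I = {a, b}"
    have r: "\<rho> b = Suc (\<rho> a)"
    proof (rule graded_onD(3)[OF gr ab])
      fix z assume z: "z \<in> closed_sets d n" "a \<subset> z" "z \<subset> b"
      then have "z \<in> ?I" by auto
      then show False using I z by blast
    qed
    have "?O = {}" unfolding OI I by auto
    then have "highly_connected (\<subseteq>) (\<rho> b - \<rho> a - 1) ?O" unfolding r by (simp only:) (simp add: highly_connected.empty)
    moreover have "(\<Sum>s\<in>?I. [:0, 1:] ^ (\<rho> b - \<rho> s)) = face_poly (\<rho> b - \<rho> a) 0"
    proof -
      have "a \<noteq> b" using ab(3) by auto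
      then show ?thesis unfolding I using r by (simp add: face_poly_def one_pCons)
    qed
    ultimately show ?thesis using r by (intro conjI exI[of _ 0]) simp_all
  next
    assume "\<exists>d' n' g. multiplex_pair d' n' \<and> closed_sets_iso d' n' ?I g"
    then obtain d' n' g where m': "multiplex_pair d' n'" and iso: "closed_sets_iso d' n' ?I g" by blast
    have g: "bij_betw g ?I (closed_sets d' n')" and le: "\<And>x y. x \<in> ?I \<Longrightarrow> y \<in> ?I \<Longrightarrow> x \<subseteq> y \<longleftrightarrow> g x \<subseteq> g y"
      using iso unfolding closed_sets_iso_def by blast+
    have gc: "g s \<in> closed_sets d' n'" if "s \<in> ?I" for s using g that unfolding bij_betw_def by blast
    have gI: "g ` ?I = closed_sets d' n'" using g by (simp only: bij_betw_def)
    have "{..n'} \<in> g ` ?I" "{} \<in> g ` ?I" unfolding gI by (rule full_closed_sets, rule empty_closed_sets[OF m'])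
    then obtain a' b' where b': "b' \<in> ?I" "g b' = {..n'}" and a': "a' \<in> ?I" "g a' = {}"
      unfolding image_iff by (elim bexE) (rule that, assumption, erule sym, assumption, erule sym)
    \<comment> \<open>\<open>b\<close> lies above the preimage of the top, so it is sent to the top
      itself; likewise \<open>a\<close> goes to the bottom.\<close>
    have "b' \<subseteq> b" using b'(1) by blast
    then have "{..n'} \<subseteq> g b" using le[OF b'(1) abI(2)] b'(2) by simp
    then have gb: "g b = {..n'}" using closed_sets_subset[OF gc[OF abI(2)]] by (rule subset_antisym[rotated])
    have "a \<subseteq> a'" using a'(1) by blast
    then have ga: "g a = {}" using le[OF abI(1) a'(1)] a'(2) by simp
    have grI: "graded_on ?I \<rho>"
      by (rule graded_on_convex[OF gr]) auto
    note F = closed_sets_iso_face_poly[OF m' iso grI abI(2) gb abI(1) ga]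
    have r: "\<rho> b - \<rho> a = d' + 1" using F(1) by simp
    have "highly_connected (\<subseteq>) d' ?O"
    proof (rule highly_connected_iso[OF _ highly_connected_closed_sets[OF m']])
      have "g ` (?I - {a, b}) = g ` ?I - g ` {a, b}"
        by (rule inj_on_image_set_diff[of _ ?I]) (use g abI in \<open>auto simp: bij_betw_def\<close>)
      then have "g ` ?O = closed_sets d' n' - {{}, {..n'}}"
        unfolding OI using g ga gb by (simp add: bij_betw_def)
      moreover have "inj_on g ?O" unfolding OI by (rule inj_on_diff[OF bij_betw_imp_inj_on[OF g]])
      ultimately show "bij_betw g ?O (closed_sets d' n' - {{}, {..n'}})" by (simp add: bij_betw_def)
      fix x y assume "x \<in> ?O" "y \<in> ?O"
      then have xy: "x \<in> ?I" "y \<in> ?I" by auto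
      show "(x \<subseteq> y \<or> y \<subseteq> x) \<longleftrightarrow> (g x \<subseteq> g y \<or> g y \<subseteq> g x)"
        by (simp only: le[OF xy] le[OF xy(2,1)])
    qed
    moreover have "(\<Sum>s\<in>?I. [:0, 1:] ^ (\<rho> b - \<rho> s)) = face_poly (\<rho> b - \<rho> a) (n' - d')"
      unfolding F(2) r by (simp add: face_poly_def one_pCons)
    \<comment> \<open>Here \<open>d' = 1\<close>, which leaves only the segment.\<close>
    moreover have "\<rho> b - \<rho> a \<le> 2 \<longrightarrow> n' - d' = 0" using r m' by (auto simp: multiplex_pair_def)
    ultimately show ?thesis unfolding r by (intro conjI exI[of _ "n' - d'"]) simp_all
  qed
  then show "highly_connected (\<subseteq>) (\<rho> b - \<rho> a - 1) ?O"
    "\<exists>e. (\<rho> b - \<rho> a \<le> 2 \<longrightarrow> e = 0) \<and> (\<Sum>s\<in>?I. [:0, 1:] ^ (\<rho> b - \<rho> s)) = face_poly (\<rho> b - \<rho> a) e"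
    by blast+
qed

lemma closed_sets_face_counts:
  assumes m: "multiplex_pair d n" and gr: "graded_on (closed_sets d n) \<rho>"
  obtains e where "face_counts (closed_sets d n) (\<subseteq>) \<rho> e"
proof -
  define Q where "Q a b e \<longleftrightarrow> (\<rho> b - \<rho> a \<le> 2 \<longrightarrow> e = 0) \<and>
      (\<Sum>s\<in>{s \<in> closed_sets d n. a \<subseteq> s \<and> s \<subseteq> b}. [:0, 1:] ^ (\<rho> b - \<rho> s)) = face_poly (\<rho> b - \<rho> a) e" for a b e
  have ex: "\<exists>e. Q a b e" if "a \<in> closed_sets d n" "b \<in> closed_sets d n" "a \<subseteq> b" for a b
  proof (cases "a = b")
    case True
    then have "{s \<in> closed_sets d n. a \<subseteq> s \<and> s \<subseteq> b} = {a}" using that by auto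
    then have "Q a b 0" unfolding Q_def using True by (simp add: face_poly_def)
    then show ?thesis by blast
  next
    case False
    then have "a \<subset> b" using that by blast
    from closed_sets_interval(2)[OF m gr that(1,2) this] show ?thesis unfolding Q_def .
  qed
  define e where "e a b = (SOME e. Q a b e)" for a b
  have Q: "Q a b (e a b)" if "a \<in> closed_sets d n" "b \<in> closed_sets d n" "a \<subseteq> b" for a b
    unfolding e_def by (rule someI_ex[OF ex[OF that]])
  have "face_counts (closed_sets d n) (\<subseteq>) \<rho> e"
  proof (rule face_counts.intro)
    show "finite (closed_sets d n)" by (rule finite_closed_sets)
    show "\<rho> x < \<rho> y" if "x \<in> closed_sets d n" "y \<in> closed_sets d n" "x \<subseteq> y" "x \<noteq> y" for x y
      by (rule graded_onD(2)[OF gr that(1,2)]) (use that in blast)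
    show "e a b = 0" if "a \<in> closed_sets d n" "b \<in> closed_sets d n" "a \<subseteq> b" "\<rho> b - \<rho> a \<le> 2" for a b
      using Q[OF that(1-3)] that(4) by (simp add: Q_def)
    show "(\<Sum>s\<in>{s \<in> closed_sets d n. a \<subseteq> s \<and> s \<subseteq> b}. [:0, 1:] ^ (\<rho> b - \<rho> s)) = face_poly (\<rho> b - \<rho> a) (e a b)"
      if "a \<in> closed_sets d n" "b \<in> closed_sets d n" "a \<subseteq> b" for a b
      using Q[OF that] by (simp add: Q_def)
  qed auto
  then show ?thesis by (rule that)
qed

lemma closed_sets_sup:
  assumes "A \<in> closed_sets d n" "B \<in> closed_sets d n"
  shows "\<exists>C\<in>closed_sets d n. A \<subseteq> C \<and> B \<subseteq> C \<and> (\<forall>Z\<in>closed_sets d n. A \<subseteq> Z \<longrightarrow> B \<subseteq> Z \<longrightarrow> C \<subseteq> Z)"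
proof (intro bexI conjI ballI impI)
  let ?C = "polar d n (polar d n (A \<union> B))"
  have AB: "A \<union> B \<subseteq> {..n}" using closed_sets_subset[OF assms(1)] closed_sets_subset[OF assms(2)] by blast
  have "A \<union> B \<subseteq> ?C" using polar_galois[OF AB polar_subset] by simp
  then show "A \<subseteq> ?C" "B \<subseteq> ?C" by blast+
  show "?C \<in> closed_sets d n" by (rule polar_closed_sets[OF polar_subset])
  fix Z assume Z: "Z \<in> closed_sets d n" "A \<subseteq> Z" "B \<subseteq> Z"
  then have "A \<union> B \<subseteq> Z" by blast
  then have "?C \<subseteq> polar d n (polar d n Z)" by (intro polar_antimono)
  then show "?C \<subseteq> Z" using polar_polar[OF Z(1)] by simp
qed

section \<open>The Bier poset of the multiplex boundary\<close>

context multiplex_polytope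
begin

text \<open>The whole polytope is missing from the boundary poset; the adjoined top
  \<open>None\<close> takes its place, so the face lattice becomes \<open>add_top\<close> of the
  boundary poset.\<close>

definition face_opt :: "nat set \<Rightarrow> 'a set option" where
  "face_opt A = (if A = {..n} then None else Some (fc A))"

abbreviation T :: "'a set option gorder" where "T \<equiv> add_top (boundary_poset S)"

lemma carrier_bp: "carrier (boundary_poset S) = {F. F face_of S \<and> F \<noteq> S}"
  and le_bp: "gorder.le (boundary_poset S) = (\<subseteq>)"
  by (simp_all add: boundary_poset_def)

lemma fc_eq_S_iff: "A \<in> closed_sets d n \<Longrightarrow> fc A = S \<longleftrightarrow> A = {..n}"
  using vs_fc[of A] vs_S fc_full by auto

lemma face_opt_in: "A \<in> closed_sets d n \<Longrightarrow> face_opt A \<in> carrier T"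
  using fc[of A] fc_eq_S_iff[of A] by (auto simp: face_opt_def carrier_bp)

lemma face_opt_surj:
  assumes "u \<in> carrier T" shows "\<exists>A\<in>closed_sets d n. face_opt A = u"
proof (cases u)
  case None
  then show ?thesis using full_closed_sets by (intro bexI[of _ "{..n}"]) (auto simp: face_opt_def)
next
  case (Some F)
  then have F: "F face_of S" "F \<noteq> S" using assms by (auto simp: carrier_bp)
  have "vs F \<noteq> {..n}" using fc_vs[OF F(1)] fc_full F(2) by auto
  then have "face_opt (vs F) = u" using fc_vs[OF F(1)] Some by (simp add: face_opt_def)
  then show ?thesis using vs_closed_sets[OF F(1)] by blast
qed

lemma face_opt_le: 
  assumes A: "A \<in> closed_sets d n" and B: "B \<in> closed_sets d n"
  shows "face_opt A \<sqsubseteq>\<^bsub>T\<^esub> face_opt B \<longleftrightarrow> A \<subseteq> B"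
proof (cases "B = {..n}")
  case True
  then show ?thesis using closed_sets_subset[OF A] by (simp add: face_opt_def)
next
  case B': False
  show ?thesis
  proof (cases "A = {..n}")
    case True
    then show ?thesis using B' closed_sets_subset[OF B] by (auto simp: face_opt_def)
  next
    case False
    then show ?thesis using B' fc_le_iff[OF A B] by (simp add: face_opt_def le_bp)
  qed
qed

definition bier_interval :: "nat set \<times> nat set \<Rightarrow> 'a set option set" where
  "bier_interval p = at_least_at_most T (face_opt (fst p)) (face_opt (snd p))"

text \<open>A nonempty interval contains its end points, and inclusion is decided by them.\<close>

lemma bier_interval_subset_iff:
  assumes "A \<in> closed_sets d n" "B \<in> closed_sets d n" "A' \<in> closed_sets d n" "B' \<in> closed_sets d n" "A' \<subseteq> B'"
  shows "bier_interval (A', B') \<subseteq> bier_interval (A, B) \<longleftrightarrow> A \<subseteq> A' \<and> B' \<subseteq> B"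
proof
  assume s: "bier_interval (A', B') \<subseteq> bier_interval (A, B)"
  have "face_opt A' \<in> bier_interval (A', B')" "face_opt B' \<in> bier_interval (A', B')"
    using assms face_opt_in face_opt_le by (simp_all add: bier_interval_def at_least_at_most_def)
  then have "face_opt A' \<in> bier_interval (A, B)" "face_opt B' \<in> bier_interval (A, B)" using s by blast+
  then show "A \<subseteq> A' \<and> B' \<subseteq> B" using face_opt_le assms by (simp add: bier_interval_def at_least_at_most_def)
next
  assume s: "A \<subseteq> A' \<and> B' \<subseteq> B"
  show "bier_interval (A', B') \<subseteq> bier_interval (A, B)"
  proof
    fix u assume u: "u \<in> bier_interval (A', B')"
    then have "u \<in> carrier T" by (simp add: bier_interval_def at_least_at_most_def)
    then obtain C where C: "C \<in> closed_sets d n" "face_opt C = u" using face_opt_surj by blast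
    have "A' \<subseteq> C" "C \<subseteq> B'"
      using u face_opt_le[OF assms(3) C(1)] face_opt_le[OF C(1) assms(4)] C(2) by (auto simp: bier_interval_def at_least_at_most_def)
    then have "A \<subseteq> C" "C \<subseteq> B" using s by auto
    then show "u \<in> bier_interval (A, B)"
      using face_opt_in[OF C(1)] face_opt_le[OF assms(1) C(1)] face_opt_le[OF C(1) assms(2)] C(2)
      by (simp add: bier_interval_def at_least_at_most_def)
  qed
qed

definition ideal_sets :: "'a set set \<Rightarrow> nat set set" where
  "ideal_sets I = {A \<in> closed_sets d n. face_opt A \<in> Some ` I}"

lemma bier_locale:
  assumes I: "order_ideal (boundary_poset S) I" and I0: "{} \<in> I"
    and e: "face_counts (closed_sets d n) (\<subseteq>) rk e"
  shows "bier (closed_sets d n) rk e (d + 1) {} {..n} (ideal_sets I) (Bier (boundary_poset S) (Some ` I)) bier_interval"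
proof -
  have Icar: "I \<subseteq> carrier (boundary_poset S)" using I by (simp add: order_ideal_def)
  have down: "b \<in> I" if "a \<in> I" "b \<in> carrier (boundary_poset S)" "b \<subseteq> a" for a b
    using I that unfolding order_ideal_def le_bp by blast
  let ?L = "closed_sets d n" and ?J = "ideal_sets I"
  let ?P = "Bier (boundary_poset S) (Some ` I)"
  let ?PR = "{(a, b). a \<in> ?J \<and> b \<in> ?L - ?J \<and> a \<subseteq> b}"
  have JL: "?J \<subseteq> ?L" by (auto simp: ideal_sets_def)
  have e0: "{} \<in> ?L" by (rule empty_closed_sets[OF multiplex_pair])
  have ne: "({}::nat set) \<noteq> {..n}" by auto
  have carP: "carrier ?P = bier_interval ` ?PR"
  proof (intro subset_antisym subsetI)
    fix v assume "v \<in> carrier ?P"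
    then obtain a b where ab: "v = at_least_at_most T a b" "a \<in> Some ` I" "b \<in> carrier T - Some ` I" "a \<sqsubseteq>\<^bsub>T\<^esub> b"
      unfolding Bier_def by auto
    have "a \<in> carrier T" using ab(2) Icar by auto
    then obtain A where A: "A \<in> ?L" "face_opt A = a" using face_opt_surj by blast
    obtain B where B: "B \<in> ?L" "face_opt B = b" using face_opt_surj ab(3) by blast
    have "A \<subseteq> B" using face_opt_le[OF A(1) B(1)] A(2) B(2) ab(4) by simp
    then have "(A, B) \<in> ?PR" using A B ab by (simp add: ideal_sets_def)
    moreover have "bier_interval (A, B) = v" using A B ab by (simp add: bier_interval_def)
    ultimately show "v \<in> bier_interval ` ?PR" by blast
  next
    fix v assume "v \<in> bier_interval ` ?PR"
    then obtain A B where AB: "A \<in> ?J" "B \<in> ?L" "B \<notin> ?J" "A \<subseteq> B" "v = bier_interval (A, B)" by blast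
    have "A \<in> ?L" using JL AB(1) by blast
    then have "face_opt A \<sqsubseteq>\<^bsub>T\<^esub> face_opt B" using face_opt_le AB by blast
    moreover have "face_opt A \<in> Some ` I" using AB(1) by (simp add: ideal_sets_def)
    moreover have "face_opt B \<in> carrier T - Some ` I" using AB face_opt_in[OF AB(2)] by (simp add: ideal_sets_def)
    ultimately have "\<exists>a b. v = at_least_at_most T a b \<and> a \<in> Some ` I \<and> b \<in> carrier T - Some ` I \<and> a \<sqsubseteq>\<^bsub>T\<^esub> b"
      using AB(5) by (intro exI[of _ "face_opt A"] exI[of _ "face_opt B"]) (simp add: bier_interval_def)
    then show "v \<in> carrier ?P" unfolding Bier_def by simp
  qed
  have lep: "bier_interval q \<subseteq> bier_interval p \<longleftrightarrow> interval_le p q" if "p \<in> ?PR" "q \<in> ?PR" for p q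
  proof -
    obtain A B where p: "p = (A, B)" by fastforce
    obtain A' B' where q: "q = (A', B')" by fastforce
    show ?thesis using bier_interval_subset_iff[of A B A' B'] that JL unfolding p q by auto
  qed
  have leB: "v \<sqsubseteq>\<^bsub>?P\<^esub> w \<longleftrightarrow> w \<subseteq> v" for v w by (simp add: Bier_def)
  show ?thesis
  proof (rule bier.intro)
    show "graded_on ?L rk" by (rule graded_closed_sets)
    show "{} \<in> ?L" by (rule e0)
    show "{..n} \<in> ?L" by (rule full_closed_sets)
    show "rk {} = 0" by (rule rk_empty)
    show "rk {..n} = d + 1" by (rule rk_full)
    show "x \<subseteq> {..n}" if "x \<in> ?L" for x by (rule closed_sets_subset[OF that])
    show "\<exists>c\<in>?L. c \<subseteq> a \<and> c \<subseteq> b \<and> (\<forall>z\<in>?L. z \<subseteq> a \<longrightarrow> z \<subseteq> b \<longrightarrow> z \<subseteq> c)" if "a \<in> ?L" "b \<in> ?L" for a b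
      by (rule bexI[OF _ closed_sets_Int[OF that]]) auto
    show "\<exists>c\<in>?L. a \<subseteq> c \<and> b \<subseteq> c \<and> (\<forall>z\<in>?L. a \<subseteq> z \<longrightarrow> b \<subseteq> z \<longrightarrow> c \<subseteq> z)" if "a \<in> ?L" "b \<in> ?L" for a b
      by (rule closed_sets_sup[OF that])
    show "highly_connected (\<subseteq>) (rk b - rk a - 1) {s \<in> ?L. a \<subset> s \<and> s \<subset> b}" if "a \<in> ?L" "b \<in> ?L" "a \<subset> b" for a b
      by (rule closed_sets_interval(1)[OF multiplex_pair graded_closed_sets that])
    show "face_counts ?L (\<subseteq>) rk e" by (rule e)
    show "?J \<subseteq> ?L" by (rule JL)
    show "{} \<in> ?J" using I0 e0 ne fc_empty by (simp add: ideal_sets_def face_opt_def)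
    show "{..n} \<notin> ?J" by (auto simp: ideal_sets_def face_opt_def)
    show "B \<in> ?J" if AB: "A \<in> ?J" "B \<in> ?L" "B \<subseteq> A" for A B
    proof -
      have A: "A \<in> ?L" "A \<noteq> {..n}" "fc A \<in> I" using AB(1) by (auto simp: ideal_sets_def face_opt_def split: if_splits)
      have "B \<noteq> {..n}" using A AB closed_sets_subset[OF A(1)] by blast
      moreover have "fc B \<in> I"
      proof (rule down[OF A(3)])
        show "fc B \<in> carrier (boundary_poset S)"
          using fc[OF AB(2)] fc_eq_S_iff[OF AB(2)] \<open>B \<noteq> {..n}\<close> by (simp add: carrier_bp)
        show "fc B \<subseteq> fc A" using fc_le_iff[OF AB(2) A(1)] AB(3) by simp
      qed
      ultimately show ?thesis using AB(2) by (simp add: ideal_sets_def face_opt_def)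
    qed
    show "eq ?P = (=)" by (simp add: Bier_def)
    show "bij_betw bier_interval ?PR (carrier ?P)"
      unfolding bij_betw_def
    proof
      show "inj_on bier_interval ?PR"
      proof (rule inj_onI)
        fix p q assume pq: "p \<in> ?PR" "q \<in> ?PR" "bier_interval p = bier_interval q"
        then have "interval_le p q" "interval_le q p" using lep[OF pq(1,2)] lep[OF pq(2,1)] by auto
        then show "p = q" by (rule porder_antisym[OF porder_interval_le])
      qed
      show "bier_interval ` ?PR = carrier ?P" by (rule carP[symmetric])
    qed
    show "bier_interval p \<sqsubseteq>\<^bsub>?P\<^esub> bier_interval q \<longleftrightarrow> interval_le p q" if "p \<in> ?PR" "q \<in> ?PR" for p q
      unfolding leB by (rule lep[OF that])
  qed simp
qed

end


theorem theorem1p2: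
  fixes d n :: nat
    and x :: "nat \<Rightarrow> 'a::euclidean_space"
    and S :: "'a set"
    and I :: "'a set set"
  assumes "4 \<le> d" and "d \<le> n"
    and "is_multiplex d n x S"
    and "order_ideal (boundary_poset S) I"
    and "\<forall>F \<in> carrier (boundary_poset S). aff_dim F + 1 \<le> \<lceil>real d / 2\<rceil> + 1 \<longrightarrow> F \<in> I"
  shows "let P = Bier (boundary_poset S) (Some ` I) in
           lower_semilattice P \<and>
           Gorenstein_star TYPE('k::field) P \<and>
           (\<forall>i. coeff (toric_g P) i \<ge> 0)"
proof -
  interpret M: multiplex_polytope d n x S by (unfold_locales) (rule assms(3))
  \<comment> \<open>\<open>D = d + 1\<close>, so the middle degree is \<open>d div 2\<close>. The
    rounded-up half in the hypothesis is at least as large, for both parities of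
    \<open>d\<close>.\<close>
  have ceil: "int (d div 2) \<le> \<lceil>real d / 2\<rceil>" by linarith
  have "{} \<noteq> S" using M.fc_eq_S_iff[OF empty_closed_sets[OF M.multiplex_pair]] M.fc_empty by auto
  then have "{} \<in> carrier (boundary_poset S)" by (simp add: M.carrier_bp)
  moreover have "aff_dim ({}::'a set) + 1 \<le> \<lceil>real d / 2\<rceil> + 1" using ceil by simp
  ultimately have I0: "{} \<in> I" using assms(5) by blast
  obtain e where e: "face_counts (closed_sets d n) (\<subseteq>) M.rk e"
    by (rule closed_sets_face_counts[OF M.multiplex_pair M.graded_closed_sets])
  interpret B: bier "closed_sets d n" M.rk e "d + 1" "{}" "{..n}" "M.ideal_sets I"
    "Bier (boundary_poset S) (Some ` I)" M.bier_interval
    by (rule M.bier_locale[OF assms(4) I0 e])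
  have high: "(d + 1 - 1) div 2 + 2 \<le> M.rk A" if A: "A \<in> closed_sets d n" "A \<notin> M.ideal_sets I" for A
  proof (cases "A = {..n}")
    case True
    \<comment> \<open>The top has rank \<open>d + 1\<close>, which reaches
      \<open>d div 2 + 2\<close> because \<open>d \<ge> 4\<close>.\<close>
    then show ?thesis using M.rk_full assms(1) by simp
  next
    case False
    then have "M.fc A \<notin> I" using A by (auto simp: M.ideal_sets_def M.face_opt_def)
    moreover have "M.fc A \<in> carrier (boundary_poset S)"
      using M.fc[OF A(1)] M.fc_eq_S_iff[OF A(1)] False by (simp add: M.carrier_bp)
    \<comment> \<open>The strict inequality between integers raises the bound
      \<open>d div 2 + 1\<close> on the rank to \<open>d div 2 + 2\<close>.\<close>
    ultimately have "\<lceil>real d / 2\<rceil> + 1 < aff_dim (M.fc A) + 1" using assms(5) by (meson not_le)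
    then show ?thesis using ceil unfolding M.rk_def by simp
  qed
  show ?thesis
    unfolding Let_def
    using B.lower_semilattice_P B.Gorenstein_star_P B.toric_g_nonneg[OF high] by blast
qed

end
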